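(* Let $\Omega\subset\mathbb{R}^2$ be a bounded, simply connected open set with Lipschitz boundary. Let $h\in C^1([0,1])$ satisfy $\inf h=h(1)$, and assume that there exists $\delta>0$ such that $h\in C^2([1-\delta,1])$. Let $F^1_\varepsilon:L^\infty(\Omega;\mathbb{M}^{2\times2}_{sym})\to\mathbb{R}\cup\{\infty\}$ be defined by $$F^1_\varepsilon(Q)=\sum_{|i-j|=1}\bigl(h(|u_i\cdot u_j|)-\inf h\bigr)\quad\text{if }Q\in C_\varepsilon(\Omega;S^1_\otimes),\ Q(\varepsilon i)=u_i\otimes u_i\ (u_i\in S^1,\ i\in\mathbb{Z}_\varepsilon(\Omega)),$$ and $F^1_\varepsilon(Q)=+\infty$ otherwise. Define $$F^1(Q)=\frac{|h'(1)|}2\int_\Omega|\nabla Q(x)|^2\,dx\ \text{ if }Q\in W^{1,2}(\Omega;\partial K),\qquad F^1(Q)=+\infty\ \text{ otherwise in }L^\infty(\Omega;\mathbb{M}^{2\times2}_{sym}).$$ (a) Let $(F^1)''$ be the $\Gamma$-limsup of $F^1_\varepsilon$ as $\varepsilon\to 0$ with respect to the weak$^*$ topology of $L^\infty(\Omega;\mathbb{M}^{2\times2}_{sym})$. Then $(F^1)''\le F^1$. (b) Assume in addition that there is $\gamma>0$ such that $h(x)-h(1)\ge\frac\gamma2(1-x^2)$ for every $x\in[0,1]$, and define $$F^1_\gamma(Q)=\frac\gamma2\int_\Omega|\nabla Q(x)|^2\,dx\ \text{ if }Q\in W^{1,2}(\Omega;\partial K),\qquad F^1_\gamma(Q)=+\infty\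 \text{ otherwise.}$$ Let $(F^1)'$ be the $\Gamma$-liminf of $F^1_\varepsilon$ as $\varepsilon\to 0$ with respect to the weak$^*$ topology of $L^\infty(\Omega;\mathbb{M}^{2\times2}_{sym})$. Then $(F^1)'\ge F^1_\gamma$. (c) If in particular one can take $\gamma=|h'(1)|$ in (b), then $F^1_\varepsilon$ $\Gamma$-converges with respect to the weak$^*$ topology of $L^\infty(\Omega;\mathbb{M}^{2\times2}_{sym})$ to $F^1$.
   Context: $\mathbb{M}^{2\times2}_{sym}$ is the space of symmetric $2\times2$ real matrices with the Frobenius norm $|\cdot|$. $K=\{Q\in\mathbb{M}^{2\times2}_{sym}:Q\ge0,\ \mathrm{tr}\,Q=1\}$, $\partial K=\{Q\in K:|Q|=1\}$, $S^1_\otimes=\{v\otimes v:v\in S^1\}$. $\mathbb{Z}_\varepsilon(\Omega)=\{i\in\mathbb{Z}^2:\varepsilon i\in\Omega\}$, $W=[-\frac12,\frac12)^2$, and $C_\varepsilon(\Omega;S^1_\otimes)=\{Q:\Omega\to S^1_\otimes:\ Q(x)=Q(\varepsilon i)\text{ if }x\in\varepsilon\{i+W\},\ i\in\mathbb{Z}_\varepsilon(\Omega)\}$. The sum over $|i-j|=1$ runs over all ordered pairs $(i,j)\in\mathbb{Z}_\varepsilon(\Omega)^2$ with $|i-j|=1$ (each bond is counted twice). $W^{1,2}(\Omega;\partial K)$ is the set of $Q\in W^{1,2}(\Omega;\mathbb{M}^{2\times2}_{sym})$ with $Q(x)\in\partial K$ for a.e. $x$. *)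

theory Defs
  imports "HOL-Analysis.Analysis"
begin

section \<open>Matrices\<close>

text \<open>The inner product and the norm of \<^typ>\<open>real^2^2\<close> are the Frobenius ones.\<close>

definition sym_mat :: "(real^2^2) set" where
  "sym_mat = {Q. transpose Q = Q}"

definition tensor_square :: "real^2 \<Rightarrow> real^2^2" where
  "tensor_square v = (\<chi> a b. v $ a * v $ b)"

definition S1_tensor :: "(real^2^2) set" where
  "S1_tensor = {tensor_square v | v. norm v = 1}"

definition K_set :: "(real^2^2) set" where
  "K_set = {Q \<in> sym_mat. (\<forall>v. 0 \<le> v \<bullet> (Q *v v)) \<and> trace Q = 1}"

definition bd_K :: "(real^2^2) set" where
  "bd_K = {Q \<in> K_set. norm Q = 1}"


section \<open>Regularity classes\<close>

text \<open>\<open>C\<^sup>n\<close> regularity of a function on an interval, with one-sided derivatives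
  at the endpoints that belong to the interval.\<close>

primrec Cn_on :: "nat \<Rightarrow> real set \<Rightarrow> (real \<Rightarrow> real) \<Rightarrow> bool" where
  "Cn_on 0 S f \<longleftrightarrow> continuous_on S f"
| "Cn_on (Suc n) S f \<longleftrightarrow>
     (\<exists>f'. (\<forall>x\<in>S. (f has_real_derivative f' x) (at x within S)) \<and> Cn_on n S f')"

definition partial_deriv :: "2 \<Rightarrow> (real^2 \<Rightarrow> real) \<Rightarrow> real^2 \<Rightarrow> real" where
  "partial_deriv k f x = frechet_derivative f (at x) (axis k 1)"

primrec Cn_plane :: "nat \<Rightarrow> (real^2 \<Rightarrow> real) \<Rightarrow> bool" where
  "Cn_plane 0 f \<longleftrightarrow> continuous_on UNIV f"
| "Cn_plane (Suc n) f \<longleftrightarrow>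
     (\<forall>x. f differentiable (at x)) \<and> (\<forall>k. Cn_plane n (partial_deriv k f))"

text \<open>The space \<open>C\<^sub>c\<^sup>\<infinity>(\<Omega>)\<close>, its elements extended by zero to the plane.\<close>

definition test_function :: "(real^2) set \<Rightarrow> (real^2 \<Rightarrow> real) \<Rightarrow> bool" where
  "test_function \<Omega> \<phi> \<longleftrightarrow> (\<forall>n. Cn_plane n \<phi>) \<and>
     compact (closure {x. \<phi> x \<noteq> 0}) \<and> closure {x. \<phi> x \<noteq> 0} \<subseteq> \<Omega>"

text \<open>Near each boundary point, and in suitable orthonormal coordinates, \<open>\<Omega>\<close> lies
  strictly above the graph of a Lipschitz function.\<close>

definition lipschitz_boundary :: "(real^2) set \<Rightarrow> bool" where
  "lipschitz_boundary \<Omega> \<longleftrightarrow>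
     (\<forall>p\<in>frontier \<Omega>. \<exists>r>0. \<exists>e1 e2 :: real^2. \<exists>(g :: real \<Rightarrow> real) L.
        norm e1 = 1 \<and> norm e2 = 1 \<and> e1 \<bullet> e2 = 0 \<and> L-lipschitz_on UNIV g \<and>
        \<Omega> \<inter> ball p r = {x \<in> ball p r. g (x \<bullet> e1) < x \<bullet> e2})"


section \<open>Function spaces\<close>

text \<open>Elements of Lebesgue and Sobolev spaces are represented by functions on the plane, of which
  only the restriction to \<open>\<Omega>\<close>, up to null sets, is relevant. All spaces of this section are
  invariant under changing a function on a null subset of \<open>\<Omega>\<close> or outside \<open>\<Omega>\<close>.\<close>

definition Linf_sym :: "(real^2) set \<Rightarrow> (real^2 \<Rightarrow> real^2^2) set" where
  "Linf_sym \<Omega> = {Q \<in> borel_measurable (lebesgue_on \<Omega>).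
     (AE x in lebesgue_on \<Omega>. Q x \<in> sym_mat) \<and> (\<exists>C. AE x in lebesgue_on \<Omega>. norm (Q x) \<le> C)}"

definition L1_sym :: "(real^2) set \<Rightarrow> (real^2 \<Rightarrow> real^2^2) set" where
  "L1_sym \<Omega> = {\<Phi>. integrable (lebesgue_on \<Omega>) \<Phi> \<and> (AE x in lebesgue_on \<Omega>. \<Phi> x \<in> sym_mat)}"

text \<open>The weak* topology is the coarsest topology on \<open>L\<^sup>\<infinity>\<close> for which all the pairings with
  elements of \<open>L\<^sup>1\<close> are continuous.\<close>

definition weak_star :: "(real^2) set \<Rightarrow> (real^2 \<Rightarrow> real^2^2) topology" where
  "weak_star \<Omega> = pullback_topology (Linf_sym \<Omega>)
     (\<lambda>Q. \<lambda>\<Phi>\<in>L1_sym \<Omega>. LINT x|lebesgue_on \<Omega>. Q x \<bullet> \<Phi> x)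
     (product_topology (\<lambda>_. euclideanreal) (L1_sym \<Omega>))"

definition L2 :: "(real^2) set \<Rightarrow> (real^2 \<Rightarrow> 'b::euclidean_space) set" where
  "L2 \<Omega> = {f \<in> borel_measurable (lebesgue_on \<Omega>). integrable (lebesgue_on \<Omega>) (\<lambda>x. (norm (f x))\<^sup>2)}"

text \<open>\<open>D x $ k\<close> is the weak partial derivative of \<open>Q\<close> at \<open>x\<close> in direction \<open>k\<close>, so that
  \<open>(norm (D x))\<^sup>2\<close> is the sum of the squares of all first-order partial derivatives of all
  entries of \<open>Q\<close>.\<close>

definition L2_weak_gradient ::
    "(real^2) set \<Rightarrow> (real^2 \<Rightarrow> real^2^2) \<Rightarrow> (real^2 \<Rightarrow> real^2^2^2) \<Rightarrow> bool" where
  "L2_weak_gradient \<Omega> Q D \<longleftrightarrow> D \<in> L2 \<Omega> \<and>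
     (\<forall>\<phi>. test_function \<Omega> \<phi> \<longrightarrow>
        (\<forall>k. (LINT x|lebesgue_on \<Omega>. partial_deriv k \<phi> x *\<^sub>R Q x)
              = - (LINT x|lebesgue_on \<Omega>. \<phi> x *\<^sub>R (D x $ k))))"

definition W12_sym :: "(real^2) set \<Rightarrow> (real^2 \<Rightarrow> real^2^2) set" where
  "W12_sym \<Omega> = {Q \<in> L2 \<Omega>. (AE x in lebesgue_on \<Omega>. Q x \<in> sym_mat) \<and> (\<exists>D. L2_weak_gradient \<Omega> Q D)}"

definition W12_bd_K :: "(real^2) set \<Rightarrow> (real^2 \<Rightarrow> real^2^2) set" where
  "W12_bd_K \<Omega> = {Q \<in> W12_sym \<Omega>. AE x in lebesgue_on \<Omega>. Q x \<in> bd_K}"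

definition weak_grad :: "(real^2) set \<Rightarrow> (real^2 \<Rightarrow> real^2^2) \<Rightarrow> real^2 \<Rightarrow> real^2^2^2" where
  "weak_grad \<Omega> Q = (SOME D. L2_weak_gradient \<Omega> Q D)"


section \<open>Gamma-limits in a topological space\<close>

definition Gamma_liminf ::
    "'a topology \<Rightarrow> 'i filter \<Rightarrow> ('i \<Rightarrow> 'a \<Rightarrow> ereal) \<Rightarrow> 'a \<Rightarrow> ereal" where
  "Gamma_liminf T I F x = (SUP U\<in>{U. openin T U \<and> x \<in> U}. Liminf I (\<lambda>i. INF y\<in>U. F i y))"

definition Gamma_limsup ::
    "'a topology \<Rightarrow> 'i filter \<Rightarrow> ('i \<Rightarrow> 'a \<Rightarrow> ereal) \<Rightarrow> 'a \<Rightarrow> ereal" where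
  "Gamma_limsup T I F x = (SUP U\<in>{U. openin T U \<and> x \<in> U}. Limsup I (\<lambda>i. INF y\<in>U. F i y))"

definition Gamma_converges ::
    "'a topology \<Rightarrow> 'i filter \<Rightarrow> ('i \<Rightarrow> 'a \<Rightarrow> ereal) \<Rightarrow> ('a \<Rightarrow> ereal) \<Rightarrow> bool" where
  "Gamma_converges T I F G \<longleftrightarrow>
     (\<forall>x\<in>topspace T. Gamma_liminf T I F x = G x \<and> Gamma_limsup T I F x = G x)"


section \<open>The discrete and the continuum energies\<close>

text \<open>Points of the integer lattice are vectors with integer coordinates.\<close>

definition Z_eps :: "real \<Rightarrow> (real^2) set \<Rightarrow> (real^2) set" where
  "Z_eps \<epsilon> \<Omega> = {i. (\<forall>k. i $ k \<in> \<int>) \<and> \<epsilon> *\<^sub>R i \<in> \<Omega>}"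

definition W_cell :: "(real^2) set" where
  "W_cell = {w. \<forall>k. - 1 / 2 \<le> w $ k \<and> w $ k < 1 / 2}"

definition C_eps :: "real \<Rightarrow> (real^2) set \<Rightarrow> (real^2 \<Rightarrow> real^2^2) set" where
  "C_eps \<epsilon> \<Omega> = {Q. (\<forall>x\<in>\<Omega>. Q x \<in> S1_tensor) \<and>
     (\<forall>i\<in>Z_eps \<epsilon> \<Omega>. \<forall>x\<in>\<Omega>. x \<in> (\<lambda>w. \<epsilon> *\<^sub>R (i + w)) ` W_cell \<longrightarrow> Q x = Q (\<epsilon> *\<^sub>R i))}"

text \<open>The function \<open>Q\<close> has a representative \<open>R\<close> in \<^const>\<open>C_eps\<close> with \<open>R(\<epsilon>i) = u\<^sub>i \<otimes> u\<^sub>i\<close>.\<close>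

definition spins_of ::
    "real \<Rightarrow> (real^2) set \<Rightarrow> (real^2 \<Rightarrow> real^2^2) \<Rightarrow> (real^2 \<Rightarrow> real^2) \<Rightarrow> bool" where
  "spins_of \<epsilon> \<Omega> Q u \<longleftrightarrow>
     (\<exists>R\<in>C_eps \<epsilon> \<Omega>. (AE x in lebesgue_on \<Omega>. Q x = R x) \<and>
        (\<forall>i\<in>Z_eps \<epsilon> \<Omega>. norm (u i) = 1 \<and> R (\<epsilon> *\<^sub>R i) = tensor_square (u i)))"

definition spin_energy ::
    "(real \<Rightarrow> real) \<Rightarrow> (real^2) set \<Rightarrow> real \<Rightarrow> (real^2 \<Rightarrow> real^2) \<Rightarrow> real" where
  "spin_energy h \<Omega> \<epsilon> u =
     (\<Sum>(i, j)\<in>{(i, j). i \<in> Z_eps \<epsilon> \<Omega> \<and> j \<in> Z_eps \<epsilon> \<Omega> \<and> norm (i - j) = 1}.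
        h \<bar>u i \<bullet> u j\<bar> - (INF x\<in>{0..1}. h x))"

definition F1_eps ::
    "(real \<Rightarrow> real) \<Rightarrow> (real^2) set \<Rightarrow> real \<Rightarrow> (real^2 \<Rightarrow> real^2^2) \<Rightarrow> ereal" where
  "F1_eps h \<Omega> \<epsilon> Q =
     (if \<exists>u. spins_of \<epsilon> \<Omega> Q u then ereal (spin_energy h \<Omega> \<epsilon> (SOME u. spins_of \<epsilon> \<Omega> Q u)) else \<infinity>)"

definition F1_gamma :: "real \<Rightarrow> (real^2) set \<Rightarrow> (real^2 \<Rightarrow> real^2^2) \<Rightarrow> ereal" where
  "F1_gamma \<gamma> \<Omega> Q =
     (if Q \<in> W12_bd_K \<Omega>
      then ereal (\<gamma> / 2 * (LINT x|lebesgue_on \<Omega>. (norm (weak_grad \<Omega> Q x))\<^sup>2)) else \<infinity>)"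

definition slope_at_1 :: "(real \<Rightarrow> real) \<Rightarrow> real" where
  "slope_at_1 h = vector_derivative h (at 1 within {0..1})"

definition F1 :: "(real \<Rightarrow> real) \<Rightarrow> (real^2) set \<Rightarrow> (real^2 \<Rightarrow> real^2^2) \<Rightarrow> ereal" where
  "F1 h \<Omega> Q =
     (if Q \<in> W12_bd_K \<Omega>
      then ereal (\<bar>slope_at_1 h\<bar> / 2 * (LINT x|lebesgue_on \<Omega>. (norm (weak_grad \<Omega> Q x))\<^sup>2)) else \<infinity>)"

text \<open>The value of \<^const>\<open>F1_eps\<close> does not depend on the chosen representative nor on the
  orientation of the spins.\<close>

lemma tensor_square_abs_inner:
  assumes "tensor_square a = tensor_square a'" "tensor_square b = tensor_square b'"
  shows "\<bar>a \<bullet> b\<bar> = \<bar>a' \<bullet> b'\<bar>"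
proof -
  have *: "tensor_square v \<bullet> tensor_square w = (v \<bullet> w)\<^sup>2" for v w :: "real^2"
    by (simp add: tensor_square_def inner_vec_def sum_2 power2_eq_square algebra_simps)
  have "(a \<bullet> b)\<^sup>2 = (a' \<bullet> b')\<^sup>2"
    using assms by (simp flip: *)
  then show ?thesis
    by (simp add: power2_eq_iff abs_eq_iff)
qed

lemma C_eps_AE_eq_at_lattice:
  assumes "open \<Omega>" "0 < \<epsilon>" "R \<in> C_eps \<epsilon> \<Omega>" "R' \<in> C_eps \<epsilon> \<Omega>" "i \<in> Z_eps \<epsilon> \<Omega>"
    and ae: "AE x in lebesgue_on \<Omega>. R x = R' x"
  shows "R (\<epsilon> *\<^sub>R i) = R' (\<epsilon> *\<^sub>R i)"
proof -
  let ?p = "\<epsilon> *\<^sub>R i"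
  have p: "?p \<in> \<Omega>" using assms by (simp add: Z_eps_def)
  obtain r where r: "0 < r" "ball ?p r \<subseteq> \<Omega>"
    using \<open>open \<Omega>\<close> p open_contains_ball by blast
  define s where "s = min r (\<epsilon> / 2)"
  have s: "0 < s" "s \<le> r" "s \<le> \<epsilon> / 2" using r \<open>0 < \<epsilon>\<close> by (auto simp: s_def)
  have cell: "x \<in> (\<lambda>w. \<epsilon> *\<^sub>R (i + w)) ` W_cell" if "x \<in> ball ?p s" for x
  proof
    show "x = \<epsilon> *\<^sub>R (i + (1 / \<epsilon>) *\<^sub>R (x - ?p))"
      using \<open>0 < \<epsilon>\<close> by (simp add: algebra_simps)
    have "\<bar>(x - ?p) $ k\<bar> < \<epsilon> / 2" for k
      using component_le_norm_cart[of "x - ?p" k] that s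
      by (simp add: dist_norm norm_minus_commute)
    then have *: "\<bar>((1 / \<epsilon>) *\<^sub>R (x - ?p)) $ k\<bar> < 1 / 2" for k
      using \<open>0 < \<epsilon>\<close> by (simp add: abs_mult field_simps)
    have "- 1 / 2 \<le> ((1 / \<epsilon>) *\<^sub>R (x - ?p)) $ k \<and> ((1 / \<epsilon>) *\<^sub>R (x - ?p)) $ k < 1 / 2" for k
      using *[of k] by linarith
    then show "(1 / \<epsilon>) *\<^sub>R (x - ?p) \<in> W_cell"
      unfolding W_cell_def by blast
  qed
  have ae': "AE x in lebesgue. x \<in> \<Omega> \<longrightarrow> R x = R' x"
    using ae \<open>open \<Omega>\<close> by (subst (asm) AE_restrict_space_iff) auto
  have "\<exists>x\<in>ball ?p s. R x = R' x"
  proof (rule ccontr)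
    assume "\<not> ?thesis"
    moreover have "ball ?p s \<subseteq> \<Omega>" using r s by (meson order_trans subset_ball)
    ultimately have "AE x in lebesgue. x \<notin> ball ?p s"
      using ae' by (auto elim!: eventually_mono)
    then have "ball ?p s \<in> null_sets lebesgue"
      by (subst (asm) AE_iff_null_sets[symmetric]) auto
    then show False
      using open_not_negligible[of "ball ?p s"] s by (auto simp: negligible_iff_null_sets)
  qed
  then obtain x where x: "x \<in> ball ?p s" "R x = R' x" by blast
  then have "x \<in> \<Omega>" using r s by auto
  then have "R x = R (\<epsilon> *\<^sub>R i)" "R' x = R' (\<epsilon> *\<^sub>R i)"
    using cell[OF x(1)] assms(3-5) unfolding C_eps_def by blast+
  then show ?thesis using x by simp
qed

lemma F1_eps_eq:
  assumes "open \<Omega>" "0 < \<epsilon>" "spins_of \<epsilon> \<Omega> Q u"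
  shows "F1_eps h \<Omega> \<epsilon> Q = ereal (spin_energy h \<Omega> \<epsilon> u)"
proof -
  define v where "v = (SOME u. spins_of \<epsilon> \<Omega> Q u)"
  have v: "spins_of \<epsilon> \<Omega> Q v" using assms(3) unfolding v_def by (rule someI[of "spins_of \<epsilon> \<Omega> Q"])
  have same: "tensor_square (v i) = tensor_square (u i)" if i: "i \<in> Z_eps \<epsilon> \<Omega>" for i
  proof -
    obtain R where R: "R \<in> C_eps \<epsilon> \<Omega>" "AE x in lebesgue_on \<Omega>. Q x = R x"
      "R (\<epsilon> *\<^sub>R i) = tensor_square (u i)"
      using assms(3) i unfolding spins_of_def by blast
    obtain R' where R': "R' \<in> C_eps \<epsilon> \<Omega>" "AE x in lebesgue_on \<Omega>. Q x = R' x"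
      "R' (\<epsilon> *\<^sub>R i) = tensor_square (v i)"
      using v i unfolding spins_of_def by blast
    have "AE x in lebesgue_on \<Omega>. R x = R' x"
      using R(2) R'(2) by eventually_elim simp
    from C_eps_AE_eq_at_lattice[OF assms(1,2) R(1) R'(1) i this] R R' show ?thesis by simp
  qed
  have "spin_energy h \<Omega> \<epsilon> v = spin_energy h \<Omega> \<epsilon> u"
    unfolding spin_energy_def
    by (intro sum.cong refl) (auto simp: tensor_square_abs_inner[OF same same])
  then show ?thesis using assms(3) by (auto simp: F1_eps_def v_def)
qed

lemma topspace_weak_star: "topspace (weak_star \<Omega>) = Linf_sym \<Omega>"
  by (auto simp: weak_star_def topspace_pullback_topology)

end

(* Since the squared distance of the tensor squares of unit vectors v, w is 2 (1 - (v.w)^2), the energy is comparable with the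
   sum of the squared differences of neighbouring values of Q.

   Lower bound: by the inequality on h, bounded energy bounds the translates of the lattice
   functions.  Testing a weak* limit Q with discrete divergences of test fields therefore shows that
   the divergence functional of Q is bounded in L^2, and the Riesz representation theorem yields
   the weak gradient with the sharp constant.  The pointwise constraint survives because on small
   cells the mean of a unit-norm function has norm at least 1 minus its mean oscillation, which the
   energy controls.

   Upper bound: a map Q in W^{1,2} with values in the circle bd_K is smoothed up to the boundary by
   mollifying and composing with a deformation that pushes the closure of Omega into Omega.  In two
   dimensions the mollified map has norm uniformly close to 1, by the same oscillation estimate and
   the absolute continuity of the Dirichlet integral, so it can be projected back to bd_K.
   Sampling on the lattice gives the recovery sequence; only the derivative of h at 1 matters, and
   boundary cells are negligible because a Lipschitz boundary is a null set. *)

theory Submission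
  imports Defs
begin

text \<open>Both halves rest on the scale invariance of the Dirichlet energy in the plane. When a
  unit-norm function is averaged over cells of side \<delta>, the defects 1 - |mean|^2 of all cells
  together are at most a multiple of the total energy, with a constant that does not see \<delta>;
  weighting every cell by its area \<delta>^2 therefore sends the defect to zero. This takes the
  place of strong compactness, which a weak* limit does not provide by itself. For the upper bound
  the same estimate on one box of side comparable to r needs only little energy on that box,
  although W^{1,2} maps of the plane need not be continuous. The sharp constant survives at the
  boundary because the deformation is the identity outside a thin layer; in the layer a crude factor
  is harmless, as little energy lies there. It survives the projection because the radial projection
  has a Lipschitz constant tending to 1 near the circle.\<close>

section \<open>Functions of class C^n of one variable\<close>

lemma Cn_on_SucD: "Cn_on (Suc n) S f \<Longrightarrow> Cn_on n S f"
proof (induct n arbitrary: f)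
  case 0
  then show ?case by (auto intro: DERIV_continuous_on)
next
  case (Suc n)
  then show ?case by (metis Cn_on.simps(2))
qed

lemma Cn_on_const: "Cn_on n S (\<lambda>_. c)"
proof (induct n arbitrary: c)
  case (Suc n)
  then show ?case by (auto intro!: exI[of _ "\<lambda>_. 0"])
qed simp

lemma Cn_on_add: "Cn_on n S f \<Longrightarrow> Cn_on n S g \<Longrightarrow> Cn_on n S (\<lambda>x. f x + g x)"
proof (induct n arbitrary: f g)
  case (Suc n)
  obtain f' g' where *: "\<forall>x\<in>S. (f has_real_derivative f' x) (at x within S)" "Cn_on n S f'"
    "\<forall>x\<in>S. (g has_real_derivative g' x) (at x within S)" "Cn_on n S g'"
    using Suc.prems by auto
  then show ?case
    by (auto intro!: exI[of _ "\<lambda>x. f' x + g' x"] Suc.hyps derivative_eq_intros)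
qed (simp add: continuous_on_add)

lemma Cn_on_mult: "Cn_on n S f \<Longrightarrow> Cn_on n S g \<Longrightarrow> Cn_on n S (\<lambda>x. f x * g x)"
proof (induct n arbitrary: f g)
  case (Suc n)
  obtain f' g' where *: "\<forall>x\<in>S. (f has_real_derivative f' x) (at x within S)" "Cn_on n S f'"
    "\<forall>x\<in>S. (g has_real_derivative g' x) (at x within S)" "Cn_on n S g'"
    using Suc.prems by auto
  moreover have "Cn_on n S f" "Cn_on n S g"
    using Suc.prems Cn_on_SucD by blast+
  ultimately have "Cn_on n S (\<lambda>x. f' x * g x + f x * g' x)"
    by (intro Cn_on_add Suc.hyps)
  then show ?case using *
    by (auto intro!: exI[of _ "\<lambda>x. f' x * g x + f x * g' x"] derivative_eq_intros)
qed (simp add: continuous_on_mult)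

lemma Cn_on_affine: "Cn_on n UNIV f \<Longrightarrow> Cn_on n UNIV (\<lambda>x. f (c * x + z))"
proof (induct n arbitrary: f)
  case 0
  then show ?case by (auto intro!: continuous_on_compose2[of UNIV f] continuous_intros)
next
  case (Suc n)
  obtain f' where *: "\<And>x. (f has_real_derivative f' x) (at x)" "Cn_on n UNIV f'"
    using Suc.prems by auto
  have "((\<lambda>x. f (c * x + z)) has_real_derivative c * f' (c * x + z)) (at x)" for x
  proof -
    have "((\<lambda>x. c * x + z) has_real_derivative c) (at x)"
      by (auto intro!: derivative_eq_intros)
    from DERIV_chain2[OF *(1) this] show ?thesis by (simp add: mult.commute)
  qed
  moreover have "Cn_on n UNIV (\<lambda>x. c * f' (c * x + z))"
    using Suc.hyps[OF *(2)] by (intro Cn_on_mult Cn_on_const)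
  ultimately show ?case unfolding Cn_on.simps
    by (intro exI[of _ "\<lambda>x. c * f' (c * x + z)"]) simp
qed

section \<open>A smooth bump function\<close>

text \<open>The classical flat function with its rate \<open>c\<close> kept as a parameter: for
  \<open>c\<close> tending to 0 it converges to the indicator of the positive half-line, so products
  of such factors approximate indicators of boxes.\<close>

definition exp_bump :: "real \<Rightarrow> real \<Rightarrow> real" where
  "exp_bump c t = (if t > 0 then exp (- c / t) else 0)"

text \<open>Substituting s = 1/t turns this into the decay of s^i exp(-c s) at infinity, monomial by
  monomial.\<close>

lemma poly_times_exp_tendsto_0:
  assumes "c > 0"
  shows "((\<lambda>t. poly p (1 / t) * exp (- c / t)) \<longlongrightarrow> (0::real)) (at_right 0)"
proof -
  have *: "((\<lambda>s. s ^ i * exp (- c * s)) \<longlongrightarrow> (0::real)) at_top" for i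
  proof -
    have "((\<lambda>s. (c * s) ^ i / exp (c * s)) \<longlongrightarrow> (0::real)) at_top"
      by (rule filterlim_compose[OF tendsto_power_div_exp_0])
         (use assms in \<open>auto intro!: filterlim_tendsto_pos_mult_at_top filterlim_ident\<close>)
    then have "((\<lambda>s. (1 / c ^ i) * ((c * s) ^ i / exp (c * s))) \<longlongrightarrow> (1 / c ^ i) * 0) at_top"
      by (intro tendsto_mult tendsto_const)
    then show ?thesis using assms
      by (simp add: power_mult_distrib exp_minus field_simps)
  qed
  have "((\<lambda>s. \<Sum>i\<le>degree p. coeff p i * (s ^ i * exp (- c * s))) \<longlongrightarrow> (\<Sum>i\<le>degree p. coeff p i * 0)) at_top"
    by (intro tendsto_sum tendsto_mult tendsto_const *)
  then have "((\<lambda>s. poly p s * exp (- c * s)) \<longlongrightarrow> 0) at_top"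
    by (simp add: poly_altdef sum_distrib_right mult.assoc)
  then show ?thesis
    by (simp add: filterlim_at_right_to_top divide_inverse)
qed

text \<open>The functions p(1/t) exp(-c/t) form a class closed under differentiation: p becomes X^2
  (c p - p'). This closure lets the smoothness of \<open>exp_bump\<close> be proved by induction on
  the order.\<close>

lemma poly_exp_bump_derivative:
  assumes "c > 0"
  shows "((\<lambda>t. poly p (1 / t) * exp_bump c t) has_real_derivative
           poly ([:0, 0, 1:] * (smult c p - pderiv p)) (1 / t) * exp_bump c t) (at t)"
proof -
  consider "t > 0" | "t < 0" | "t = 0" by linarith
  then show ?thesis
  proof cases
    case 1
    have "((\<lambda>t. poly p (1 / t) * exp (- c / t)) has_real_derivative
           poly ([:0, 0, 1:] * (smult c p - pderiv p)) (1 / t) * exp (- c / t)) (at t)"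
      using 1 by (auto intro!: derivative_eq_intros DERIV_chain2[OF poly_DERIV]
          simp: field_simps power2_eq_square)
    then have "((\<lambda>t. poly p (1 / t) * exp_bump c t) has_real_derivative
           poly ([:0, 0, 1:] * (smult c p - pderiv p)) (1 / t) * exp (- c / t)) (at t)"
      by (rule has_field_derivative_transform_within_open[where S = "{0<..}"])
         (use 1 in \<open>auto simp: exp_bump_def\<close>)
    then show ?thesis using 1 by (simp add: exp_bump_def)
  next
    case 2
    have "((\<lambda>t. 0) has_real_derivative 0) (at t)" by simp
    then have "((\<lambda>t. poly p (1 / t) * exp_bump c t) has_real_derivative 0) (at t)"
      by (rule has_field_derivative_transform_within_open[where S = "{..<0}"])
         (use 2 in \<open>auto simp: exp_bump_def\<close>)
    then show ?thesis using 2 by (simp add: exp_bump_def)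
  next
    case 3
    \<comment> \<open>At 0 the difference quotient is again of this form, with p replaced by X
      p.\<close>
    have "((\<lambda>h. poly p (1 / h) * exp_bump c h / h) \<longlongrightarrow> 0) (at_right 0)"
      by (rule Lim_transform_eventually[OF poly_times_exp_tendsto_0[OF assms, of "pCons 0 p"]])
         (auto simp: eventually_at_right_field exp_bump_def intro!: exI[of _ 1])
    moreover have "((\<lambda>h. poly p (1 / h) * exp_bump c h / h) \<longlongrightarrow> 0) (at_left 0)"
      by (rule Lim_transform_eventually[OF tendsto_const])
         (auto simp: eventually_at_left_field exp_bump_def intro!: exI[of _ "-1"])
    ultimately have "((\<lambda>h. poly p (1 / h) * exp_bump c h / h) \<longlongrightarrow> 0) (at 0)"
      by (simp add: filterlim_at_split)
    then show ?thesis using 3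
      by (simp add: has_field_derivative_iff exp_bump_def)
  qed
qed

lemma Cn_on_exp_bump:
  assumes "c > 0"
  shows "Cn_on n UNIV (exp_bump c)"
proof -
  have "Cn_on n UNIV (\<lambda>t. poly p (1 / t) * exp_bump c t)" for p
  proof (induct n arbitrary: p)
    case 0
    show ?case
      using poly_exp_bump_derivative[OF assms, of p] by (auto intro!: DERIV_continuous_on)
  next
    case (Suc n)
    show ?case
      unfolding Cn_on.simps
      using poly_exp_bump_derivative[OF assms, of p] Suc
      by (intro exI[of _ "\<lambda>t. poly ([:0, 0, 1:] * (smult c p - pderiv p)) (1 / t) * exp_bump c t"])
         blast
  qed
  from this[of 1] show ?thesis by simp
qed

section \<open>Smooth functions on the plane\<close>

lemma partial_deriv_eqI:
  "(f has_derivative f') (at x) \<Longrightarrow> partial_deriv k f x = f' (axis k 1)"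
  unfolding partial_deriv_def by (metis frechet_derivative_at)

lemma differentiable_has_derivative_partial:
  assumes "f differentiable (at x)"
  shows "(f has_derivative (\<lambda>v. \<Sum>k\<in>UNIV. v $ k * partial_deriv k f x)) (at x)"
proof -
  have d: "(f has_derivative frechet_derivative f (at x)) (at x)"
    using assms frechet_derivative_works by blast
  then interpret linear "frechet_derivative f (at x)"
    by (rule has_derivative_linear)
  have "frechet_derivative f (at x) v = (\<Sum>k\<in>UNIV. v $ k * partial_deriv k f x)" for v
  proof -
    have "v = (\<Sum>k\<in>UNIV. v $ k *\<^sub>R axis k 1)"
      by (simp add: vec_eq_iff axis_def if_distrib cong: if_cong)
    then have "frechet_derivative f (at x) v = frechet_derivative f (at x) (\<Sum>k\<in>UNIV. v $ k *\<^sub>R axis k 1)"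
      by simp
    also have "\<dots> = (\<Sum>k\<in>UNIV. v $ k * partial_deriv k f x)"
      by (simp add: sum scale partial_deriv_def)
    finally show ?thesis .
  qed
  then have "frechet_derivative f (at x) = (\<lambda>v. \<Sum>k\<in>UNIV. v $ k * partial_deriv k f x)"
    by (rule ext)
  with d show ?thesis by (simp only:)
qed

text \<open>Each partial derivative of a product of one-variable functions has the same shape with
  one factor differentiated, so the induction runs over both factors at once.\<close>

lemma Cn_plane_product:
  "\<lbrakk>Cn_on n UNIV f; Cn_on n UNIV g\<rbrakk> \<Longrightarrow> Cn_plane n (\<lambda>x. f (x $ 1) * g (x $ 2))"
proof (induct n arbitrary: f g)
  case 0
  then show ?case
    by (auto intro!: continuous_on_mult continuous_on_compose2[of UNIV f]
      continuous_on_compose2[of UNIV g] continuous_intros)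
next
  case (Suc n)
  obtain f' g' where *: "\<And>x. (f has_real_derivative f' x) (at x)" "Cn_on n UNIV f'"
    "\<And>x. (g has_real_derivative g' x) (at x)" "Cn_on n UNIV g'"
    using Suc.prems by auto
  have fn: "Cn_on n UNIV f" "Cn_on n UNIV g"
    using Suc.prems Cn_on_SucD by blast+
  note fd = *(1,3)
  have d: "((\<lambda>x::real^2. f (x $ 1) * g (x $ 2)) has_derivative
      (\<lambda>v. f (x $ 1) * (g' (x $ 2) * v $ 2) + f' (x $ 1) * v $ 1 * g (x $ 2))) (at x)" for x
  proof -
    have *: "((\<lambda>x::real^2. x $ k) has_derivative (\<lambda>v. v $ k)) (at x)" for k
      by (rule bounded_linear_imp_has_derivative[OF bounded_linear_vec_nth])
    have "((\<lambda>x::real^2. f (x $ 1)) has_derivative (\<lambda>v. f' (x $ 1) * v $ 1)) (at x)"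
      using has_derivative_compose[OF *[of 1] has_field_derivative_imp_has_derivative[OF fd(1)]]
      by simp
    moreover have "((\<lambda>x::real^2. g (x $ 2)) has_derivative (\<lambda>v. g' (x $ 2) * v $ 2)) (at x)"
      using has_derivative_compose[OF *[of 2] has_field_derivative_imp_has_derivative[OF fd(2)]]
      by simp
    ultimately show ?thesis
      by (rule has_derivative_mult)
  qed
  have "partial_deriv k (\<lambda>x. f (x $ 1) * g (x $ 2)) =
      (if k = 1 then (\<lambda>x. f' (x $ 1) * g (x $ 2)) else (\<lambda>x. f (x $ 1) * g' (x $ 2)))" for k
    using partial_deriv_eqI[OF d, of k] exhaust_2[of k]
    by (auto simp: fun_eq_iff axis_def)
  then show ?case using d Suc.hyps * fn
    by (auto simp: differentiable_def)
qed

lemma partial_deriv_add: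
  "f differentiable (at x) \<Longrightarrow> g differentiable (at x) \<Longrightarrow>
    partial_deriv k (\<lambda>x. f x + g x) x = partial_deriv k f x + partial_deriv k g x"
  using partial_deriv_eqI[OF has_derivative_add, of f "frechet_derivative f (at x)" x g "frechet_derivative g (at x)"]
  by (simp add: partial_deriv_def frechet_derivative_works)

lemma Cn_plane_add: "\<lbrakk>Cn_plane n f; Cn_plane n g\<rbrakk> \<Longrightarrow> Cn_plane n (\<lambda>x. f x + g x)"
proof (induct n arbitrary: f g)
  case (Suc n)
  have "partial_deriv k (\<lambda>x. f x + g x) = (\<lambda>x. partial_deriv k f x + partial_deriv k g x)" for k
    using Suc.prems by (auto simp: partial_deriv_add)
  then show ?case using Suc by auto
qed (simp add: continuous_on_add)

lemma partial_deriv_cmult: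
  "f differentiable (at x) \<Longrightarrow> partial_deriv k (\<lambda>x. c * f x) x = c * partial_deriv k f x"
  using partial_deriv_eqI[OF has_derivative_mult_right, of f "frechet_derivative f (at x)" x]
  by (simp add: partial_deriv_def frechet_derivative_works)

lemma Cn_plane_cmult: "Cn_plane n f \<Longrightarrow> Cn_plane n (\<lambda>x. c * f x)"
proof (induct n arbitrary: f)
  case (Suc n)
  have "partial_deriv k (\<lambda>x. c * f x) = (\<lambda>x. c * partial_deriv k f x)" for k
    using Suc.prems by (auto simp: partial_deriv_cmult)
  then show ?case using Suc by auto
qed (simp add: continuous_on_mult_left)

lemma partial_deriv_affine:
  assumes "\<And>x. f differentiable (at x)"
  shows "(\<lambda>x. f (c *\<^sub>R x + z)) differentiable (at x)"
    and "partial_deriv k (\<lambda>x. f (c *\<^sub>R x + z)) x = c * partial_deriv k f (c *\<^sub>R x + z)"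
proof -
  have "((\<lambda>x. f (c *\<^sub>R x + z)) has_derivative (\<lambda>v. \<Sum>k\<in>UNIV. (c *\<^sub>R v) $ k * partial_deriv k f (c *\<^sub>R x + z))) (at x)"
    by (rule has_derivative_compose[OF _ differentiable_has_derivative_partial[OF assms]])
       (auto intro!: derivative_eq_intros)
  from partial_deriv_eqI[OF this, of k] this
  show "(\<lambda>x. f (c *\<^sub>R x + z)) differentiable (at x)"
    and "partial_deriv k (\<lambda>x. f (c *\<^sub>R x + z)) x = c * partial_deriv k f (c *\<^sub>R x + z)"
    using exhaust_2[of k] by (auto simp: differentiable_def axis_def sum_2)
qed

lemma Cn_plane_affine: "Cn_plane n f \<Longrightarrow> Cn_plane n (\<lambda>x. f (c *\<^sub>R x + z))"
proof (induct n arbitrary: f)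
  case 0
  then show ?case by (auto intro!: continuous_on_compose2[of UNIV f] continuous_intros)
next
  case (Suc n)
  then have d: "\<And>x. f differentiable (at x)" by simp
  have "partial_deriv k (\<lambda>x. f (c *\<^sub>R x + z)) = (\<lambda>x. c * partial_deriv k f (c *\<^sub>R x + z))" for k
    using partial_deriv_affine[OF d] by blast
  then show ?case using Suc partial_deriv_affine[OF d]
    by (auto intro!: Cn_plane_cmult)
qed

section \<open>Square-integrable functions: Cauchy-Schwarz and Riesz representation\<close>

lemma L2_inner_integrable:
  fixes f g :: "'a \<Rightarrow> 'b::euclidean_space"
  assumes [measurable]: "f \<in> borel_measurable M" "g \<in> borel_measurable M"
    and "integrable M (\<lambda>x. (norm (f x))^2)" "integrable M (\<lambda>x. (norm (g x))^2)"
  shows "integrable M (\<lambda>x. f x \<bullet> g x)"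
proof (rule Bochner_Integration.integrable_bound)
  show "integrable M (\<lambda>x. (norm (f x))^2 + (norm (g x))^2)"
    using assms by simp
  show "AE x in M. norm (f x \<bullet> g x) \<le> norm ((norm (f x))^2 + (norm (g x))^2)"
  proof (intro always_eventually allI)
    fix x
    have "\<bar>f x \<bullet> g x\<bar> \<le> norm (f x) * norm (g x)" by (rule Cauchy_Schwarz_ineq2)
    also have "\<dots> \<le> (norm (f x))^2 + (norm (g x))^2"
      using sum_squares_bound[of "norm (f x)" "norm (g x)"]
        mult_nonneg_nonneg[OF norm_ge_zero[of "f x"] norm_ge_zero[of "g x"]] by linarith
    finally show "norm (f x \<bullet> g x) \<le> norm ((norm (f x))^2 + (norm (g x))^2)" by simp
  qed
qed measurable

lemma norm_add_sq: "(norm (a + b :: 'b::real_inner))^2 = (norm a)^2 + 2 * (a \<bullet> b) + (norm b)^2"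
  by (simp add: power2_norm_eq_inner inner_add_left inner_add_right inner_commute)

lemma L2_add:
  fixes f g :: "'a \<Rightarrow> 'b::euclidean_space"
  assumes [measurable]: "f \<in> borel_measurable M" "g \<in> borel_measurable M"
    and "integrable M (\<lambda>x. (norm (f x))^2)" "integrable M (\<lambda>x. (norm (g x))^2)"
  shows "integrable M (\<lambda>x. (norm (f x + g x))^2)"
    and "(LINT x|M. (norm (f x + g x))^2) =
      (LINT x|M. (norm (f x))^2) + 2 * (LINT x|M. f x \<bullet> g x) + (LINT x|M. (norm (g x))^2)"
  using assms L2_inner_integrable[OF assms] by (simp_all add: norm_add_sq)

lemma L2_scaleR:
  fixes f :: "'a \<Rightarrow> 'b::euclidean_space"
  assumes "integrable M (\<lambda>x. (norm (f x))^2)"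
  shows "integrable M (\<lambda>x. (norm (c *\<^sub>R f x))^2)"
  using assms by (simp add: power_mult_distrib)

text \<open>The squared norm of f + t g is a nonnegative quadratic in t; the bound is its
  discriminant condition.\<close>

lemma L2_Cauchy_Schwarz:
  fixes f g :: "'a \<Rightarrow> 'b::euclidean_space"
  assumes [measurable]: "f \<in> borel_measurable M" "g \<in> borel_measurable M"
    and "integrable M (\<lambda>x. (norm (f x))^2)" "integrable M (\<lambda>x. (norm (g x))^2)"
  shows "\<bar>LINT x|M. f x \<bullet> g x\<bar> \<le> sqrt (LINT x|M. (norm (f x))^2) * sqrt (LINT x|M. (norm (g x))^2)"
proof -
  define A B C where "A = (LINT x|M. (norm (f x))^2)" and "B = (LINT x|M. f x \<bullet> g x)"
    and "C = (LINT x|M. (norm (g x))^2)"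
  have q: "0 \<le> A + 2 * t * B + t^2 * C" for t
  proof -
    have "0 \<le> (LINT x|M. (norm (f x + t *\<^sub>R g x))^2)" by simp
    also have "\<dots> = A + 2 * t * B + t^2 * C"
      by (subst L2_add(2)) (use assms in \<open>simp_all add: A_def B_def C_def power_mult_distrib\<close>)
    finally show ?thesis .
  qed
  have "0 \<le> A" "0 \<le> C" by (simp_all add: A_def C_def)
  have "B^2 \<le> A * C"
  proof (cases "C = 0")
    case True
    have "B = 0"
    proof (rule ccontr)
      assume "B \<noteq> 0"
      \<comment> \<open>For \<open>C = 0\<close> the quadratic is affine in t, and this t gives it
        the value -1.\<close>
      then show False using q[of "- (A + 1) / (2 * B)"] True by (simp add: field_simps)
    qed
    then show ?thesis using True by simp
  next
    case False
    then have "0 < C" using \<open>0 \<le> C\<close> by simp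
    then show ?thesis using q[of "- B / C"] by (simp add: field_simps power2_eq_square)
  qed
  then have "sqrt (B^2) \<le> sqrt (A * C)" by (rule real_sqrt_le_mono)
  then show ?thesis by (simp add: A_def B_def C_def real_sqrt_mult)
qed

text \<open>The representing function is the limit of a minimizing sequence of
  \<open>f \<mapsto> \<parallel>f\<parallel>^2 / 2 - L f\<close>.\<close>

lemma (in finite_measure) L2_Riesz_representation:
  fixes X :: "('a \<Rightarrow> 'b::euclidean_space) set" and L :: "('a \<Rightarrow> 'b) \<Rightarrow> real"
  assumes meas: "\<And>f. f \<in> X \<Longrightarrow> f \<in> borel_measurable M"
    and sq: "\<And>f. f \<in> X \<Longrightarrow> integrable M (\<lambda>x. (norm (f x))^2)"
    and "X \<noteq> {}"
    and add: "\<And>f g. f \<in> X \<Longrightarrow> g \<in> X \<Longrightarrow> (\<lambda>x. f x + g x) \<in> X"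
    and scale: "\<And>f t. f \<in> X \<Longrightarrow> (\<lambda>x. t *\<^sub>R f x) \<in> X"
    and L_add: "\<And>f g. f \<in> X \<Longrightarrow> g \<in> X \<Longrightarrow> L (\<lambda>x. f x + g x) = L f + L g"
    and L_scale: "\<And>f t. f \<in> X \<Longrightarrow> L (\<lambda>x. t *\<^sub>R f x) = t * L f"
    and bound: "\<And>f. f \<in> X \<Longrightarrow> L f \<le> c * sqrt (LINT x|M. (norm (f x))^2)" and "0 \<le> c"
  obtains D where "D \<in> borel_measurable M" "integrable M (\<lambda>x. (norm (D x))^2)"
    "(LINT x|M. (norm (D x))^2) \<le> c^2" "\<And>f. f \<in> X \<Longrightarrow> (LINT x|M. D x \<bullet> f x) = L f"
proof -
  define N where "N f = (LINT x|M. (norm (f x :: 'b))^2)" for f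
  define J where "J f = N f / 2 - L f" for f
  have N0: "0 \<le> N f" for f by (simp add: N_def)
  \<comment> \<open>Completing the square: N/2 - c sqrt N is least at sqrt N = c.\<close>
  have "J f \<ge> - (c^2) / 2" if "f \<in> X" for f
  proof -
    have "0 \<le> (sqrt (N f) - c)^2" by simp
    then have "2 * (c * sqrt (N f)) \<le> N f + c^2"
      using N0[of f] by (simp add: power2_diff algebra_simps)
    then show ?thesis using bound[OF that] by (simp add: J_def N_def)
  qed
  then have bdd: "bdd_below (J ` X)" by (meson bdd_belowI2)
  define m where "m = Inf (J ` X)"
  have m: "m \<le> J f" if "f \<in> X" for f
    unfolding m_def using that bdd by (intro cInf_lower) auto
  define h :: "nat \<Rightarrow> real" where "h n = (1/2) ^ n" for n
  have h_lim: "h \<longlonglongrightarrow> 0" unfolding h_def by (rule LIMSEQ_power_zero) simp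
  have h_mono: "h i \<le> h k" if "k \<le> i" for i k
    unfolding h_def using that by (intro power_decreasing) auto
  have h_pos: "0 < h n" for n by (simp add: h_def)
  have "\<exists>f\<in>X. J f < m + h n" for n :: nat
  proof (rule ccontr)
    assume "\<not> ?thesis"
    then have "m + h n \<le> Inf (J ` X)"
      using \<open>X \<noteq> {}\<close> by (intro cInf_greatest) (auto simp: not_less)
    moreover have "0 < h n" by (simp add: h_def)
    ultimately show False unfolding m_def[symmetric] by linarith
  qed
  then obtain F where FX: "\<And>n. F n \<in> X" and FJ: "\<And>n::nat. J (F n) < m + h n" by metis
  note [measurable] = meas[OF FX]
  note Fsq = sq[OF FX]
  have diffX: "(\<lambda>x. f x - g x) \<in> X" if "f \<in> X" "g \<in> X" for f g
    using add[OF that(1) scale[OF that(2), of "-1"]] by simp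
  have J_expand: "J (\<lambda>x. f x + t *\<^sub>R g x) = J f + t * ((LINT x|M. f x \<bullet> g x) - L g) + t^2 / 2 * N g"
    if "f \<in> X" "g \<in> X" for f g t
    unfolding J_def N_def L_add[OF that(1) scale[OF that(2)]] L_scale[OF that(2)]
    by (subst L2_add(2)) (use that meas sq L2_scaleR[OF sq] in \<open>auto simp: power_mult_distrib algebra_simps\<close>)
  \<comment> \<open>Uniform convexity: the midpoint of \<open>F i\<close> and \<open>F j\<close> is
    also a competitor, and \<open>J\<close> there lies N(F j - F i)/8 below the average of the two
    values. As both values are within \<open>h\<close> of the infimum, the sequence is Cauchy in
    L^2.\<close>
  have par: "N (\<lambda>x. F j x - F i x) \<le> 4 * (h i + h j)" for i j
  proof -
    define g where "g = (\<lambda>x. F j x - F i x)"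
    have gX: "g \<in> X" unfolding g_def by (intro diffX FX)
    have "(\<lambda>x. F i x + 1 *\<^sub>R g x) = F j" by (simp add: g_def)
    with J_expand[OF FX gX, of i 1]
    have 1: "J (F j) = J (F i) + ((LINT x|M. F i x \<bullet> g x) - L g) + N g / 2" by simp
    have "m \<le> J (\<lambda>x. F i x + (1/2) *\<^sub>R g x)"
      by (intro m add FX scale gX)
    then have "m \<le> J (F i) + ((LINT x|M. F i x \<bullet> g x) - L g) / 2 + N g / 8"
      using J_expand[OF FX gX, of i "1/2"] by (simp add: power2_eq_square)
    then have "N g \<le> 4 * h i + 4 * h j" using 1 FJ[of i] FJ[of j] by argo
    then show ?thesis unfolding g_def[symmetric] by simp
  qed
  \<comment> \<open>The measure is finite, so the L^2 Cauchy property passes to L^1, and from there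
    to an almost everywhere convergent subsequence that defines \<open>D\<close> pointwise.\<close>
  have L1_Cauchy: "\<exists>k. \<forall>i\<ge>k. \<forall>j\<ge>k. (LINT x|M. norm (F i x - F j x)) < e" if "e > 0" for e
  proof -
    define C where "C = sqrt (measure M (space M)) * sqrt 8"
    have "C \<ge> 0" by (simp add: C_def)
    have "(\<lambda>k. C * sqrt (h k)) \<longlonglongrightarrow> C * sqrt 0"
      by (intro tendsto_intros h_lim)
    then have "eventually (\<lambda>k. C * sqrt (h k) < e) sequentially"
      by (rule order_tendstoD(2)) (simp add: that)
    then obtain k where k: "C * sqrt (h k) < e" by (auto simp: eventually_sequentially)
    show ?thesis
    proof (intro exI allI impI)
      fix i j assume ij: "k \<le> i" "k \<le> j"
      have "(LINT x|M. norm (F i x - F j x)) = (LINT x|M. (norm (F i x - F j x)) \<bullet> 1)" by simp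
      also have "\<dots> \<le> sqrt (LINT x|M. (norm (norm (F i x - F j x)))^2) * sqrt (LINT x|M. (norm (1::real))^2)"
        using sq[OF diffX[OF FX FX]] by (intro order_trans[OF abs_ge_self L2_Cauchy_Schwarz]) simp_all
      also have "\<dots> = sqrt (N (\<lambda>x. F i x - F j x)) * sqrt (measure M (space M))"
        by (simp add: N_def)
      also have "\<dots> \<le> sqrt (8 * h k) * sqrt (measure M (space M))"
      proof (intro mult_right_mono real_sqrt_le_mono)
        have "h i \<le> h k" "h j \<le> h k"
          using ij by (auto intro: h_mono)
        then show "N (\<lambda>x. F i x - F j x) \<le> 8 * h k" using par[of i j] by argo
      qed simp
      also have "\<dots> < e" using k by (simp add: C_def real_sqrt_mult mult_ac)
      finally show "(LINT x|M. norm (F i x - F j x)) < e" .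
    qed
  qed
  have Fint: "integrable M (F n)" for n
    using square_integrable_imp_integrable[of "\<lambda>x. norm (F n x)"] Fsq[of n]
    by (intro integrable_norm_cancel[of M "F n"]) simp_all
  obtain r where r: "strict_mono r" "AE x in M. Cauchy (\<lambda>i. F (r i) x)"
    by (rule cauchy_L1_AE_cauchy_subseq[OF Fint L1_Cauchy])
  define D where "D x = lim (\<lambda>i. F (r i) x)" for x
  have [measurable]: "D \<in> borel_measurable M" unfolding D_def by measurable
  have lim: "AE x in M. (\<lambda>i. F (r i) x) \<longlonglongrightarrow> D x"
    using r(2) unfolding D_def by eventually_elim (metis Cauchy_convergent_iff convergent_LIMSEQ_iff)
  \<comment> \<open>Fatou's lemma along the subsequence carries the Cauchy estimate over to the
    limit \<open>D\<close>.\<close>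
  have DF: "integrable M (\<lambda>x. (norm (F i x - D x))^2)" "N (\<lambda>x. F i x - D x) \<le> 8 * h i" for i
  proof -
    have "(\<integral>\<^sup>+ x. ennreal ((norm (F i x - D x))^2) \<partial>M) \<le>
        (\<integral>\<^sup>+ x. liminf (\<lambda>k. ennreal ((norm (F i x - F (r k) x))^2)) \<partial>M)"
    proof (rule nn_integral_mono_AE)
      show "AE x in M. ennreal ((norm (F i x - D x))^2) \<le> liminf (\<lambda>k. ennreal ((norm (F i x - F (r k) x))^2))"
        using lim
      proof eventually_elim
        case (elim x)
        then have "(\<lambda>k. ennreal ((norm (F i x - F (r k) x))^2)) \<longlonglongrightarrow> ennreal ((norm (F i x - D x))^2)"
          by (intro tendsto_intros)
        from lim_imp_Liminf[OF _ this] show ?case by simp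
      qed
    qed
    also have "\<dots> \<le> liminf (\<lambda>k. \<integral>\<^sup>+ x. ennreal ((norm (F i x - F (r k) x))^2) \<partial>M)"
      by (rule nn_integral_liminf) measurable
    also have "\<dots> \<le> ennreal (8 * h i)"
    proof -
      have "eventually (\<lambda>k. (\<integral>\<^sup>+ x. ennreal ((norm (F i x - F (r k) x))^2) \<partial>M) \<le> ennreal (8 * h i)) sequentially"
        unfolding eventually_sequentially
      proof (intro exI allI impI)
        fix k assume "i \<le> k"
        then have "i \<le> r k" using seq_suble[OF r(1), of k] by simp
        then have "h (r k) \<le> h i" by (auto intro: h_mono)
        then have "N (\<lambda>x. F i x - F (r k) x) \<le> 8 * h i" using h_pos[of "r k"] par[of i "r k"] par[of "r k" i] by argo
        then show "(\<integral>\<^sup>+ x. ennreal ((norm (F i x - F (r k) x))^2) \<partial>M) \<le> ennreal (8 * h i)"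
          using sq[OF diffX[OF FX FX]]
          by (subst nn_integral_eq_integral) (auto simp: N_def ennreal_leI)
      qed
      then show ?thesis
        by (rule Liminf_le[rotated]) simp
    qed
    finally have *: "(\<integral>\<^sup>+ x. ennreal ((norm (F i x - D x))^2) \<partial>M) \<le> ennreal (8 * h i)" .
    then show int: "integrable M (\<lambda>x. (norm (F i x - D x))^2)"
      by (intro integrableI_bounded) (auto simp: less_top[symmetric] top_unique)
    show "N (\<lambda>x. F i x - D x) \<le> 8 * h i"
      using * h_pos[of i] unfolding N_def
      by (subst (asm) nn_integral_eq_integral[OF int]) (auto simp: ennreal_le_iff less_imp_le)
  qed
  have "D x = F 0 x + (-1) *\<^sub>R (F 0 x - D x)" for x by simp
  then have Dsq: "integrable M (\<lambda>x. (norm (D x))^2)"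
    using L2_add(1)[OF _ _ Fsq[of 0] L2_scaleR[OF DF(1)[of 0], of "-1"]] by simp
  have half: "(\<lambda>i. 8 * h i) \<longlonglongrightarrow> (8 * 0 :: real)"
    by (intro tendsto_intros h_lim)
  have inner_lim: "(\<lambda>i. LINT x|M. F i x \<bullet> g x) \<longlonglongrightarrow> (LINT x|M. D x \<bullet> g x)"
    if [measurable]: "g \<in> borel_measurable M" and g: "integrable M (\<lambda>x. (norm (g x))^2)" for g
  proof (rule Lim_null[THEN iffD2], rule tendsto_0_le[where K = 1])
    show "(\<lambda>i. sqrt (8 * h i) * sqrt (N g)) \<longlonglongrightarrow> 0"
      using tendsto_mult[OF tendsto_real_sqrt[OF half] tendsto_const[of "sqrt (N g)"]] by simp
    show "eventually (\<lambda>i. norm ((LINT x|M. F i x \<bullet> g x) - (LINT x|M. D x \<bullet> g x)) \<le>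
        norm (sqrt (8 * h i) * sqrt (N g)) * 1) sequentially"
    proof (intro always_eventually allI)
      fix i
      have "(LINT x|M. F i x \<bullet> g x) - (LINT x|M. D x \<bullet> g x) = (LINT x|M. (F i x - D x) \<bullet> g x)"
        unfolding inner_diff_left
        by (rule Bochner_Integration.integral_diff[symmetric]; intro L2_inner_integrable) (use g Dsq Fsq in simp_all)
      also have "\<bar>\<dots>\<bar> \<le> sqrt (N (\<lambda>x. F i x - D x)) * sqrt (N g)"
        unfolding N_def by (rule L2_Cauchy_Schwarz) (use DF(1) g in simp_all)
      also have "\<dots> \<le> sqrt (8 * h i) * sqrt (N g)"
        using DF(2)[of i] N0 by (intro mult_right_mono) auto
      finally show "norm ((LINT x|M. F i x \<bullet> g x) - (LINT x|M. D x \<bullet> g x)) \<le>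
        norm (sqrt (8 * h i) * sqrt (N g)) * 1" using N0[of g] h_pos[of i] by (simp add: abs_mult)
    qed
  qed
  have J_lim: "(\<lambda>i. J (F i)) \<longlonglongrightarrow> m"
  proof (rule tendsto_sandwich[OF _ _ tendsto_const])
    have "(\<lambda>i. m + h i) \<longlonglongrightarrow> m + 0"
      by (intro tendsto_intros h_lim)
    then show "(\<lambda>i. m + h i) \<longlonglongrightarrow> m" by simp
    show "eventually (\<lambda>i. m \<le> J (F i)) sequentially" using m[OF FX] by simp
    show "eventually (\<lambda>i. J (F i) \<le> m + h i) sequentially" using FJ by (simp add: less_imp_le)
  qed
  \<comment> \<open>First variation: perturbing \<open>F i\<close> in a direction \<open>g\<close>
    of \<open>X\<close> and letting i grow gives 0 \<le> t B + t^2 N g / 2 for every t, which forces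
    B = 0.\<close>
  have rep: "(LINT x|M. D x \<bullet> g x) = L g" if "g \<in> X" for g
  proof -
    define B where "B = (LINT x|M. D x \<bullet> g x) - L g"
    have q: "0 \<le> t * B + t^2 / 2 * N g" for t
    proof -
      have "(\<lambda>i. J (F i) + t * ((LINT x|M. F i x \<bullet> g x) - L g) + t^2 / 2 * N g)
          \<longlonglongrightarrow> m + t * B + t^2 / 2 * N g"
        unfolding B_def by (intro tendsto_intros J_lim inner_lim meas sq that)
      then have "m \<le> m + t * B + t^2 / 2 * N g"
      proof (rule LIMSEQ_le_const)
        show "\<exists>k. \<forall>i\<ge>k. m \<le> J (F i) + t * ((LINT x|M. F i x \<bullet> g x) - L g) + t^2 / 2 * N g"
          using m[OF add[OF FX scale[OF that]]] J_expand[OF FX that] by auto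
      qed
      then show ?thesis by simp
    qed
    have "B = 0"
    proof (cases "N g = 0")
      case True
      then show ?thesis using q[of 1] q[of "-1"] by simp
    next
      case False
      then have "N g > 0" using N0[of g] by simp
      then have "B * B \<le> 0" using q[of "- B / N g"] by (simp add: field_simps power2_eq_square)
      then show ?thesis by (auto simp: mult_le_0_iff)
    qed
    then show ?thesis by (simp add: B_def)
  qed
  \<comment> \<open>\<open>D\<close> need not belong to \<open>X\<close>, so the bound on
    \<open>L\<close> is applied to \<open>F i\<close>; both L (F i) and N (F i) converge to N
    D.\<close>
  have "N D \<le> c^2"
  proof -
    have 1: "(\<lambda>i. LINT x|M. F i x \<bullet> D x) \<longlonglongrightarrow> N D"
      using inner_lim[of D] Dsq by (simp add: N_def power2_norm_eq_inner)
    have eq: "(LINT x|M. F i x \<bullet> D x) = L (F i)" for i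
      using rep[OF FX[of i]] by (simp add: inner_commute)
    have NF': "(\<lambda>i. N (F i)) \<longlonglongrightarrow> N D"
    proof -
      have "N (\<lambda>x. F i x - D x) = N (F i) - 2 * L (F i) + N D" for i
        using L2_add(2)[of "F i" M "\<lambda>x. (-1) *\<^sub>R D x"] Fsq Dsq
        by (simp add: N_def eq)
      moreover have "(\<lambda>i. N (\<lambda>x. F i x - D x)) \<longlonglongrightarrow> 0"
      proof (rule tendsto_sandwich[OF _ _ tendsto_const])
        show "eventually (\<lambda>i. 0 \<le> N (\<lambda>x. F i x - D x)) sequentially" using N0 by simp
        show "eventually (\<lambda>i. N (\<lambda>x. F i x - D x) \<le> 8 * h i) sequentially" using DF(2) by simp
        show "(\<lambda>i. 8 * h i) \<longlonglongrightarrow> 0" using half by simp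
      qed
      ultimately have "(\<lambda>i. N (F i) - 2 * L (F i) + N D) \<longlonglongrightarrow> 0" by (simp only:)
      then have "(\<lambda>i. (N (F i) - 2 * L (F i) + N D) + 2 * L (F i) - N D) \<longlonglongrightarrow> 0 + 2 * N D - N D"
        using 1 unfolding eq by (intro tendsto_intros)
      then show ?thesis by simp
    qed
    have "(\<lambda>i. c * sqrt (N (F i))) \<longlonglongrightarrow> c * sqrt (N D)"
      by (intro tendsto_intros NF')
    with 1 have "N D \<le> c * sqrt (N D)"
      unfolding eq by (rule LIMSEQ_le) (use bound[OF FX] in \<open>auto simp: N_def\<close>)
    then have "sqrt (N D) * sqrt (N D) \<le> c * sqrt (N D)" using N0[of D] by simp
    have "sqrt (N D) \<le> c"
    proof (rule ccontr)
      assume "\<not> sqrt (N D) \<le> c"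
      then have "c < sqrt (N D)" "0 < sqrt (N D)" using \<open>0 \<le> c\<close> by linarith+
      then have "c * sqrt (N D) < sqrt (N D) * sqrt (N D)" by (intro mult_strict_right_mono)
      then show False using \<open>N D \<le> c * sqrt (N D)\<close> N0[of D] by simp
    qed
    then have "(sqrt (N D))^2 \<le> c^2" using N0[of D] by (intro power_mono) auto
    then show ?thesis using N0[of D] by simp
  qed
  then show ?thesis using rep Dsq by (intro that[of D]) (simp_all add: N_def)
qed

section \<open>Test functions\<close>

lemma test_functionI:
  assumes "\<And>n. Cn_plane n \<phi>" "compact K" "K \<subseteq> \<Omega>" "\<And>x. \<phi> x \<noteq> 0 \<Longrightarrow> x \<in> K"
  shows "test_function \<Omega> \<phi>"
proof -
  have "closure {x. \<phi> x \<noteq> 0} \<subseteq> K"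
    using assms by (intro closure_minimal) (auto simp: compact_imp_closed)
  then show ?thesis using assms closed_Int_compact[of "closure {x. \<phi> x \<noteq> 0}" K]
    by (auto simp: test_function_def Int_absorb2)
qed

lemma test_functionE:
  assumes "test_function \<Omega> \<phi>"
  obtains K where "compact K" "K \<subseteq> \<Omega>" "\<And>x. x \<notin> K \<Longrightarrow> \<phi> x = 0"
proof (rule that[of "closure {x. \<phi> x \<noteq> 0}"])
  show "\<phi> x = 0" if "x \<notin> closure {x. \<phi> x \<noteq> 0}" for x
    using that closure_subset[of "{x. \<phi> x \<noteq> 0}"] by blast
qed (use assms in \<open>simp_all add: test_function_def\<close>)

lemma test_function_outside: "test_function \<Omega> \<phi> \<Longrightarrow> x \<notin> \<Omega> \<Longrightarrow> \<phi> x = 0"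
  by (metis test_functionE subsetD)

lemma test_function_Cn: "test_function \<Omega> \<phi> \<Longrightarrow> Cn_plane n \<phi>"
  by (simp add: test_function_def)

lemma test_function_differentiable: "test_function \<Omega> \<phi> \<Longrightarrow> \<phi> differentiable (at x)"
  using test_function_Cn[of \<Omega> \<phi> 1] by simp

lemma test_function_has_derivative:
  "test_function \<Omega> \<phi> \<Longrightarrow> (\<phi> has_derivative (\<lambda>v. \<Sum>k\<in>UNIV. v $ k * partial_deriv k \<phi> x)) (at x)"
  by (intro differentiable_has_derivative_partial test_function_differentiable)

lemma test_function_continuous: "test_function \<Omega> \<phi> \<Longrightarrow> continuous_on S \<phi>"
  using test_function_Cn[of \<Omega> \<phi> 0] by (auto intro: continuous_on_subset)

lemma test_function_borel [measurable_dest]: "test_function \<Omega> \<phi> \<Longrightarrow> \<phi> \<in> borel_measurable borel"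
  by (intro borel_measurable_continuous_onI test_function_continuous)

lemma test_function_partial_deriv:
  assumes "test_function \<Omega> \<phi>"
  shows "test_function \<Omega> (partial_deriv k \<phi>)"
proof -
  obtain K where K: "compact K" "K \<subseteq> \<Omega>" "\<And>x. x \<notin> K \<Longrightarrow> \<phi> x = 0"
    using test_functionE[OF assms] by blast
  show ?thesis
  proof (rule test_functionI[OF _ K(1,2)])
    show "Cn_plane n (partial_deriv k \<phi>)" for n
      using test_function_Cn[OF assms, of "Suc n"] by simp
    show "x \<in> K" if "partial_deriv k \<phi> x \<noteq> 0" for x
    proof (rule ccontr)
      assume "x \<notin> K"
      have "(\<phi> has_derivative (\<lambda>_. 0)) (at x)"
        by (rule has_derivative_transform_within_open[OF has_derivative_const[of 0], of "- K"])
           (use K \<open>x \<notin> K\<close> in \<open>auto simp: compact_imp_closed open_Compl\<close>)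
      from partial_deriv_eqI[OF this] that show False by simp
    qed
  qed
qed

lemma test_function_add:
  assumes "test_function \<Omega> \<phi>" "test_function \<Omega> \<psi>"
  shows "test_function \<Omega> (\<lambda>x. \<phi> x + \<psi> x)"
proof -
  obtain K where K: "compact K" "K \<subseteq> \<Omega>" "\<And>x. x \<notin> K \<Longrightarrow> \<phi> x = 0"
    using test_functionE[OF assms(1)] by blast
  obtain L where L: "compact L" "L \<subseteq> \<Omega>" "\<And>x. x \<notin> L \<Longrightarrow> \<psi> x = 0"
    using test_functionE[OF assms(2)] by blast
  show ?thesis
  proof (rule test_functionI[of _ "K \<union> L"])
    show "x \<in> K \<union> L" if "\<phi> x + \<psi> x \<noteq> 0" for x
      using K(3)[of x] L(3)[of x] that by (cases "x \<in> K"; cases "x \<in> L") auto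
  qed (use K L test_function_Cn[OF assms(1)] test_function_Cn[OF assms(2)] in
      \<open>auto intro!: Cn_plane_add compact_Un\<close>)
qed

lemma test_function_cmult:
  assumes "test_function \<Omega> \<phi>"
  shows "test_function \<Omega> (\<lambda>x. c * \<phi> x)"
proof -
  obtain K where K: "compact K" "K \<subseteq> \<Omega>" "\<And>x. x \<notin> K \<Longrightarrow> \<phi> x = 0"
    using test_functionE[OF assms(1)] by blast
  show ?thesis
    by (rule test_functionI[of _ K]) (use K assms test_function_Cn in \<open>auto intro!: Cn_plane_cmult\<close>)
qed

lemma test_function_zero: "test_function \<Omega> (\<lambda>_. 0)"
proof (rule test_functionI[of _ "{}"])
  show "Cn_plane n (\<lambda>_. 0)" for n
    using Cn_plane_product[OF Cn_on_const[of n UNIV 0] Cn_on_const[of n UNIV 0]] by simp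
qed auto

lemma test_function_affine:
  assumes "test_function \<Omega> \<phi>" "c \<noteq> 0" "\<And>x. \<phi> (c *\<^sub>R x + z) \<noteq> 0 \<Longrightarrow> c *\<^sub>R x + z \<in> K"
    "compact K" "\<And>y. y \<in> K \<Longrightarrow> (1 / c) *\<^sub>R (y - z) \<in> \<Omega>'"
  shows "test_function \<Omega>' (\<lambda>x. \<phi> (c *\<^sub>R x + z))"
proof (rule test_functionI[of _ "(\<lambda>y. (1 / c) *\<^sub>R (y - z)) ` K"])
  show "Cn_plane n (\<lambda>x. \<phi> (c *\<^sub>R x + z))" for n
    by (intro Cn_plane_affine test_function_Cn[OF assms(1)])
  show "compact ((\<lambda>y. (1 / c) *\<^sub>R (y - z)) ` K)"
    using assms by (intro compact_continuous_image continuous_intros)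
  show "x \<in> (\<lambda>y. (1 / c) *\<^sub>R (y - z)) ` K" if "\<phi> (c *\<^sub>R x + z) \<noteq> 0" for x
    using assms that by (intro image_eqI[of _ _ "c *\<^sub>R x + z"]) auto
qed (use assms in auto)

lemma test_function_bounded:
  assumes "test_function \<Omega> \<phi>"
  obtains B where "B > 0" "\<And>x. \<bar>\<phi> x\<bar> \<le> B"
proof -
  obtain K where K: "compact K" "K \<subseteq> \<Omega>" "\<And>x. x \<notin> K \<Longrightarrow> \<phi> x = 0"
    using test_functionE[OF assms] by blast
  have "bounded (\<phi> ` K)"
    by (intro compact_imp_bounded compact_continuous_image test_function_continuous[OF assms] K(1))
  then obtain B where "\<forall>y\<in>\<phi> ` K. norm y \<le> B" "B > 0" unfolding bounded_pos by blast
  then have "\<bar>\<phi> x\<bar> \<le> B" for x using K(3)[of x] by (cases "x \<in> K") auto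
  then show ?thesis using that \<open>B > 0\<close> by blast
qed

lemma test_function_integrable:
  assumes "test_function \<Omega> \<phi>"
  shows "integrable lborel \<phi>"
proof -
  obtain K where K: "compact K" "K \<subseteq> \<Omega>" "\<And>x. x \<notin> K \<Longrightarrow> \<phi> x = 0"
    using test_functionE[OF assms] by blast
  have "(\<lambda>x. indicator K x *\<^sub>R \<phi> x) = \<phi>"
    using K(3) by (auto simp: fun_eq_iff indicator_def)
  then show ?thesis
    using borel_integrable_compact[OF K(1) test_function_continuous[OF assms]] by simp
qed

lemma test_function_times_integrable:
  fixes f :: "real^2 \<Rightarrow> 'b::{banach, second_countable_topology}"
  assumes "test_function \<Omega> \<phi>" "integrable lborel f"
  shows "integrable lborel (\<lambda>x. \<phi> x *\<^sub>R f x)"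
proof -
  obtain B where B: "B > 0" "\<And>x. \<bar>\<phi> x\<bar> \<le> B"
    using test_function_bounded[OF assms(1)] by blast
  note [measurable] = test_function_borel[OF assms(1)] borel_measurable_integrable[OF assms(2)]
  show ?thesis
  proof (rule Bochner_Integration.integrable_bound)
    show "integrable lborel (\<lambda>x. B *\<^sub>R f x)" using assms by simp
    show "AE x in lborel. norm (\<phi> x *\<^sub>R f x) \<le> norm (B *\<^sub>R f x)"
      using B by (auto intro!: mult_right_mono simp: abs_of_pos)
  qed measurable
qed

section \<open>Bump functions supported in a rectangle\<close>

definition box_bump :: "real \<Rightarrow> real^2 \<Rightarrow> real^2 \<Rightarrow> real^2 \<Rightarrow> real" where
  "box_bump c a b x = (exp_bump c (x $ 1 - a $ 1) * exp_bump c (b $ 1 - x $ 1)) *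
     (exp_bump c (x $ 2 - a $ 2) * exp_bump c (b $ 2 - x $ 2))"

lemma exp_bump_nonneg: "0 \<le> exp_bump c t" and exp_bump_pos_iff: "exp_bump c t > 0 \<longleftrightarrow> t > 0"
  by (auto simp: exp_bump_def)

lemma exp_bump_le_1: "c > 0 \<Longrightarrow> exp_bump c t \<le> 1"
  by (auto simp: exp_bump_def)

lemma box_bump_nonneg: "0 \<le> box_bump c a b x"
  by (simp add: box_bump_def exp_bump_nonneg)

lemma box_bump_le_1: "c > 0 \<Longrightarrow> box_bump c a b x \<le> 1"
  unfolding box_bump_def by (intro mult_le_one mult_nonneg_nonneg exp_bump_nonneg exp_bump_le_1)

lemma box_bump_pos_iff: "box_bump c a b x > 0 \<longleftrightarrow> x \<in> box a b"
  by (auto simp: box_bump_def mem_box_cart forall_2 exp_bump_def)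

lemma box_bump_outside: "x \<notin> box a b \<Longrightarrow> box_bump c a b x = 0"
  using box_bump_pos_iff[of c a b x] box_bump_nonneg[of c a b x] by auto

lemma Cn_plane_box_bump: "c > 0 \<Longrightarrow> Cn_plane n (box_bump c a b)"
proof -
  assume c: "c > 0"
  have 1: "Cn_on n UNIV (\<lambda>t. exp_bump c (t - s))" for s
    using Cn_on_affine[OF Cn_on_exp_bump[OF c], of n 1 "-s"] by simp
  have 2: "Cn_on n UNIV (\<lambda>t. exp_bump c (s - t))" for s
    using Cn_on_affine[OF Cn_on_exp_bump[OF c], of n "-1" s] by simp
  show ?thesis
    unfolding box_bump_def[abs_def]
    by (intro Cn_plane_product[of n "\<lambda>t. exp_bump c (t - a $ 1) * exp_bump c (b $ 1 - t)"
      "\<lambda>t. exp_bump c (t - a $ 2) * exp_bump c (b $ 2 - t)"] Cn_on_mult 1 2)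
qed

lemma test_function_box_bump:
  assumes "c > 0" "cbox a b \<subseteq> \<Omega>"
  shows "test_function \<Omega> (box_bump c a b)"
  by (rule test_functionI[of _ "cbox a b"])
     (use assms box_bump_outside box_subset_cbox[of a b] in \<open>auto intro: Cn_plane_box_bump\<close>, blast)

lemma box_bump_tendsto: "(\<lambda>n. box_bump (1 / real (Suc n)) a b x) \<longlonglongrightarrow> indicator (box a b) x"
proof -
  have *: "(\<lambda>n. exp_bump (1 / real (Suc n)) t) \<longlonglongrightarrow> (if t > 0 then 1 else 0)" for t
  proof (cases "t > 0")
    case True
    have "(\<lambda>n. exp (- (1 / real (Suc n)) / t)) \<longlonglongrightarrow> exp (- 0 / t)"
      using True by (intro tendsto_intros LIMSEQ_Suc[OF lim_1_over_n]) auto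
    then show ?thesis using True by (simp add: exp_bump_def)
  qed (simp add: exp_bump_def)
  show ?thesis
    unfolding box_bump_def
    by (rule tendsto_eq_rhs, (rule tendsto_mult *)+)
       (auto simp: indicator_def mem_box_cart forall_2)
qed

section \<open>The fundamental lemma of the calculus of variations\<close>

text \<open>Open boxes are an intersection-stable generator, so the sets over which \<open>f\<close>
  integrates to zero include all Borel sets; testing with the sets where \<open>f\<close> is
  positive and where it is negative finishes.\<close>

lemma AE_zero_if_integral_boxes_zero:
  fixes f :: "'a::euclidean_space \<Rightarrow> real"
  assumes f: "integrable lborel f"
    and box: "\<And>c d. (LINT x|lborel. indicator (box c d) x * f x) = 0"
  shows "AE x in lborel. f x = 0"
proof -
  note [measurable] = borel_measurable_integrable[OF f]
  have int: "integrable lborel (\<lambda>x. indicator A x * f x)" if "A \<in> sets borel" for A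
    using integrable_mult_indicator[OF _ f, of A] that by simp
  have *: "(LINT x|lborel. indicator A x * f x) = 0" if A: "A \<in> sets borel" for A
  proof -
    \<comment> \<open>Passing to complements requires the whole space, which is exhausted by growing
      boxes.\<close>
    have U0: "(LINT x|lborel. f x) = 0"
    proof -
      have "(\<lambda>n. LINT x|lborel. indicator (box (- real n *\<^sub>R One) (real n *\<^sub>R One)) x * f x)
        \<longlonglongrightarrow> (LINT x|lborel. f x)"
      proof (rule integral_dominated_convergence[where w = "\<lambda>x. norm (f x)"])
        show "AE x in lborel. (\<lambda>n. indicator (box (- real n *\<^sub>R One) (real n *\<^sub>R One)) x * f x) \<longlonglongrightarrow> f x"
        proof (intro AE_I2 tendsto_eventually)
          fix x :: 'a
          obtain N :: nat where N: "norm x < real N" using reals_Archimedean2 by blast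
          show "eventually (\<lambda>n. indicator (box (- real n *\<^sub>R One) (real n *\<^sub>R One)) x * f x = f x) sequentially"
            unfolding eventually_sequentially
          proof (intro exI allI impI)
            fix n assume "N \<le> n"
            then have "norm x < real n" using N by linarith
            then have "\<bar>x \<bullet> i\<bar> < real n" if "i \<in> Basis" for i
              using Basis_le_norm[OF that, of x] by linarith
            then have "x \<in> box (- real n *\<^sub>R One) (real n *\<^sub>R One)"
              by (auto simp: mem_box abs_less_iff) (smt (verit, best))
            then show "indicator (box (- real n *\<^sub>R One) (real n *\<^sub>R One)) x * f x = f x" by simp
          qed
        qed
      qed (use f in \<open>auto simp: indicator_def\<close>)
      then show ?thesis using LIMSEQ_unique[OF _ tendsto_const[of 0]] by (simp add: box)
    qed
    have "Int_stable (range (\<lambda>(a, b). box a b :: 'a set))"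
      by (auto simp: Int_stable_def box_Int_box)
    moreover have "range (\<lambda>(a, b). box a b :: 'a set) \<subseteq> Pow UNIV" by auto
    moreover have "A \<in> sigma_sets UNIV (range (\<lambda>(a, b). box a b))"
      using A unfolding borel_eq_box by simp
    ultimately show ?thesis
    proof (induction rule: sigma_sets_induct_disjoint)
      case (basic A)
      then show ?case using box by auto
    next
      case empty
      then show ?case by simp
    next
      case (compl A)
      then have [measurable]: "A \<in> sets borel" by (simp add: borel_eq_box)
      have "(LINT x|lborel. indicator (UNIV - A) x * f x) = (LINT x|lborel. f x - indicator A x * f x)"
        by (intro Bochner_Integration.integral_cong) (auto simp: indicator_def)
      also have "\<dots> = (LINT x|lborel. f x) - (LINT x|lborel. indicator A x * f x)"
        using f int by (intro Bochner_Integration.integral_diff) auto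
      finally show ?case using compl U0 by simp
    next
      case (union A)
      then have [measurable]: "A i \<in> sets borel" for i by (auto simp: borel_eq_box)
      have "(LINT x:(\<Union>i. A i)|lborel. f x) = (\<Sum>i. (LINT x:(A i)|lborel. f x))"
        using union f
        by (intro lebesgue_integral_countable_add)
           (auto simp: set_integrable_def int disjoint_family_on_def)
      then show ?case using union by (simp add: set_lebesgue_integral_def)
    qed
  qed
  have "AE x in lborel. indicator {x. f x > 0} x * f x = 0"
    using * [of "{x. f x > 0}"] int[of "{x. f x > 0}"]
    by (subst integral_nonneg_eq_0_iff_AE[symmetric]) (auto simp: indicator_def)
  moreover have "AE x in lborel. - (indicator {x. f x < 0} x * f x) = 0"
    using * [of "{x. f x < 0}"] int[of "{x. f x < 0}"]
    by (subst integral_nonneg_eq_0_iff_AE[symmetric]) (auto simp: indicator_def)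
  ultimately show ?thesis
    by eventually_elim (auto simp: indicator_def split: if_splits)
qed

text \<open>Box bumps with rate 1/(n+1) are admissible tests and converge boundedly to the indicator
  of the box, which reduces the claim to integrals over boxes; countably many boxes with closure in
  \<open>S\<close> cover \<open>S\<close>.\<close>

lemma test_function_separating:
  fixes f :: "real^2 \<Rightarrow> 'b::euclidean_space"
  assumes "open S" and f: "integrable lborel f"
    and zero: "\<And>\<phi>. test_function S \<phi> \<Longrightarrow> (LINT x|lborel. \<phi> x *\<^sub>R f x) = 0"
  shows "AE x in lborel. x \<in> S \<longrightarrow> f x = 0"
proof -
  note [measurable] = borel_measurable_integrable[OF f]
  have 1: "(LINT x|lborel. indicator (box a b) x *\<^sub>R f x) = 0" if ab: "cbox a b \<subseteq> S" for a b
  proof -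
    have "(\<lambda>n. LINT x|lborel. box_bump (1 / real (Suc n)) a b x *\<^sub>R f x)
        \<longlonglongrightarrow> (LINT x|lborel. indicator (box a b) x *\<^sub>R f x)"
    proof (rule integral_dominated_convergence[where w = "\<lambda>x. norm (f x)"])
      show "(\<lambda>x. box_bump (1 / real (Suc n)) a b x *\<^sub>R f x) \<in> borel_measurable lborel" for n
        using test_function_borel[OF test_function_box_bump[OF _ ab], of "1 / real (Suc n)"] by simp
      show "AE x in lborel. (\<lambda>n. box_bump (1 / real (Suc n)) a b x *\<^sub>R f x) \<longlonglongrightarrow> indicator (box a b) x *\<^sub>R f x"
        by (intro always_eventually allI tendsto_scaleR box_bump_tendsto tendsto_const)
      show "AE x in lborel. norm (box_bump (1 / real (Suc n)) a b x *\<^sub>R f x) \<le> norm (f x)" for n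
        using box_bump_le_1[of "1 / real (Suc n)" a b] box_bump_nonneg[of "1 / real (Suc n)" a b]
        by (auto intro!: mult_left_le_one_le)
    qed (use f in auto)
    moreover have "(LINT x|lborel. box_bump (1 / real (Suc n)) a b x *\<^sub>R f x) = 0" for n
      by (intro zero test_function_box_bump ab) simp
    ultimately show ?thesis using LIMSEQ_unique[OF _ tendsto_const[of 0]] by simp
  qed
  have 2: "AE x in lborel. x \<in> box a b \<longrightarrow> f x = 0" if ab: "cbox a b \<subseteq> S" for a b
  proof -
    have "AE x in lborel. \<forall>e\<in>Basis. indicator (box a b) x * (f x \<bullet> e) = 0"
    proof (subst AE_finite_all; intro ballI finite_Basis)
      fix e :: 'b assume "e \<in> Basis"
      have int: "integrable lborel (\<lambda>x. indicator A x *\<^sub>R f x)" if "A \<in> sets borel" for A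
        using integrable_mult_indicator[OF _ f, of A] that by simp
      show "AE x in lborel. indicator (box a b) x * (f x \<bullet> e) = 0"
      proof (rule AE_zero_if_integral_boxes_zero)
        show "integrable lborel (\<lambda>x. indicator (box a b) x * (f x \<bullet> e))"
          using integrable_inner_left[where f = "\<lambda>x. indicator (box a b) x *\<^sub>R f x" and c = e and M = lborel]
            int[of "box a b"] by simp
        fix c d :: "real^2"
        \<comment> \<open>The box criterion asks for all boxes; intersecting with
          \<open>box a b\<close> gives a box for which \<open>cbox p q\<close> still lies in
          \<open>S\<close>.\<close>
        define p q where "p = (\<Sum>i\<in>Basis. max (a\<bullet>i) (c\<bullet>i) *\<^sub>R i)" and "q = (\<Sum>i\<in>Basis. min (b\<bullet>i) (d\<bullet>i) *\<^sub>R i)"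
        have pq: "box a b \<inter> box c d = box p q" by (simp add: box_Int_box p_def q_def)
        have "cbox p q \<subseteq> cbox a b" by (auto simp: mem_box p_def q_def)
        then have "(LINT x|lborel. indicator (box p q) x *\<^sub>R f x) \<bullet> e = 0"
          using 1[of p q] ab by simp
        also have "(LINT x|lborel. indicator (box p q) x *\<^sub>R f x) \<bullet> e =
            (LINT x|lborel. (indicator (box p q) x *\<^sub>R f x) \<bullet> e)"
          using int by (intro integral_inner_left[symmetric]) auto
        also have "\<dots> = (LINT x|lborel. indicator (box c d) x * (indicator (box a b) x * (f x \<bullet> e)))"
          unfolding pq[symmetric]
          by (intro Bochner_Integration.integral_cong) (auto simp: indicator_def)
        finally show "(LINT x|lborel. indicator (box c d) x * (indicator (box a b) x * (f x \<bullet> e))) = 0" .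
      qed
    qed
    then show ?thesis
      by eventually_elim (auto simp: euclidean_eq_iff[of "f _" 0])
  qed
  define F where "F = {box a b | a b. cbox a b \<subseteq> S}"
  have "S \<subseteq> \<Union>F"
  proof
    fix x assume "x \<in> S"
    then obtain e where e: "e > 0" "cball x e \<subseteq> S"
      using \<open>open S\<close> open_contains_cball by blast
    obtain a b where ab: "x \<in> box a b" "box a b \<subseteq> ball x e" using rational_boxes[OF e(1), of x] by blast
    then have "closure (box a b) \<subseteq> closure (ball x e)" by (intro closure_mono)
    moreover have "closure (box a b) = cbox a b" using ab(1) by (intro closure_box) auto
    ultimately have "cbox a b \<subseteq> S" using e by auto
    then show "x \<in> \<Union>F" using ab(1) by (auto simp: F_def)
  qed
  obtain G where G: "G \<subseteq> F" "countable G" "\<Union>G = \<Union>F"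
    by (rule Lindelof[of F]) (auto simp: F_def)
  have "AE x in lborel. \<forall>B\<in>G. x \<in> B \<longrightarrow> f x = 0"
    using G(1) 2 by (subst AE_ball_countable[OF G(2)]) (auto simp: F_def)
  then show ?thesis
    by eventually_elim (use \<open>S \<subseteq> \<Union>F\<close> G(3) in blast)
qed

section \<open>Vector-valued test functions and duality\<close>

definition test_field :: "(real^2) set \<Rightarrow> (real^2 \<Rightarrow> 'b::euclidean_space) \<Rightarrow> bool" where
  "test_field S \<psi> \<longleftrightarrow> (\<forall>b\<in>Basis. test_function S (\<lambda>x. \<psi> x \<bullet> b))"

lemma test_field_add: "test_field S \<phi> \<Longrightarrow> test_field S \<psi> \<Longrightarrow> test_field S (\<lambda>x. \<phi> x + \<psi> x)"
  by (simp add: test_field_def inner_add_left test_function_add)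

lemma test_field_scaleR: "test_field S \<phi> \<Longrightarrow> test_field S (\<lambda>x. c *\<^sub>R \<phi> x)"
  by (simp add: test_field_def test_function_cmult)

lemma test_field_zero: "test_field S (\<lambda>x. 0)"
  by (simp add: test_field_def test_function_zero)

lemma test_field_scaleR_const: "test_function S \<phi> \<Longrightarrow> test_field S (\<lambda>x. \<phi> x *\<^sub>R v)"
  using test_function_cmult[of S \<phi>] by (auto simp: test_field_def mult.commute[of "\<phi> _"])

lemma test_field_outside: "test_field S \<psi> \<Longrightarrow> x \<notin> S \<Longrightarrow> \<psi> x = 0"
  using test_function_outside[of S "\<lambda>x. \<psi> x \<bullet> b" x for b]
  by (auto simp: euclidean_eq_iff[of "\<psi> x" 0] test_field_def)

lemma test_field_borel: "test_field S \<psi> \<Longrightarrow> \<psi> \<in> borel_measurable borel"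
  unfolding test_field_def
  by (subst borel_measurable_euclidean_space) (auto intro: test_function_borel)

lemma norm_sq_Basis: "(norm (x :: 'b::euclidean_space))^2 = (\<Sum>b\<in>Basis. (x \<bullet> b)^2)"
  unfolding power2_norm_eq_inner by (subst euclidean_inner) (simp add: power2_eq_square)

lemma test_field_L2:
  assumes "test_field S \<psi>"
  shows "integrable lborel (\<lambda>x. (norm (\<psi> x))^2)"
  unfolding norm_sq_Basis
proof (intro Bochner_Integration.integrable_sum)
  fix b :: 'a assume "b \<in> Basis"
  then have "test_function S (\<lambda>x. \<psi> x \<bullet> b)" using assms by (simp add: test_field_def)
  from test_function_times_integrable[OF this test_function_integrable[OF this]]
  show "integrable lborel (\<lambda>x. (\<psi> x \<bullet> b)^2)" by (simp add: power2_eq_square)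
qed

text \<open>For bounded \<open>S\<close> the Lebesgue measure restricted to \<open>S\<close> is
  finite, as the Riesz argument needs; the representing function is then extended by zero to a Borel
  function on the plane.\<close>

lemma test_field_Riesz:
  fixes L :: "(real^2 \<Rightarrow> 'b::euclidean_space) \<Rightarrow> real"
  assumes "open S" "bounded S"
    and L_add: "\<And>f g. test_field S f \<Longrightarrow> test_field S g \<Longrightarrow> L (\<lambda>x. f x + g x) = L f + L g"
    and L_scale: "\<And>f t. test_field S f \<Longrightarrow> L (\<lambda>x. t *\<^sub>R f x) = t * L f"
    and bound: "\<And>f. test_field S f \<Longrightarrow> L f \<le> c * sqrt (LINT x|lborel. (norm (f x))^2)" and "0 \<le> c"
  obtains D where "D \<in> borel_measurable borel" "\<And>x. x \<notin> S \<Longrightarrow> D x = 0"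
    "integrable lborel (\<lambda>x. (norm (D x))^2)" "(LINT x|lborel. (norm (D x))^2) \<le> c^2"
    "\<And>f. test_field S f \<Longrightarrow> (LINT x|lborel. D x \<bullet> f x) = L f"
proof -
  define M where "M = restrict_space lborel S"
  have S: "S \<in> sets lborel" using \<open>open S\<close> by simp
  interpret M: finite_measure M
    unfolding M_def
    using emeasure_bounded_finite[OF \<open>bounded S\<close>] S
    by (intro finite_measure_restrict_space finite_measureI) (auto simp: emeasure_restrict_space space_restrict_space)
  have intM: "(LINT x|M. f x) = (LINT x|lborel. indicator S x * f x)"
    for f :: "real^2 \<Rightarrow> real"
    unfolding M_def using S by (subst integral_restrict_space) auto
  have iM: "integrable M f \<longleftrightarrow> integrable lborel (\<lambda>x. indicator S x * f x)" for f :: "real^2 \<Rightarrow> real"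
    unfolding M_def using S by (subst integrable_restrict_space) auto
  have tf: "(\<lambda>x. indicator S x * (norm (f x))^2) = (\<lambda>x. (norm (f x))^2)" if "test_field S f" for f :: "real^2 \<Rightarrow> 'b"
    using test_field_outside[OF that] by (auto simp: fun_eq_iff indicator_def)
  obtain D where D: "D \<in> borel_measurable M" "integrable M (\<lambda>x. (norm (D x))^2)"
    "(LINT x|M. (norm (D x))^2) \<le> c^2"
    "\<And>f. f \<in> {f. test_field S f} \<Longrightarrow> (LINT x|M. D x \<bullet> f x) = L f"
  proof (rule M.L2_Riesz_representation[of "{f. test_field S f}" L c])
    show "{f. test_field S f} \<noteq> {}" using test_field_zero by auto
    show "f \<in> borel_measurable M" if "f \<in> {f. test_field S f}" for f :: "real^2 \<Rightarrow> 'b"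
      using that test_field_borel[of S f] unfolding M_def by (intro measurable_restrict_space1) simp
  qed (use assms test_field_L2 in \<open>auto simp: test_field_add test_field_scaleR intM iM tf\<close>)
  define E where "E x = indicator S x *\<^sub>R D x" for x
  have E: "E \<in> borel_measurable borel"
    using D(1) S unfolding E_def M_def by (subst (asm) borel_measurable_restrict_space_iff) auto
  have nE: "(norm (E x))^2 = indicator S x * (norm (D x))^2" for x
    by (auto simp: E_def indicator_def)
  have iE: "E x \<bullet> f x = indicator S x * (D x \<bullet> f x)" for f x
    by (auto simp: E_def indicator_def)
  show ?thesis
    by (rule that[of E]) (use D E in \<open>auto simp: nE iE iM intM\<close>, auto simp: E_def)
qed

text \<open>On a set of finite measure the bound |f| \<le> 1 + |f|^2 suffices.\<close>

lemma L2_on_finite_integrable: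
  fixes f :: "'a::euclidean_space \<Rightarrow> 'b::euclidean_space"
  assumes [measurable]: "f \<in> borel_measurable borel" "S \<in> sets borel" and "bounded S"
    and "integrable lborel (\<lambda>x. indicator S x * (norm (f x))^2)"
  shows "integrable lborel (\<lambda>x. indicator S x *\<^sub>R f x)"
proof (rule Bochner_Integration.integrable_bound)
  have "integrable lborel (indicat_real S)"
    using emeasure_bounded_finite[OF \<open>bounded S\<close>] by (simp add: integrable_indicator_iff)
  then show "integrable lborel (\<lambda>x. indicator S x + indicator S x * (norm (f x))^2)"
    using assms by simp
  show "AE x in lborel. norm (indicator S x *\<^sub>R f x) \<le> norm (indicator S x + indicator S x * (norm (f x))^2)"
  proof (intro AE_I2)
    fix x
    have "norm (f x) \<le> 1 + (norm (f x))^2"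
      using sum_squares_bound[of "norm (f x)" 1] by (simp add: power2_eq_square) (smt (verit) norm_ge_zero)
    then show "norm (indicator S x *\<^sub>R f x) \<le> norm (indicator S x + indicator S x * (norm (f x))^2)"
      by (auto simp: indicator_def)
  qed
qed measurable

text \<open>Instead of proving that test fields are dense in L^2, the functional that pairs \<psi>
  with \<open>f\<close> is represented by some \<open>D\<close> of norm at most \<open>c\<close>,
  and \<open>D\<close> is identified with \<open>f\<close> on \<open>S\<close> by the fundamental
  lemma.\<close>

lemma L2_bound_by_duality:
  fixes f :: "real^2 \<Rightarrow> 'b::euclidean_space"
  assumes S: "open S" "bounded S" and [measurable]: "f \<in> borel_measurable borel"
    and f2: "integrable lborel (\<lambda>x. indicator S x * (norm (f x))^2)"
    and bound: "\<And>\<psi>. test_field S \<psi> \<Longrightarrow> (LINT x|lborel. f x \<bullet> \<psi> x) \<le> c * sqrt (LINT x|lborel. (norm (\<psi> x))^2)"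
    and "0 \<le> c"
  shows "(LINT x|lborel. indicator S x * (norm (f x))^2) \<le> c^2"
proof -
  have [measurable]: "S \<in> sets borel" using S by simp
  define g where "g x = indicator S x *\<^sub>R f x" for x
  have [measurable]: "g \<in> borel_measurable borel" unfolding g_def by measurable
  have ng: "(norm (g x))^2 = indicator S x * (norm (f x))^2" for x
    by (auto simp: g_def indicator_def)
  have fg: "f x \<bullet> \<psi> x = g x \<bullet> \<psi> x" if "test_field S \<psi>" for \<psi> x
    using test_field_outside[OF that] by (auto simp: g_def indicator_def)
  have int: "integrable lborel (\<lambda>x. f x \<bullet> \<psi> x)" if "test_field S \<psi>" for \<psi>
    unfolding fg[OF that]
    by (rule L2_inner_integrable) (use f2 that test_field_borel[OF that] test_field_L2[OF that] in \<open>auto simp: ng\<close>)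
  obtain D where D: "D \<in> borel_measurable borel" "\<And>x. x \<notin> S \<Longrightarrow> D x = 0"
    "integrable lborel (\<lambda>x. (norm (D x))^2)" "(LINT x|lborel. (norm (D x))^2) \<le> c^2"
    "\<And>\<psi>. test_field S \<psi> \<Longrightarrow> (LINT x|lborel. D x \<bullet> \<psi> x) = (LINT x|lborel. f x \<bullet> \<psi> x)"
    by (rule test_field_Riesz[of S "\<lambda>\<psi>. LINT x|lborel. f x \<bullet> \<psi> x" c])
       (use S bound int \<open>0 \<le> c\<close> in \<open>auto simp: inner_add_right\<close>)
  note [measurable] = D(1)
  have gi: "integrable lborel g"
    unfolding g_def using f2 S by (intro L2_on_finite_integrable) auto
  have Di: "integrable lborel D"
  proof -
    have "(\<lambda>x. indicator S x *\<^sub>R D x) = D" "(\<lambda>x. indicator S x * (norm (D x))^2) = (\<lambda>x. (norm (D x))^2)"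
      using D(2) by (auto simp: fun_eq_iff indicator_def)
    then show ?thesis using L2_on_finite_integrable[of D S] D S by simp
  qed
  have "AE x in lborel. x \<in> S \<longrightarrow> D x - g x = 0"
  proof (rule test_function_separating[OF S(1)])
    show "integrable lborel (\<lambda>x. D x - g x)" using gi Di by simp
    fix \<phi> assume \<phi>: "test_function S \<phi>"
    show "(LINT x|lborel. \<phi> x *\<^sub>R (D x - g x)) = 0"
    proof (rule euclidean_eqI)
      fix b :: 'b assume "b \<in> Basis"
      have t: "test_field S (\<lambda>x. \<phi> x *\<^sub>R b)" by (rule test_field_scaleR_const[OF \<phi>])
      have i: "integrable lborel (\<lambda>x. \<phi> x *\<^sub>R (D x - g x))"
        using gi Di by (intro test_function_times_integrable[OF \<phi>]) auto
      have "(LINT x|lborel. \<phi> x *\<^sub>R (D x - g x)) \<bullet> b = (LINT x|lborel. (\<phi> x *\<^sub>R (D x - g x)) \<bullet> b)"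
        using i by (intro integral_inner_left[symmetric]) auto
      also have "\<dots> = (LINT x|lborel. D x \<bullet> (\<phi> x *\<^sub>R b) - g x \<bullet> (\<phi> x *\<^sub>R b))"
        by (intro Bochner_Integration.integral_cong) (auto simp: algebra_simps inner_diff_left)
      also have "\<dots> = (LINT x|lborel. D x \<bullet> (\<phi> x *\<^sub>R b)) - (LINT x|lborel. g x \<bullet> (\<phi> x *\<^sub>R b))"
        using test_field_borel[OF t] D(3) f2
        by (intro Bochner_Integration.integral_diff L2_inner_integrable test_field_L2[OF t])
           (simp_all add: ng)
      also have "\<dots> = 0" using D(5)[OF t] by (simp only: fg[OF t])
      finally show "(LINT x|lborel. \<phi> x *\<^sub>R (D x - g x)) \<bullet> b = 0 \<bullet> b" by simp
    qed
  qed
  then have "(LINT x|lborel. (norm (g x))^2) = (LINT x|lborel. (norm (D x))^2)"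
    by (intro integral_cong_AE) (auto simp: g_def D(2) elim!: eventually_mono split: split_indicator)
  then show ?thesis using D(4) by (simp add: ng)
qed

section \<open>Convolution with a test function\<close>

lemma test_function_Lipschitz:
  assumes "test_function S \<phi>"
  obtains B where "B > 0" "\<And>x y. \<bar>\<phi> x - \<phi> y\<bar> \<le> B * norm (x - y)"
proof -
  have "\<exists>B>0. \<forall>x. \<bar>partial_deriv k \<phi> x\<bar> \<le> B" for k
    using test_function_bounded[OF test_function_partial_deriv[OF assms, of k]] by metis
  then obtain B where B: "\<And>k. B k > 0" "\<And>k x. \<bar>partial_deriv k \<phi> x\<bar> \<le> B k" by metis
  have "norm (\<phi> x - \<phi> y) \<le> (\<Sum>k\<in>UNIV. B k) * norm (x - y)" for x y
  proof (rule differentiable_bound[of UNIV \<phi>])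
    show "(\<phi> has_derivative (\<lambda>v. \<Sum>k\<in>UNIV. v $ k * partial_deriv k \<phi> x)) (at x within UNIV)" for x
      using test_function_has_derivative[OF assms] by simp
    show "onorm (\<lambda>v. \<Sum>k\<in>UNIV. v $ k * partial_deriv k \<phi> x) \<le> (\<Sum>k\<in>UNIV. B k)" for x
    proof (rule onorm_bound)
      fix v :: "real^2"
      have "norm (\<Sum>k\<in>UNIV. v $ k * partial_deriv k \<phi> x) \<le> (\<Sum>k\<in>UNIV. norm v * B k)"
        by (rule order_trans[OF norm_sum sum_mono])
           (auto simp: abs_mult intro!: mult_mono component_le_norm_cart B)
      then show "norm (\<Sum>k\<in>UNIV. v $ k * partial_deriv k \<phi> x) \<le> (\<Sum>k\<in>UNIV. B k) * norm v"
        by (subst sum_distrib_right) (simp add: mult.commute)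
    qed (use B in \<open>auto intro!: sum_nonneg simp: less_imp_le\<close>)
  qed auto
  moreover have "(\<Sum>k\<in>UNIV. B k) > 0" using B by (intro sum_pos) auto
  ultimately show ?thesis by (intro that[of "\<Sum>k\<in>UNIV. B k"]) auto
qed

text \<open>The partial derivatives are Lipschitz, so the mean value inequality for the
  linearisation error gives a quadratic remainder with one constant for all base points.\<close>

lemma test_function_Taylor:
  assumes "test_function S \<phi>"
  obtains C where "C > 0"
    "\<And>x v. \<bar>\<phi> (x + v) - \<phi> x - (\<Sum>k\<in>UNIV. v $ k * partial_deriv k \<phi> x)\<bar> \<le> C * (norm v)^2"
proof -
  have "\<exists>B>0. \<forall>x y. \<bar>partial_deriv k \<phi> x - partial_deriv k \<phi> y\<bar> \<le> B * norm (x - y)" for k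
    using test_function_Lipschitz[OF test_function_partial_deriv[OF assms, of k]] by metis
  then obtain B where B: "\<And>k. B k > 0"
    "\<And>k x y. \<bar>partial_deriv k \<phi> x - partial_deriv k \<phi> y\<bar> \<le> B k * norm (x - y)" by metis
  define C where "C = (\<Sum>k\<in>UNIV. B k)"
  have "C > 0" unfolding C_def using B by (intro sum_pos) auto
  have "norm (\<phi> (x + v) - \<phi> x - (\<Sum>k\<in>UNIV. v $ k * partial_deriv k \<phi> x)) \<le> norm v * (C * norm v)" for x v
  proof -
    have "norm (\<phi> (x + v) - \<phi> x - (\<lambda>v. \<Sum>k\<in>UNIV. v $ k * partial_deriv k \<phi> x) ((x + v) - x)) \<le> norm ((x + v) - x) * (C * norm v)"
    proof (rule differentiable_bound_linearization[where S = "cball x (norm v)"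
          and f' = "\<lambda>x v. \<Sum>k\<in>UNIV. v $ k * partial_deriv k \<phi> x"])
      show "x + t *\<^sub>R (x + v - x) \<in> cball x (norm v)" if "t \<in> {0..1}" for t
        using that by (auto simp: dist_norm mult_left_le_one_le)
      show "(\<phi> has_derivative (\<lambda>v. \<Sum>k\<in>UNIV. v $ k * partial_deriv k \<phi> x)) (at x within cball x' r)" for x x' r
        using test_function_has_derivative[OF assms] by (rule has_derivative_at_withinI)
      fix y assume y: "y \<in> cball x (norm v)"
      show "onorm ((\<lambda>i. \<Sum>k\<in>UNIV. i $ k * partial_deriv k \<phi> y) - (\<lambda>i. \<Sum>k\<in>UNIV. i $ k * partial_deriv k \<phi> x)) \<le> C * norm v"
        unfolding fun_diff_def
      proof (rule onorm_bound)
        fix i :: "real^2"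
        have "norm ((\<Sum>k\<in>UNIV. i $ k * partial_deriv k \<phi> y) - (\<Sum>k\<in>UNIV. i $ k * partial_deriv k \<phi> x))
          = norm (\<Sum>k\<in>UNIV. i $ k * (partial_deriv k \<phi> y - partial_deriv k \<phi> x))"
          by (simp add: sum_subtractf right_diff_distrib)
        also have "\<dots> \<le> (\<Sum>k\<in>UNIV. norm i * (B k * norm v))"
        proof (rule order_trans[OF norm_sum sum_mono])
          fix k
          have "\<bar>partial_deriv k \<phi> y - partial_deriv k \<phi> x\<bar> \<le> B k * norm (y - x)" by (rule B)
          also have "\<dots> \<le> B k * norm v" using y B(1)[of k]
            by (intro mult_left_mono) (auto simp: dist_norm norm_minus_commute)
          finally show "norm (i $ k * (partial_deriv k \<phi> y - partial_deriv k \<phi> x)) \<le> norm i * (B k * norm v)"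
            by (auto simp: abs_mult intro!: mult_mono component_le_norm_cart)
        qed
        also have "\<dots> = C * norm v * norm i"
          by (simp add: C_def sum_distrib_left sum_distrib_right mult_ac)
        finally show "norm ((\<Sum>k\<in>UNIV. i $ k * partial_deriv k \<phi> y) - (\<Sum>k\<in>UNIV. i $ k * partial_deriv k \<phi> x)) \<le> C * norm v * norm i" .
      qed (use \<open>C > 0\<close> in auto)
    qed auto
    then show ?thesis by simp
  qed
  then show ?thesis using \<open>C > 0\<close> by (intro that[of C]) (auto simp: power2_eq_square mult_ac)
qed

lemma test_function_shift_integrable:
  fixes g :: "real^2 \<Rightarrow> 'b::{banach, second_countable_topology}"
  assumes "test_function S \<phi>" "integrable lborel g"
  shows "integrable lborel (\<lambda>y. \<phi> (z - y) *\<^sub>R g y)"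
proof -
  obtain K where K: "compact K" "\<And>x. \<phi> x \<noteq> 0 \<Longrightarrow> x \<in> K"
    using test_functionE[OF assms(1)] by metis
  have "test_function UNIV (\<lambda>y. \<phi> ((-1) *\<^sub>R y + z))"
    using test_function_affine[OF assms(1), of "-1" z K UNIV] K by auto
  from test_function_times_integrable[OF this assms(2)] show ?thesis by simp
qed

text \<open>The quadratic Taylor remainder is uniform in the base point, hence can be integrated
  against |g|; this differentiates under the integral directly in the Frechet sense.\<close>

lemma convolution_has_derivative:
  fixes g :: "real^2 \<Rightarrow> 'b::euclidean_space"
  assumes \<phi>: "test_function S \<phi>" and g: "integrable lborel g"
  shows "((\<lambda>z. LINT y|lborel. \<phi> (z - y) *\<^sub>R g y) has_derivative
    (\<lambda>v. \<Sum>k\<in>UNIV. v $ k *\<^sub>R (LINT y|lborel. partial_deriv k \<phi> (z - y) *\<^sub>R g y))) (at z)"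
  (is "(?N has_derivative ?N') _")
  unfolding has_derivative_at_alt
proof
  note int = test_function_shift_integrable[OF \<phi> g]
    test_function_shift_integrable[OF test_function_partial_deriv[OF \<phi>] g]
  show "bounded_linear ?N'"
    by (intro bounded_linear_sum bounded_linear_scaleR_left[THEN bounded_linear_compose] bounded_linear_vec_nth)
  obtain C where C: "C > 0"
    "\<And>x v. \<bar>\<phi> (x + v) - \<phi> x - (\<Sum>k\<in>UNIV. v $ k * partial_deriv k \<phi> x)\<bar> \<le> C * (norm v)^2"
    using test_function_Taylor[OF \<phi>] by blast
  define G where "G = (LINT y|lborel. norm (g y))"
  have "G \<ge> 0" by (simp add: G_def)
  have est: "norm (?N y - ?N z - ?N' (y - z)) \<le> C * G * (norm (y - z))^2" for y
  proof -
    define v where "v = y - z"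
    have "?N y - ?N z - ?N' v = (LINT x|lborel. \<phi> (y - x) *\<^sub>R g x) - (LINT x|lborel. \<phi> (z - x) *\<^sub>R g x)
        - (LINT x|lborel. (\<Sum>k\<in>UNIV. v $ k *\<^sub>R (partial_deriv k \<phi> (z - x) *\<^sub>R g x)))"
      by (subst Bochner_Integration.integral_sum)
         (simp_all add: int integrable_scaleR_right del: scaleR_scaleR)
    also have "\<dots> = (LINT x|lborel. \<phi> (y - x) *\<^sub>R g x - \<phi> (z - x) *\<^sub>R g x
        - (\<Sum>k\<in>UNIV. v $ k *\<^sub>R (partial_deriv k \<phi> (z - x) *\<^sub>R g x)))"
      by (simp add: int integrable_scaleR_right del: scaleR_scaleR integral_scaleR_right)
    also have "norm \<dots> \<le> (LINT x|lborel. C * (norm v)^2 * norm (g x))"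
    proof (rule Bochner_Integration.integral_norm_bound_integral)
      show "integrable lborel (\<lambda>x. \<phi> (y - x) *\<^sub>R g x - \<phi> (z - x) *\<^sub>R g x
        - (\<Sum>k\<in>UNIV. v $ k *\<^sub>R (partial_deriv k \<phi> (z - x) *\<^sub>R g x)))"
        using int by (intro Bochner_Integration.integrable_diff Bochner_Integration.integrable_sum integrable_scaleR_right)
      show "integrable lborel (\<lambda>x. C * (norm v)^2 * norm (g x))" using g by simp
      fix x
      have "\<phi> (y - x) *\<^sub>R g x - \<phi> (z - x) *\<^sub>R g x - (\<Sum>k\<in>UNIV. v $ k *\<^sub>R (partial_deriv k \<phi> (z - x) *\<^sub>R g x))
        = (\<phi> ((z - x) + v) - \<phi> (z - x) - (\<Sum>k\<in>UNIV. v $ k * partial_deriv k \<phi> (z - x))) *\<^sub>R g x"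
        by (simp add: v_def scaleR_sum_left scaleR_diff_left)
      then show "norm (\<phi> (y - x) *\<^sub>R g x - \<phi> (z - x) *\<^sub>R g x - (\<Sum>k\<in>UNIV. v $ k *\<^sub>R (partial_deriv k \<phi> (z - x) *\<^sub>R g x)))
        \<le> C * (norm v)^2 * norm (g x)"
        using C(2)[of "z - x" v] by (auto intro!: mult_right_mono)
    qed
    also have "\<dots> = C * G * (norm v)^2" by (simp add: G_def)
    finally show ?thesis by (simp add: v_def)
  qed
  show "\<forall>e>0. \<exists>d>0. \<forall>y. norm (y - z) < d \<longrightarrow> norm (?N y - ?N z - ?N' (y - z)) \<le> e * norm (y - z)"
  proof (intro allI impI)
    fix e :: real assume "e > 0"
    show "\<exists>d>0. \<forall>y. norm (y - z) < d \<longrightarrow> norm (?N y - ?N z - ?N' (y - z)) \<le> e * norm (y - z)"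
    \<comment> \<open>The added 1 keeps the denominator positive when \<open>g\<close> vanishes
      almost everywhere.\<close>
    proof (intro exI[of _ "e / (C * G + 1)"] conjI allI impI)
      have "C * G + 1 > 0" using C \<open>G \<ge> 0\<close> by (simp add: add_nonneg_pos)
      then show "e / (C * G + 1) > 0" using \<open>e > 0\<close> by simp
      fix y assume "norm (y - z) < e / (C * G + 1)"
      then have "(C * G + 1) * norm (y - z) \<le> e" using \<open>C * G + 1 > 0\<close> by (simp add: field_simps)
      moreover have "C * G * norm (y - z) \<le> (C * G + 1) * norm (y - z)" by (simp add: algebra_simps)
      ultimately have "C * G * norm (y - z) * norm (y - z) \<le> e * norm (y - z)" 
        by (intro mult_right_mono) auto
      then show "norm (?N y - ?N z - ?N' (y - z)) \<le> e * norm (y - z)"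
        using est[of y] by (simp add: power2_eq_square)
    qed
  qed
qed

lemma lborel_integral_translate:
  fixes f :: "'a::euclidean_space \<Rightarrow> 'b::{banach, second_countable_topology}"
  assumes [measurable]: "f \<in> borel_measurable borel"
  shows "(LINT x|lborel. f (x + c)) = (LINT x|lborel. f x)"
    and "integrable lborel (\<lambda>x. f (x + c)) \<longleftrightarrow> integrable lborel f"
proof -
  have "(LINT x|lborel. f x) = (LINT x|distr lborel borel ((+) c). f x)" by (simp add: lborel_distr_plus)
  also have "\<dots> = (LINT x|lborel. f (x + c))" by (subst integral_distr) (auto simp: add.commute)
  finally show "(LINT x|lborel. f (x + c)) = (LINT x|lborel. f x)" by simp
  have "integrable lborel f \<longleftrightarrow> integrable (distr lborel borel ((+) c)) f" by (simp add: lborel_distr_plus)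
  also have "\<dots> \<longleftrightarrow> integrable lborel (\<lambda>x. f (x + c))" by (subst integrable_distr_eq) (auto simp: add.commute)
  finally show "integrable lborel (\<lambda>x. f (x + c)) \<longleftrightarrow> integrable lborel f" by simp
qed

section \<open>Weak gradients of Borel functions\<close>

text \<open>A Borel version of the weak gradient: both functions are defined everywhere and vanish
  outside \<open>S\<close>, so all integrals run over the whole plane. The test functions still live
  in \<open>S\<close>, so no weak differentiability across the boundary is claimed.\<close>

definition weak_pair :: "(real^2) set \<Rightarrow> (real^2 \<Rightarrow> 'b::euclidean_space) \<Rightarrow> (real^2 \<Rightarrow> 'b^2) \<Rightarrow> bool" where
  "weak_pair S q d \<longleftrightarrow> q \<in> borel_measurable borel \<and> d \<in> borel_measurable borel \<and>
     integrable lborel q \<and> integrable lborel (\<lambda>x. (norm (d x))^2) \<and>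
     (\<forall>x. x \<notin> S \<longrightarrow> q x = 0 \<and> d x = 0) \<and>
     (\<forall>\<phi>. test_function S \<phi> \<longrightarrow> (\<forall>k. (LINT x|lborel. partial_deriv k \<phi> x *\<^sub>R q x)
        = - (LINT x|lborel. \<phi> x *\<^sub>R (d x $ k))))"

lemma norm_sq_vec: "(norm (x :: 'b::real_normed_vector^'n))^2 = (\<Sum>k\<in>UNIV. (norm (x $ k))^2)"
  by (simp add: norm_vec_def L2_set_def sum_nonneg)

lemma norm_combination_sq_le:
  fixes w :: "real^2" and d :: "'b::real_inner^2"
  shows "(norm (\<Sum>k\<in>UNIV. w $ k *\<^sub>R d $ k))^2 \<le> (norm w)^2 * (norm d)^2"
proof -
  have "norm (\<Sum>k\<in>UNIV. w $ k *\<^sub>R d $ k) \<le> (\<Sum>k\<in>UNIV. \<bar>w $ k\<bar> * norm (d $ k))"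
    by (rule order_trans[OF norm_sum]) simp
  also have "\<dots> \<le> L2_set (\<lambda>k. w $ k) UNIV * L2_set (\<lambda>k. norm (d $ k)) UNIV"
    using L2_set_mult_ineq[of "\<lambda>k. w $ k" "\<lambda>k. norm (d $ k)" UNIV] by simp
  also have "\<dots> = norm w * norm d" by (simp add: norm_vec_def L2_set_def)
  finally show ?thesis by (metis norm_ge_zero power_mono power_mult_distrib)
qed

lemma borel_measurable_vec_nth': 
  fixes d :: "'a \<Rightarrow> 'b::euclidean_space^'n"
  assumes "d \<in> borel_measurable M" shows "(\<lambda>x. d x $ k) \<in> borel_measurable M"
  by (rule borel_measurable_continuous_on[OF _ assms, of "\<lambda>v. v $ k"]) (intro continuous_intros)

lemma L2_scaleR_integrable:
  fixes g :: "'a \<Rightarrow> 'b::euclidean_space"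
  assumes [measurable]: "f \<in> borel_measurable M" "g \<in> borel_measurable M"
    and "integrable M (\<lambda>x. (f x)^2)" "integrable M (\<lambda>x. (norm (g x))^2)"
  shows "integrable M (\<lambda>x. f x *\<^sub>R g x)"
proof (rule integrable_norm_cancel)
  show "integrable M (\<lambda>x. norm (f x *\<^sub>R g x))"
    using L2_inner_integrable[of "\<lambda>x. \<bar>f x\<bar>" M "\<lambda>x. norm (g x)"] assms by simp
qed measurable

lemma test_function_translate:
  assumes "test_function S \<phi>" "\<And>y. y \<in> S \<Longrightarrow> y + v \<in> T"
  shows "test_function T (\<lambda>y. \<phi> (y - v))"
proof -
  obtain K where K: "compact K" "K \<subseteq> S" "\<And>x. x \<notin> K \<Longrightarrow> \<phi> x = 0"
    using test_functionE[OF assms(1)] by blast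
  have "test_function T (\<lambda>y. \<phi> (1 *\<^sub>R y + (- v)))"
    by (rule test_function_affine[OF assms(1), of 1 "-v" K]) (use K assms(2) in auto)
  then show ?thesis by simp
qed

lemma test_function_reflect:
  assumes "test_function S \<phi>"
  shows "test_function UNIV (\<lambda>y. \<phi> (z - y))"
proof -
  obtain K where K: "compact K" "K \<subseteq> S" "\<And>x. x \<notin> K \<Longrightarrow> \<phi> x = 0"
    using test_functionE[OF assms(1)] by blast
  have "test_function UNIV (\<lambda>y. \<phi> ((-1) *\<^sub>R y + z))"
    by (rule test_function_affine[OF assms(1), of "-1" z K]) (use K in auto)
  then show ?thesis by simp
qed

text \<open>By duality it suffices to pair q(. + w) - q with a test field \<psi> on
  \<open>T\<close>. The function F(s) = \<integral> q(y).\<psi>(y - s w) dy is differentiable; on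
  [0, 1] its derivative is the pairing of \<psi>(. - s w) with the weak derivative of
  \<open>q\<close> along \<open>w\<close>, and the mean value theorem bounds F(1) - F(0). The set
  \<open>W\<close> records where the gradient is used, and the bound \<open>C\<close> makes the
  difference square integrable over \<open>T\<close>.\<close>

lemma weak_pair_translation:
  fixes q :: "real^2 \<Rightarrow> 'b::euclidean_space"
  assumes wp: "weak_pair S q d" and bd: "\<And>x. norm (q x) \<le> C"
    and T: "open T" "bounded T" and [measurable]: "W \<in> sets borel"
    and seg: "\<And>s y. 0 \<le> s \<Longrightarrow> s \<le> 1 \<Longrightarrow> y \<in> T \<Longrightarrow> y + s *\<^sub>R w \<in> S \<inter> W"
  shows "(LINT y|lborel. indicator T y * (norm (q (y + w) - q y))^2)
    \<le> (norm w)^2 * (LINT y|lborel. indicator W y * (norm (d y))^2)"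
proof -
  have q[measurable]: "q \<in> borel_measurable borel" and d[measurable]: "d \<in> borel_measurable borel"
    and qi: "integrable lborel q" and d2: "integrable lborel (\<lambda>x. (norm (d x))^2)"
    and weak: "\<And>\<phi> k. test_function S \<phi> \<Longrightarrow> (LINT x|lborel. partial_deriv k \<phi> x *\<^sub>R q x)
        = - (LINT x|lborel. \<phi> x *\<^sub>R (d x $ k))"
    using wp by (auto simp: weak_pair_def)
  note [measurable] = borel_measurable_vec_nth'[OF d]
  have [measurable]: "T \<in> sets borel" using T by simp
  define I where "I = (LINT y|lborel. indicator W y * (norm (d y))^2)"
  have I0: "0 \<le> I" unfolding I_def by (intro integral_nonneg_AE) auto
  define e where "e y = indicator W y *\<^sub>R (\<Sum>k\<in>UNIV. w $ k *\<^sub>R d y $ k)" for y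
  have [measurable]: "e \<in> borel_measurable borel" unfolding e_def by measurable
  have Wd: "integrable lborel (\<lambda>y. indicator W y * (norm (d y))^2)"
    using integrable_mult_indicator[OF _ d2, of W] by simp
  have e_le: "(norm (e y))^2 \<le> (norm w)^2 * (indicator W y * (norm (d y))^2)" for y
    using norm_combination_sq_le[of w "d y"] by (auto simp: e_def indicator_def)
  have e2: "integrable lborel (\<lambda>y. (norm (e y))^2)"
    by (rule Bochner_Integration.integrable_bound[of _ "\<lambda>y. (norm w)^2 * (indicator W y * (norm (d y))^2)"])
       (use Wd e_le in \<open>auto simp: abs_mult\<close>)
  have e2_le: "(LINT y|lborel. (norm (e y))^2) \<le> (norm w)^2 * I"
    unfolding I_def integral_mult_right_zero[symmetric]
    by (rule integral_mono[OF e2]) (use Wd e_le in auto)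
  have bddT: "integrable lborel (\<lambda>y. indicator T y * (norm (q (y + w) - q y))^2)"
  proof (rule Bochner_Integration.integrable_bound[where f = "\<lambda>y. (2 * C)^2 * indicator T y"])
    show "integrable lborel (\<lambda>y. (2 * C)^2 * indicat_real T y)"
      using emeasure_bounded_finite[OF T(2)] by (simp add: integrable_indicator_iff)
    have "norm (q (y + w) - q y) \<le> 2 * C" for y
      using norm_triangle_ineq4[of "q (y + w)" "q y"] bd[of y] bd[of "y + w"] by linarith
    then have "(norm (q (y + w) - q y))^2 \<le> (2 * C)^2" for y by (intro power_mono) auto
    then show "AE y in lborel. norm (indicator T y * (norm (q (y + w) - q y))^2) \<le> norm ((2 * C)^2 * indicat_real T y)"
      by (intro AE_I2) (simp add: indicator_def)
  qed measurable
  have "(LINT y|lborel. indicator T y * (norm (q (y + w) - q y))^2) \<le> (norm w * sqrt I)^2"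
  proof (rule L2_bound_by_duality[OF T])
    show "(\<lambda>y. q (y + w) - q y) \<in> borel_measurable borel" by measurable
    show "integrable lborel (\<lambda>y. indicator T y * (norm (q (y + w) - q y))^2)" by (fact bddT)
    show "0 \<le> norm w * sqrt I" using I0 by simp
    fix \<psi> :: "real^2 \<Rightarrow> 'b" assume \<psi>: "test_field T \<psi>"
    note [measurable] = test_field_borel[OF \<psi>]
    define P where "P = (LINT x|lborel. (norm (\<psi> x))^2)"
    \<comment> \<open>The reflection turns F(s) into a convolution evaluated at s w, whose
      derivative is already known; \<open>X s b\<close> is the same function of \<open>y\<close>
      seen as a test function in \<open>S\<close>, for which the weak derivative is
      available.\<close>
    define \<phi> where "\<phi> b x = \<psi> (- x) \<bullet> b" for b x
    define X where "X s b y = \<psi> (y - s *\<^sub>R w) \<bullet> b" for s b y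
    have tb: "test_function T (\<lambda>x. \<psi> x \<bullet> b)" if "b \<in> Basis" for b
      using \<psi> that by (simp add: test_field_def)
    have \<phi>t: "test_function UNIV (\<phi> b)" if "b \<in> Basis" for b
      using test_function_reflect[OF tb[OF that], of 0] by (simp add: \<phi>_def[abs_def])
    have Xt: "test_function S (X s b)" if "b \<in> Basis" "0 \<le> s" "s \<le> 1" for s b
      unfolding X_def[abs_def]
      by (rule test_function_translate[OF tb[OF that(1)]]) (use seg[OF that(2,3)] in auto)
    have pd\<phi>: "partial_deriv k (\<phi> b) (s *\<^sub>R w - y) = - partial_deriv k (X s b) y" if "b \<in> Basis" for k s b y
    proof -
      have "partial_deriv k (\<lambda>x. \<psi> ((-1) *\<^sub>R x + 0) \<bullet> b) (s *\<^sub>R w - y) =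
          (-1) * partial_deriv k (\<lambda>x. \<psi> x \<bullet> b) ((-1) *\<^sub>R (s *\<^sub>R w - y) + 0)"
        by (rule partial_deriv_affine(2)) (rule test_function_differentiable[OF tb[OF that]])
      moreover have "partial_deriv k (\<lambda>x. \<psi> (1 *\<^sub>R x + (- s *\<^sub>R w)) \<bullet> b) y =
          1 * partial_deriv k (\<lambda>x. \<psi> x \<bullet> b) (1 *\<^sub>R y + (- s *\<^sub>R w))"
        by (rule partial_deriv_affine(2)) (rule test_function_differentiable[OF tb[OF that]])
      ultimately show ?thesis by (simp add: \<phi>_def[abs_def] X_def[abs_def])
    qed
    define N where "N b z = (LINT y|lborel. \<phi> b (z - y) *\<^sub>R q y)" for b z
    define A where "A b k s = (LINT y|lborel. partial_deriv k (\<phi> b) (s *\<^sub>R w - y) *\<^sub>R q y)" for b k s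
    define F where "F s = (\<Sum>b\<in>Basis. N b (s *\<^sub>R w) \<bullet> b)" for s
    define F' where "F' s = (\<Sum>b\<in>Basis. \<Sum>k\<in>UNIV. w $ k * (A b k s \<bullet> b))" for s
    have dF: "(F has_real_derivative F' s) (at s)" for s
    proof -
      have "((\<lambda>s. N b (s *\<^sub>R w)) has_derivative (\<lambda>t. \<Sum>k\<in>UNIV. (t *\<^sub>R w) $ k *\<^sub>R A b k s)) (at s)"
        if "b \<in> Basis" for b
        unfolding N_def A_def
        by (rule has_derivative_compose[OF _ convolution_has_derivative[OF \<phi>t[OF that] qi], of "\<lambda>s. s *\<^sub>R w" "\<lambda>t. t *\<^sub>R w"])
           (auto intro!: derivative_eq_intros)
      then have "(F has_derivative (\<lambda>t. \<Sum>b\<in>Basis. (\<Sum>k\<in>UNIV. (t *\<^sub>R w) $ k *\<^sub>R A b k s) \<bullet> b)) (at s)"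
        unfolding F_def by (intro has_derivative_sum has_derivative_inner_left)
      moreover have "(\<lambda>t. \<Sum>b\<in>Basis. (\<Sum>k\<in>UNIV. (t *\<^sub>R w) $ k *\<^sub>R A b k s) \<bullet> b) = (*) (F' s)"
        by (auto simp: F'_def fun_eq_iff inner_sum_left sum_distrib_right intro!: sum.cong)
      ultimately show ?thesis by (simp add: has_field_derivative_def)
    qed
    have F'_bound: "\<bar>F' s\<bar> \<le> norm w * sqrt I * sqrt P" if s: "0 \<le> s" "s \<le> 1" for s
    proof -
      have A: "A b k s \<bullet> b = (LINT y|lborel. X s b y * (d y $ k \<bullet> b))"
        and i: "integrable lborel (\<lambda>y. X s b y * (d y $ k \<bullet> b))" if b: "b \<in> Basis" for b k
      proof -
        have t: "test_field S (\<lambda>y. X s b y *\<^sub>R b)" by (rule test_field_scaleR_const[OF Xt[OF b s]])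
        have dk: "integrable lborel (\<lambda>y. (norm (d y $ k))^2)"
          by (rule Bochner_Integration.integrable_bound[OF d2])
             (auto intro!: AE_I2 power_mono simp: Finite_Cartesian_Product.norm_nth_le)
        have *: "integrable lborel (\<lambda>y. (X s b y *\<^sub>R b) \<bullet> (d y $ k))"
          by (rule L2_inner_integrable[OF _ _ test_field_L2[OF t] dk]) (use test_field_borel[OF t] in auto)
        then show i: "integrable lborel (\<lambda>y. X s b y * (d y $ k \<bullet> b))"
          by (simp add: inner_commute)
        have vi: "integrable lborel (\<lambda>y. X s b y *\<^sub>R d y $ k)"
          using test_function_times_integrable[OF Xt[OF b s] test_function_integrable[OF Xt[OF b s]]]
            test_function_borel[OF Xt[OF b s]]
          by (intro L2_scaleR_integrable dk) (auto simp: power2_eq_square)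
        have "A b k s = - (LINT y|lborel. partial_deriv k (X s b) y *\<^sub>R q y)"
          unfolding A_def by (simp add: pd\<phi>[OF b])
        also have "\<dots> = (LINT y|lborel. X s b y *\<^sub>R d y $ k)" by (simp add: weak[OF Xt[OF b s]])
        finally have "A b k s \<bullet> b = (LINT y|lborel. (X s b y *\<^sub>R d y $ k) \<bullet> b)"
          by (subst integral_inner_left) (use vi in auto)
        then show "A b k s \<bullet> b = (LINT y|lborel. X s b y * (d y $ k \<bullet> b))" by simp
      qed
      have "F' s = (LINT y|lborel. (\<Sum>b\<in>Basis. \<Sum>k\<in>UNIV. w $ k * (X s b y * (d y $ k \<bullet> b))))"
      proof -
        have "(LINT y|lborel. (\<Sum>b\<in>Basis. \<Sum>k\<in>UNIV. w $ k * (X s b y * (d y $ k \<bullet> b)))) =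
            (\<Sum>b\<in>Basis. LINT y|lborel. (\<Sum>k\<in>UNIV. w $ k * (X s b y * (d y $ k \<bullet> b))))"
          by (rule Bochner_Integration.integral_sum)
             (intro Bochner_Integration.integrable_sum integrable_mult_right i)
        also have "\<dots> = (\<Sum>b\<in>Basis. \<Sum>k\<in>UNIV. LINT y|lborel. w $ k * (X s b y * (d y $ k \<bullet> b)))"
          by (intro sum.cong refl Bochner_Integration.integral_sum integrable_mult_right i)
        also have "\<dots> = F' s" unfolding F'_def by (intro sum.cong refl) (simp add: A)
        finally show ?thesis by simp
      qed
      also have "\<dots> = (LINT y|lborel. e y \<bullet> \<psi> (y - s *\<^sub>R w))"
      proof (rule Bochner_Integration.integral_cong[OF refl])
        fix y
        have "(\<Sum>b\<in>Basis. \<Sum>k\<in>UNIV. w $ k * (X s b y * (d y $ k \<bullet> b))) = (\<Sum>k\<in>UNIV. w $ k *\<^sub>R d y $ k) \<bullet> \<psi> (y - s *\<^sub>R w)"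
        proof -
          have "(\<Sum>k\<in>UNIV. w $ k *\<^sub>R d y $ k) \<bullet> \<psi> (y - s *\<^sub>R w) =
              (\<Sum>k\<in>UNIV. w $ k * (d y $ k \<bullet> \<psi> (y - s *\<^sub>R w)))"
            by (simp add: inner_sum_left)
          also have "\<dots> = (\<Sum>k\<in>UNIV. w $ k * (\<Sum>b\<in>Basis. (d y $ k \<bullet> b) * X s b y))"
            unfolding X_def by (intro sum.cong refl arg_cong2[where f = "(*)"] euclidean_inner)
          also have "\<dots> = (\<Sum>k\<in>UNIV. \<Sum>b\<in>Basis. w $ k * (X s b y * (d y $ k \<bullet> b)))"
            by (simp add: sum_distrib_left mult.commute)
          also have "\<dots> = (\<Sum>b\<in>Basis. \<Sum>k\<in>UNIV. w $ k * (X s b y * (d y $ k \<bullet> b)))"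
            by (rule sum.swap)
          finally show ?thesis by simp
        qed
        \<comment> \<open>Outside \<open>W\<close> the shifted field vanishes by \<open>seg\<close>,
          so the cut-off contained in \<open>e\<close> changes nothing.\<close>
        moreover have "\<psi> (y - s *\<^sub>R w) = 0" if "y \<notin> W"
        proof (rule test_field_outside[OF \<psi>])
          show "y - s *\<^sub>R w \<notin> T" using seg[OF s, of "y - s *\<^sub>R w"] that by auto
        qed
        ultimately show "(\<Sum>b\<in>Basis. \<Sum>k\<in>UNIV. w $ k * (X s b y * (d y $ k \<bullet> b))) = e y \<bullet> \<psi> (y - s *\<^sub>R w)"
          by (auto simp: e_def indicator_def)
      qed
      also have "\<bar>\<dots>\<bar> \<le> sqrt (LINT y|lborel. (norm (e y))^2) * sqrt (LINT y|lborel. (norm (\<psi> (y - s *\<^sub>R w)))^2)"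
        using test_field_L2[OF \<psi>] lborel_integral_translate(2)[of "\<lambda>y. (norm (\<psi> y))^2" "- s *\<^sub>R w"]
        by (intro L2_Cauchy_Schwarz e2) auto
      also have "(LINT y|lborel. (norm (\<psi> (y - s *\<^sub>R w)))^2) = P"
        using lborel_integral_translate(1)[of "\<lambda>y. (norm (\<psi> y))^2" "- s *\<^sub>R w"] by (simp add: P_def)
      also have "sqrt (LINT y|lborel. (norm (e y))^2) \<le> norm w * sqrt I"
        using e2_le by (metis real_sqrt_le_mono real_sqrt_mult real_sqrt_abs abs_norm_cancel)
      finally show ?thesis by (simp add: P_def mult_right_mono)
    qed
    have F_eq: "F s = (LINT y|lborel. q y \<bullet> \<psi> (y - s *\<^sub>R w))"
      and F_int: "integrable lborel (\<lambda>y. q y \<bullet> \<psi> (y - s *\<^sub>R w))" for s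
    proof -
      have i: "integrable lborel (\<lambda>y. \<phi> b (s *\<^sub>R w - y) *\<^sub>R q y)" if "b \<in> Basis" for b
        by (rule test_function_shift_integrable[OF \<phi>t[OF that] qi])
      have *: "q y \<bullet> \<psi> (y - s *\<^sub>R w) = (\<Sum>b\<in>Basis. (\<phi> b (s *\<^sub>R w - y) *\<^sub>R q y) \<bullet> b)" for y
        by (subst euclidean_inner) (simp add: \<phi>_def mult.commute)
      show "F s = (LINT y|lborel. q y \<bullet> \<psi> (y - s *\<^sub>R w))"
      proof -
        have "(LINT y|lborel. q y \<bullet> \<psi> (y - s *\<^sub>R w)) = (\<Sum>b\<in>Basis. LINT y|lborel. (\<phi> b (s *\<^sub>R w - y) *\<^sub>R q y) \<bullet> b)"
          unfolding * by (rule Bochner_Integration.integral_sum) (intro integrable_inner_left i)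
        also have "\<dots> = F s"
          unfolding F_def N_def by (intro sum.cong refl integral_inner_left i)
        finally show ?thesis by simp
      qed
      show "integrable lborel (\<lambda>y. q y \<bullet> \<psi> (y - s *\<^sub>R w))"
        unfolding * using i by (intro Bochner_Integration.integrable_sum integrable_inner_left) auto
    qed
    have "(LINT y|lborel. (q (y + w) - q y) \<bullet> \<psi> y) = (LINT y|lborel. q (y + w) \<bullet> \<psi> (y + w - w)) - (LINT y|lborel. q y \<bullet> \<psi> y)"
      using F_int[of 0] F_int[of 1] lborel_integral_translate(2)[of "\<lambda>y. q y \<bullet> \<psi> (y - w)" w]
      unfolding inner_diff_left
      by (subst Bochner_Integration.integral_diff) simp_all
    also have "\<dots> = F 1 - F 0"
      using lborel_integral_translate(1)[of "\<lambda>y. q y \<bullet> \<psi> (y - w)" w] by (simp add: F_eq)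
    also have "\<dots> \<le> norm w * sqrt I * sqrt P"
    proof -
      obtain z where "0 < z" "z < 1" "F 1 - F 0 = (1 - 0) * F' z"
        using MVT2[of 0 1 F F'] dF by auto
      then show ?thesis using F'_bound[of z] by auto
    qed
    finally show "(LINT y|lborel. (q (y + w) - q y) \<bullet> \<psi> y) \<le> norm w * sqrt I * sqrt (LINT x|lborel. (norm (\<psi> x))^2)"
      by (simp add: P_def)
  qed
  then show ?thesis using I0 by (simp add: power_mult_distrib I_def)
qed

section \<open>Oscillation and translations\<close>

lemma nn_integral_lborel_translate:
  fixes f :: "'a::euclidean_space \<Rightarrow> ennreal"
  assumes [measurable]: "f \<in> borel_measurable borel"
  shows "(\<integral>\<^sup>+x. f (c + x) \<partial>lborel) = (\<integral>\<^sup>+x. f x \<partial>lborel)"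
proof -
  have "(\<integral>\<^sup>+x. f x \<partial>lborel) = (\<integral>\<^sup>+x. f x \<partial>distr lborel borel ((+) c))" by (simp add: lborel_distr_plus)
  also have "\<dots> = (\<integral>\<^sup>+x. f (c + x) \<partial>lborel)" by (subst nn_integral_distr) auto
  finally show ?thesis by simp
qed

text \<open>Substituting z = y + w and exchanging the integrals turns the double integral of
  differences into an integral of translation estimates over the shifts w in
  \<open>W\<close>.\<close>

lemma nn_integral_oscillation_le:
  fixes f :: "'a::euclidean_space \<Rightarrow> 'b::euclidean_space" and \<rho> :: "'a \<Rightarrow> 'a \<Rightarrow> ennreal"
  assumes [measurable]: "f \<in> borel_measurable borel" "W \<in> sets borel"
      "(\<lambda>(y, z). \<rho> y z) \<in> borel_measurable (borel \<Otimes>\<^sub>M borel)"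
    and diff: "\<And>y z. z - y \<notin> W \<Longrightarrow> \<rho> y z = 0"
    and K: "\<And>w. w \<in> W \<Longrightarrow> (\<integral>\<^sup>+y. \<rho> y (y + w) * ennreal ((norm (f (y + w) - f y))^2) \<partial>lborel) \<le> K"
  shows "(\<integral>\<^sup>+y. \<integral>\<^sup>+z. \<rho> y z * ennreal ((norm (f z - f y))^2) \<partial>lborel \<partial>lborel) \<le> emeasure lborel W * K"
proof -
  have "(\<integral>\<^sup>+y. \<integral>\<^sup>+z. \<rho> y z * ennreal ((norm (f z - f y))^2) \<partial>lborel \<partial>lborel) =
    (\<integral>\<^sup>+y. \<integral>\<^sup>+w. \<rho> y (y + w) * ennreal ((norm (f (y + w) - f y))^2) \<partial>lborel \<partial>lborel)"
    by (intro nn_integral_cong nn_integral_lborel_translate[symmetric]) measurable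
  also have "\<dots> = (\<integral>\<^sup>+w. \<integral>\<^sup>+y. \<rho> y (y + w) * ennreal ((norm (f (y + w) - f y))^2) \<partial>lborel \<partial>lborel)"
    by (rule lborel_pair.Fubini') measurable
  also have "\<dots> \<le> (\<integral>\<^sup>+w. indicator W w * K \<partial>lborel)"
  proof (rule nn_integral_mono)
    fix w :: 'a
    show "(\<integral>\<^sup>+y. \<rho> y (y + w) * ennreal ((norm (f (y + w) - f y))^2) \<partial>lborel) \<le> indicator W w * K"
      using K[of w] diff[of "_ + w" _] by (cases "w \<in> W") auto
  qed
  also have "\<dots> = emeasure lborel W * K" by (simp add: nn_integral_multc)
  finally show ?thesis .
qed

text \<open>For unit vectors |f z - f y|^2 = 2 - 2 (f z).(f y), so the double integral against k(y)
  k(z) equals exactly 2 (1 - |m|^2) for the weighted mean m; bounding the two densities by \<kappa>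
  gives the factor \<kappa>^2. Oscillation thus measures how far a mean of unit vectors falls short
  of norm 1.\<close>

lemma weighted_mean_norm:
  fixes f :: "'a::euclidean_space \<Rightarrow> 'b::euclidean_space" and k :: "'a \<Rightarrow> real"
  assumes [measurable]: "f \<in> borel_measurable borel" "B \<in> sets borel"
    and f1: "\<And>y. y \<in> B \<Longrightarrow> norm (f y) = 1"
    and k: "integrable lborel k" "(LINT y|lborel. k y) = 1" "\<And>y. 0 \<le> k y" "\<And>y. k y \<le> \<kappa>" "\<And>y. y \<notin> B \<Longrightarrow> k y = 0"
  shows "ennreal (2 * (1 - (norm (LINT y|lborel. k y *\<^sub>R f y))^2)) \<le> ennreal (\<kappa>^2) *
    (\<integral>\<^sup>+y. \<integral>\<^sup>+z. indicator B y * indicator B z * ennreal ((norm (f z - f y))^2) \<partial>lborel \<partial>lborel)"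
proof -
  note [measurable] = borel_measurable_integrable[OF k(1)]
  define m where "m = (LINT y|lborel. k y *\<^sub>R f y)"
  have kn: "norm (k y *\<^sub>R f y) = k y" for y using k(3)[of y] k(5)[of y] f1[of y] by (cases "y \<in> B") auto
  have kf: "integrable lborel (\<lambda>y. k y *\<^sub>R f y)"
    by (rule Bochner_Integration.integrable_bound[OF k(1)]) (simp_all only: kn, simp_all add: k(3))
  define G where "G y = (LINT z|lborel. k z * (norm (f z - f y))^2)" for y
  have expand: "k z * (norm (f z - f y))^2 = 2 * k z - 2 * ((k z *\<^sub>R f z) \<bullet> f y)" if "y \<in> B" for y z
  proof (cases "z \<in> B")
    case True
    have sq: "(norm (f z - f y))^2 = 2 - 2 * (f z \<bullet> f y)"
      using f1[OF that] f1[OF True] unfolding norm_eq_1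
      by (simp add: power2_norm_eq_inner inner_diff_left inner_diff_right inner_commute)
    show ?thesis unfolding sq by (simp add: algebra_simps)
  qed (simp add: k)
  have iG: "integrable lborel (\<lambda>z. k z * (norm (f z - f y))^2)" if "y \<in> B" for y
    unfolding expand[OF that] using k(1) kf by (simp del: inner_scaleR_left)
  have G: "G y = 2 - 2 * (m \<bullet> f y)" if "y \<in> B" for y
    unfolding G_def expand[OF that] using k(1,2) kf by (simp add: m_def del: inner_scaleR_left)
  have kG: "k y * G y = 2 * k y - 2 * (m \<bullet> (k y *\<^sub>R f y))" for y
  proof (cases "y \<in> B")
    case True
    show ?thesis by (simp add: G[OF True] algebra_simps)
  qed (simp add: k)
  have int_kG: "integrable lborel (\<lambda>y. k y * G y)" unfolding kG using k(1) kf by (simp del: inner_scaleR_right)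
  have "2 * (1 - (norm m)^2) = (LINT y|lborel. k y * G y)"
    unfolding kG using k(1,2) kf by (simp add: m_def[symmetric] power2_norm_eq_inner del: inner_scaleR_right)
  also have "ennreal \<dots> \<le> ennreal (\<kappa>^2) *
    (\<integral>\<^sup>+y. \<integral>\<^sup>+z. indicator B y * indicator B z * ennreal ((norm (f z - f y))^2) \<partial>lborel \<partial>lborel)"
  proof -
    have "ennreal (LINT y|lborel. k y * G y) = (\<integral>\<^sup>+y. ennreal (k y * G y) \<partial>lborel)"
      using int_kG k(3) by (intro nn_integral_eq_integral[symmetric]) (auto simp: G_def intro!: mult_nonneg_nonneg integral_nonneg_AE)
    also have "\<dots> \<le> (\<integral>\<^sup>+y. \<integral>\<^sup>+z. ennreal (\<kappa>^2) * (indicator B y * indicator B z * ennreal ((norm (f z - f y))^2)) \<partial>lborel \<partial>lborel)"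
    proof (rule nn_integral_mono)
      fix y
      show "ennreal (k y * G y) \<le> (\<integral>\<^sup>+z. ennreal (\<kappa>^2) * (indicator B y * indicator B z * ennreal ((norm (f z - f y))^2)) \<partial>lborel)"
      proof (cases "y \<in> B")
        case True
        have "k y * G y = (LINT z|lborel. k y * (k z * (norm (f z - f y))^2))" by (simp add: G_def)
        also have "ennreal \<dots> = (\<integral>\<^sup>+z. ennreal (k y * (k z * (norm (f z - f y))^2)) \<partial>lborel)"
          using iG[OF True] k(3) by (intro nn_integral_eq_integral[symmetric]) auto
        also have "\<dots> \<le> (\<integral>\<^sup>+z. ennreal (\<kappa>^2) * (indicator B y * indicator B z * ennreal ((norm (f z - f y))^2)) \<partial>lborel)"
        proof (rule nn_integral_mono)
          fix z
          have "k y * k z \<le> \<kappa> * \<kappa>" using k(3,4) by (intro mult_mono) (auto intro: order_trans)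
          then have "k y * (k z * (norm (f z - f y))^2) \<le> \<kappa>^2 * (norm (f z - f y))^2"
            by (simp add: power2_eq_square[of \<kappa>] mult.assoc[symmetric] mult_right_mono)
          then show "ennreal (k y * (k z * (norm (f z - f y))^2)) \<le> ennreal (\<kappa>^2) * (indicator B y * indicator B z * ennreal ((norm (f z - f y))^2))"
            using True k(5)[of z] by (auto simp: indicator_def ennreal_mult[symmetric] intro!: ennreal_leI)
        qed
        finally show ?thesis .
      qed (simp add: k)
    qed
    also have "\<dots> = ennreal (\<kappa>^2) * (\<integral>\<^sup>+y. \<integral>\<^sup>+z. indicator B y * indicator B z * ennreal ((norm (f z - f y))^2) \<partial>lborel \<partial>lborel)"
      by (simp add: nn_integral_cmult)
    finally show ?thesis .
  qed
  finally show ?thesis by (simp add: m_def)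
qed

lemma weighted_mean_norm_ge:
  fixes f :: "'a::euclidean_space \<Rightarrow> 'b::euclidean_space" and k :: "'a \<Rightarrow> real"
  assumes [measurable]: "f \<in> borel_measurable borel" "B \<in> sets borel" "W \<in> sets borel"
    and diff: "\<And>y z. y \<in> B \<Longrightarrow> z \<in> B \<Longrightarrow> z - y \<in> W"
    and K: "\<And>w. w \<in> W \<Longrightarrow>
      (\<integral>\<^sup>+y. indicator B y * indicator B (y + w) * ennreal ((norm (f (y + w) - f y))^2) \<partial>lborel) \<le> ennreal K"
    and "0 \<le> K" and Wfin: "emeasure lborel W < \<infinity>"
    and f1: "\<And>y. y \<in> B \<Longrightarrow> norm (f y) = 1"
    and k: "integrable lborel k" "(LINT y|lborel. k y) = 1" "\<And>y. 0 \<le> k y" "\<And>y. k y \<le> \<kappa>" "\<And>y. y \<notin> B \<Longrightarrow> k y = 0"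
  shows "1 - (norm (LINT y|lborel. k y *\<^sub>R f y))^2 \<le> \<kappa>^2 * (measure lborel W * K) / 2"
proof -
  have "ennreal (2 * (1 - (norm (LINT y|lborel. k y *\<^sub>R f y))^2)) \<le> ennreal (\<kappa>^2) *
    (\<integral>\<^sup>+y. \<integral>\<^sup>+z. indicator B y * indicator B z * ennreal ((norm (f z - f y))^2) \<partial>lborel \<partial>lborel)"
    by (rule weighted_mean_norm) (use f1 k in auto)
  also have "\<dots> \<le> ennreal (\<kappa>^2) * (emeasure lborel W * ennreal K)"
    by (intro mult_left_mono nn_integral_oscillation_le K) (use diff in \<open>auto simp: indicator_def\<close>)
  also have "\<dots> = ennreal (\<kappa>^2 * (measure lborel W * K))"
    using Wfin \<open>0 \<le> K\<close> by (simp add: emeasure_eq_ennreal_measure ennreal_mult)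
  finally show ?thesis using \<open>0 \<le> K\<close> by (subst (asm) ennreal_le_iff) auto
qed

section \<open>Borel representatives\<close>

text \<open>The definitions integrate over Lebesgue measure on \<open>S\<close>, while translations,
  Tonelli and convolution are carried out with Borel functions on the plane; a Borel representative
  vanishing outside \<open>S\<close> is the interface between the two.\<close>

lemma lebesgue_on_borel_rep:
  fixes f :: "'a::euclidean_space \<Rightarrow> 'b::euclidean_space"
  assumes "open S" "f \<in> borel_measurable (lebesgue_on S)"
  obtains g where "g \<in> borel_measurable borel" "\<And>x. x \<notin> S \<Longrightarrow> g x = 0" "AE x in lebesgue_on S. f x = g x"
proof -
  have S: "S \<in> sets lebesgue" "S \<in> sets borel" using \<open>open S\<close> by auto
  define F where "F x = indicator S x *\<^sub>R f x" for x
  have F: "F \<in> borel_measurable lebesgue"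
    using assms(2) S unfolding F_def by (subst (asm) borel_measurable_restrict_space_iff) auto
  have "\<exists>g\<in>borel_measurable lborel. AE x in lborel. F x \<bullet> b = g x" for b
    using F by (intro completion_ex_borel_measurable_real) auto
  then obtain g where g: "\<And>b. g b \<in> borel_measurable lborel" "\<And>b. AE x in lborel. F x \<bullet> b = g b x" by metis
  define G where "G x = indicator S x *\<^sub>R (\<Sum>b\<in>Basis. g b x *\<^sub>R b)" for x
  have "AE x in lborel. \<forall>b\<in>Basis. F x \<bullet> b = g b x"
    by (subst AE_finite_all) (auto intro: g)
  then have "AE x in lborel. x \<in> S \<longrightarrow> f x = G x"
  proof eventually_elim
    case (elim x)
    then have "F x = (\<Sum>b\<in>Basis. g b x *\<^sub>R b)"
      using euclidean_representation[of "F x"] by simp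
    then show ?case by (auto simp: F_def G_def)
  qed
  then have "AE x in lebesgue. x \<in> S \<longrightarrow> f x = G x" by (rule AE_completion)
  then have "AE x in lebesgue_on S. f x = G x" using S by (subst AE_restrict_space_iff) auto
  moreover have "G \<in> borel_measurable borel" using g S unfolding G_def by measurable
  ultimately show ?thesis by (intro that[of G]) (auto simp: G_def)
qed

lemma lebesgue_on_borel_integral:
  fixes f g :: "'a::euclidean_space \<Rightarrow> 'b::euclidean_space"
  assumes "open S" "f \<in> borel_measurable (lebesgue_on S)" "g \<in> borel_measurable borel"
    "\<And>x. x \<notin> S \<Longrightarrow> g x = 0" "AE x in lebesgue_on S. f x = g x"
  shows "(LINT x|lebesgue_on S. f x) = (LINT x|lborel. g x)"
    and "integrable (lebesgue_on S) f \<longleftrightarrow> integrable lborel g"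
proof -
  have S: "S \<in> sets lebesgue" using \<open>open S\<close> by auto
  have gl: "g \<in> borel_measurable lborel" using assms by simp
  then have gL: "g \<in> borel_measurable lebesgue" by (rule measurable_completion)
  then have gS: "g \<in> borel_measurable (lebesgue_on S)" by (rule measurable_restrict_space1)
  have ind: "(\<lambda>x. indicator S x *\<^sub>R g x) = g" using assms(4) by (auto simp: fun_eq_iff indicator_def)
  have "(LINT x|lebesgue_on S. f x) = (LINT x|lebesgue_on S. g x)"
    using assms gS by (intro integral_cong_AE) auto
  also have "\<dots> = (LINT x|lebesgue. g x)"
    using S by (subst integral_restrict_space) (auto simp: ind)
  also have "\<dots> = (LINT x|lborel. g x)" by (rule integral_completion[OF gl])
  finally show "(LINT x|lebesgue_on S. f x) = (LINT x|lborel. g x)" .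
  have "integrable (lebesgue_on S) f \<longleftrightarrow> integrable (lebesgue_on S) g"
    using assms gS by (intro integrable_cong_AE) auto
  also have "\<dots> \<longleftrightarrow> integrable lebesgue g"
    using S by (subst integrable_restrict_space) (auto simp: ind)
  also have "\<dots> \<longleftrightarrow> integrable lborel g" by (rule integrable_completion[OF gl])
  finally show "integrable (lebesgue_on S) f \<longleftrightarrow> integrable lborel g" .
qed

lemma borel_measurable_lebesgue_on: "open S \<Longrightarrow> g \<in> borel_measurable borel \<Longrightarrow> g \<in> borel_measurable (lebesgue_on S)"
  by (intro measurable_restrict_space1 measurable_completion) simp

section \<open>Neighbourhoods in the weak* topology\<close>

definition pairing :: "(real^2) set \<Rightarrow> (real^2 \<Rightarrow> real^2^2) \<Rightarrow> (real^2 \<Rightarrow> real^2^2) \<Rightarrow> real" where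
  "pairing S Q \<Phi> = (LINT x|lebesgue_on S. Q x \<bullet> \<Phi> x)"

text \<open>A basic open set of the product restricts only finitely many coordinates, so one
  tolerance, the least of finitely many, serves them all.\<close>

lemma weak_star_nbhd:
  assumes "openin (weak_star S) U" "Q \<in> U"
  obtains F e where "finite F" "F \<subseteq> L1_sym S" "e > 0"
    "\<And>P. P \<in> Linf_sym S \<Longrightarrow> (\<And>\<Phi>. \<Phi> \<in> F \<Longrightarrow> \<bar>pairing S P \<Phi> - pairing S Q \<Phi>\<bar> < e) \<Longrightarrow> P \<in> U"
proof -
  let ?f = "\<lambda>Q. \<lambda>\<Phi>\<in>L1_sym S. pairing S Q \<Phi>"
  obtain V where V: "openin (product_topology (\<lambda>_. euclideanreal) (L1_sym S)) V"
    "U = ?f -` V \<inter> Linf_sym S"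
    using assms(1) unfolding weak_star_def openin_pullback_topology pairing_def[symmetric] by blast
  have "?f Q \<in> V" using assms V by auto
  then obtain W where W: "finite {i \<in> L1_sym S. W i \<noteq> UNIV}" "\<And>i. i \<in> L1_sym S \<Longrightarrow> open (W i)"
    "?f Q \<in> Pi\<^sub>E (L1_sym S) W" "Pi\<^sub>E (L1_sym S) W \<subseteq> V"
    using V(1) unfolding openin_product_topology_alt by force
  define F where "F = {i \<in> L1_sym S. W i \<noteq> UNIV}"
  have FL: "F \<subseteq> L1_sym S" by (auto simp: F_def)
  have "\<exists>e>0. \<forall>y. \<bar>y - pairing S Q \<Phi>\<bar> < e \<longrightarrow> y \<in> W \<Phi>" if "\<Phi> \<in> F" for \<Phi>
  proof -
    have "pairing S Q \<Phi> \<in> W \<Phi>" "open (W \<Phi>)" using W(2,3) FL that by (auto simp: PiE_iff)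
    then show ?thesis unfolding open_dist dist_real_def by blast
  qed
  then obtain e where e: "\<And>\<Phi>. \<Phi> \<in> F \<Longrightarrow> e \<Phi> > 0 \<and> (\<forall>y. \<bar>y - pairing S Q \<Phi>\<bar> < e \<Phi> \<longrightarrow> y \<in> W \<Phi>)" by metis
  define d where "d = Min (insert 1 (e ` F))"
  have fin: "finite F" using W(1) by (simp add: F_def)
  have d: "d > 0" "\<And>\<Phi>. \<Phi> \<in> F \<Longrightarrow> d \<le> e \<Phi>" unfolding d_def using fin e by auto
  show ?thesis
  proof (rule that[OF fin FL d(1)])
    fix P assume P: "P \<in> Linf_sym S" "\<And>\<Phi>. \<Phi> \<in> F \<Longrightarrow> \<bar>pairing S P \<Phi> - pairing S Q \<Phi>\<bar> < d"
    have "pairing S P \<Phi> \<in> W \<Phi>" if "\<Phi> \<in> L1_sym S" for \<Phi>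
    proof (cases "\<Phi> \<in> F")
      case True
      then show ?thesis using P(2)[OF True] d(2)[OF True] e[OF True] by force
    next
      case False
      then show ?thesis using that by (auto simp: F_def)
    qed
    then have "?f P \<in> Pi\<^sub>E (L1_sym S) W" by auto
    then have "?f P \<in> V" by (rule subsetD[OF W(4)])
    then show "P \<in> U" using V(2) P(1) by simp
  qed
qed

lemma weak_star_open:
  assumes "finite F" "F \<subseteq> L1_sym S"
  shows "openin (weak_star S) {P \<in> Linf_sym S. \<forall>\<Phi>\<in>F. \<bar>pairing S P \<Phi> - c \<Phi>\<bar> < e}"
  using assms
proof (induction F)
  case empty
  then show ?case using openin_topspace[of "weak_star S"] by (simp add: topspace_weak_star)
next
  case (insert \<Phi> F)
  let ?f = "\<lambda>Q. \<lambda>\<Phi>\<in>L1_sym S. pairing S Q \<Phi>"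
  have \<Phi>: "\<Phi> \<in> L1_sym S" using insert by simp
  have 1: "openin (weak_star S) {P \<in> Linf_sym S. \<bar>pairing S P \<Phi> - c \<Phi>\<bar> < e}"
    unfolding weak_star_def openin_pullback_topology pairing_def[symmetric]
  proof (intro exI conjI)
    show "openin (product_topology (\<lambda>_. euclideanreal) (L1_sym S))
       {x \<in> topspace (product_topology (\<lambda>_. euclideanreal) (L1_sym S)). x \<Phi> \<in> {y. \<bar>y - c \<Phi>\<bar> < e}}"
    proof (rule openin_continuous_map_preimage[OF continuous_map_product_projection[OF \<Phi>]])
      have "{y. \<bar>y - c \<Phi>\<bar> < e} = ball (c \<Phi>) e" by (auto simp: dist_real_def abs_minus_commute)
      then show "openin euclideanreal {y. \<bar>y - c \<Phi>\<bar> < e}" by simp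
    qed
    show "{P \<in> Linf_sym S. \<bar>pairing S P \<Phi> - c \<Phi>\<bar> < e} =
      ?f -` {x \<in> topspace (product_topology (\<lambda>_. euclideanreal) (L1_sym S)). x \<Phi> \<in> {y. \<bar>y - c \<Phi>\<bar> < e}} \<inter> Linf_sym S"
      using \<Phi> by auto
  qed
  have "{P \<in> Linf_sym S. \<forall>\<Psi>\<in>insert \<Phi> F. \<bar>pairing S P \<Psi> - c \<Psi>\<bar> < e} =
     {P \<in> Linf_sym S. \<bar>pairing S P \<Phi> - c \<Phi>\<bar> < e} \<inter> {P \<in> Linf_sym S. \<forall>\<Psi>\<in>F. \<bar>pairing S P \<Psi> - c \<Psi>\<bar> < e}"
    by auto
  then show ?case using openin_Int[OF 1 insert.IH] insert.prems by simp
qed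

section \<open>Symmetrised test fields\<close>

text \<open>The weak* topology is generated by symmetric fields, whereas later tests single out
  individual matrix entries. Symmetrising a field leaves its pairings with symmetric
  \<open>P\<close> unchanged, so such tests remain admissible.\<close>

definition sym_part :: "real^2^2 \<Rightarrow> real^2^2" where
  "sym_part A = (1/2) *\<^sub>R (A + transpose A)"

lemma inner_mat2: "(A :: real^2^2) \<bullet> B = A$1$1 * B$1$1 + A$1$2 * B$1$2 + A$2$1 * B$2$1 + A$2$2 * B$2$2"
  by (simp add: inner_vec_def sum_2)

lemma sym_mat_iff: "A \<in> sym_mat \<longleftrightarrow> A $ 1 $ 2 = A $ 2 $ 1"
  by (auto simp: sym_mat_def transpose_def vec_eq_iff forall_2)

lemma sym_part_in: "sym_part A \<in> sym_mat"
  by (simp add: sym_mat_iff sym_part_def transpose_def)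

lemma sym_part_inner: "P \<in> sym_mat \<Longrightarrow> P \<bullet> sym_part A = P \<bullet> A"
  by (simp add: sym_mat_iff inner_mat2 sym_part_def transpose_def field_simps)

lemma bounded_linear_sym_part: "bounded_linear sym_part"
proof -
  have "linear sym_part"
    by (rule linearI) (simp_all add: sym_part_def transpose_def vec_eq_iff algebra_simps)
  then show ?thesis by (simp add: linear_conv_bounded_linear)
qed

lemma sym_part_L1:
  assumes "integrable (lebesgue_on S) \<Phi>"
  shows "(\<lambda>x. sym_part (\<Phi> x)) \<in> L1_sym S"
  using integrable_bounded_linear[OF bounded_linear_sym_part assms]
  by (auto simp: L1_sym_def sym_part_in)

lemma pairing_sym_part:
  assumes "P \<in> Linf_sym S" "integrable (lebesgue_on S) \<Phi>"
  shows "pairing S P (\<lambda>x. sym_part (\<Phi> x)) = pairing S P \<Phi>"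
proof -
  have m: "P \<in> borel_measurable (lebesgue_on S)" "AE x in lebesgue_on S. P x \<in> sym_mat"
    using assms(1) by (auto simp: Linf_sym_def)
  note [measurable] = m(1) borel_measurable_integrable[OF assms(2)]
    borel_measurable_integrable[OF integrable_bounded_linear[OF bounded_linear_sym_part assms(2)]]
  show ?thesis
    unfolding pairing_def
    by (rule integral_cong_AE; measurable?) (use m(2) in \<open>auto elim!: eventually_mono simp: sym_part_inner\<close>)
qed

text \<open>Against a symmetric field, a matrix field acts only through its symmetric part.\<close>

lemma weak_star_open_nonsym:
  assumes "finite F" "\<And>\<Phi>. \<Phi> \<in> F \<Longrightarrow> integrable (lebesgue_on S) \<Phi>"
  shows "openin (weak_star S) {P \<in> Linf_sym S. \<forall>\<Phi>\<in>F. \<bar>pairing S P \<Phi> - c \<Phi>\<bar> < e}"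
  using assms
proof (induction F)
  case empty
  then show ?case using openin_topspace[of "weak_star S"] by (simp add: topspace_weak_star)
next
  case (insert \<Phi> F)
  have "{P \<in> Linf_sym S. \<bar>pairing S P \<Phi> - c \<Phi>\<bar> < e} =
      {P \<in> Linf_sym S. \<forall>\<Psi>\<in>{\<lambda>x. sym_part (\<Phi> x)}. \<bar>pairing S P \<Psi> - c \<Phi>\<bar> < e}"
    using pairing_sym_part insert.prems by auto
  then have 1: "openin (weak_star S) {P \<in> Linf_sym S. \<bar>pairing S P \<Phi> - c \<Phi>\<bar> < e}"
    using weak_star_open[of "{\<lambda>x. sym_part (\<Phi> x)}" S "\<lambda>_. c \<Phi>" e] sym_part_L1 insert.prems by simp
  have "{P \<in> Linf_sym S. \<forall>\<Psi>\<in>insert \<Phi> F. \<bar>pairing S P \<Psi> - c \<Psi>\<bar> < e} =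
     {P \<in> Linf_sym S. \<bar>pairing S P \<Phi> - c \<Phi>\<bar> < e} \<inter> {P \<in> Linf_sym S. \<forall>\<Psi>\<in>F. \<bar>pairing S P \<Psi> - c \<Psi>\<bar> < e}"
    by auto
  then show ?case using openin_Int[OF 1 insert.IH] insert.prems by simp
qed

section \<open>The boundary of K\<close>

lemma trace_mat2: "trace (A :: real^2^2) = A$1$1 + A$2$2"
  by (simp add: trace_def sum_2)

lemma norm_mat2_sq: "(norm (A :: real^2^2))^2 = (A$1$1)^2 + (A$1$2)^2 + (A$2$1)^2 + (A$2$2)^2"
  unfolding power2_norm_eq_inner inner_mat2 by (simp add: power2_eq_square)

text \<open>Trace one and norm one force the determinant to vanish, which is the first identity; it
  also confines the diagonal entries to [0, 1].\<close>

lemma bd_K_off_diagonal: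
  assumes "(A :: real^2^2) \<in> sym_mat" "trace A = 1" "norm A = 1"
  shows "(A$1$2)^2 = A$1$1 * (1 - A$1$1)" "0 \<le> A$1$1" "A$1$1 \<le> 1" "A$2$1 = A$1$2" "A$2$2 = 1 - A$1$1"
proof -
  show s: "A$2$1 = A$1$2" and t: "A$2$2 = 1 - A$1$1"
    using assms by (auto simp: sym_mat_iff trace_mat2)
  have "(norm A)^2 = 1" using assms by simp
  then show o: "(A$1$2)^2 = A$1$1 * (1 - A$1$1)"
    unfolding norm_mat2_sq s t by (simp add: power2_eq_square algebra_simps)
  have "0 \<le> A$1$1 * (1 - A$1$1)" unfolding o[symmetric] by simp
  then show "0 \<le> A$1$1" "A$1$1 \<le> 1" by (auto simp: zero_le_mult_iff)
qed

text \<open>Positivity follows from the equations: with vanishing determinant the quadratic form is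
  the perfect square of a v1 + b v2 or of a v1 - b v2. What remains are two linear conditions and
  one on the norm, which can be treated one at a time.\<close>

lemma bd_K_iff: "A \<in> bd_K \<longleftrightarrow> A \<in> sym_mat \<and> trace A = 1 \<and> norm A = 1"
proof
  assume A: "A \<in> sym_mat \<and> trace A = 1 \<and> norm A = 1"
  note o = bd_K_off_diagonal[of A]
  have "0 \<le> v \<bullet> (A *v v)" for v
  proof -
    define a b where "a = sqrt (A$1$1)" and "b = sqrt (1 - A$1$1)"
    have ab: "a^2 = A$1$1" "b^2 = 1 - A$1$1" using o A by (auto simp: a_def b_def)
    have "(A$1$2)^2 = (a * b)^2" using o(1) A ab by (simp add: power_mult_distrib)
    then consider "A$1$2 = a * b" | "A$1$2 = - (a * b)" by (auto simp: power2_eq_iff)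
    then have "v \<bullet> (A *v v) = (a * v$1 + b * v$2)^2 \<or> v \<bullet> (A *v v) = (a * v$1 - b * v$2)^2"
    proof cases
      case 1
      then have "v \<bullet> (A *v v) = (a * v$1 + b * v$2)^2"
        using o(4,5) A ab[symmetric] by (simp add: matrix_vector_mult_def inner_vec_def sum_2 power2_eq_square algebra_simps)
      then show ?thesis ..
    next
      case 2
      then have "v \<bullet> (A *v v) = (a * v$1 - b * v$2)^2"
        using o(4,5) A ab[symmetric] by (simp add: matrix_vector_mult_def inner_vec_def sum_2 power2_eq_square algebra_simps)
      then show ?thesis ..
    qed
    then show ?thesis by auto
  qed
  then show "A \<in> bd_K" using A by (simp add: bd_K_def K_set_def)
qed (auto simp: bd_K_def K_set_def)

lemma tensor_square_inner: "tensor_square v \<bullet> tensor_square w = (v \<bullet> w)^2"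
  by (simp add: tensor_square_def inner_vec_def sum_2 power2_eq_square algebra_simps)

lemma norm_tensor_square: "norm v = 1 \<Longrightarrow> norm (tensor_square v) = 1"
  using tensor_square_inner[of v v] by (simp add: norm_eq_1)

lemma tensor_square_dist:
  assumes "norm v = 1" "norm w = 1"
  shows "(norm (tensor_square v - tensor_square w))^2 = 2 * (1 - (v \<bullet> w)^2)"
  using norm_tensor_square[OF assms(1)] norm_tensor_square[OF assms(2)]
  by (simp add: power2_norm_eq_inner inner_diff_left inner_diff_right norm_eq_1 tensor_square_inner[of v w]
      tensor_square_inner[of w v] inner_commute[of w v])

lemma S1_tensor_eq_bd_K: "S1_tensor = bd_K"
proof (intro equalityI subsetI)
  fix A assume "A \<in> S1_tensor"
  then obtain v where v: "norm v = 1" "A = tensor_square v" by (auto simp: S1_tensor_def)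
  then have "v \<bullet> v = 1" by (simp add: norm_eq_1)
  then have "A \<in> sym_mat" "trace A = 1"
    using v by (simp_all add: sym_mat_iff tensor_square_def trace_mat2 inner_vec_def sum_2)
  then show "A \<in> bd_K" using v norm_tensor_square by (simp add: bd_K_iff)
next
  fix A assume A: "A \<in> bd_K"
  note o = bd_K_off_diagonal[of A]
  define a b where "a = sqrt (A$1$1)" and "b = sgn (A$1$2) * sqrt (1 - A$1$1)"
  have s: "\<bar>A$1$2\<bar> = sqrt (A$1$1) * sqrt (1 - A$1$1)"
    using o(1-3) A real_sqrt_abs[of "A$1$2"] by (simp add: bd_K_iff real_sqrt_mult)
  have ab: "a * b = A$1$2"
  proof -
    have "a * b = sgn (A$1$2) * (sqrt (A$1$1) * sqrt (1 - A$1$1))" by (simp add: a_def b_def)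
    also have "\<dots> = A$1$2" unfolding s[symmetric] by (rule sgn_mult_abs)
    finally show ?thesis .
  qed
  have a2: "a * a = A$1$1" using o A by (simp add: a_def bd_K_iff)
  \<comment> \<open>Since sgn 0 = 0, the entry \<open>b\<close> would be wrong for a matrix such as
    diag(0, 1), so the sign is dropped when the off-diagonal entry is zero.\<close>
  define b' where "b' = (if A$1$2 = 0 then sqrt (1 - A$1$1) else b)"
  have "a * b' = A$1$2"
    using ab s by (auto simp: b'_def a_def)
  moreover have "b' * b' = 1 - A$1$1"
    using o A by (auto simp: b'_def b_def bd_K_iff mult_ac sgn_real_def)
  ultimately have "A = tensor_square (vector [a, b'])"
    using o(4,5) A a2 by (simp add: tensor_square_def vec_eq_iff forall_2 bd_K_iff mult.commute)
  moreover have "norm (vector [a, b'] :: real^2) = 1"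
    using a2 \<open>b' * b' = 1 - A$1$1\<close> by (simp add: norm_eq_1 inner_vec_def sum_2)
  ultimately show "A \<in> S1_tensor" by (auto simp: S1_tensor_def)
qed

section \<open>The lattice and its cells\<close>

lemma Basis_axis: "(e :: real^2) \<in> Basis \<Longrightarrow> \<exists>k. e = axis k 1"
  by (auto simp: Basis_vec_def)

lemma norm_le_of_components:
  fixes w :: "real^2"
  assumes w: "\<And>k. \<bar>w $ k\<bar> \<le> r"
  shows "norm w \<le> 2 * r" "(norm w)^2 \<le> 2 * r^2"
proof -
  have "(w $ k)^2 \<le> r^2" for k using power_mono[OF w abs_ge_zero, of k 2] by simp
  from this[of 1] this[of 2] show "(norm w)^2 \<le> 2 * r^2" unfolding norm_sq_vec sum_2 real_norm_def power2_abs by linarith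
  show "norm w \<le> 2 * r" using norm_le_l1_cart[of w] w[of 1] w[of 2] unfolding sum_2 by linarith
qed

lemma square_borel: "{w :: real^2. \<forall>k. \<bar>w $ k\<bar> \<le> r} \<in> sets borel"
  by (intro borel_closed closed_Collect_all closed_Collect_le continuous_intros)

definition lattice :: "(real^2) set" where
  "lattice = {i. \<forall>k. i $ k \<in> \<int>}"

text \<open>Rounding to the nearest lattice index; the floor reproduces the half-open cells of
  \<open>W_cell\<close>, so every point of the plane belongs to exactly one cell.\<close>

definition cell_index :: "real \<Rightarrow> real^2 \<Rightarrow> real^2" where
  "cell_index \<epsilon> x = (\<chi> k. of_int \<lfloor>x $ k / \<epsilon> + 1/2\<rfloor>)"

lemma cell_index_in_lattice: "cell_index \<epsilon> x \<in> lattice"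
  by (simp add: cell_index_def lattice_def)

lemma axis_in_lattice: "axis k 1 \<in> lattice"
  by (simp add: lattice_def axis_def)

lemma lattice_add: "i \<in> lattice \<Longrightarrow> j \<in> lattice \<Longrightarrow> i + j \<in> lattice"
  by (simp add: lattice_def)

lemma lattice_diff: "i \<in> lattice \<Longrightarrow> j \<in> lattice \<Longrightarrow> i - j \<in> lattice"
  by (simp add: lattice_def)

lemma cell_index_eq_iff:
  assumes "0 < \<epsilon>" "i \<in> lattice"
  shows "cell_index \<epsilon> x = i \<longleftrightarrow> (\<forall>k. \<epsilon> * (i $ k - 1/2) \<le> x $ k \<and> x $ k < \<epsilon> * (i $ k + 1/2))"
proof -
  have "of_int \<lfloor>x $ k / \<epsilon> + 1/2\<rfloor> = i $ k \<longleftrightarrow> \<epsilon> * (i $ k - 1/2) \<le> x $ k \<and> x $ k < \<epsilon> * (i $ k + 1/2)" for k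
  proof -
    obtain n :: int where n: "i $ k = of_int n" using assms(2) by (auto simp: lattice_def Ints_def)
    have "of_int \<lfloor>x $ k / \<epsilon> + 1/2\<rfloor> = i $ k \<longleftrightarrow> \<lfloor>x $ k / \<epsilon> + 1/2\<rfloor> = n" by (simp add: n)
    also have "\<dots> \<longleftrightarrow> of_int n \<le> x $ k / \<epsilon> + 1/2 \<and> x $ k / \<epsilon> + 1/2 < of_int n + 1"
      by (rule floor_eq_iff)
    also have "\<dots> \<longleftrightarrow> \<epsilon> * (i $ k - 1/2) \<le> x $ k \<and> x $ k < \<epsilon> * (i $ k + 1/2)"
      using assms(1) by (auto simp: n field_simps)
    finally show ?thesis .
  qed
  then show ?thesis by (simp add: cell_index_def vec_eq_iff)
qed

lemma cell_index_iff_cell: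
  assumes "0 < \<epsilon>" "i \<in> lattice"
  shows "cell_index \<epsilon> x = i \<longleftrightarrow> x \<in> (\<lambda>w. \<epsilon> *\<^sub>R (i + w)) ` W_cell"
proof
  assume *: "cell_index \<epsilon> x = i"
  show "x \<in> (\<lambda>w. \<epsilon> *\<^sub>R (i + w)) ` W_cell"
  proof
    show "x = \<epsilon> *\<^sub>R (i + ((1 / \<epsilon>) *\<^sub>R x - i))" using assms by simp
    show "(1 / \<epsilon>) *\<^sub>R x - i \<in> W_cell"
      using * assms(1) unfolding cell_index_eq_iff[OF assms] W_cell_def by (auto simp: field_simps)
  qed
next
  assume "x \<in> (\<lambda>w. \<epsilon> *\<^sub>R (i + w)) ` W_cell"
  then obtain w where w: "x = \<epsilon> *\<^sub>R (i + w)" "w \<in> W_cell" by auto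
  have "\<epsilon> * (i $ k - 1/2) \<le> x $ k \<and> x $ k < \<epsilon> * (i $ k + 1/2)" for k
  proof -
    have "- 1 / 2 \<le> w $ k" "w $ k < 1 / 2" using w(2) by (auto simp: W_cell_def)
    then show ?thesis using assms(1) by (simp add: w(1))
  qed
  then show "cell_index \<epsilon> x = i" by (simp add: cell_index_eq_iff[OF assms])
qed

lemma cell_index_lattice_point: "0 < \<epsilon> \<Longrightarrow> i \<in> lattice \<Longrightarrow> cell_index \<epsilon> (\<epsilon> *\<^sub>R i) = i"
  by (subst cell_index_eq_iff) auto

lemma cell_index_shift: "0 < \<epsilon> \<Longrightarrow> cell_index \<epsilon> (x + \<epsilon> *\<^sub>R axis k 1) = cell_index \<epsilon> x + axis k 1"
proof -
  assume e: "0 < \<epsilon>"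
  have "\<lfloor>(x $ j + \<epsilon> * axis k 1 $ j) / \<epsilon> + 1/2\<rfloor> = \<lfloor>x $ j / \<epsilon> + 1/2\<rfloor> + (if j = k then 1 else 0)" for j
  proof -
    have "(x $ j + \<epsilon> * axis k 1 $ j) / \<epsilon> + 1/2 = (x $ j / \<epsilon> + 1/2) + of_int (if j = k then 1 else 0)"
      using e by (auto simp: axis_def add_divide_distrib)
    then show ?thesis by (simp only: floor_add_int)
  qed
  then show ?thesis using e by (auto simp: cell_index_def vec_eq_iff axis_def)
qed

lemma cell_index_close:
  assumes "0 < \<epsilon>"
  shows "\<bar>(\<epsilon> *\<^sub>R cell_index \<epsilon> x) $ k - x $ k\<bar> \<le> \<epsilon> / 2" and "norm (\<epsilon> *\<^sub>R cell_index \<epsilon> x - x) \<le> \<epsilon>"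
proof -
  have *: "\<bar>(\<epsilon> *\<^sub>R cell_index \<epsilon> x) $ k - x $ k\<bar> \<le> \<epsilon> / 2" for k
  proof -
    have "\<epsilon> * (cell_index \<epsilon> x $ k - 1/2) \<le> x $ k \<and> x $ k < \<epsilon> * (cell_index \<epsilon> x $ k + 1/2)"
      using cell_index_eq_iff[OF assms cell_index_in_lattice[of \<epsilon> x], of x] by blast
    then have "\<epsilon> * cell_index \<epsilon> x $ k - x $ k \<le> \<epsilon> / 2" "- (\<epsilon> * cell_index \<epsilon> x $ k - x $ k) \<le> \<epsilon> / 2"
      by (simp_all add: algebra_simps)
    then show ?thesis by (intro abs_leI) simp_all
  qed
  then show "\<bar>(\<epsilon> *\<^sub>R cell_index \<epsilon> x) $ k - x $ k\<bar> \<le> \<epsilon> / 2" .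
  show "norm (\<epsilon> *\<^sub>R cell_index \<epsilon> x - x) \<le> \<epsilon>"
    using * norm_le_of_components(1)[of "\<epsilon> *\<^sub>R cell_index \<epsilon> x - x" "\<epsilon> / 2"] by simp
qed

lemma cell_index_measurable [measurable]: "cell_index \<epsilon> \<in> borel_measurable borel"
proof (subst borel_measurable_euclidean_space, intro ballI)
  fix b :: "real^2" assume "b \<in> Basis"
  then obtain k where b: "b = axis k 1" using Basis_axis by blast
  have "(\<lambda>x. x $ k / \<epsilon> + 1/2) \<in> borel_measurable (borel :: (real^2) measure)"
    unfolding divide_inverse by (intro borel_measurable_continuous_onI continuous_intros)
  then have "(\<lambda>x. real_of_int \<lfloor>x $ k / \<epsilon> + 1/2\<rfloor>) \<in> borel_measurable (borel :: (real^2) measure)"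
    by (rule measurable_compose[OF _ borel_measurable_real_floor])
  then show "(\<lambda>x. cell_index \<epsilon> x \<bullet> b) \<in> borel_measurable borel"
    by (simp add: b inner_axis cell_index_def)
qed

text \<open>The cell lies between an open and a closed box of side \<epsilon>.\<close>

lemma cell_measure:
  assumes "0 < \<epsilon>" "i \<in> lattice"
  shows "emeasure lborel {x. cell_index \<epsilon> x = i} = ennreal (\<epsilon>^2)"
proof -
  define a b where "a = \<epsilon> *\<^sub>R (i - (\<chi> k. 1/2))" and "b = \<epsilon> *\<^sub>R (i + (\<chi> k. 1/2))"
  have ba: "(b - a) $ k = \<epsilon>" for k by (simp add: a_def b_def algebra_simps)
  have le: "a \<bullet> e \<le> b \<bullet> e" if e: "e \<in> Basis" for e
  proof -
    obtain k where "e = axis k 1" using Basis_axis[OF e] by blast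
    then show ?thesis using ba[of k] assms(1) by (simp add: inner_axis)
  qed
  have p: "(\<Prod>e\<in>Basis. (b - a) \<bullet> e) = \<epsilon>^2"
  proof -
    have "(\<Prod>e\<in>Basis. (b - a) \<bullet> e) = (\<Prod>e\<in>(Basis :: (real^2) set). \<epsilon>)"
    proof (rule prod.cong[OF refl])
      fix e :: "real^2" assume "e \<in> Basis"
      then obtain k where "e = axis k 1" using Basis_axis by blast
      then show "(b - a) \<bullet> e = \<epsilon>" using ba[of k] by (simp add: inner_axis)
    qed
    then show ?thesis by simp
  qed
  have 1: "box a b \<subseteq> {x. cell_index \<epsilon> x = i}" and 2: "{x. cell_index \<epsilon> x = i} \<subseteq> cbox a b"
    by (auto simp: cell_index_eq_iff[OF assms] mem_box_cart a_def b_def less_imp_le)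
  have m: "{x. cell_index \<epsilon> x = i} \<in> sets lborel" by measurable
  have "ennreal (\<epsilon>^2) \<le> emeasure lborel {x. cell_index \<epsilon> x = i}"
    using emeasure_mono[OF 1 m] le p by (simp add: emeasure_lborel_box)
  moreover have "emeasure lborel {x. cell_index \<epsilon> x = i} \<le> ennreal (\<epsilon>^2)"
    using emeasure_mono[OF 2, of lborel] le p by (simp add: emeasure_lborel_cbox)
  ultimately show ?thesis by (rule antisym[rotated])
qed

lemma cell_step_integral:
  fixes f :: "real^2 \<Rightarrow> real"
  assumes "0 < \<epsilon>" "finite I" "I \<subseteq> lattice"
  shows "integrable lborel (\<lambda>x. indicator I (cell_index \<epsilon> x) * f (cell_index \<epsilon> x))"
    and "(LINT x|lborel. indicator I (cell_index \<epsilon> x) * f (cell_index \<epsilon> x)) = \<epsilon>^2 * (\<Sum>i\<in>I. f i)"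
proof -
  have eq: "indicator I (cell_index \<epsilon> x) * f (cell_index \<epsilon> x) =
      (\<Sum>i\<in>I. f i * indicator {x. cell_index \<epsilon> x = i} x)" for x
  proof (cases "cell_index \<epsilon> x \<in> I")
    case True
    have "(\<Sum>i\<in>I. f i * indicator {x. cell_index \<epsilon> x = i} x) = (\<Sum>i\<in>I. if i = cell_index \<epsilon> x then f i else 0)"
      by (intro sum.cong) (auto simp: indicator_def)
    then show ?thesis using True assms(2) by simp
  next
    case False
    then show ?thesis by (auto simp: indicator_def intro!: sum.neutral)
  qed
  have i: "integrable lborel (\<lambda>x. f i * indicat_real {x. cell_index \<epsilon> x = i} x)" if "i \<in> I" for i
    using cell_measure[OF assms(1), of i] that assms(3) by (auto simp: integrable_indicator_iff)
  show "integrable lborel (\<lambda>x. indicator I (cell_index \<epsilon> x) * f (cell_index \<epsilon> x))"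
    unfolding eq by (intro Bochner_Integration.integrable_sum i)
  have "measure lborel {x. cell_index \<epsilon> x = i} = \<epsilon>^2" if "i \<in> I" for i
    using cell_measure[OF assms(1), of i] that assms(3) by (auto simp: measure_def)
  then show "(LINT x|lborel. indicator I (cell_index \<epsilon> x) * f (cell_index \<epsilon> x)) = \<epsilon>^2 * (\<Sum>i\<in>I. f i)"
  proof -
    have "(LINT x|lborel. (\<Sum>i\<in>I. f i * indicator {x. cell_index \<epsilon> x = i} x)) =
        (\<Sum>i\<in>I. LINT x|lborel. f i * indicator {x. cell_index \<epsilon> x = i} x)"
      by (rule Bochner_Integration.integral_sum[OF i])
    also have "\<dots> = (\<Sum>i\<in>I. f i * \<epsilon>^2)"
      using \<open>\<And>i. i \<in> I \<Longrightarrow> measure lborel {x. cell_index \<epsilon> x = i} = \<epsilon>^2\<close>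
      by (intro sum.cong) auto
    also have "\<dots> = \<epsilon>^2 * (\<Sum>i\<in>I. f i)"
      by (subst mult.commute) (rule sum_distrib_right[symmetric])
    finally show ?thesis unfolding eq .
  qed
qed

lemma Z_eps_lattice: "Z_eps \<epsilon> S \<subseteq> lattice"
  by (auto simp: Z_eps_def lattice_def)

lemma mem_Z_eps: "i \<in> Z_eps \<epsilon> S \<longleftrightarrow> i \<in> lattice \<and> \<epsilon> *\<^sub>R i \<in> S"
  by (auto simp: Z_eps_def lattice_def)

lemma finite_Z_eps:
  assumes "0 < \<epsilon>" "bounded S"
  shows "finite (Z_eps \<epsilon> S)"
proof -
  obtain B where B: "\<And>x. x \<in> S \<Longrightarrow> norm x \<le> B" using assms(2) by (auto simp: bounded_iff)
  define N where "N = \<lceil>B / \<epsilon>\<rceil>"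
  have "Z_eps \<epsilon> S \<subseteq> (\<lambda>(a, b). vector [of_int a, of_int b]) ` ({-N..N} \<times> {-N..N})"
  proof
    fix i assume i: "i \<in> Z_eps \<epsilon> S"
    then have "i $ 1 \<in> \<int>" "i $ 2 \<in> \<int>" by (auto simp: Z_eps_def)
    then obtain a b :: int where ab: "i $ 1 = of_int a" "i $ 2 = of_int b"
      by (elim Ints_cases)
    have "\<bar>i $ k\<bar> \<le> of_int N" for k
    proof -
      have "\<epsilon> * \<bar>i $ k\<bar> = \<bar>(\<epsilon> *\<^sub>R i) $ k\<bar>" using assms(1) by (simp add: abs_mult)
      also have "\<dots> \<le> B" using component_le_norm_cart[of "\<epsilon> *\<^sub>R i" k] B[of "\<epsilon> *\<^sub>R i"] i by (simp add: Z_eps_def)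
      finally have "\<bar>i $ k\<bar> \<le> B / \<epsilon>" using assms(1) by (simp add: field_simps)
      also have "\<dots> \<le> of_int N" by (simp add: N_def)
      finally show ?thesis .
    qed
    from this[of 1] this[of 2] have "\<bar>a\<bar> \<le> N" "\<bar>b\<bar> \<le> N" unfolding ab by linarith+
    then have "(a, b) \<in> {-N..N} \<times> {-N..N}" by auto
    moreover have "i = vector [of_int a, of_int b]" using ab by (simp add: vec_eq_iff forall_2)
    ultimately show "i \<in> (\<lambda>(a, b). vector [of_int a, of_int b]) ` ({-N..N} \<times> {-N..N})" by force
  qed
  then show ?thesis by (rule finite_subset) simp
qed

lemma lattice_unit:
  assumes "i \<in> lattice" "norm i = 1"
  obtains k where "i = axis k 1" | k where "i = - axis k 1"
proof -
  have "i $ 1 \<in> \<int>" "i $ 2 \<in> \<int>" using assms(1) by (auto simp: lattice_def)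
  then obtain a b :: int where ab: "i $ 1 = of_int a" "i $ 2 = of_int b"
    by (elim Ints_cases)
  have "(norm i)^2 = 1" using assms by simp
  then have "(of_int a)^2 + (of_int b)^2 = (1::real)"
    unfolding power2_norm_eq_inner by (simp add: inner_vec_def sum_2 ab power2_eq_square)
  then have s: "a^2 + b^2 = 1" by (simp flip: of_int_power of_int_add)
  have "a^2 \<le> 1" "b^2 \<le> 1" using s zero_le_power2[of a] zero_le_power2[of b] by linarith+
  then have "\<bar>a\<bar> \<le> 1" "\<bar>b\<bar> \<le> 1" by (simp_all add: abs_square_le_1)
  then have "a \<in> {-1, 0, 1}" "b \<in> {-1, 0, 1}" by auto
  then consider "a = 1" "b = 0" | "a = -1" "b = 0" | "a = 0" "b = 1" | "a = 0" "b = -1"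
    using s by auto
  then show ?thesis
  proof cases
    case 1
    then show ?thesis using ab by (intro that(1)[of 1]) (simp add: vec_eq_iff forall_2 axis_def)
  next
    case 2
    then show ?thesis using ab by (intro that(2)[of 1]) (simp add: vec_eq_iff forall_2 axis_def)
  next
    case 3
    then show ?thesis using ab by (intro that(1)[of 2]) (simp add: vec_eq_iff forall_2 axis_def)
  next
    case 4
    then show ?thesis using ab by (intro that(2)[of 2]) (simp add: vec_eq_iff forall_2 axis_def)
  qed
qed

text \<open>Every ordered pair of neighbours is (i, i + e) or (i + e, i) for a unique coordinate
  vector e; the two families are disjoint because two coordinate vectors never add up to zero. The
  factor 2 is the double counting of bonds.\<close>

lemma bond_sum:
  fixes g :: "real^2 \<Rightarrow> real^2 \<Rightarrow> real"
  assumes Z: "finite Z" "Z \<subseteq> lattice" and sym: "\<And>i j. g i j = g j i"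
  shows "(\<Sum>(i, j)\<in>{(i, j). i \<in> Z \<and> j \<in> Z \<and> norm (i - j) = 1}. g i j) =
    2 * (\<Sum>k\<in>UNIV. \<Sum>i\<in>{i \<in> Z. i + axis k 1 \<in> Z}. g i (i + axis k 1))"
proof -
  define P where "P = (SIGMA k:(UNIV::2 set). {i \<in> Z. i + axis k 1 \<in> Z})"
  define f1 f2 :: "2 \<times> (real^2) \<Rightarrow> (real^2) \<times> (real^2)" where
    "f1 = (\<lambda>(k, i). (i, i + axis k 1))" and "f2 = (\<lambda>(k, i). (i + axis k 1, i))"
  have ax: "axis k (1::real) = axis l 1 \<longleftrightarrow> k = l" for k l :: 2 by (simp add: axis_eq_axis)
  have ax2: "axis k (1::real) + axis l 1 \<noteq> 0" for k l :: 2
  proof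
    assume "axis k (1::real) + axis l 1 = 0"
    then have "(axis k (1::real) + axis l 1) $ k = 0" by simp
    then show False by (simp add: axis_def split: if_splits)
  qed
  have fin: "finite P" using Z by (auto simp: P_def)
  have inj: "inj_on f1 P" "inj_on f2 P" by (auto simp: inj_on_def f1_def f2_def ax)
  have disj: "f1 ` P \<inter> f2 ` P = {}"
    by (auto simp: f1_def f2_def ax2 add.assoc)
  have un: "{(i, j). i \<in> Z \<and> j \<in> Z \<and> norm (i - j) = 1} = f1 ` P \<union> f2 ` P"
  proof (intro equalityI subsetI)
    fix p assume "p \<in> {(i, j). i \<in> Z \<and> j \<in> Z \<and> norm (i - j) = 1}"
    then obtain i j where p: "p = (i, j)" "i \<in> Z" "j \<in> Z" "norm (i - j) = 1" by auto
    then have "i - j \<in> lattice" using Z by (auto intro: lattice_diff)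
    then show "p \<in> f1 ` P \<union> f2 ` P"
    proof (rule lattice_unit[OF _ p(4)])
      fix k assume "i - j = axis k 1"
      then have "i = j + axis k 1" by (simp add: algebra_simps)
      then show ?thesis using p by (auto simp: f2_def P_def intro!: image_eqI[of _ _ "(k, j)"])
    next
      fix k assume "i - j = - axis k 1"
      then have "j = i + axis k 1" by (simp add: algebra_simps)
      then show ?thesis using p by (auto simp: f1_def P_def intro!: image_eqI[of _ _ "(k, i)"])
    qed
  next
    fix p assume "p \<in> f1 ` P \<union> f2 ` P"
    then show "p \<in> {(i, j). i \<in> Z \<and> j \<in> Z \<and> norm (i - j) = 1}"
      by (auto simp: f1_def f2_def P_def norm_axis_1)
  qed
  have "(\<Sum>(i, j)\<in>{(i, j). i \<in> Z \<and> j \<in> Z \<and> norm (i - j) = 1}. g i j) =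
      (\<Sum>(i, j)\<in>f1 ` P. g i j) + (\<Sum>(i, j)\<in>f2 ` P. g i j)"
    unfolding un by (rule sum.union_disjoint) (use fin disj in auto)
  also have "\<dots> = (\<Sum>(k, i)\<in>P. g i (i + axis k 1)) + (\<Sum>(k, i)\<in>P. g (i + axis k 1) i)"
    by (simp only: sum.reindex[OF inj(1)] sum.reindex[OF inj(2)] o_def)
       (simp add: f1_def f2_def case_prod_unfold)
  also have "\<dots> = 2 * (\<Sum>(k, i)\<in>P. g i (i + axis k 1))" by (simp add: sym)
  also have "(\<Sum>(k, i)\<in>P. g i (i + axis k 1)) = (\<Sum>k\<in>UNIV. \<Sum>i\<in>{i \<in> Z. i + axis k 1 \<in> Z}. g i (i + axis k 1))"
    unfolding P_def using Z by (subst sum.Sigma) auto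
  finally show ?thesis .
qed

section \<open>Estimates for lattice functions\<close>

lemma norm_int_telescope_sq_le:
  fixes a :: "int \<Rightarrow> 'b::real_normed_vector"
  assumes "p \<le> r"
  shows "(norm (a r - a p))^2 \<le> real_of_int (r - p) * (\<Sum>l\<in>{p..<r}. (norm (a (l + 1) - a l))^2)"
proof -
  have "a r - a p = (\<Sum>l\<in>{p..<r}. a (l + 1) - a l)"
    using assms
  proof (induction r rule: int_ge_induct)
    case (step r)
    have "{p..<r + 1} = insert r {p..<r}" using step by auto
    then show ?case using step.IH[symmetric] by simp
  qed simp
  then have "norm (a r - a p) \<le> (\<Sum>l\<in>{p..<r}. norm (a (l + 1) - a l))"
    by (simp add: norm_sum)
  then have "(norm (a r - a p))^2 \<le> (\<Sum>l\<in>{p..<r}. norm (a (l + 1) - a l))^2"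
    by (intro power_mono) auto
  also have "\<dots> \<le> (\<Sum>l\<in>{p..<r}. (norm (a (l + 1) - a l))^2) * card {p..<r}"
    by (rule sum_squared_le_sum_of_squares) 
  also have "real (card {p..<r}) = real_of_int (r - p)" using assms by simp
  finally show ?thesis by (simp add: mult.commute)
qed

text \<open>The window from -M to M does not depend on \<open>m\<close>; this matters because the
  number of cells crossed by a fixed shift varies with the starting point.\<close>

lemma norm_int_difference_sq_le:
  fixes a :: "int \<Rightarrow> 'b::real_normed_vector"
  assumes "\<bar>m\<bar> \<le> M"
  shows "(norm (a m - a 0))^2 \<le> real_of_int M * (\<Sum>l\<in>{-M..<M}. (norm (a (l + 1) - a l))^2)"
proof -
  have "0 \<le> M" using assms by linarith
  have *: "(norm (a m - a 0))^2 \<le> real_of_int \<bar>m\<bar> * (\<Sum>l\<in>{min 0 m..<max 0 m}. (norm (a (l + 1) - a l))^2)"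
    using norm_int_telescope_sq_le[of 0 m a] norm_int_telescope_sq_le[of m 0 a]
    by (cases "0 \<le> m") (auto simp: norm_minus_commute)
  also have "\<dots> \<le> real_of_int M * (\<Sum>l\<in>{-M..<M}. (norm (a (l + 1) - a l))^2)"
    using assms \<open>0 \<le> M\<close> by (intro mult_mono sum_mono2 sum_nonneg) auto
  finally show ?thesis .
qed

lemma cell_index_shift_int:
  assumes "0 < \<epsilon>"
  shows "cell_index \<epsilon> (x + (\<epsilon> * of_int l) *\<^sub>R axis k 1) = cell_index \<epsilon> x + of_int l *\<^sub>R axis k 1"
proof -
  have "\<lfloor>(x $ j + \<epsilon> * of_int l * axis k 1 $ j) / \<epsilon> + 1/2\<rfloor> = \<lfloor>x $ j / \<epsilon> + 1/2\<rfloor> + (if j = k then l else 0)" for j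
  proof -
    have "(x $ j + \<epsilon> * of_int l * axis k 1 $ j) / \<epsilon> + 1/2 = (x $ j / \<epsilon> + 1/2) + of_int (if j = k then l else 0)"
      using assms by (auto simp: axis_def add_divide_distrib)
    then show ?thesis by (simp only: floor_add_int)
  qed
  then show ?thesis by (auto simp: cell_index_def vec_eq_iff axis_def)
qed

text \<open>\<open>F\<close> is an arbitrary function on the plane, but it vanishes off the finite
  set \<open>Z\<close>, so only finitely many indicators contribute.\<close>

lemma step_function_measurable:
  fixes F :: "real^2 \<Rightarrow> 'b::euclidean_space"
  assumes "finite Z" "\<And>i. i \<notin> Z \<Longrightarrow> F i = 0"
  shows "(\<lambda>x. F (cell_index \<epsilon> x + v)) \<in> borel_measurable borel"
proof -
  have "F (cell_index \<epsilon> x + v) = (\<Sum>i\<in>Z. indicator {x. cell_index \<epsilon> x = i - v} x *\<^sub>R F i)" for x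
  proof -
    have "(\<Sum>i\<in>Z. indicator {x. cell_index \<epsilon> x = i - v} x *\<^sub>R F i) =
        (\<Sum>i\<in>Z. if i = cell_index \<epsilon> x + v then F i else 0)"
      by (intro sum.cong) (auto simp: indicator_def)
    then show ?thesis using assms by simp
  qed
  then show ?thesis by (simp only:) measurable
qed

lemma lattice_difference_integral_le:
  fixes F :: "real^2 \<Rightarrow> 'b::euclidean_space"
  assumes "0 < \<epsilon>" "finite Z" "Z \<subseteq> lattice"
    and A: "\<And>x. x \<in> A \<Longrightarrow> cell_index \<epsilon> x \<in> Z \<and> cell_index \<epsilon> x + axis k 1 \<in> Z"
  shows "(\<integral>\<^sup>+x. indicator A x * ennreal ((norm (F (cell_index \<epsilon> x + axis k 1) - F (cell_index \<epsilon> x)))^2) \<partial>lborel)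
    \<le> ennreal (\<epsilon>^2 * (\<Sum>i\<in>{i \<in> Z. i + axis k 1 \<in> Z}. (norm (F (i + axis k 1) - F i))^2))"
proof -
  define I where "I = {i \<in> Z. i + axis k 1 \<in> Z}"
  define f where "f i = (norm (F (i + axis k 1) - F i))^2" for i
  have I: "finite I" "I \<subseteq> lattice" using assms by (auto simp: I_def)
  have "(\<integral>\<^sup>+x. indicator A x * ennreal (f (cell_index \<epsilon> x)) \<partial>lborel) \<le>
      (\<integral>\<^sup>+x. ennreal (indicator I (cell_index \<epsilon> x) * f (cell_index \<epsilon> x)) \<partial>lborel)"
    by (intro nn_integral_mono) (use A in \<open>auto simp: indicator_def I_def\<close>)
  also have "\<dots> = ennreal (LINT x|lborel. indicator I (cell_index \<epsilon> x) * f (cell_index \<epsilon> x))"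
    by (intro nn_integral_eq_integral cell_step_integral(1)[OF assms(1) I]) (auto simp: f_def)
  also have "\<dots> = ennreal (\<epsilon>^2 * (\<Sum>i\<in>I. f i))"
    by (simp add: cell_step_integral(2)[OF assms(1) I])
  finally show ?thesis by (simp add: f_def I_def)
qed

text \<open>A shift by \<open>t\<close> changes the cell index by at most M, which is about
  |t|/\<epsilon>. Telescoping with Cauchy-Schwarz costs a factor M, and each of the 2M unit steps in
  the window contributes \<epsilon>^2 times the lattice energy; as \<epsilon> M \<le> |t| + 2
  \<epsilon>, the powers of \<epsilon> disappear. The margin around \<open>A\<close> guarantees that
  all cells visited belong to \<open>Z\<close>.\<close>

lemma lattice_line_translation_le:
  fixes F :: "real^2 \<Rightarrow> 'b::euclidean_space"
  assumes e: "0 < \<epsilon>" and Z: "finite Z" "Z \<subseteq> lattice" and F0: "\<And>i. i \<notin> Z \<Longrightarrow> F i = 0"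
    and [measurable]: "A \<in> sets borel"
    and A: "\<And>y z. y \<in> A \<Longrightarrow> norm (z - y) \<le> \<bar>t\<bar> + 3 * \<epsilon> \<Longrightarrow> cell_index \<epsilon> z \<in> Z"
  shows "(\<integral>\<^sup>+y. indicator A y * ennreal ((norm (F (cell_index \<epsilon> (y + t *\<^sub>R axis k 1)) - F (cell_index \<epsilon> y)))^2) \<partial>lborel)
    \<le> ennreal (2 * (\<bar>t\<bar> + 2 * \<epsilon>)^2 * (\<Sum>i\<in>{i \<in> Z. i + axis k 1 \<in> Z}. (norm (F (i + axis k 1) - F i))^2))"
proof -
  define e1 where "e1 = (axis k 1 :: real^2)"
  define E where "E = (\<Sum>i\<in>{i \<in> Z. i + e1 \<in> Z}. (norm (F (i + e1) - F i))^2)"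
  have E0: "0 \<le> E" by (auto simp: E_def intro: sum_nonneg)
  define M where "M = \<lceil>\<bar>t\<bar> / \<epsilon>\<rceil> + 1"
  have M0: "0 < M" using divide_nonneg_pos[OF abs_ge_zero[of t] e] unfolding M_def by linarith
  have "real_of_int M \<le> \<bar>t\<bar> / \<epsilon> + 2" unfolding M_def by linarith
  then have M: "\<epsilon> * real_of_int M \<le> \<bar>t\<bar> + 2 * \<epsilon>" using e by (simp add: field_simps)
  have mM: "\<exists>m. cell_index \<epsilon> (y + t *\<^sub>R e1) = cell_index \<epsilon> y + of_int m *\<^sub>R e1 \<and> \<bar>m\<bar> \<le> M" for y
  proof (intro exI conjI)
    define m where "m = \<lfloor>(y $ k + t) / \<epsilon> + 1/2\<rfloor> - \<lfloor>y $ k / \<epsilon> + 1/2\<rfloor>"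
    show "cell_index \<epsilon> (y + t *\<^sub>R e1) = cell_index \<epsilon> y + of_int m *\<^sub>R e1"
      by (simp add: cell_index_def vec_eq_iff e1_def axis_def m_def)
    have "(y $ k + t) / \<epsilon> = y $ k / \<epsilon> + t / \<epsilon>" by (simp add: add_divide_distrib)
    moreover have "\<bar>t / \<epsilon>\<bar> \<le> of_int \<lceil>\<bar>t\<bar> / \<epsilon>\<rceil>" using e by (simp add: abs_divide)
    ultimately show "\<bar>m\<bar> \<le> M" unfolding m_def M_def by linarith
  qed
  have pw: "(norm (F (cell_index \<epsilon> (y + t *\<^sub>R e1)) - F (cell_index \<epsilon> y)))^2 \<le>
    real_of_int M * (\<Sum>l\<in>{-M..<M}. (norm (F (cell_index \<epsilon> y + of_int (l + 1) *\<^sub>R e1) - F (cell_index \<epsilon> y + of_int l *\<^sub>R e1)))^2)" for y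
  proof -
    obtain m where m: "cell_index \<epsilon> (y + t *\<^sub>R e1) = cell_index \<epsilon> y + of_int m *\<^sub>R e1" "\<bar>m\<bar> \<le> M"
      using mM by blast
    show ?thesis
      using norm_int_difference_sq_le[OF m(2), of "\<lambda>l. F (cell_index \<epsilon> y + of_int l *\<^sub>R e1)"] m(1) by simp
  qed
  define g where "g l y = indicator A y * ennreal ((norm (F (cell_index \<epsilon> y + of_int (l + 1) *\<^sub>R e1) - F (cell_index \<epsilon> y + of_int l *\<^sub>R e1)))^2)"
    for l y
  have [measurable]: "(\<lambda>x. F (cell_index \<epsilon> x + v)) \<in> borel_measurable borel" for v
    by (rule step_function_measurable[OF Z(1) F0])
  have gm[measurable]: "g l \<in> borel_measurable borel" for l unfolding g_def by measurable
  have gl: "(\<integral>\<^sup>+y. g l y \<partial>lborel) \<le> ennreal (\<epsilon>^2 * E)" if l: "l \<in> {-M..<M}" for l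
  proof -
    \<comment> \<open>Translating by l cells turns the l-th unit step into the unit step at the
      current cell.\<close>
    define v where "v = (\<epsilon> * of_int l) *\<^sub>R e1"
    have "(\<integral>\<^sup>+y. g l y \<partial>lborel) = (\<integral>\<^sup>+x. g l (- v + x) \<partial>lborel)"
      by (rule nn_integral_lborel_translate[symmetric]) measurable
    also have "\<dots> = (\<integral>\<^sup>+x. indicator {x. - v + x \<in> A} x * ennreal ((norm (F (cell_index \<epsilon> x + e1) - F (cell_index \<epsilon> x)))^2) \<partial>lborel)"
    proof (rule nn_integral_cong)
      fix x
      have "cell_index \<epsilon> x = cell_index \<epsilon> (- v + x) + of_int l *\<^sub>R e1"
        using cell_index_shift_int[OF e, of "- v + x" l k] by (simp add: v_def e1_def)
      then show "g l (- v + x) = indicator {x. - v + x \<in> A} x * ennreal ((norm (F (cell_index \<epsilon> x + e1) - F (cell_index \<epsilon> x)))^2)"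
        by (simp add: g_def indicator_def algebra_simps)
    qed
    also have "\<dots> \<le> ennreal (\<epsilon>^2 * E)"
      unfolding E_def e1_def
    proof (rule lattice_difference_integral_le[OF e Z])
      fix x assume x: "x \<in> {x. - v + x \<in> A}"
      have *: "norm ((\<epsilon> * of_int j) *\<^sub>R e1) \<le> \<bar>t\<bar> + 3 * \<epsilon>" if "\<bar>j\<bar> \<le> M" for j
      proof -
        have "\<bar>real_of_int j\<bar> \<le> real_of_int M" using that by linarith
        then have "\<epsilon> * \<bar>real_of_int j\<bar> \<le> \<epsilon> * real_of_int M" using e by (intro mult_left_mono) auto
        then have "\<epsilon> * \<bar>real_of_int j\<bar> \<le> \<bar>t\<bar> + 3 * \<epsilon>" using M e by linarith
        then show ?thesis using e by (simp add: e1_def norm_axis_1 abs_mult)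
      qed
      have "cell_index \<epsilon> x \<in> Z"
        using A[of "- v + x" x] x *[of l] l by (auto simp: v_def)
      moreover have "cell_index \<epsilon> (x + \<epsilon> *\<^sub>R e1) \<in> Z"
      proof (rule A[of "- v + x"])
        have "(x + \<epsilon> *\<^sub>R e1) - (- v + x) = (\<epsilon> * of_int (l + 1)) *\<^sub>R e1" by (simp add: v_def algebra_simps)
        then show "norm ((x + \<epsilon> *\<^sub>R e1) - (- v + x)) \<le> \<bar>t\<bar> + 3 * \<epsilon>" using *[of "l + 1"] l by auto
      qed (use x in auto)
      ultimately show "cell_index \<epsilon> x \<in> Z \<and> cell_index \<epsilon> x + axis k 1 \<in> Z"
        using cell_index_shift[OF e, of x k] by (simp add: e1_def)
    qed
    finally show ?thesis .
  qed
  have "(\<integral>\<^sup>+y. indicator A y * ennreal ((norm (F (cell_index \<epsilon> (y + t *\<^sub>R e1)) - F (cell_index \<epsilon> y)))^2) \<partial>lborel)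
    \<le> (\<integral>\<^sup>+y. ennreal (real_of_int M) * (\<Sum>l\<in>{-M..<M}. g l y) \<partial>lborel)"
  proof (rule nn_integral_mono)
    fix y
    show "indicator A y * ennreal ((norm (F (cell_index \<epsilon> (y + t *\<^sub>R e1)) - F (cell_index \<epsilon> y)))^2)
      \<le> ennreal (real_of_int M) * (\<Sum>l\<in>{-M..<M}. g l y)"
      using ennreal_leI[OF pw[of y]] M0
      by (cases "y \<in> A") (auto simp: g_def ennreal_mult sum_nonneg sum_ennreal)
  qed
  also have "\<dots> = ennreal (real_of_int M) * (\<Sum>l\<in>{-M..<M}. (\<integral>\<^sup>+y. g l y \<partial>lborel))"
    by (subst nn_integral_cmult) (auto simp: nn_integral_sum)
  also have "\<dots> \<le> ennreal (real_of_int M) * (\<Sum>l\<in>{-M..<M}. ennreal (\<epsilon>^2 * E))"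
    by (intro mult_left_mono sum_mono gl) auto
  also have "\<dots> = ennreal (real_of_int M * (2 * real_of_int M * (\<epsilon>^2 * E)))"
  proof -
    have "(\<Sum>l\<in>{-M..<M}. ennreal (\<epsilon>^2 * E)) = ennreal (\<Sum>l\<in>{-M..<M}. \<epsilon>^2 * E)"
      using E0 by (intro sum_ennreal) auto
    also have "(\<Sum>l\<in>{-M..<M}. \<epsilon>^2 * E) = 2 * real_of_int M * (\<epsilon>^2 * E)" using M0 by simp
    finally show ?thesis using M0 E0 by (simp only:) (rule ennreal_mult[symmetric], auto)
  qed
  also have "\<dots> \<le> ennreal (2 * (\<bar>t\<bar> + 2 * \<epsilon>)^2 * E)"
  proof (rule ennreal_leI)
    have "(\<epsilon> * real_of_int M)^2 \<le> (\<bar>t\<bar> + 2 * \<epsilon>)^2" using M M0 e by (intro power_mono) auto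
    then have "2 * (\<epsilon> * real_of_int M)^2 * E \<le> 2 * (\<bar>t\<bar> + 2 * \<epsilon>)^2 * E"
      using E0 by (intro mult_right_mono) auto
    then show "real_of_int M * (2 * real_of_int M * (\<epsilon>^2 * E)) \<le> 2 * (\<bar>t\<bar> + 2 * \<epsilon>)^2 * E"
      by (simp add: power2_eq_square mult_ac)
  qed
  finally show ?thesis by (simp add: E_def e1_def)
qed

text \<open>The shift is split into one along each axis; squaring a sum of two differences costs
  another factor 2, which makes 4 out of 2.\<close>

lemma lattice_translation_le:
  fixes F :: "real^2 \<Rightarrow> 'b::euclidean_space"
  assumes e: "0 < \<epsilon>" and Z: "finite Z" "Z \<subseteq> lattice" and F0: "\<And>i. i \<notin> Z \<Longrightarrow> F i = 0"
    and [measurable]: "A \<in> sets borel" and w: "\<And>k. \<bar>w $ k\<bar> \<le> \<delta>"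
    and A: "\<And>y z. y \<in> A \<Longrightarrow> norm (z - y) \<le> 2 * \<delta> + 3 * \<epsilon> \<Longrightarrow> cell_index \<epsilon> z \<in> Z"
  shows "(\<integral>\<^sup>+y. indicator A y * ennreal ((norm (F (cell_index \<epsilon> (y + w)) - F (cell_index \<epsilon> y)))^2) \<partial>lborel)
    \<le> ennreal (4 * (\<delta> + 2 * \<epsilon>)^2 * (\<Sum>k\<in>UNIV. \<Sum>i\<in>{i \<in> Z. i + axis k 1 \<in> Z}. (norm (F (i + axis k 1) - F i))^2))"
proof -
  define E where "E k = (\<Sum>i\<in>{i \<in> Z. i + axis k 1 \<in> Z}. (norm (F (i + axis k 1) - F i))^2)" for k
  have E0: "0 \<le> E k" for k by (auto simp: E_def intro: sum_nonneg)
  define S where "S y = F (cell_index \<epsilon> y)" for y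
  have Sm[measurable]: "S \<in> borel_measurable borel"
    using step_function_measurable[OF Z(1) F0, where \<epsilon> = \<epsilon> and v = 0] by (simp add: S_def[abs_def])
  have d0: "0 \<le> \<delta>" using w[of 1] by linarith
  define v :: "real^2" where "v = w $ 1 *\<^sub>R axis 1 1"
  have nv: "norm v \<le> \<delta>" using w[of 1] by (simp add: v_def norm_axis_1)
  have vw: "y + w = y + v + w $ 2 *\<^sub>R axis 2 1" for y
    by (simp add: v_def vec_eq_iff forall_2 axis_def)
  define A' where "A' = {x. x - v \<in> A}"
  have [measurable]: "A' \<in> sets borel" unfolding A'_def by measurable
  have T1: "(\<integral>\<^sup>+y. indicator A y * ennreal ((norm (S (y + v) - S y))^2) \<partial>lborel) \<le> ennreal (2 * (\<bar>w $ 1\<bar> + 2 * \<epsilon>)^2 * E 1)"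
    unfolding S_def v_def E_def
    by (rule lattice_line_translation_le[OF e Z F0]) (use A w[of 1] d0 in \<open>auto intro: order_trans\<close>)
  have "(\<integral>\<^sup>+y. indicator A y * ennreal ((norm (S (y + w) - S (y + v)))^2) \<partial>lborel) =
      (\<integral>\<^sup>+y. indicator A' (v + y) * ennreal ((norm (S ((v + y) + w $ 2 *\<^sub>R axis 2 1) - S (v + y)))^2) \<partial>lborel)"
    by (intro nn_integral_cong) (simp add: A'_def vw indicator_def algebra_simps)
  also have "\<dots> = (\<integral>\<^sup>+y. indicator A' y * ennreal ((norm (S (y + w $ 2 *\<^sub>R axis 2 1) - S y))^2) \<partial>lborel)"
    by (rule nn_integral_lborel_translate) measurable
  also have "\<dots> \<le> ennreal (2 * (\<bar>w $ 2\<bar> + 2 * \<epsilon>)^2 * E 2)"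
    unfolding S_def E_def
  proof (rule lattice_line_translation_le[OF e Z F0])
    fix y z assume yz: "y \<in> A'" "norm (z - y) \<le> \<bar>w $ 2\<bar> + 3 * \<epsilon>"
    show "cell_index \<epsilon> z \<in> Z"
    proof (rule A[of "y - v"])
      have "norm (z - (y - v)) \<le> norm (z - y) + norm v"
        using norm_triangle_ineq[of "z - y" v] by (simp add: algebra_simps)
      then show "norm (z - (y - v)) \<le> 2 * \<delta> + 3 * \<epsilon>" using yz(2) nv w[of 2] by linarith
    qed (use yz in \<open>simp add: A'_def\<close>)
  qed auto
  finally have T2: "(\<integral>\<^sup>+y. indicator A y * ennreal ((norm (S (y + w) - S (y + v)))^2) \<partial>lborel) \<le> ennreal (2 * (\<bar>w $ 2\<bar> + 2 * \<epsilon>)^2 * E 2)" .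
  have "(\<integral>\<^sup>+y. indicator A y * ennreal ((norm (S (y + w) - S y))^2) \<partial>lborel) \<le>
    (\<integral>\<^sup>+y. 2 * (indicator A y * ennreal ((norm (S (y + w) - S (y + v)))^2)) + 2 * (indicator A y * ennreal ((norm (S (y + v) - S y))^2)) \<partial>lborel)"
  proof (rule nn_integral_mono)
    fix y
    define a b where "a = S (y + w) - S (y + v)" and "b = S (y + v) - S y"
    have "(norm (a + b))^2 \<le> 2 * (norm a)^2 + 2 * (norm b)^2"
      using norm_triangle_ineq[of a b] sum_squares_bound[of "norm a" "norm b"]
        power_mono[OF norm_triangle_ineq[of a b], of 2] by (simp add: power2_sum)
    then have "ennreal ((norm (a + b))^2) \<le> 2 * ennreal ((norm a)^2) + 2 * ennreal ((norm b)^2)"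
      by (simp add: ennreal_mult'[symmetric] ennreal_plus[symmetric] del: ennreal_plus flip: ennreal_numeral)
    then show "indicator A y * ennreal ((norm (S (y + w) - S y))^2) \<le>
      2 * (indicator A y * ennreal ((norm (S (y + w) - S (y + v)))^2)) + 2 * (indicator A y * ennreal ((norm (S (y + v) - S y))^2))"
      by (auto simp: a_def b_def indicator_def)
  qed
  also have "\<dots> = 2 * (\<integral>\<^sup>+y. indicator A y * ennreal ((norm (S (y + w) - S (y + v)))^2) \<partial>lborel)
    + 2 * (\<integral>\<^sup>+y. indicator A y * ennreal ((norm (S (y + v) - S y))^2) \<partial>lborel)"
    by (simp add: nn_integral_add nn_integral_cmult)
  also have "\<dots> \<le> 2 * ennreal (2 * (\<bar>w $ 2\<bar> + 2 * \<epsilon>)^2 * E 2) + 2 * ennreal (2 * (\<bar>w $ 1\<bar> + 2 * \<epsilon>)^2 * E 1)"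
    by (intro add_mono mult_left_mono T1 T2) auto
  also have "\<dots> = ennreal (4 * (\<bar>w $ 2\<bar> + 2 * \<epsilon>)^2 * E 2 + 4 * (\<bar>w $ 1\<bar> + 2 * \<epsilon>)^2 * E 1)"
    using E0 by (simp add: ennreal_mult'[symmetric] ennreal_plus[symmetric] mult.assoc[symmetric] del: ennreal_plus flip: ennreal_numeral)
  also have "\<dots> \<le> ennreal (4 * (\<delta> + 2 * \<epsilon>)^2 * (\<Sum>k\<in>UNIV. E k))"
  proof (rule ennreal_leI)
    have "4 * (\<bar>w $ k\<bar> + 2 * \<epsilon>)^2 * E k \<le> 4 * (\<delta> + 2 * \<epsilon>)^2 * E k" for k
      using w[of k] e E0[of k] by (intro mult_right_mono mult_left_mono power_mono) auto
    from this[of 1] this[of 2]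
    show "4 * (\<bar>w $ 2\<bar> + 2 * \<epsilon>)^2 * E 2 + 4 * (\<bar>w $ 1\<bar> + 2 * \<epsilon>)^2 * E 1 \<le> 4 * (\<delta> + 2 * \<epsilon>)^2 * (\<Sum>k\<in>UNIV. E k)"
      by (simp add: sum_2 distrib_left)
  qed
  finally show ?thesis by (simp add: S_def E_def)
qed

section \<open>The discrete energy controls differences of neighbouring values\<close>

text \<open>The hypothesis on \<open>h\<close> gives \<gamma>/4 times the squared difference per
  bond, because the squared distance of tensor squares is 2 (1 - x^2); counting bonds twice makes
  this \<gamma>/2 times the sum.\<close>

lemma spin_energy_ge:
  assumes "0 < \<epsilon>" "bounded S" "0 < \<gamma>" and h: "\<And>x. x \<in> {0..1} \<Longrightarrow> h x - h 1 \<ge> \<gamma> / 2 * (1 - x^2)"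
    and inf: "(INF x\<in>{0..1}. h x) = h 1" and u: "\<And>i. i \<in> Z_eps \<epsilon> S \<Longrightarrow> norm (u i) = 1"
    and c: "spin_energy h S \<epsilon> u \<le> c"
  shows "(\<Sum>k\<in>UNIV. \<Sum>i\<in>{i \<in> Z_eps \<epsilon> S. i + axis k 1 \<in> Z_eps \<epsilon> S}.
    (norm (tensor_square (u (i + axis k 1)) - tensor_square (u i)))^2) \<le> 2 * c / \<gamma>"
proof -
  let ?Z = "Z_eps \<epsilon> S"
  have "(\<gamma> / 4) * (norm (tensor_square (u j) - tensor_square (u i)))^2 \<le> h \<bar>u i \<bullet> u j\<bar> - h 1" if "i \<in> ?Z" "j \<in> ?Z" for i j
  proof -
    have "\<bar>u i \<bullet> u j\<bar> \<in> {0..1}" using Cauchy_Schwarz_ineq2[of "u i" "u j"] u that by simp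
    from h[OF this] show ?thesis
      unfolding tensor_square_dist[OF u[OF that(2)] u[OF that(1)]] inner_commute[of "u j"] by (simp add: algebra_simps)
  qed
  then have "2 * (\<Sum>k\<in>UNIV. \<Sum>i\<in>{i \<in> ?Z. i + axis k 1 \<in> ?Z}. (\<gamma> / 4) * (norm (tensor_square (u (i + axis k 1)) - tensor_square (u i)))^2)
      \<le> 2 * (\<Sum>k\<in>UNIV. \<Sum>i\<in>{i \<in> ?Z. i + axis k 1 \<in> ?Z}. h \<bar>u i \<bullet> u (i + axis k 1)\<bar> - h 1)"
    by (intro mult_left_mono sum_mono) auto
  also have "\<dots> = spin_energy h S \<epsilon> u"
    unfolding spin_energy_def inf
    by (rule bond_sum[symmetric]) (use finite_Z_eps[OF assms(1,2)] Z_eps_lattice in \<open>auto simp: inner_commute\<close>)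
  also note c
  finally have "2 * ((\<gamma> / 4) * (\<Sum>k\<in>UNIV. \<Sum>i\<in>{i \<in> ?Z. i + axis k 1 \<in> ?Z}.
      (norm (tensor_square (u (i + axis k 1)) - tensor_square (u i)))^2)) \<le> c"
    by (simp only: sum_distrib_left)
  then show ?thesis using \<open>0 < \<gamma>\<close> by (simp add: field_simps)
qed

section \<open>Weak limits of lattice functions with bounded energy\<close>

text \<open>\<open>F\<close> holds the lattice values, extended by zero so that the step function
  has finite support. On cells whose centre lies outside \<open>S\<close> nothing ties
  \<open>P\<close> to \<open>F\<close>; there only membership in \<open>bd_K\<close> is known, which
  is all that \<open>C_eps\<close> provides.\<close>

definition lattice_approx ::
    "(real^2) set \<Rightarrow> real \<Rightarrow> real \<Rightarrow> (real^2 \<Rightarrow> real^2^2) \<Rightarrow> (real^2 \<Rightarrow> real^2^2) \<Rightarrow> bool" where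
  "lattice_approx S C \<epsilon> P F \<longleftrightarrow> 0 < \<epsilon> \<and> P \<in> Linf_sym S \<and>
     (\<forall>i. i \<notin> Z_eps \<epsilon> S \<longrightarrow> F i = 0) \<and> (\<forall>i\<in>Z_eps \<epsilon> S. F i \<in> bd_K) \<and>
     (AE x in lebesgue_on S. P x \<in> bd_K \<and> (cell_index \<epsilon> x \<in> Z_eps \<epsilon> S \<longrightarrow> P x = F (cell_index \<epsilon> x))) \<and>
     (\<Sum>k\<in>UNIV. \<Sum>i\<in>{i \<in> Z_eps \<epsilon> S. i + axis k 1 \<in> Z_eps \<epsilon> S}. (norm (F (i + axis k 1) - F i))^2) \<le> C"

text \<open>A formulation without sequences or nets: every weak* neighbourhood contains approximants
  at arbitrarily small scales. A liminf below a bound yields it directly, and no metrisability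
  enters.\<close>

definition energy_limit :: "(real^2) set \<Rightarrow> real \<Rightarrow> (real^2 \<Rightarrow> real^2^2) \<Rightarrow> bool" where
  "energy_limit S C Q \<longleftrightarrow> Q \<in> Linf_sym S \<and>
     (\<forall>U e. openin (weak_star S) U \<and> Q \<in> U \<and> 0 < e \<longrightarrow>
        (\<exists>\<epsilon> P F. \<epsilon> < e \<and> P \<in> U \<and> lattice_approx S C \<epsilon> P F))"

text \<open>A liminf below \<open>c\<close> excludes that the infimum over the neighbourhood stays
  at or above \<open>c\<close> at all small scales; the spins of a function with energy below
  \<open>c\<close> supply the lattice values.\<close>

lemma energy_limitI:
  assumes S: "open S" "bounded S" and "0 < \<gamma>"
    and h: "\<And>x. x \<in> {0..1} \<Longrightarrow> h x - h 1 \<ge> \<gamma> / 2 * (1 - x^2)"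
    and inf: "(INF x\<in>{0..1}. h x) = h 1" and Q: "Q \<in> Linf_sym S"
    and less: "Gamma_liminf (weak_star S) (at_right 0) (F1_eps h S) Q < ereal c"
  shows "energy_limit S (2 * c / \<gamma>) Q"
  unfolding energy_limit_def
proof (intro conjI allI impI Q)
  fix U e assume U: "openin (weak_star S) U \<and> Q \<in> U \<and> 0 < (e::real)"
  have "Liminf (at_right 0) (\<lambda>\<epsilon>. INF y\<in>U. F1_eps h S \<epsilon> y) \<le>
      Gamma_liminf (weak_star S) (at_right 0) (F1_eps h S) Q"
    unfolding Gamma_liminf_def using U by (intro SUP_upper) auto
  then have less': "Liminf (at_right 0) (\<lambda>\<epsilon>. INF y\<in>U. F1_eps h S \<epsilon> y) < ereal c" using less by (rule le_less_trans)
  have "\<exists>\<epsilon>. 0 < \<epsilon> \<and> \<epsilon> < e \<and> (INF y\<in>U. F1_eps h S \<epsilon> y) < ereal c"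
  proof (rule ccontr)
    assume *: "\<not> ?thesis"
    have "eventually (\<lambda>\<epsilon>. ereal c \<le> (INF y\<in>U. F1_eps h S \<epsilon> y)) (at_right 0)"
      unfolding eventually_at_right_field using * U by (intro exI[of _ e]) (metis not_less)
    then have "ereal c \<le> Liminf (at_right 0) (\<lambda>\<epsilon>. INF y\<in>U. F1_eps h S \<epsilon> y)" by (rule Liminf_bounded)
    then show False using less' by simp
  qed
  then obtain \<epsilon> P where \<epsilon>: "0 < \<epsilon>" "\<epsilon> < e" and P: "P \<in> U" "F1_eps h S \<epsilon> P < ereal c"
    by (auto simp: INF_less_iff)
  then have ex: "\<exists>u. spins_of \<epsilon> S P u" by (auto simp: F1_eps_def split: if_splits)
  then obtain u where u: "spins_of \<epsilon> S P u" by blast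
  have en: "spin_energy h S \<epsilon> u \<le> c" using P(2) F1_eps_eq[OF S(1) \<epsilon>(1) u, of h] by simp
  obtain R where R: "R \<in> C_eps \<epsilon> S" "AE x in lebesgue_on S. P x = R x"
    "\<And>i. i \<in> Z_eps \<epsilon> S \<Longrightarrow> norm (u i) = 1 \<and> R (\<epsilon> *\<^sub>R i) = tensor_square (u i)"
    using u unfolding spins_of_def by blast
  define F where "F i = (if i \<in> Z_eps \<epsilon> S then tensor_square (u i) else 0)" for i
  have "P \<in> Linf_sym S" using P(1) U openin_subset[of "weak_star S" U] by (auto simp: topspace_weak_star)
  moreover have "\<forall>i\<in>Z_eps \<epsilon> S. F i \<in> bd_K"
    using R(3) by (auto simp: F_def S1_tensor_eq_bd_K[symmetric] S1_tensor_def)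
  moreover have "AE x in lebesgue_on S. P x \<in> bd_K \<and> (cell_index \<epsilon> x \<in> Z_eps \<epsilon> S \<longrightarrow> P x = F (cell_index \<epsilon> x))"
    using R(2) AE_space
  proof eventually_elim
    case (elim x)
    then have x: "x \<in> S" by simp
    have "R x \<in> bd_K" using R(1) x by (auto simp: C_eps_def S1_tensor_eq_bd_K)
    moreover have "R x = R (\<epsilon> *\<^sub>R cell_index \<epsilon> x)" if "cell_index \<epsilon> x \<in> Z_eps \<epsilon> S"
    proof -
      have "x \<in> (\<lambda>w. \<epsilon> *\<^sub>R (cell_index \<epsilon> x + w)) ` W_cell"
        using cell_index_iff_cell[OF \<epsilon>(1) cell_index_in_lattice[of \<epsilon> x], of x] by simp
      then show ?thesis using R(1) x that unfolding C_eps_def by blast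
    qed
    ultimately show ?case using elim R(3) by (auto simp: F_def)
  qed
  moreover have "(\<Sum>k\<in>UNIV. \<Sum>i\<in>{i \<in> Z_eps \<epsilon> S. i + axis k 1 \<in> Z_eps \<epsilon> S}. (norm (F (i + axis k 1) - F i))^2) \<le> 2 * c / \<gamma>"
    using spin_energy_ge[OF \<epsilon>(1) S(2) \<open>0 < \<gamma>\<close> h inf _ en] R(3) by (simp add: F_def)
  ultimately have "lattice_approx S (2 * c / \<gamma>) \<epsilon> P F"
    using \<epsilon>(1) by (auto simp: lattice_approx_def F_def)
  then show "\<exists>\<epsilon> P F. \<epsilon> < e \<and> P \<in> U \<and> lattice_approx S (2 * c / \<gamma>) \<epsilon> P F" using \<epsilon> P by blast
qed

text \<open>The form in which the property is used: finitely many integrable test fields at a time,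
  symmetric or not.\<close>

lemma energy_limit_approx:
  assumes "energy_limit S C Q" "finite A" "\<And>\<Phi>. \<Phi> \<in> A \<Longrightarrow> integrable (lebesgue_on S) \<Phi>" "0 < e" "0 < \<eta>"
  obtains \<epsilon> P F where "\<epsilon> < e" "lattice_approx S C \<epsilon> P F"
    "\<And>\<Phi>. \<Phi> \<in> A \<Longrightarrow> \<bar>pairing S P \<Phi> - pairing S Q \<Phi>\<bar> < \<eta>"
proof -
  let ?U = "{P \<in> Linf_sym S. \<forall>\<Phi>\<in>A. \<bar>pairing S P \<Phi> - pairing S Q \<Phi>\<bar> < \<eta>}"
  have "openin (weak_star S) ?U" by (rule weak_star_open_nonsym) (use assms in auto)
  moreover have "Q \<in> ?U" using assms by (auto simp: energy_limit_def)
  ultimately have U: "openin (weak_star S) ?U \<and> Q \<in> ?U \<and> 0 < e" using assms(4) by blast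
  have "\<forall>U e. openin (weak_star S) U \<and> Q \<in> U \<and> 0 < e \<longrightarrow>
        (\<exists>\<epsilon> P F. \<epsilon> < e \<and> P \<in> U \<and> lattice_approx S C \<epsilon> P F)"
    using assms(1) by (simp add: energy_limit_def)
  from this[rule_format, OF U] obtain \<epsilon> P F where *: "\<epsilon> < e" "P \<in> ?U" "lattice_approx S C \<epsilon> P F" by (elim exE conjE)
  show ?thesis by (rule that[OF *(1,3)]) (use *(2) in simp)
qed

lemma compact_subset_open_margin:
  fixes K :: "'a::euclidean_space set"
  assumes "compact K" "K \<subseteq> S" "open S"
  obtains d where "d > 0" "\<And>x z. x \<in> K \<Longrightarrow> norm (z - x) < d \<Longrightarrow> z \<in> S"
proof -
  obtain d where d: "d > 0" "\<And>x y. x \<in> K \<Longrightarrow> y \<in> - S \<Longrightarrow> d \<le> dist x y"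
  proof -
    have "closed (- S)" "K \<inter> - S = {}" using assms by auto
    from separate_compact_closed[OF assms(1) this] show ?thesis using that by blast
  qed
  show ?thesis
  proof (rule that[OF d(1)])
    fix x z assume "x \<in> K" "norm (z - x) < d"
    then show "z \<in> S" using d(2)[of x z] by (auto simp: dist_norm norm_minus_commute)
  qed
qed

lemma cell_index_in_Z_eps:
  assumes "0 < \<epsilon>" "\<And>z. norm (z - x) < d \<Longrightarrow> z \<in> S" "norm (y - x) + \<epsilon> < d"
  shows "cell_index \<epsilon> y \<in> Z_eps \<epsilon> S"
proof -
  have "norm (\<epsilon> *\<^sub>R cell_index \<epsilon> y - x) \<le> norm (\<epsilon> *\<^sub>R cell_index \<epsilon> y - y) + norm (y - x)"
    using norm_triangle_ineq[of "\<epsilon> *\<^sub>R cell_index \<epsilon> y - y" "y - x"] by simp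
  then have "norm (\<epsilon> *\<^sub>R cell_index \<epsilon> y - x) < d" using cell_index_close(2)[OF assms(1), of y] assms(3) by linarith
  then show ?thesis using assms(2) by (simp add: mem_Z_eps cell_index_in_lattice)
qed

lemma integrable_of_nn_bound:
  fixes f :: "'a \<Rightarrow> real"
  assumes [measurable]: "f \<in> borel_measurable M" and "\<And>x. 0 \<le> f x" "(\<integral>\<^sup>+x. ennreal (f x) \<partial>M) \<le> ennreal c" "0 \<le> c"
  shows "integrable M f" "(LINT x|M. f x) \<le> c"
proof -
  show i: "integrable M f"
  proof (rule integrableI_bounded)
    show "(\<integral>\<^sup>+x. ennreal (norm (f x)) \<partial>M) < \<infinity>"
      using le_less_trans[OF assms(3) ennreal_less_top] assms(2) by simp
  qed measurable
  show "(LINT x|M. f x) \<le> c"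
    using assms(3) nn_integral_eq_integral[OF i] assms(2,4) by (simp add: ennreal_le_iff)
qed

section \<open>Divergence of a test field and its difference quotients\<close>

definition field_div :: "(real^2 \<Rightarrow> 'b::euclidean_space^2) \<Rightarrow> real^2 \<Rightarrow> 'b" where
  "field_div \<psi> x = (\<Sum>k\<in>UNIV. \<Sum>b\<in>Basis. partial_deriv k (\<lambda>x. \<psi> x $ k \<bullet> b) x *\<^sub>R b)"

text \<open>Backward differences: after a translation in the integral they become forward
  differences of the lattice function, which are the ones in the energy.\<close>

definition field_quot :: "real \<Rightarrow> (real^2 \<Rightarrow> 'b::euclidean_space^2) \<Rightarrow> real^2 \<Rightarrow> 'b" where
  "field_quot \<epsilon> \<psi> x = (1 / \<epsilon>) *\<^sub>R (\<Sum>k\<in>UNIV. \<psi> x $ k - \<psi> (x - \<epsilon> *\<^sub>R axis k 1) $ k)"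

lemma test_field_component:
  assumes "test_field S \<psi>" "b \<in> Basis"
  shows "test_function S (\<lambda>x. \<psi> x $ k \<bullet> b)"
proof -
  have "axis k b \<in> Basis" using assms(2) by (auto simp: Basis_vec_def)
  then have "test_function S (\<lambda>x. \<psi> x \<bullet> axis k b)" using assms(1) by (auto simp: test_field_def)
  then show ?thesis by (simp add: inner_axis)
qed

lemma field_div_add:
  assumes "test_field S f" "test_field S g"
  shows "field_div (\<lambda>x. f x + g x) x = field_div f x + field_div g x"
proof -
  have "partial_deriv k (\<lambda>x. (f x + g x) $ k \<bullet> b) x =
      partial_deriv k (\<lambda>x. f x $ k \<bullet> b) x + partial_deriv k (\<lambda>x. g x $ k \<bullet> b) x" if "b \<in> Basis" for k b
    by (simp add: inner_add_left partial_deriv_add[OF test_function_differentiable[OF test_field_component[OF assms(1) that]]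
        test_function_differentiable[OF test_field_component[OF assms(2) that]]])
  then show ?thesis by (simp add: field_div_def scaleR_add_left sum.distrib)
qed

lemma field_div_scaleR:
  assumes "test_field S f"
  shows "field_div (\<lambda>x. t *\<^sub>R f x) x = t *\<^sub>R field_div f x"
proof -
  have "partial_deriv k (\<lambda>x. (t *\<^sub>R f x) $ k \<bullet> b) x = t * partial_deriv k (\<lambda>x. f x $ k \<bullet> b) x" if "b \<in> Basis" for k b
    by (simp add: partial_deriv_cmult[OF test_function_differentiable[OF test_field_component[OF assms that]]])
  then show ?thesis by (simp add: field_div_def scaleR_sum_right)
qed

lemma field_div_integrable: "test_field S \<psi> \<Longrightarrow> integrable lborel (field_div \<psi>)"
  unfolding field_div_def[abs_def]
  by (intro Bochner_Integration.integrable_sum integrable_scaleR_left test_function_integrable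
      test_function_partial_deriv test_field_component)

lemma test_field_support:
  assumes "test_field S \<psi>"
  obtains K where "compact K" "K \<subseteq> S" "\<And>x. x \<notin> K \<Longrightarrow> \<psi> x = 0"
proof -
  have "\<exists>K. compact K \<and> K \<subseteq> S \<and> (\<forall>x. x \<notin> K \<longrightarrow> \<psi> x \<bullet> b = 0)" if "b \<in> Basis" for b
    using assms that by (auto simp: test_field_def elim!: test_functionE)
  then obtain K where K: "\<And>b. b \<in> Basis \<Longrightarrow> compact (K b) \<and> K b \<subseteq> S \<and> (\<forall>x. x \<notin> K b \<longrightarrow> \<psi> x \<bullet> b = 0)" by metis
  show ?thesis
  proof (rule that[of "\<Union>b\<in>Basis. K b"])
    show "compact (\<Union>b\<in>Basis. K b)" by (rule compact_UN) (use K in auto)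
    show "(\<Union>b\<in>Basis. K b) \<subseteq> S" using K by auto
    show "\<psi> x = 0" if "x \<notin> (\<Union>b\<in>Basis. K b)" for x
      using that K by (subst euclidean_eq_iff) auto
  qed
qed

text \<open>Taylor expansion of every component with its quadratic remainder, divided by
  \<epsilon>.\<close>

lemma field_quot_close:
  assumes "test_field S \<psi>"
  obtains C where "C > 0" "\<And>\<epsilon> x. 0 < \<epsilon> \<Longrightarrow> norm (field_div \<psi> x - field_quot \<epsilon> \<psi> x) \<le> C * \<epsilon>"
proof -
  define f where "f k b x = \<psi> x $ k \<bullet> b" for k b x
  define C where "C k b = (SOME c. c > 0 \<and> (\<forall>x v. \<bar>f k b (x + v) - f k b x -
      (\<Sum>j\<in>UNIV. v $ j * partial_deriv j (f k b) x)\<bar> \<le> c * (norm v)^2))" for k b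
  have Cc: "C k b > 0 \<and> (\<forall>x v. \<bar>f k b (x + v) - f k b x -
      (\<Sum>j\<in>UNIV. v $ j * partial_deriv j (f k b) x)\<bar> \<le> C k b * (norm v)^2)" if b: "b \<in> Basis" for k b
    unfolding C_def
  proof (rule someI_ex)
    have "test_function S (f k b)" using test_field_component[OF assms b, of k] by (simp add: f_def[abs_def])
    then show "\<exists>c. c > 0 \<and> (\<forall>x v. \<bar>f k b (x + v) - f k b x -
      (\<Sum>j\<in>UNIV. v $ j * partial_deriv j (f k b) x)\<bar> \<le> c * (norm v)^2)"
    proof (rule test_function_Taylor)
      fix c assume "0 < c" "\<And>x v. \<bar>f k b (x + v) - f k b x -
        (\<Sum>j\<in>UNIV. v $ j * partial_deriv j (f k b) x)\<bar> \<le> c * (norm v)^2"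
      then show ?thesis by (intro exI[of _ c]) simp
    qed
  qed
  have C: "C k b > 0" if "b \<in> Basis" for k b using Cc[OF that] by blast
  have Cb: "\<bar>f k b (x + v) - f k b x - (\<Sum>j\<in>UNIV. v $ j * partial_deriv j (f k b) x)\<bar> \<le> C k b * (norm v)^2"
    if "b \<in> Basis" for k b x v using Cc[OF that] by blast
  define B where "B = (\<Sum>k\<in>UNIV. \<Sum>b\<in>Basis. C k b)"
  have "B \<ge> 0" unfolding B_def using C by (intro sum_nonneg) (auto simp: less_imp_le)
  have est: "norm (field_div \<psi> x - field_quot \<epsilon> \<psi> x) \<le> B * \<epsilon>" if \<epsilon>: "0 < \<epsilon>" for \<epsilon> x
  proof -
    have "field_quot \<epsilon> \<psi> x = (\<Sum>k\<in>UNIV. \<Sum>b\<in>Basis. ((f k b x - f k b (x - \<epsilon> *\<^sub>R axis k 1)) / \<epsilon>) *\<^sub>R b)"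
    proof -
      have "\<psi> x $ k - \<psi> (x - \<epsilon> *\<^sub>R axis k 1) $ k = (\<Sum>b\<in>Basis. (f k b x - f k b (x - \<epsilon> *\<^sub>R axis k 1)) *\<^sub>R b)" for k
      proof -
        have "(\<Sum>b\<in>Basis. (f k b x - f k b (x - \<epsilon> *\<^sub>R axis k 1)) *\<^sub>R b) =
            (\<Sum>b\<in>Basis. ((\<psi> x $ k - \<psi> (x - \<epsilon> *\<^sub>R axis k 1) $ k) \<bullet> b) *\<^sub>R b)"
          by (simp add: f_def inner_diff_left)
        also have "\<dots> = \<psi> x $ k - \<psi> (x - \<epsilon> *\<^sub>R axis k 1) $ k" by (rule euclidean_representation)
        finally show ?thesis by simp
      qed
      then show ?thesis by (simp add: field_quot_def scaleR_sum_right)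
    qed
    moreover have "field_div \<psi> x = (\<Sum>k\<in>UNIV. \<Sum>b\<in>Basis. partial_deriv k (f k b) x *\<^sub>R b)"
      unfolding field_div_def f_def[abs_def] ..
    ultimately have "field_div \<psi> x - field_quot \<epsilon> \<psi> x =
        (\<Sum>k\<in>UNIV. \<Sum>b\<in>Basis. (partial_deriv k (f k b) x - (f k b x - f k b (x - \<epsilon> *\<^sub>R axis k 1)) / \<epsilon>) *\<^sub>R b)"
      by (simp only: scaleR_diff_left sum_subtractf)
    also have "norm \<dots> \<le> (\<Sum>k\<in>UNIV. \<Sum>b\<in>Basis. C k b * \<epsilon>)"
    proof (intro order_trans[OF norm_sum sum_mono] order_trans[OF norm_sum sum_mono])
      fix k :: 2 and b :: 'a assume b: "b \<in> Basis"
      have "(\<Sum>j\<in>UNIV. (- \<epsilon> *\<^sub>R axis k 1 :: real^2) $ j * partial_deriv j (f k b) x) = - \<epsilon> * partial_deriv k (f k b) x"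
        using exhaust_2[of k] by (auto simp: sum_2 axis_def)
      then have "\<bar>f k b (x - \<epsilon> *\<^sub>R axis k 1) - f k b x + \<epsilon> * partial_deriv k (f k b) x\<bar> \<le> C k b * \<epsilon>^2"
        using Cb[OF b, of k x "- \<epsilon> *\<^sub>R axis k 1"] \<epsilon> by (simp add: norm_axis_1)
      moreover have "f k b (x - \<epsilon> *\<^sub>R axis k 1) - f k b x + \<epsilon> * partial_deriv k (f k b) x =
          \<epsilon> * (partial_deriv k (f k b) x - (f k b x - f k b (x - \<epsilon> *\<^sub>R axis k 1)) / \<epsilon>)"
        using \<epsilon> by (simp add: field_simps)
      ultimately have "\<epsilon> * \<bar>partial_deriv k (f k b) x - (f k b x - f k b (x - \<epsilon> *\<^sub>R axis k 1)) / \<epsilon>\<bar> \<le> \<epsilon> * (C k b * \<epsilon>)"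
        using \<epsilon> by (simp add: abs_mult power2_eq_square mult_ac)
      then have "\<bar>partial_deriv k (f k b) x - (f k b x - f k b (x - \<epsilon> *\<^sub>R axis k 1)) / \<epsilon>\<bar> \<le> C k b * \<epsilon>"
        using \<epsilon> by (simp only: mult_le_cancel_left_pos)
      then show "norm ((partial_deriv k (f k b) x - (f k b x - f k b (x - \<epsilon> *\<^sub>R axis k 1)) / \<epsilon>) *\<^sub>R b) \<le> C k b * \<epsilon>"
        using b by simp
    qed
    also have "\<dots> = B * \<epsilon>" by (simp add: B_def sum_distrib_right)
    finally show ?thesis .
  qed
  show ?thesis
  proof (rule that[of "B + 1"])
    show "norm (field_div \<psi> x - field_quot \<epsilon> \<psi> x) \<le> (B + 1) * \<epsilon>" if "0 < \<epsilon>" for \<epsilon> x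
      using est[OF that, of x] that by (simp add: distrib_right)
  qed (use \<open>B \<ge> 0\<close> in auto)
qed

lemma step_function_L2:
  fixes F :: "real^2 \<Rightarrow> 'b::euclidean_space"
  assumes "0 < \<epsilon>" "finite Z" "Z \<subseteq> lattice" "\<And>i. i \<notin> Z \<Longrightarrow> F i = 0"
  shows "integrable lborel (\<lambda>x. (norm (F (cell_index \<epsilon> x)))^2)"
proof -
  have "integrable lborel (\<lambda>x. indicator Z (cell_index \<epsilon> x) * (norm (F (cell_index \<epsilon> x)))^2)"
    by (rule cell_step_integral(1)[OF assms(1-3)])
  also have "(\<lambda>x. indicator Z (cell_index \<epsilon> x) * (norm (F (cell_index \<epsilon> x)))^2) = (\<lambda>x. (norm (F (cell_index \<epsilon> x)))^2)"
    using assms(4) by (auto simp: fun_eq_iff indicator_def)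
  finally show ?thesis .
qed

lemma borel_measurable_vec_lambda:
  fixes f :: "'a \<Rightarrow> 'n::finite \<Rightarrow> 'b::euclidean_space"
  assumes "\<And>k. (\<lambda>x. f x k) \<in> borel_measurable M"
  shows "(\<lambda>x. \<chi> k. f x k) \<in> borel_measurable M"
proof (subst borel_measurable_euclidean_space, intro ballI)
  fix b :: "'b^'n" assume "b \<in> Basis"
  then obtain k u where "b = axis k u" by (auto simp: Basis_vec_def)
  then show "(\<lambda>x. (\<chi> k. f x k) \<bullet> b) \<in> borel_measurable M"
    using assms[of k] by (simp add: inner_axis)
qed

text \<open>Summation by parts: the backward quotient of \<psi> becomes minus the forward quotient
  of the step function, cut off to the set \<open>K\<close> outside which \<psi> vanishes. Its
  squared L^2 norm is at most \<epsilon>^-2 times the cell area \<epsilon>^2 times the lattice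
  energy, so in the plane the powers of \<epsilon> cancel and the constant is sqrt C.\<close>

lemma field_quot_integral_le:
  fixes F :: "real^2 \<Rightarrow> 'b::euclidean_space" and \<psi> :: "real^2 \<Rightarrow> 'b^2"
  assumes e: "0 < \<epsilon>" and Z: "finite Z" "Z \<subseteq> lattice" and F0: "\<And>i. i \<notin> Z \<Longrightarrow> F i = 0"
    and \<psi>: "test_field S \<psi>" and K: "compact K" "\<And>x. x \<notin> K \<Longrightarrow> \<psi> x = 0"
    and KZ: "\<And>x k. x \<in> K \<Longrightarrow> cell_index \<epsilon> x \<in> Z \<and> cell_index \<epsilon> x + axis k 1 \<in> Z"
    and C: "(\<Sum>k\<in>UNIV. \<Sum>i\<in>{i \<in> Z. i + axis k 1 \<in> Z}. (norm (F (i + axis k 1) - F i))^2) \<le> C"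
  shows "- (LINT x|lborel. F (cell_index \<epsilon> x) \<bullet> field_quot \<epsilon> \<psi> x) \<le> sqrt C * sqrt (LINT x|lborel. (norm (\<psi> x))^2)"
proof -
  define s where "s x = F (cell_index \<epsilon> x)" for x
  have Fm[measurable]: "(\<lambda>x. F (cell_index \<epsilon> x + v)) \<in> borel_measurable borel" for v
    by (rule step_function_measurable[OF Z(1) F0])
  have sm[measurable]: "s \<in> borel_measurable borel" using Fm[of 0] by (simp add: s_def[abs_def])
  have s2: "integrable lborel (\<lambda>x. (norm (s x))^2)" unfolding s_def by (rule step_function_L2[OF e Z F0])
  note [measurable] = test_field_borel[OF \<psi>]
  have \<psi>km[measurable]: "(\<lambda>x. \<psi> x $ k) \<in> borel_measurable borel" for k
    by (rule borel_measurable_vec_nth'[OF test_field_borel[OF \<psi>]])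
  have \<psi>k2: "integrable lborel (\<lambda>x. (norm (\<psi> x $ k))^2)" for k
    by (rule Bochner_Integration.integrable_bound[OF test_field_L2[OF \<psi>]])
       (auto intro!: AE_I2 power_mono simp: Finite_Cartesian_Product.norm_nth_le)
  define a where "a k = \<epsilon> *\<^sub>R (axis k 1 :: real^2)" for k
  have i1: "integrable lborel (\<lambda>x. s x \<bullet> \<psi> x $ k)" for k
    by (rule L2_inner_integrable[OF _ _ s2 \<psi>k2]) measurable
  have sa2: "integrable lborel (\<lambda>x. (norm (s (x + a k)))^2)" for k
    using lborel_integral_translate(2)[of "\<lambda>x. (norm (s x))^2" "a k"] s2 by simp
  have i2: "integrable lborel (\<lambda>x. s (x + a k) \<bullet> \<psi> x $ k)" for k
    by (rule L2_inner_integrable[OF _ _ sa2 \<psi>k2]) measurable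
  have i3: "integrable lborel (\<lambda>x. s x \<bullet> \<psi> (x - a k) $ k)"
    and t3: "(LINT x|lborel. s x \<bullet> \<psi> (x - a k) $ k) = (LINT x|lborel. s (x + a k) \<bullet> \<psi> x $ k)" for k
    using i2[of k] lborel_integral_translate[of "\<lambda>x. s x \<bullet> \<psi> (x - a k) $ k" "a k"] by simp_all
  define T where "T x = (indicator K x * (1 / \<epsilon>)) *\<^sub>R (\<chi> k. s (x + a k) - s x)" for x
  have [measurable]: "K \<in> sets borel" using K(1) by (simp add: borel_compact)
  have [measurable]: "T \<in> borel_measurable borel"
    unfolding T_def by (intro borel_measurable_scaleR borel_measurable_vec_lambda) measurable
  have C0: "0 \<le> C" using C by (rule order_trans[rotated]) (auto intro!: sum_nonneg)
  have "(\<integral>\<^sup>+x. ennreal ((norm (T x))^2) \<partial>lborel) \<le> ennreal C"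
  proof -
    have "(\<integral>\<^sup>+x. ennreal ((norm (T x))^2) \<partial>lborel) = (\<integral>\<^sup>+x. (\<Sum>k\<in>UNIV. ennreal (1 / \<epsilon>^2) *
        (indicator K x * ennreal ((norm (F (cell_index \<epsilon> x + axis k 1) - F (cell_index \<epsilon> x)))^2))) \<partial>lborel)"
    proof (rule nn_integral_cong)
      fix x
      have "(norm (T x))^2 = (\<Sum>k\<in>UNIV. (1 / \<epsilon>^2) * (indicator K x * (norm (s (x + a k) - s x))^2))"
        using e by (simp add: norm_sq_vec T_def power_mult_distrib sum_distrib_left power_divide indicator_def sum_divide_distrib)
      then show "ennreal ((norm (T x))^2) = (\<Sum>k\<in>UNIV. ennreal (1 / \<epsilon>^2) *
        (indicator K x * ennreal ((norm (F (cell_index \<epsilon> x + axis k 1) - F (cell_index \<epsilon> x)))^2)))"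
      proof (simp only:)
        have "ennreal (\<Sum>k\<in>UNIV. (1 / \<epsilon>^2) * (indicator K x * (norm (s (x + a k) - s x))^2)) =
            (\<Sum>k\<in>UNIV. ennreal ((1 / \<epsilon>^2) * (indicator K x * (norm (s (x + a k) - s x))^2)))"
          by (rule sum_ennreal[symmetric]) auto
        also have "\<dots> = (\<Sum>k\<in>UNIV. ennreal (1 / \<epsilon>^2) *
            (indicator K x * ennreal ((norm (F (cell_index \<epsilon> x + axis k 1) - F (cell_index \<epsilon> x)))^2)))"
          unfolding s_def a_def cell_index_shift[OF e]
          by (intro sum.cong refl) (auto simp: indicator_def ennreal_mult[symmetric])
        finally show "ennreal (\<Sum>k\<in>UNIV. (1 / \<epsilon>^2) * (indicator K x * (norm (s (x + a k) - s x))^2)) = \<dots>" .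
      qed
    qed
    also have "\<dots> = (\<Sum>k\<in>UNIV. ennreal (1 / \<epsilon>^2) *
        (\<integral>\<^sup>+x. indicator K x * ennreal ((norm (F (cell_index \<epsilon> x + axis k 1) - F (cell_index \<epsilon> x)))^2) \<partial>lborel))"
      using sm unfolding s_def by (subst nn_integral_sum) (auto intro!: sum.cong nn_integral_cmult)
    also have "\<dots> \<le> (\<Sum>k\<in>UNIV. ennreal (1 / \<epsilon>^2) * ennreal (\<epsilon>^2 * (\<Sum>i\<in>{i \<in> Z. i + axis k 1 \<in> Z}. (norm (F (i + axis k 1) - F i))^2)))"
      by (intro sum_mono mult_left_mono lattice_difference_integral_le e Z KZ) auto
    also have "\<dots> = ennreal (\<Sum>k\<in>UNIV. \<Sum>i\<in>{i \<in> Z. i + axis k 1 \<in> Z}. (norm (F (i + axis k 1) - F i))^2)"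
      using e by (subst sum_ennreal[symmetric]) (auto intro!: sum_nonneg sum.cong simp: ennreal_mult[symmetric] sum_nonneg)
    also have "\<dots> \<le> ennreal C" using C by (rule ennreal_leI)
    finally show ?thesis .
  qed
  from integrable_of_nn_bound[OF _ _ this C0]
  have T2: "integrable lborel (\<lambda>x. (norm (T x))^2)" "(LINT x|lborel. (norm (T x))^2) \<le> C" by auto
  have "(LINT x|lborel. s x \<bullet> field_quot \<epsilon> \<psi> x) =
      (LINT x|lborel. (1 / \<epsilon>) * (\<Sum>k\<in>UNIV. s x \<bullet> \<psi> x $ k - s x \<bullet> \<psi> (x - a k) $ k))"
    by (simp add: field_quot_def a_def inner_sum_right inner_diff_right)
  also have "\<dots> = (1 / \<epsilon>) * (\<Sum>k\<in>UNIV. (LINT x|lborel. s x \<bullet> \<psi> x $ k) - (LINT x|lborel. s (x + a k) \<bullet> \<psi> x $ k))"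
    using i1 i3 by (simp add: Bochner_Integration.integral_sum Bochner_Integration.integral_diff t3)
  also have "\<dots> = - (LINT x|lborel. (1 / \<epsilon>) * (\<Sum>k\<in>UNIV. s (x + a k) \<bullet> \<psi> x $ k - s x \<bullet> \<psi> x $ k))"
    using i1 i2 by (simp add: Bochner_Integration.integral_sum Bochner_Integration.integral_diff sum_subtractf algebra_simps)
  also have "\<dots> = - (LINT x|lborel. T x \<bullet> \<psi> x)"
  proof -
    have "(1 / \<epsilon>) * (\<Sum>k\<in>UNIV. s (x + a k) \<bullet> \<psi> x $ k - s x \<bullet> \<psi> x $ k) = T x \<bullet> \<psi> x" for x
      using K(2)[of x] by (cases "x \<in> K") (auto simp: T_def inner_vec_def inner_diff_left sum_divide_distrib)
    then show ?thesis by simp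
  qed
  finally have "- (LINT x|lborel. s x \<bullet> field_quot \<epsilon> \<psi> x) = (LINT x|lborel. T x \<bullet> \<psi> x)" by simp
  also have "\<dots> \<le> sqrt (LINT x|lborel. (norm (T x))^2) * sqrt (LINT x|lborel. (norm (\<psi> x))^2)"
    by (intro order_trans[OF abs_ge_self L2_Cauchy_Schwarz] T2 test_field_L2[OF \<psi>]) measurable
  also have "\<dots> \<le> sqrt C * sqrt (LINT x|lborel. (norm (\<psi> x))^2)"
    using T2(2) by (intro mult_right_mono) auto
  finally show ?thesis by (simp add: s_def)
qed

lemma Linf_sym_bound:
  assumes "Q \<in> Linf_sym S"
  obtains B where "0 < B" "AE x in lebesgue_on S. norm (Q x) \<le> B"
proof -
  obtain C where C: "AE x in lebesgue_on S. norm (Q x) \<le> C" using assms by (auto simp: Linf_sym_def)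
  show ?thesis
    by (rule that[of "max C 1"]) (use C in \<open>auto elim!: eventually_mono\<close>)
qed

lemma Linf_sym_inner_integrable:
  assumes "Q \<in> Linf_sym S" "integrable (lebesgue_on S) \<Phi>"
  shows "integrable (lebesgue_on S) (\<lambda>x. Q x \<bullet> \<Phi> x)"
proof -
  obtain B where B: "0 < B" "AE x in lebesgue_on S. norm (Q x) \<le> B" using Linf_sym_bound[OF assms(1)] .
  have [measurable]: "Q \<in> borel_measurable (lebesgue_on S)" using assms(1) by (simp add: Linf_sym_def)
  note [measurable] = borel_measurable_integrable[OF assms(2)]
  show ?thesis
  proof (rule Bochner_Integration.integrable_bound)
    show "integrable (lebesgue_on S) (\<lambda>x. B * norm (\<Phi> x))" using assms(2) by simp
    show "AE x in lebesgue_on S. norm (Q x \<bullet> \<Phi> x) \<le> norm (B * norm (\<Phi> x))"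
      using B(2)
    proof eventually_elim
      case (elim x)
      have "\<bar>Q x \<bullet> \<Phi> x\<bar> \<le> norm (Q x) * norm (\<Phi> x)" by (rule Cauchy_Schwarz_ineq2)
      also have "\<dots> \<le> B * norm (\<Phi> x)" using elim by (intro mult_right_mono) auto
      finally show ?case using B(1) by simp
    qed
  qed measurable
qed

lemma finite_measure_lebesgue_on: "bounded S \<Longrightarrow> open S \<Longrightarrow> finite_measure (lebesgue_on S)"
  for S :: "'a::euclidean_space set"
  by (intro finite_measureI)
     (auto simp: space_restrict_space emeasure_restrict_space emeasure_completion emeasure_bounded_finite
       less_top[symmetric] dest!: emeasure_bounded_finite)

lemma borel_integrable_lebesgue_on:
  fixes g :: "'a::euclidean_space \<Rightarrow> 'b::euclidean_space"
  assumes "open S" "integrable lborel g"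
  shows "integrable (lebesgue_on S) g"
proof -
  have "g \<in> borel_measurable lborel" using assms(2) by (rule borel_measurable_integrable)
  then have g: "g \<in> borel_measurable borel" by simp
  have "integrable lborel (\<lambda>x. indicator S x *\<^sub>R g x)"
    using integrable_mult_indicator[of S lborel g] assms by simp
  moreover have "AE x in lebesgue_on S. g x = indicator S x *\<^sub>R g x"
    using assms(1) by (intro AE_I2) (simp add: space_restrict_space)
  ultimately show ?thesis
    using lebesgue_on_borel_integral(2)[OF assms(1) borel_measurable_lebesgue_on[OF assms(1) g], of "\<lambda>x. indicator S x *\<^sub>R g x"]
      assms(1) g by simp
qed

text \<open>Weak* closeness allows replacing \<open>Q\<close> by an approximant \<open>P\<close> in
  the pairing; then \<open>field_quot\<close> replaces \<open>field_div\<close> with a uniformly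
  small error because |P| = 1, and the discrete estimate applies. Both errors are at most
  e/2.\<close>

lemma energy_limit_field_estimate:
  fixes \<psi> :: "real^2 \<Rightarrow> real^2^2^2"
  assumes S: "open S" "bounded S" and lim: "energy_limit S C Q" and \<psi>: "test_field S \<psi>"
  shows "- pairing S Q (field_div \<psi>) \<le> sqrt C * sqrt (LINT x|lborel. (norm (\<psi> x))^2)"
proof (rule field_le_epsilon)
  fix e :: real assume e: "0 < e"
  interpret fm: finite_measure "lebesgue_on S" by (rule finite_measure_lebesgue_on[OF S(2,1)])
  define \<mu> where "\<mu> = measure (lebesgue_on S) (space (lebesgue_on S))"
  obtain K where K: "compact K" "K \<subseteq> S" "\<And>x. x \<notin> K \<Longrightarrow> \<psi> x = 0" using test_field_support[OF \<psi>] by blast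
  obtain d where d: "d > 0" "\<And>x z. x \<in> K \<Longrightarrow> norm (z - x) < d \<Longrightarrow> z \<in> S"
    using compact_subset_open_margin[OF K(1,2) S(1)] by blast
  obtain c where c: "c > 0" "\<And>\<epsilon> x. 0 < \<epsilon> \<Longrightarrow> norm (field_div \<psi> x - field_quot \<epsilon> \<psi> x) \<le> c * \<epsilon>"
    using field_quot_close[OF \<psi>] by blast
  have \<mu>0: "0 \<le> \<mu>" by (simp add: \<mu>_def)
  \<comment> \<open>The first bound keeps the cells met by the shifted support inside
    \<open>S\<close>; the second makes the replacement error c \<epsilon> \<mu> at most e/2.\<close>
  define e0 where "e0 = min (d / 4) (e / (2 * (c * \<mu> + 1)))"
  have cm: "0 < c * \<mu> + 1" using c(1) \<mu>0 by (simp add: add_nonneg_pos)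
  have e0: "0 < e0" using d(1) e cm by (simp add: e0_def)
  have \<Phi>i: "integrable lborel (field_div \<psi>)" by (rule field_div_integrable[OF \<psi>])
  have \<Phi>S: "integrable (lebesgue_on S) (field_div \<psi>)" by (rule borel_integrable_lebesgue_on[OF S(1) \<Phi>i])
  obtain \<epsilon> P F where ap: "\<epsilon> < e0" "lattice_approx S C \<epsilon> P F"
    "\<bar>pairing S P (field_div \<psi>) - pairing S Q (field_div \<psi>)\<bar> < e / 2"
  proof (rule energy_limit_approx[OF lim, of "{field_div \<psi>}" e0 "e / 2"])
    show "\<And>\<Phi>. \<Phi> \<in> {field_div \<psi>} \<Longrightarrow> integrable (lebesgue_on S) \<Phi>" using \<Phi>S by simp
    fix \<epsilon> P F assume "\<epsilon> < e0" "lattice_approx S C \<epsilon> P F"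
      "\<And>\<Phi>. \<Phi> \<in> {field_div \<psi>} \<Longrightarrow> \<bar>pairing S P \<Phi> - pairing S Q \<Phi>\<bar> < e / 2"
    then show thesis using that by simp
  qed (use e e0 in auto)
  define Z where "Z = Z_eps \<epsilon> S"
  have eps: "0 < \<epsilon>" and P: "P \<in> Linf_sym S" and F0: "\<And>i. i \<notin> Z \<Longrightarrow> F i = 0"
    and AEP: "AE x in lebesgue_on S. P x \<in> bd_K \<and> (cell_index \<epsilon> x \<in> Z \<longrightarrow> P x = F (cell_index \<epsilon> x))"
    and en: "(\<Sum>k\<in>UNIV. \<Sum>i\<in>{i \<in> Z. i + axis k 1 \<in> Z}. (norm (F (i + axis k 1) - F i))^2) \<le> C"
    using ap(2) by (auto simp: lattice_approx_def Z_def)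
  have Z: "finite Z" "Z \<subseteq> lattice" using finite_Z_eps[OF eps S(2)] Z_eps_lattice by (auto simp: Z_def)
  have ed: "\<epsilon> < d / 4" using ap(1) by (simp add: e0_def)
  have near: "cell_index \<epsilon> y \<in> Z" if "x \<in> K" "norm (y - x) \<le> \<epsilon>" for x y
    unfolding Z_def by (rule cell_index_in_Z_eps[OF eps, of x d]) (use d that ed in auto)
  have nax: "norm (\<epsilon> *\<^sub>R (axis k 1 :: real^2)) = \<epsilon>" for k using eps by (simp add: norm_axis_1)
  define fq where "fq = field_quot \<epsilon> \<psi>"
  \<comment> \<open>The difference quotient lives within distance \<epsilon> of \<open>K\<close>,
    where the cells still belong to \<open>Z\<close> and \<open>P\<close> agrees with the step
    function.\<close>
  have fq0: "\<exists>y\<in>K. norm (x - y) \<le> \<epsilon>" if nz: "fq x \<noteq> 0" for x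
  proof (rule ccontr)
    assume *: "\<not> ?thesis"
    have "\<psi> x = 0" using * eps by (intro K(3)) force
    moreover have "\<psi> (x - \<epsilon> *\<^sub>R axis k 1) = 0" for k
      using * nax[of k] by (intro K(3)) (metis diff_diff_eq2 add_diff_cancel_left' order_refl)
    ultimately show False using nz by (simp add: fq_def field_quot_def)
  qed
  note [measurable] = test_field_borel[OF \<psi>]
  have fqm[measurable]: "fq \<in> borel_measurable borel"
    unfolding fq_def field_quot_def[abs_def]
    by (intro borel_measurable_scaleR borel_measurable_const borel_measurable_sum borel_measurable_diff borel_measurable_vec_nth') measurable
  have fqS: "fq \<in> borel_measurable (lebesgue_on S)" by (rule borel_measurable_lebesgue_on[OF S(1) fqm])
  have diffi: "integrable (lebesgue_on S) (\<lambda>x. field_div \<psi> x - fq x)"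
    by (rule fm.integrable_const_bound[of _ "c * \<epsilon>"])
       (use c(2)[OF eps] fqS borel_measurable_integrable[OF \<Phi>S] in \<open>auto simp: fq_def\<close>)
  have fqi: "integrable (lebesgue_on S) fq"
    using Bochner_Integration.integrable_diff[OF \<Phi>S diffi] by simp
  have Pm[measurable]: "P \<in> borel_measurable (lebesgue_on S)" using P by (simp add: Linf_sym_def)
  have 1: "pairing S P (field_div \<psi>) - pairing S P fq \<ge> - (c * \<epsilon> * \<mu>)"
  proof -
    have "pairing S P (field_div \<psi>) - pairing S P fq = (LINT x|lebesgue_on S. P x \<bullet> (field_div \<psi> x - fq x))"
      unfolding pairing_def inner_diff_right
      by (rule Bochner_Integration.integral_diff[symmetric]) (intro Linf_sym_inner_integrable P \<Phi>S fqi)+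
    also have "\<dots> \<ge> (LINT x|lebesgue_on S. - (c * \<epsilon>))"
    proof (rule integral_mono_AE)
      show "AE x in lebesgue_on S. - (c * \<epsilon>) \<le> P x \<bullet> (field_div \<psi> x - fq x)"
        using AEP
      proof eventually_elim
        case (elim x)
        then have "norm (P x) = 1" by (simp add: bd_K_iff)
        then have "\<bar>P x \<bullet> (field_div \<psi> x - fq x)\<bar> \<le> c * \<epsilon>"
          using Cauchy_Schwarz_ineq2[of "P x" "field_div \<psi> x - fq x"] c(2)[OF eps, of x] by (simp add: fq_def)
        then show ?case by linarith
      qed
    qed (use Linf_sym_inner_integrable[OF P diffi] in auto)
    finally show ?thesis by (simp add: \<mu>_def mult_ac)
  qed
  have 2: "pairing S P fq = (LINT x|lborel. F (cell_index \<epsilon> x) \<bullet> fq x)"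
    unfolding pairing_def
  proof (rule lebesgue_on_borel_integral(1)[OF S(1)])
    show "(\<lambda>x. P x \<bullet> fq x) \<in> borel_measurable (lebesgue_on S)" using fqS by measurable
    have [measurable]: "(\<lambda>x. F (cell_index \<epsilon> x)) \<in> borel_measurable borel"
      using step_function_measurable[OF Z(1) F0, where \<epsilon> = \<epsilon> and v = 0] by simp
    show "(\<lambda>x. F (cell_index \<epsilon> x) \<bullet> fq x) \<in> borel_measurable borel" by measurable
    show "F (cell_index \<epsilon> x) \<bullet> fq x = 0" if "x \<notin> S" for x
    proof (cases "fq x = 0")
      case False
      then obtain y where "y \<in> K" "norm (x - y) \<le> \<epsilon>" using fq0 by blast
      then have "x \<in> S" using d(2)[of y x] ed eps by simp
      then show ?thesis using that by simp
    qed simp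
    show "AE x in lebesgue_on S. P x \<bullet> fq x = F (cell_index \<epsilon> x) \<bullet> fq x"
      using AEP
    proof eventually_elim
      case (elim x)
      show ?case
      proof (cases "fq x = 0")
        case False
        then obtain y where "y \<in> K" "norm (x - y) \<le> \<epsilon>" using fq0 by blast
        then show ?thesis using near[of y x] elim by simp
      qed simp
    qed
  qed
  have 3: "- (LINT x|lborel. F (cell_index \<epsilon> x) \<bullet> fq x) \<le> sqrt C * sqrt (LINT x|lborel. (norm (\<psi> x))^2)"
    unfolding fq_def
  proof (rule field_quot_integral_le[OF eps Z F0 \<psi> K(1,3) _ en])
    fix x k assume x: "x \<in> K"
    show "cell_index \<epsilon> x \<in> Z \<and> cell_index \<epsilon> x + axis k 1 \<in> Z"
      using near[OF x, of x] near[OF x, of "x + \<epsilon> *\<^sub>R axis k 1"] nax[of k] eps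
      by (simp add: cell_index_shift[OF eps])
  qed
  have 4: "c * \<epsilon> * \<mu> \<le> e / 2"
  proof -
    have "\<epsilon> \<le> e / (2 * (c * \<mu> + 1))" using ap(1) by (simp add: e0_def)
    then have "\<epsilon> * (2 * (c * \<mu> + 1)) \<le> e" using cm by (simp add: pos_le_divide_eq)
    then show ?thesis using eps by (simp add: algebra_simps)
  qed
  show "- pairing S Q (field_div \<psi>) \<le> sqrt C * sqrt (LINT x|lborel. (norm (\<psi> x))^2) + e"
    using 1 2 3 4 ap(3) by linarith
qed

lemma energy_limit_nonneg:
  assumes "energy_limit S C Q"
  shows "0 \<le> C"
proof -
  obtain \<epsilon> P F where ap: "lattice_approx S C \<epsilon> P F"
    by (rule energy_limit_approx[OF assms, of "{}" 1 1]) auto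
  have "0 \<le> (\<Sum>k\<in>UNIV. \<Sum>i\<in>{i \<in> Z_eps \<epsilon> S. i + axis k 1 \<in> Z_eps \<epsilon> S}. (norm (F (i + axis k 1) - F i))^2)"
    by (intro sum_nonneg) auto
  then show ?thesis using ap unfolding lattice_approx_def by linarith
qed

lemma Linf_sym_integrable:
  assumes "open S" "bounded S" "Q \<in> Linf_sym S"
  shows "integrable (lebesgue_on S) Q" "integrable (lebesgue_on S) (\<lambda>x. (norm (Q x))^2)"
proof -
  interpret fm: finite_measure "lebesgue_on S" by (rule finite_measure_lebesgue_on[OF assms(2,1)])
  obtain B where B: "0 < B" "AE x in lebesgue_on S. norm (Q x) \<le> B" using Linf_sym_bound[OF assms(3)] .
  have [measurable]: "Q \<in> borel_measurable (lebesgue_on S)" using assms(3) by (simp add: Linf_sym_def)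
  show i: "integrable (lebesgue_on S) Q" by (rule fm.integrable_const_bound[OF B(2)]) measurable
  show "integrable (lebesgue_on S) (\<lambda>x. (norm (Q x))^2)"
    using Linf_sym_inner_integrable[OF assms(3) i] by (simp add: power2_norm_eq_inner)
qed

text \<open>By the field estimate, minus the pairing with the divergence is an L^2 functional of
  norm at most sqrt C, so some \<open>D\<close> with squared norm at most \<open>C\<close>
  represents it; fields with a single nonzero component turn this into the definition of the weak
  gradient.\<close>

lemma energy_limit_weak_gradient:
  assumes S: "open S" "bounded S" and lim: "energy_limit S C Q"
  obtains D where "L2_weak_gradient S Q D" "(LINT x|lebesgue_on S. (norm (D x))^2) \<le> C"
proof -
  have Q: "Q \<in> Linf_sym S" using lim by (simp add: energy_limit_def)
  have C0: "0 \<le> C" by (rule energy_limit_nonneg[OF lim])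
  have pint: "integrable (lebesgue_on S) (\<lambda>x. Q x \<bullet> field_div \<psi> x)" if "test_field S \<psi>" for \<psi>
    by (intro Linf_sym_inner_integrable[OF Q] borel_integrable_lebesgue_on[OF S(1)] field_div_integrable[OF that])
  obtain D where D: "D \<in> borel_measurable borel" "\<And>x. x \<notin> S \<Longrightarrow> D x = 0"
    "integrable lborel (\<lambda>x. (norm (D x))^2)" "(LINT x|lborel. (norm (D x))^2) \<le> (sqrt C)^2"
    "\<And>\<psi>. test_field S \<psi> \<Longrightarrow> (LINT x|lborel. D x \<bullet> \<psi> x) = - pairing S Q (field_div \<psi>)"
  proof (rule test_field_Riesz[OF S, of "\<lambda>\<psi>. - pairing S Q (field_div \<psi>)" "sqrt C"])
    fix f g :: "real^2 \<Rightarrow> real^2^2^2" and t assume fg: "test_field S f" "test_field S g"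
    show "- pairing S Q (field_div (\<lambda>x. f x + g x)) = - pairing S Q (field_div f) + - pairing S Q (field_div g)"
      unfolding pairing_def field_div_add[OF fg] inner_add_right
      by (subst Bochner_Integration.integral_add) (use pint fg in auto)
  next
    fix f :: "real^2 \<Rightarrow> real^2^2^2" and t assume f: "test_field S f"
    show "- pairing S Q (field_div (\<lambda>x. t *\<^sub>R f x)) = t * - pairing S Q (field_div f)"
      unfolding pairing_def field_div_scaleR[OF f] by simp
  next
    fix f :: "real^2 \<Rightarrow> real^2^2^2" assume f: "test_field S f"
    show "- pairing S Q (field_div f) \<le> sqrt C * sqrt (LINT x|lborel. (norm (f x))^2)"
      by (rule energy_limit_field_estimate[OF S lim f])
  qed (use C0 in auto)
  note [measurable] = D(1)
  have Dm: "D \<in> borel_measurable (lebesgue_on S)" by (rule borel_measurable_lebesgue_on[OF S(1) D(1)])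
  have toS: "(LINT x|lebesgue_on S. g x) = (LINT x|lborel. g x)" "integrable (lebesgue_on S) g \<longleftrightarrow> integrable lborel g"
    if "g \<in> borel_measurable borel" "\<And>x. x \<notin> S \<Longrightarrow> g x = 0" for g :: "real^2 \<Rightarrow> 'c::euclidean_space"
    using lebesgue_on_borel_integral[OF S(1) borel_measurable_lebesgue_on[OF S(1) that(1)] that] by auto
  have D2: "integrable (lebesgue_on S) (\<lambda>x. (norm (D x))^2)" "(LINT x|lebesgue_on S. (norm (D x))^2) \<le> C"
    using toS[of "\<lambda>x. (norm (D x))^2"] D C0 by auto
  have "L2_weak_gradient S Q D"
    unfolding L2_weak_gradient_def
  proof (intro conjI allI impI)
    show "D \<in> L2 S" using Dm D2 by (simp add: L2_def)
    fix \<phi> k assume \<phi>: "test_function S \<phi>"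
    have dk2: "integrable lborel (\<lambda>y. (norm (D y $ k))^2)"
      by (rule Bochner_Integration.integrable_bound[OF D(3)])
         (use borel_measurable_vec_nth'[OF D(1), of k] in \<open>auto intro!: AE_I2 power_mono simp: Finite_Cartesian_Product.norm_nth_le\<close>)
    have \<phi>2: "integrable lborel (\<lambda>x. (\<phi> x)^2)"
      using test_function_times_integrable[OF \<phi> test_function_integrable[OF \<phi>]] by (simp add: power2_eq_square)
    have i1: "integrable lborel (\<lambda>x. \<phi> x *\<^sub>R D x $ k)"
      by (rule L2_scaleR_integrable[OF _ _ \<phi>2 dk2])
         (use test_function_borel[OF \<phi>] borel_measurable_vec_nth'[OF D(1), of k] in auto)
    have i2: "integrable (lebesgue_on S) (\<lambda>x. \<phi> x *\<^sub>R D x $ k)" by (rule borel_integrable_lebesgue_on[OF S(1) i1])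
    have pk: "test_function S (partial_deriv k \<phi>)" by (rule test_function_partial_deriv[OF \<phi>])
    have i3: "integrable (lebesgue_on S) (\<lambda>x. partial_deriv k \<phi> x *\<^sub>R Q x)"
    proof -
      obtain B where B: "\<And>x. \<bar>partial_deriv k \<phi> x\<bar> \<le> B" "B > 0" using test_function_bounded[OF pk] by metis
      show ?thesis
      proof (rule Bochner_Integration.integrable_bound)
        show "integrable (lebesgue_on S) (\<lambda>x. B *\<^sub>R Q x)" using Linf_sym_integrable(1)[OF S Q] by simp
        show "AE x in lebesgue_on S. norm (partial_deriv k \<phi> x *\<^sub>R Q x) \<le> norm (B *\<^sub>R Q x)"
          using B by (auto intro!: mult_right_mono AE_I2 simp: abs_of_pos)
        have "partial_deriv k \<phi> \<in> borel_measurable (lebesgue_on S)"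
          by (rule borel_measurable_lebesgue_on[OF S(1) test_function_borel[OF pk]])
        then show "(\<lambda>x. partial_deriv k \<phi> x *\<^sub>R Q x) \<in> borel_measurable (lebesgue_on S)"
          using Q by (auto simp: Linf_sym_def)
      qed
    qed
    show "(LINT x|lebesgue_on S. partial_deriv k \<phi> x *\<^sub>R Q x) = - (LINT x|lebesgue_on S. \<phi> x *\<^sub>R D x $ k)"
    proof (rule euclidean_eqI)
      fix b :: "real^2^2" assume b: "b \<in> Basis"
      define \<psi> where "\<psi> x = \<phi> x *\<^sub>R (axis k b :: real^2^2^2)" for x
      have t: "test_field S \<psi>" unfolding \<psi>_def by (rule test_field_scaleR_const[OF \<phi>])
      have fd: "field_div \<psi> x = partial_deriv k \<phi> x *\<^sub>R b" for x
      proof -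
        have z: "partial_deriv j (\<lambda>x. 0) x = 0" for j
          using partial_deriv_eqI[OF has_derivative_const[of 0 "at x"], of j] by simp
        have "partial_deriv j (\<lambda>x. \<psi> x $ j \<bullet> b') x = (if j = k then if b' = b then partial_deriv k \<phi> x else 0 else 0)"
          if "b' \<in> Basis" for j b'
          using that b z by (auto simp: \<psi>_def axis_def inner_Basis)
        then have "field_div \<psi> x = (\<Sum>j\<in>UNIV. \<Sum>b'\<in>Basis. (if j = k then if b' = b then partial_deriv k \<phi> x else 0 else 0) *\<^sub>R b')"
          by (simp add: field_div_def)
        also have "\<dots> = (\<Sum>j\<in>UNIV. \<Sum>b'\<in>Basis. if b' = b then (if j = k then partial_deriv k \<phi> x *\<^sub>R b else 0) else 0)"
          by (intro sum.cong refl) simp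
        also have "\<dots> = partial_deriv k \<phi> x *\<^sub>R b" using b by simp
        finally show ?thesis .
      qed
      have "(LINT x|lebesgue_on S. partial_deriv k \<phi> x *\<^sub>R Q x) \<bullet> b = (LINT x|lebesgue_on S. (partial_deriv k \<phi> x *\<^sub>R Q x) \<bullet> b)"
        by (rule integral_inner_left[symmetric]) (rule i3)
      also have "\<dots> = pairing S Q (field_div \<psi>)" by (simp add: pairing_def fd)
      also have "\<dots> = - (LINT x|lborel. D x \<bullet> \<psi> x)" using D(5)[OF t] by simp
      also have "\<dots> = - (LINT x|lborel. (\<phi> x *\<^sub>R D x $ k) \<bullet> b)"
        by (simp add: \<psi>_def inner_axis)
      also have "\<dots> = - ((LINT x|lborel. \<phi> x *\<^sub>R D x $ k) \<bullet> b)" 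
        by (subst integral_inner_left) (use i1 in auto)
      also have "(LINT x|lborel. \<phi> x *\<^sub>R D x $ k) = (LINT x|lebesgue_on S. \<phi> x *\<^sub>R D x $ k)"
        by (rule toS(1)[symmetric])
           (use D(2) test_function_borel[OF \<phi>] borel_measurable_vec_nth'[OF D(1), of k] in auto)
      finally show "(LINT x|lebesgue_on S. partial_deriv k \<phi> x *\<^sub>R Q x) \<bullet> b = (- (LINT x|lebesgue_on S. \<phi> x *\<^sub>R D x $ k)) \<bullet> b"
        by simp
    qed
  qed
  then show ?thesis using D2(2) by (rule that)
qed

text \<open>Needed because \<open>weak_grad\<close> is an arbitrary choice, on which the limit
  energy must not depend. A Borel version of the difference integrates to zero against all test
  functions and hence vanishes.\<close>

lemma L2_weak_gradient_unique:
  assumes S: "open S" "bounded S" and D: "L2_weak_gradient S Q D" "L2_weak_gradient S Q E"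
  shows "AE x in lebesgue_on S. D x = E x"
proof -
  have DE: "D \<in> L2 S" "E \<in> L2 S" using D by (auto simp: L2_weak_gradient_def)
  define f where "f x = D x + (-1) *\<^sub>R E x" for x
  have fm[measurable]: "f \<in> borel_measurable (lebesgue_on S)" using DE unfolding f_def by (auto simp: L2_def)
  have f2: "integrable (lebesgue_on S) (\<lambda>x. (norm (f x))^2)"
    unfolding f_def by (rule L2_add(1)) (use DE in \<open>auto simp: L2_def\<close>)
  obtain g where g: "g \<in> borel_measurable borel" "\<And>x. x \<notin> S \<Longrightarrow> g x = 0" "AE x in lebesgue_on S. f x = g x"
    using lebesgue_on_borel_rep[OF S(1) fm] by blast
  note [measurable] = g(1) borel_measurable_vec_nth'[OF g(1)]
  have "AE x in lebesgue_on S. (norm (f x))^2 = (norm (g x))^2" using g(3) by eventually_elim simp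
  then have "integrable lborel (\<lambda>x. (norm (g x))^2)"
    using lebesgue_on_borel_integral(2)[OF S(1) _ _ _, of "\<lambda>x. (norm (f x))^2" "\<lambda>x. (norm (g x))^2"] f2 g(2)
    by simp
  moreover have "(\<lambda>x. indicator S x * (norm (g x))^2) = (\<lambda>x. (norm (g x))^2)" "(\<lambda>x. indicator S x *\<^sub>R g x) = g"
    using g(2) by (auto simp: fun_eq_iff indicator_def)
  ultimately have gi: "integrable lborel g" using L2_on_finite_integrable[of g S] S by simp
  have gki: "integrable lborel (\<lambda>x. g x $ k)" for k
    by (rule Bochner_Integration.integrable_bound[OF gi]) (auto intro!: AE_I2 simp: Finite_Cartesian_Product.norm_nth_le)
  have "AE x in lborel. x \<in> S \<longrightarrow> g x $ k = 0" for k
  proof (rule test_function_separating[OF S(1) gki])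
    fix \<phi> assume \<phi>: "test_function S \<phi>"
    have \<phi>m: "\<phi> \<in> borel_measurable (lebesgue_on S)" by (rule borel_measurable_lebesgue_on[OF S(1) test_function_borel[OF \<phi>]])
    have \<phi>2: "integrable (lebesgue_on S) (\<lambda>x. (\<phi> x)^2)"
      using test_function_times_integrable[OF \<phi> test_function_integrable[OF \<phi>]]
      by (intro borel_integrable_lebesgue_on[OF S(1)]) (simp add: power2_eq_square)
    have i: "integrable (lebesgue_on S) (\<lambda>x. \<phi> x *\<^sub>R X x $ k)" if X: "X \<in> L2 S" for X :: "real^2 \<Rightarrow> real^2^2^2"
    proof (rule L2_scaleR_integrable[OF \<phi>m _ \<phi>2])
      show m: "(\<lambda>x. X x $ k) \<in> borel_measurable (lebesgue_on S)"
        by (rule borel_measurable_vec_nth') (use X in \<open>simp add: L2_def\<close>)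
      show "integrable (lebesgue_on S) (\<lambda>x. (norm (X x $ k))^2)"
        by (rule Bochner_Integration.integrable_bound[of _ "\<lambda>x. (norm (X x))^2"])
           (use X m in \<open>auto simp: L2_def intro!: AE_I2 power_mono Finite_Cartesian_Product.norm_nth_le\<close>)
    qed
    have "(LINT x|lebesgue_on S. \<phi> x *\<^sub>R f x $ k) = (LINT x|lborel. \<phi> x *\<^sub>R g x $ k)"
      by (rule lebesgue_on_borel_integral(1)[OF S(1)])
         (use g \<phi>m test_function_borel[OF \<phi>] borel_measurable_vec_nth'[OF fm, of k] in \<open>auto elim!: eventually_mono\<close>)
    moreover have "(LINT x|lebesgue_on S. \<phi> x *\<^sub>R f x $ k) = (LINT x|lebesgue_on S. \<phi> x *\<^sub>R D x $ k) - (LINT x|lebesgue_on S. \<phi> x *\<^sub>R E x $ k)"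
      unfolding f_def using i[OF DE(1)] i[OF DE(2)]
      by (subst Bochner_Integration.integral_diff[symmetric]) (auto simp: scaleR_diff_right)
    moreover have "(LINT x|lebesgue_on S. \<phi> x *\<^sub>R D x $ k) = (LINT x|lebesgue_on S. \<phi> x *\<^sub>R E x $ k)"
    proof -
      have "(LINT x|lebesgue_on S. partial_deriv k \<phi> x *\<^sub>R Q x) = - (LINT x|lebesgue_on S. \<phi> x *\<^sub>R X x $ k)"
        if "L2_weak_gradient S Q X" for X
        using that \<phi> by (simp add: L2_weak_gradient_def)
      from this[OF D(1)] this[OF D(2)] show ?thesis by simp
    qed
    ultimately show "(LINT x|lborel. \<phi> x *\<^sub>R g x $ k) = 0" by simp
  qed
  then have "AE x in lborel. \<forall>k\<in>UNIV. x \<in> S \<longrightarrow> g x $ k = 0"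
    by (subst AE_finite_all) auto
  then have "AE x in lebesgue. x \<in> S \<longrightarrow> g x = 0"
    by (intro AE_completion) (auto elim!: eventually_mono simp: vec_eq_iff)
  then have "AE x in lebesgue_on S. g x = 0" using S by (subst AE_restrict_space_iff) auto
  with g(3) show ?thesis by eventually_elim (simp add: f_def)
qed

section \<open>The limit takes values in the boundary of K\<close>

text \<open>A device for pointwise constraints: if one fixed test field detects the violation
  \<open>f\<close> of a constraint against every approximant, weak* closeness makes the integral of
  \<open>f\<close> arbitrarily small.\<close>

lemma energy_limit_AE_zero:
  fixes f :: "real^2 \<Rightarrow> real"
  assumes S: "open S" "bounded S" and lim: "energy_limit S C Q" and \<Phi>: "integrable (lebesgue_on S) \<Phi>"
    and f: "integrable (lebesgue_on S) f" "\<And>x. 0 \<le> f x"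
    and le: "\<And>\<epsilon> P F. lattice_approx S C \<epsilon> P F \<Longrightarrow> (LINT x|lebesgue_on S. f x) \<le> \<bar>pairing S P \<Phi> - pairing S Q \<Phi>\<bar>"
  shows "AE x in lebesgue_on S. f x = 0"
proof -
  have "(LINT x|lebesgue_on S. f x) \<le> 0"
  proof (rule field_le_epsilon)
    fix e :: real assume e: "0 < e"
    obtain \<epsilon> P F where "lattice_approx S C \<epsilon> P F" "\<bar>pairing S P \<Phi> - pairing S Q \<Phi>\<bar> < e"
    proof (rule energy_limit_approx[OF lim, of "{\<Phi>}" 1 e])
      fix \<epsilon> P F assume "lattice_approx S C \<epsilon> P F"
        "\<And>\<Psi>. \<Psi> \<in> {\<Phi>} \<Longrightarrow> \<bar>pairing S P \<Psi> - pairing S Q \<Psi>\<bar> < e"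
      then show thesis using that by simp
    qed (use e \<Phi> in auto)
    then show "(LINT x|lebesgue_on S. f x) \<le> 0 + e" using le[of \<epsilon> P F] by linarith
  qed
  moreover have "0 \<le> (LINT x|lebesgue_on S. f x)" using f(2) by simp
  ultimately have "(LINT x|lebesgue_on S. f x) = 0" by simp
  then show ?thesis using f by (subst (asm) integral_nonneg_eq_0_iff_AE) auto
qed

lemma inner_mat_1: "(A :: real^2^2) \<bullet> mat 1 = trace A"
  by (simp add: inner_mat2 trace_mat2 mat_def)

text \<open>The test field is (tr Q - 1) I: every approximant has trace 1, so the pairings with
  \<open>Q\<close> and with \<open>P\<close> differ by the integral of (tr Q - 1)^2.\<close>

lemma energy_limit_trace:
  assumes S: "open S" "bounded S" and lim: "energy_limit S C Q"
  shows "AE x in lebesgue_on S. trace (Q x) = 1"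
proof -
  have Q: "Q \<in> Linf_sym S" using lim by (simp add: energy_limit_def)
  interpret fm: finite_measure "lebesgue_on S" by (rule finite_measure_lebesgue_on[OF S(2,1)])
  have Qi: "integrable (lebesgue_on S) Q" by (rule Linf_sym_integrable(1)[OF S Q])
  define t where "t x = trace (Q x) - 1" for x
  have ti: "integrable (lebesgue_on S) t"
  proof -
    have "integrable (lebesgue_on S) (\<lambda>x. Q x \<bullet> mat 1)" using Qi by (intro integrable_inner_left)
    then show ?thesis unfolding t_def inner_mat_1 by simp
  qed
  have \<Phi>: "integrable (lebesgue_on S) (\<lambda>x. t x *\<^sub>R (mat 1 :: real^2^2))" using ti by simp
  have Qt: "integrable (lebesgue_on S) (\<lambda>x. Q x \<bullet> (t x *\<^sub>R mat 1))" by (rule Linf_sym_inner_integrable[OF Q \<Phi>])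
  then have tQ: "integrable (lebesgue_on S) (\<lambda>x. t x * trace (Q x))" by (simp add: inner_mat_1)
  have eq: "(t x)^2 = t x * trace (Q x) - t x" for x by (simp add: t_def power2_eq_square algebra_simps)
  have "AE x in lebesgue_on S. (t x)^2 = 0"
  proof (rule energy_limit_AE_zero[OF S lim \<Phi>])
    show "integrable (lebesgue_on S) (\<lambda>x. (t x)^2)" unfolding eq using tQ ti by simp
    fix \<epsilon> P F assume ap: "lattice_approx S C \<epsilon> P F"
    have "pairing S P (\<lambda>x. t x *\<^sub>R mat 1) = (LINT x|lebesgue_on S. t x)"
      unfolding pairing_def
    proof (rule integral_cong_AE)
      have [measurable]: "P \<in> borel_measurable (lebesgue_on S)" using ap by (auto simp: lattice_approx_def Linf_sym_def)
      note [measurable] = borel_measurable_integrable[OF ti]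
      show "(\<lambda>x. P x \<bullet> (t x *\<^sub>R mat 1)) \<in> borel_measurable (lebesgue_on S)" by measurable
      have "AE x in lebesgue_on S. P x \<in> bd_K" using ap by (auto simp: lattice_approx_def elim!: eventually_mono)
      then show "AE x in lebesgue_on S. P x \<bullet> (t x *\<^sub>R mat 1) = t x"
        by eventually_elim (simp add: inner_mat_1 bd_K_iff)
    qed (use ti in auto)
    moreover have "pairing S Q (\<lambda>x. t x *\<^sub>R mat 1) = (LINT x|lebesgue_on S. t x * trace (Q x))"
      by (simp add: pairing_def inner_mat_1)
    ultimately show "(LINT x|lebesgue_on S. (t x)^2) \<le> \<bar>pairing S P (\<lambda>x. t x *\<^sub>R mat 1) - pairing S Q (\<lambda>x. t x *\<^sub>R mat 1)\<bar>"
      unfolding eq using tQ ti by simp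
  qed simp
  then show ?thesis by eventually_elim (simp add: t_def)
qed

text \<open>The test field is \<open>Q\<close> cut off to the set where |Q| > 1: there Q.Q exceeds
  P.Q by at least |Q|^2 - |Q|, because |P| = 1.\<close>

lemma energy_limit_norm_le:
  assumes S: "open S" "bounded S" and lim: "energy_limit S C Q"
  shows "AE x in lebesgue_on S. norm (Q x) \<le> 1"
proof -
  have Q: "Q \<in> Linf_sym S" using lim by (simp add: energy_limit_def)
  have Qm[measurable]: "Q \<in> borel_measurable (lebesgue_on S)" using Q by (simp add: Linf_sym_def)
  note Qi = Linf_sym_integrable[OF S Q]
  define \<Phi> where "\<Phi> x = (if norm (Q x) > 1 then 1 else 0 :: real) *\<^sub>R Q x" for x
  have \<Phi>m[measurable]: "\<Phi> \<in> borel_measurable (lebesgue_on S)" unfolding \<Phi>_def by measurable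
  have \<Phi>: "integrable (lebesgue_on S) \<Phi>"
    by (rule Bochner_Integration.integrable_bound[OF Qi(1)]) (auto simp: \<Phi>_def)
  define f where "f x = (if norm (Q x) > 1 then 1 else 0) * ((norm (Q x))^2 - norm (Q x))" for x
  have f0: "0 \<le> f x" for x
    unfolding f_def using mult_left_mono[of 1 "norm (Q x)" "norm (Q x)"] by (auto simp: power2_eq_square)
  have fi: "integrable (lebesgue_on S) f"
  proof (rule Bochner_Integration.integrable_bound[OF Qi(2)])
    show "f \<in> borel_measurable (lebesgue_on S)" unfolding f_def by measurable
    show "AE x in lebesgue_on S. norm (f x) \<le> norm ((norm (Q x))^2)"
      using f0 by (intro AE_I2) (auto simp: f_def)
  qed
  have "AE x in lebesgue_on S. f x = 0"
  proof (rule energy_limit_AE_zero[OF S lim \<Phi> fi f0])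
    fix \<epsilon> P F assume ap: "lattice_approx S C \<epsilon> P F"
    have P: "P \<in> Linf_sym S" and Pb: "AE x in lebesgue_on S. P x \<in> bd_K"
      using ap by (auto simp: lattice_approx_def elim!: eventually_mono)
    have "(LINT x|lebesgue_on S. f x) \<le> (LINT x|lebesgue_on S. Q x \<bullet> \<Phi> x - P x \<bullet> \<Phi> x)"
    proof (rule integral_mono_AE[OF fi])
      show "integrable (lebesgue_on S) (\<lambda>x. Q x \<bullet> \<Phi> x - P x \<bullet> \<Phi> x)"
        by (intro Bochner_Integration.integrable_diff Linf_sym_inner_integrable P Q \<Phi>)
      show "AE x in lebesgue_on S. f x \<le> Q x \<bullet> \<Phi> x - P x \<bullet> \<Phi> x"
        using Pb
      proof eventually_elim
        case (elim x)
        have "P x \<bullet> Q x \<le> norm (Q x)"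
          using Cauchy_Schwarz_ineq2[of "P x" "Q x"] elim by (simp add: bd_K_iff)
        then show ?case by (simp add: f_def \<Phi>_def power2_norm_eq_inner)
      qed
    qed
    also have "\<dots> = pairing S Q \<Phi> - pairing S P \<Phi>"
      unfolding pairing_def by (intro Bochner_Integration.integral_diff Linf_sym_inner_integrable P Q \<Phi>)
    finally show "(LINT x|lebesgue_on S. f x) \<le> \<bar>pairing S P \<Phi> - pairing S Q \<Phi>\<bar>" by linarith
  qed
  then show ?thesis
  proof eventually_elim
    case (elim x)
    show ?case
    proof (rule ccontr)
      assume "\<not> norm (Q x) \<le> 1"
      then have "1 < norm (Q x)" by simp
      then have "norm (Q x) * 1 < norm (Q x) * norm (Q x)" by (intro mult_strict_left_mono) auto
      then show False using elim \<open>1 < norm (Q x)\<close> by (simp add: f_def power2_eq_square)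
    qed
  qed
qed

section \<open>Means over cells of a fixed size\<close>

lemma cell_diff_bound:
  assumes "0 < \<delta>" "cell_index \<delta> y = cell_index \<delta> x"
  shows "\<bar>y $ k - x $ k\<bar> \<le> \<delta>" "norm (y - x) \<le> 2 * \<delta>"
proof -
  have *: "\<bar>y $ k - x $ k\<bar> \<le> \<delta>" for k
    using cell_index_close(1)[OF assms(1), of x k] cell_index_close(1)[OF assms(1), of y k] unfolding assms(2) by linarith
  then show "\<bar>y $ k - x $ k\<bar> \<le> \<delta>" .
  show "norm (y - x) \<le> 2 * \<delta>" using * by (intro norm_le_of_components(1)) simp
qed

lemma emeasure_square:
  assumes "0 \<le> \<delta>"
  shows "emeasure lborel {w :: real^2. \<forall>k. \<bar>w $ k\<bar> \<le> \<delta>} = ennreal (4 * \<delta>^2)"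
proof -
  have eq: "{w :: real^2. \<forall>k. \<bar>w $ k\<bar> \<le> \<delta>} = cbox (- (\<chi> k. \<delta>)) (\<chi> k. \<delta>)"
  proof -
    have "\<bar>w $ k\<bar> \<le> \<delta> \<longleftrightarrow> - \<delta> \<le> w $ k \<and> w $ k \<le> \<delta>" for w :: "real^2" and k by linarith
    then show ?thesis by (simp add: mem_box_cart set_eq_iff)
  qed
  have e: "((\<chi> k. \<delta>) - (- (\<chi> k. \<delta>)) :: real^2) \<bullet> e = 2 * \<delta>" "(- (\<chi> k. \<delta>) :: real^2) \<bullet> e \<le> (\<chi> k. \<delta>) \<bullet> e" if "e \<in> Basis" for e
    using Basis_axis[OF that] assms by (auto simp: inner_axis)
  have "(\<Prod>e\<in>Basis. ((\<chi> k. \<delta>) - (- (\<chi> k. \<delta>)) :: real^2) \<bullet> e) = (\<Prod>e\<in>(Basis :: (real^2) set). 2 * \<delta>)"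
    by (rule prod.cong[OF refl]) (rule e)
  then show ?thesis unfolding eq using e(2)
    by (subst emeasure_lborel_cbox) (auto simp: power2_eq_square)
qed

text \<open>Twice each defect is at most 1/\<delta>^4 times the oscillation over one cell. All cells
  are collected in one kernel \<rho>, so that the translation estimate is used once over their union
  and not cell by cell. With shifts in a square of area 4 \<delta>^2 and \<delta> + 2 \<epsilon>
  \<le> 3 \<delta> the oscillation is at most 4 \<delta>^2 times 36 \<delta>^2 C; this leaves 144 C,
  halved to 72 C, and \<delta> has dropped out.\<close>

lemma cell_means_norm_ge:
  fixes F :: "real^2 \<Rightarrow> real^2^2"
  assumes e: "0 < \<epsilon>" "\<epsilon> \<le> \<delta>" and Z: "finite Z" "Z \<subseteq> lattice" and F0: "\<And>i. i \<notin> Z \<Longrightarrow> F i = 0"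
    and F1: "\<And>i. i \<in> Z \<Longrightarrow> norm (F i) = 1"
    and J: "finite J" "J \<subseteq> lattice"
    and JZ: "\<And>y z. cell_index \<delta> y \<in> J \<Longrightarrow> norm (z - y) \<le> 2 * \<delta> + 3 * \<epsilon> \<Longrightarrow> cell_index \<epsilon> z \<in> Z"
    and C: "(\<Sum>k\<in>UNIV. \<Sum>i\<in>{i \<in> Z. i + axis k 1 \<in> Z}. (norm (F (i + axis k 1) - F i))^2) \<le> C"
  shows "(\<Sum>j\<in>J. 1 - (norm (LINT y|lborel. (indicator {y. cell_index \<delta> y = j} y / \<delta>^2) *\<^sub>R F (cell_index \<epsilon> y)))^2) \<le> 72 * C"
proof -
  have d: "0 < \<delta>" using e by simp
  define p where "p y = F (cell_index \<epsilon> y)" for y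
  have pm[measurable]: "p \<in> borel_measurable borel"
    using step_function_measurable[OF Z(1) F0, where \<epsilon> = \<epsilon> and v = 0] by (simp add: p_def[abs_def])
  define B where "B j = {y. cell_index \<delta> y = j}" for j
  have Bm[measurable]: "B j \<in> sets borel" for j unfolding B_def by measurable
  define m where "m j = (LINT y|lborel. (indicator (B j) y / \<delta>^2) *\<^sub>R p y)" for j
  define a where "a j = 2 * (1 - (norm (m j))^2)" for j
  define I where "I j = (\<integral>\<^sup>+y. \<integral>\<^sup>+z. indicator (B j) y * indicator (B j) z * ennreal ((norm (p z - p y))^2) \<partial>lborel \<partial>lborel)" for j
  have C0: "0 \<le> C" using C by (rule order_trans[rotated]) (auto intro!: sum_nonneg)
  have a_le: "ennreal (a j) \<le> ennreal ((1 / \<delta>^2)^2) * I j" if j: "j \<in> J" for j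
    unfolding a_def m_def I_def
  proof (rule weighted_mean_norm)
    have mB: "emeasure lborel (B j) = ennreal (\<delta>^2)" using cell_measure[OF d, of j] J j by (auto simp: B_def)
    then have ib: "integrable lborel (indicat_real (B j))" by (simp add: integrable_indicator_iff)
    show "integrable lborel (\<lambda>y. indicat_real (B j) y / \<delta>^2)" using ib by simp
    show "(LINT y|lborel. indicat_real (B j) y / \<delta>^2) = 1"
      using ib mB d by (simp add: measure_def)
    show "norm (p y) = 1" if "y \<in> B j" for y
      unfolding p_def by (intro F1 JZ[of y y]) (use that j d e in \<open>auto simp: B_def\<close>)
    show "indicat_real (B j) y / \<delta>^2 \<le> 1 / \<delta>^2" for y by (auto simp: indicator_def)
  qed auto
  define W where "W = {w :: real^2. \<forall>k. \<bar>w $ k\<bar> \<le> \<delta>}"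
  define \<rho> :: "real^2 \<Rightarrow> real^2 \<Rightarrow> ennreal" where "\<rho> y z = (\<Sum>j\<in>J. indicator (B j) y * indicator (B j) z)" for y z
  have Wm[measurable]: "W \<in> sets borel" unfolding W_def by (rule square_borel)
  have \<rho>m[measurable]: "(\<lambda>(y, z). \<rho> y z) \<in> borel_measurable (borel \<Otimes>\<^sub>M borel)"
    unfolding \<rho>_def by measurable
  have \<rho>1: "\<rho> y z = (if cell_index \<delta> y = cell_index \<delta> z \<and> cell_index \<delta> y \<in> J then 1 else 0)" for y z
  proof -
    have "\<rho> y z = (\<Sum>j\<in>J. if j = cell_index \<delta> y then (if cell_index \<delta> y = cell_index \<delta> z then 1 else 0) else 0)"
      unfolding \<rho>_def by (intro sum.cong refl) (auto simp: B_def indicator_def)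
    then show ?thesis using J by simp
  qed
  define A where "A = {y. cell_index \<delta> y \<in> J}"
  have Am[measurable]: "A \<in> sets borel"
  proof -
    have "A = (\<Union>j\<in>J. B j)" by (auto simp: A_def B_def)
    then show ?thesis using J by auto
  qed
  have "(\<Sum>j\<in>J. I j) = (\<integral>\<^sup>+y. \<integral>\<^sup>+z. \<rho> y z * ennreal ((norm (p z - p y))^2) \<partial>lborel \<partial>lborel)"
  proof -
    have "(\<Sum>j\<in>J. I j) = (\<integral>\<^sup>+y. (\<Sum>j\<in>J. \<integral>\<^sup>+z. indicator (B j) y * indicator (B j) z * ennreal ((norm (p z - p y))^2) \<partial>lborel) \<partial>lborel)"
      unfolding I_def by (rule nn_integral_sum[symmetric]) measurable
    also have "\<dots> = (\<integral>\<^sup>+y. (\<integral>\<^sup>+z. (\<Sum>j\<in>J. indicator (B j) y * indicator (B j) z * ennreal ((norm (p z - p y))^2)) \<partial>lborel) \<partial>lborel)"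
      by (intro nn_integral_cong nn_integral_sum[symmetric]) measurable
    finally show ?thesis by (simp add: \<rho>_def sum_distrib_right)
  qed
  also have "\<dots> \<le> emeasure lborel W * ennreal (36 * \<delta>^2 * C)"
  proof (rule nn_integral_oscillation_le)
    show "\<rho> y z = 0" if "z - y \<notin> W" for y z
      using that cell_diff_bound(1)[OF d, of z y] unfolding \<rho>1 W_def by auto
    fix w assume w: "w \<in> W"
    have "(\<integral>\<^sup>+y. \<rho> y (y + w) * ennreal ((norm (p (y + w) - p y))^2) \<partial>lborel) \<le>
        (\<integral>\<^sup>+y. indicator A y * ennreal ((norm (p (y + w) - p y))^2) \<partial>lborel)"
      unfolding \<rho>1 A_def by (intro nn_integral_mono) (auto simp: indicator_def)
    also have "\<dots> \<le> ennreal (4 * (\<delta> + 2 * \<epsilon>)^2 * (\<Sum>k\<in>UNIV. \<Sum>i\<in>{i \<in> Z. i + axis k 1 \<in> Z}. (norm (F (i + axis k 1) - F i))^2))"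
      unfolding p_def
      by (rule lattice_translation_le[OF e(1) Z F0 Am]) (use w JZ in \<open>auto simp: W_def A_def\<close>)
    also have "\<dots> \<le> ennreal (36 * \<delta>^2 * C)"
    proof (rule ennreal_leI)
      have "(\<delta> + 2 * \<epsilon>)^2 \<le> (3 * \<delta>)^2" using e d by (intro power_mono) auto
      then have "4 * (\<delta> + 2 * \<epsilon>)^2 \<le> 36 * \<delta>^2" by (simp add: power_mult_distrib)
      then show "4 * (\<delta> + 2 * \<epsilon>)^2 * (\<Sum>k\<in>UNIV. \<Sum>i\<in>{i \<in> Z. i + axis k 1 \<in> Z}. (norm (F (i + axis k 1) - F i))^2) \<le> 36 * \<delta>^2 * C"
        using C by (rule mult_mono) (auto intro!: sum_nonneg)
    qed
    finally show "(\<integral>\<^sup>+y. \<rho> y (y + w) * ennreal ((norm (p (y + w) - p y))^2) \<partial>lborel) \<le> ennreal (36 * \<delta>^2 * C)" .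
  qed measurable
  also have "\<dots> = ennreal (4 * \<delta>^2 * (36 * \<delta>^2 * C))"
  proof -
    have "emeasure lborel W = ennreal (4 * \<delta>^2)" unfolding W_def using d by (intro emeasure_square) simp
    then show ?thesis using C0 by (simp only:) (rule ennreal_mult[symmetric], auto)
  qed
  finally have SI: "(\<Sum>j\<in>J. I j) \<le> ennreal (4 * \<delta>^2 * (36 * \<delta>^2 * C))" .
  \<comment> \<open>The truncation is needed because \<open>ennreal\<close> sends negative reals to
    0, so only nonnegative terms can be summed on either side.\<close>
  have "ennreal (\<Sum>j\<in>J. max 0 (a j)) = (\<Sum>j\<in>J. ennreal (max 0 (a j)))"
    by (rule sum_ennreal[symmetric]) auto
  also have "\<dots> = (\<Sum>j\<in>J. ennreal (a j))" by (intro sum.cong refl) (simp add: ennreal_max_0)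
  also have "\<dots> \<le> (\<Sum>j\<in>J. ennreal ((1 / \<delta>^2)^2) * I j)" by (intro sum_mono a_le)
  also have "\<dots> = ennreal ((1 / \<delta>^2)^2) * (\<Sum>j\<in>J. I j)" by (rule sum_distrib_left[symmetric])
  also have "\<dots> \<le> ennreal ((1 / \<delta>^2)^2) * ennreal (4 * \<delta>^2 * (36 * \<delta>^2 * C))" by (intro mult_left_mono SI) simp
  also have "\<dots> = ennreal ((1 / \<delta>^2)^2 * (4 * \<delta>^2 * (36 * \<delta>^2 * C)))" using C0 by (intro ennreal_mult[symmetric]) auto
  also have "(1 / \<delta>^2)^2 * (4 * \<delta>^2 * (36 * \<delta>^2 * C)) = 144 * C" using d by (simp add: power2_eq_square)
  finally have "(\<Sum>j\<in>J. max 0 (a j)) \<le> 144 * C" using C0 by (simp add: ennreal_le_iff)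
  moreover have "(\<Sum>j\<in>J. a j) \<le> (\<Sum>j\<in>J. max 0 (a j))" by (intro sum_mono) simp
  moreover have "(\<Sum>j\<in>J. a j) = 2 * (\<Sum>j\<in>J. 1 - (norm (m j))^2)" by (simp add: a_def sum_distrib_left)
  ultimately show ?thesis by (simp add: m_def B_def p_def)
qed

text \<open>On a grid of fixed size \<delta> the cell means are finitely many weak* continuous
  quantities, so the bound 72 C on the total defect passes from the approximants to
  \<open>q\<close>. By Jensen the mean of 1 - |q|^2 over a cell is at most the defect of the mean.
  Multiplying by the cell area bounds the integral by 72 C \<delta>^2, where \<delta> is
  free.\<close>

lemma energy_limit_norm_eq_on_compact:
  assumes S: "open S" "bounded S" and lim: "energy_limit S C Q"
    and T: "compact T" "T \<subseteq> S"
    and q: "q \<in> borel_measurable borel" "AE x in lebesgue_on S. Q x = q x" and q1: "\<And>x. norm (q x) \<le> 1"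
  shows "(LINT x|lborel. indicator T x * (1 - (norm (q x))^2)) \<le> 0"
proof -
  note [measurable] = q(1)
  have Q: "Q \<in> Linf_sym S" using lim by (simp add: energy_limit_def)
  obtain d where d: "d > 0" "\<And>x z. x \<in> T \<Longrightarrow> norm (z - x) < d \<Longrightarrow> z \<in> S"
    using compact_subset_open_margin[OF T S(1)] by blast
  have [measurable]: "T \<in> sets borel" using T(1) by (simp add: borel_compact)
  \<comment> \<open>The margin: a point of a cell meeting \<open>T\<close> is within 2 \<delta> of
    \<open>T\<close>, and the translation estimate looks 2 \<delta> + 3 \<epsilon> further, plus one
    \<epsilon> for the cell centre; with \<epsilon> < \<delta> this is less than 8 \<delta>.\<close>
  have est: "(LINT x|lborel. indicator T x * (1 - (norm (q x))^2)) \<le> 72 * C * \<delta>^2" if \<delta>: "0 < \<delta>" "9 * \<delta> < d" for \<delta>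
  proof -
    define J where "J = cell_index \<delta> ` T"
    have JS: "cell_index \<delta> x \<in> Z_eps \<delta> S" if "x \<in> T" for x
      by (rule cell_index_in_Z_eps[OF \<delta>(1), of x d]) (use d that \<delta> in auto)
    then have "J \<subseteq> Z_eps \<delta> S" by (auto simp: J_def)
    then have J: "finite J" "J \<subseteq> lattice"
      using finite_Z_eps[OF \<delta>(1) S(2)] Z_eps_lattice by (auto intro: finite_subset)
    have near: "\<exists>x\<in>T. norm (y - x) \<le> 2 * \<delta>" if "cell_index \<delta> y \<in> J" for y
      using that cell_diff_bound(2)[OF \<delta>(1), of y] by (auto simp: J_def)
    define B where "B j = {y. cell_index \<delta> y = j}" for j
    have Bm[measurable]: "B j \<in> sets borel" for j unfolding B_def by measurable
    have BS: "B j \<subseteq> S" if j: "j \<in> J" for j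
    proof
      fix y assume "y \<in> B j"
      then obtain x where "x \<in> T" "norm (y - x) \<le> 2 * \<delta>" using near[of y] j by (auto simp: B_def)
      then show "y \<in> S" using d(2)[of x y] \<delta> by simp
    qed
    have mB: "emeasure lborel (B j) = ennreal (\<delta>^2)" if "j \<in> J" for j
      using cell_measure[OF \<delta>(1), of j] J that by (auto simp: B_def)
    define k where "k j y = indicat_real (B j) y / \<delta>^2" for j y
    have km[measurable]: "k j \<in> borel_measurable borel" for j unfolding k_def by measurable
    have ki: "integrable lborel (k j)" "(LINT y|lborel. k j y) = 1" if "j \<in> J" for j
    proof -
      have ib: "integrable lborel (indicat_real (B j))" using mB[OF that] by (simp add: integrable_indicator_iff)
      then show "integrable lborel (k j)" unfolding k_def by simp
      show "(LINT y|lborel. k j y) = 1" unfolding k_def using ib mB[OF that] \<delta> by (simp add: measure_def)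
    qed
    have k0: "0 \<le> k j y" for j y by (simp add: k_def)
    have kfi: "integrable lborel (\<lambda>y. k j y *\<^sub>R f y)"
      if "j \<in> J" "f \<in> borel_measurable borel" "\<And>y. norm (f y) \<le> 1" for j and f :: "real^2 \<Rightarrow> 'c::euclidean_space"
    proof (rule Bochner_Integration.integrable_bound[OF ki(1)[OF that(1)]])
      show "(\<lambda>y. k j y *\<^sub>R f y) \<in> borel_measurable lborel" using that(2) by simp
      show "AE y in lborel. norm (k j y *\<^sub>R f y) \<le> norm (k j y)"
        using that(3) k0 by (intro AE_I2) (simp add: mult_left_le)
    qed
    define m where "m j f = (LINT y|lborel. k j y *\<^sub>R f y)" for j and f :: "real^2 \<Rightarrow> real^2^2"
    have m1: "norm (m j f) \<le> 1" if "j \<in> J" "f \<in> borel_measurable borel" "\<And>y. norm (f y) \<le> 1" for j f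
    proof -
      have "norm (m j f) \<le> (LINT y|lborel. norm (k j y *\<^sub>R f y))" unfolding m_def by (rule integral_norm_bound)
      also have "\<dots> \<le> (LINT y|lborel. k j y)"
        by (rule integral_mono[OF integrable_norm[OF kfi[OF that]] ki(1)[OF that(1)]])
           (use that(3) k0 in \<open>simp add: mult_left_le\<close>)
      finally show ?thesis using ki(2)[OF that(1)] by simp
    qed
    have sum_le: "(\<Sum>j\<in>J. 1 - (norm (m j q))^2) \<le> 72 * C"
    proof (rule field_le_epsilon)
      fix e :: real assume e: "0 < e"
      \<comment> \<open>Chosen so that the errors of all components of all cell means together stay
        below \<open>e\<close>.\<close>
      define \<eta> where "\<eta> = e / (2 * (of_nat (card (Basis :: (real^2^2) set)) * (of_nat (card J) + 1)))"
      have \<eta>0: "0 < \<eta>" unfolding \<eta>_def using e by (intro divide_pos_pos mult_pos_pos) auto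
      \<comment> \<open>Pairing with the normalised indicator of a cell times a basis matrix gives
        one entry of the mean over that cell.\<close>
      define A where "A = (\<lambda>(j, b) y. k j y *\<^sub>R b) ` (J \<times> (Basis :: (real^2^2) set))"
      obtain \<epsilon> P F where ap: "\<epsilon> < \<delta>" "lattice_approx S C \<epsilon> P F"
        "\<And>\<Phi>. \<Phi> \<in> A \<Longrightarrow> \<bar>pairing S P \<Phi> - pairing S Q \<Phi>\<bar> < \<eta>"
      proof (rule energy_limit_approx[OF lim, of A \<delta> \<eta>])
        show "finite A" unfolding A_def using J by (intro finite_imageI finite_cartesian_product) auto
        show "integrable (lebesgue_on S) \<Phi>" if "\<Phi> \<in> A" for \<Phi>
          using that ki(1) by (auto simp: A_def intro!: borel_integrable_lebesgue_on[OF S(1)])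
        fix \<epsilon> P F assume "\<epsilon> < \<delta>" "lattice_approx S C \<epsilon> P F"
          "\<And>\<Phi>. \<Phi> \<in> A \<Longrightarrow> \<bar>pairing S P \<Phi> - pairing S Q \<Phi>\<bar> < \<eta>"
        then show thesis using that by blast
      qed (use \<delta> \<eta>0 in auto)
      define Z where "Z = Z_eps \<epsilon> S"
      have eps: "0 < \<epsilon>" and P: "P \<in> Linf_sym S" and F0: "\<And>i. i \<notin> Z \<Longrightarrow> F i = 0"
        and FK: "\<And>i. i \<in> Z \<Longrightarrow> F i \<in> bd_K"
        and AEP: "AE x in lebesgue_on S. P x \<in> bd_K \<and> (cell_index \<epsilon> x \<in> Z \<longrightarrow> P x = F (cell_index \<epsilon> x))"
        and en: "(\<Sum>k\<in>UNIV. \<Sum>i\<in>{i \<in> Z. i + axis k 1 \<in> Z}. (norm (F (i + axis k 1) - F i))^2) \<le> C"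
        using ap(2) by (auto simp: lattice_approx_def Z_def)
      have Z: "finite Z" "Z \<subseteq> lattice" using finite_Z_eps[OF eps S(2)] Z_eps_lattice by (auto simp: Z_def)
      define p where "p y = F (cell_index \<epsilon> y)" for y
      have pm[measurable]: "p \<in> borel_measurable borel"
        using step_function_measurable[OF Z(1) F0, where \<epsilon> = \<epsilon> and v = 0] by (simp add: p_def[abs_def])
      have F1: "norm (F i) = 1" if "i \<in> Z" for i using FK[OF that] by (simp add: bd_K_iff)
      have p1: "norm (p y) \<le> 1" for y using F1 F0 by (cases "cell_index \<epsilon> y \<in> Z") (auto simp: p_def)
      have JZ: "cell_index \<epsilon> z \<in> Z" if yz: "cell_index \<delta> y \<in> J" "norm (z - y) \<le> 2 * \<delta> + 3 * \<epsilon>" for y z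
      proof -
        obtain x where x: "x \<in> T" "norm (y - x) \<le> 2 * \<delta>" using near[OF yz(1)] by blast
        have "norm (z - x) \<le> norm (z - y) + norm (y - x)" using norm_triangle_ineq[of "z - y" "y - x"] by simp
        then have "norm (z - x) + \<epsilon> < d" using x yz ap(1) \<delta> by linarith
        then show ?thesis unfolding Z_def by (intro cell_index_in_Z_eps[OF eps, of x d]) (use d x in auto)
      qed
      have mp: "(\<Sum>j\<in>J. 1 - (norm (m j p))^2) \<le> 72 * C"
        using cell_means_norm_ge[OF eps _ Z F0 F1 J JZ en, of \<delta>] ap(1) by (simp add: m_def k_def B_def p_def)
      have close: "(norm (m j p))^2 \<le> (norm (m j q))^2 + 2 * of_nat (card (Basis :: (real^2^2) set)) * \<eta>" if j: "j \<in> J" for j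
      proof -
        have comp: "\<bar>(m j p - m j q) \<bullet> b\<bar> \<le> \<eta>" if b: "b \<in> Basis" for b
        proof -
          define \<Phi> where "\<Phi> y = k j y *\<^sub>R b" for y
          have "\<Phi> \<in> A" unfolding A_def \<Phi>_def[abs_def] using j b by (intro image_eqI[of _ _ "(j, b)"]) auto
          have out: "k j y = 0" if "y \<notin> S" for y using BS[OF j] that by (auto simp: k_def indicator_def)
          have kS: "k j \<in> borel_measurable (lebesgue_on S)" by (rule borel_measurable_lebesgue_on[OF S(1) km])
          have pairP: "pairing S P \<Phi> = m j p \<bullet> b"
          proof -
            have "pairing S P \<Phi> = (LINT y|lborel. p y \<bullet> \<Phi> y)"
              unfolding pairing_def
            proof (rule lebesgue_on_borel_integral(1)[OF S(1)])
              show "(\<lambda>x. P x \<bullet> \<Phi> x) \<in> borel_measurable (lebesgue_on S)"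
                using P kS unfolding \<Phi>_def Linf_sym_def by auto
              show "(\<lambda>x. p x \<bullet> \<Phi> x) \<in> borel_measurable borel" unfolding \<Phi>_def by measurable
              show "p x \<bullet> \<Phi> x = 0" if "x \<notin> S" for x using out[OF that] by (simp add: \<Phi>_def)
              show "AE x in lebesgue_on S. P x \<bullet> \<Phi> x = p x \<bullet> \<Phi> x"
                using AEP
              proof eventually_elim
                case (elim x)
                show ?case
                proof (cases "x \<in> B j")
                  case True
                  then have "cell_index \<epsilon> x \<in> Z" using JZ[of x x] j \<delta> eps by (auto simp: B_def)
                  then show ?thesis using elim by (simp add: p_def)
                qed (simp add: \<Phi>_def k_def)
              qed
            qed
            also have "\<dots> = (LINT y|lborel. (k j y *\<^sub>R p y) \<bullet> b)" by (simp add: \<Phi>_def)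
            also have "\<dots> = m j p \<bullet> b" unfolding m_def by (rule integral_inner_left) (rule kfi[OF j pm p1])
            finally show ?thesis .
          qed
          have pairQ: "pairing S Q \<Phi> = m j q \<bullet> b"
          proof -
            have "pairing S Q \<Phi> = (LINT y|lborel. q y \<bullet> \<Phi> y)"
              unfolding pairing_def
            proof (rule lebesgue_on_borel_integral(1)[OF S(1)])
              show "(\<lambda>x. Q x \<bullet> \<Phi> x) \<in> borel_measurable (lebesgue_on S)"
                using Q kS unfolding \<Phi>_def Linf_sym_def by auto
              show "(\<lambda>x. q x \<bullet> \<Phi> x) \<in> borel_measurable borel" unfolding \<Phi>_def by measurable
              show "q x \<bullet> \<Phi> x = 0" if "x \<notin> S" for x using out[OF that] by (simp add: \<Phi>_def)
              show "AE x in lebesgue_on S. Q x \<bullet> \<Phi> x = q x \<bullet> \<Phi> x"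
                using q(2) by eventually_elim simp
            qed
            also have "\<dots> = (LINT y|lborel. (k j y *\<^sub>R q y) \<bullet> b)" by (simp add: \<Phi>_def)
            also have "\<dots> = m j q \<bullet> b" unfolding m_def by (rule integral_inner_left) (rule kfi[OF j q(1) q1])
            finally show ?thesis .
          qed
          show ?thesis using ap(3)[OF \<open>\<Phi> \<in> A\<close>] unfolding pairP pairQ by (simp add: inner_diff_left)
        qed
        have "norm (m j p - m j q) \<le> (\<Sum>b\<in>Basis. \<bar>(m j p - m j q) \<bullet> b\<bar>)" by (rule norm_le_l1)
        also have "\<dots> \<le> (\<Sum>b\<in>(Basis :: (real^2^2) set). \<eta>)" by (intro sum_mono comp)
        finally have n: "norm (m j p - m j q) \<le> of_nat (card (Basis :: (real^2^2) set)) * \<eta>" by simp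
        \<comment> \<open>The squares are compared through the factor |m p| + |m q|, which is at
          most 2.\<close>
        have "norm (m j p) - norm (m j q) \<le> norm (m j p - m j q)" by (rule norm_triangle_ineq2)
        then have "(norm (m j p) - norm (m j q)) * (norm (m j p) + norm (m j q)) \<le> (of_nat (card (Basis :: (real^2^2) set)) * \<eta>) * 2"
          using n m1[OF j pm p1] m1[OF j q(1) q1] \<eta>0 by (intro mult_mono) auto
        then show ?thesis by (simp add: power2_eq_square algebra_simps)
      qed
      have "(\<Sum>j\<in>J. 1 - (norm (m j q))^2) \<le> (\<Sum>j\<in>J. (1 - (norm (m j p))^2) + 2 * of_nat (card (Basis :: (real^2^2) set)) * \<eta>)"
      proof (rule sum_mono)
        fix j assume "j \<in> J"
        then show "1 - (norm (m j q))^2 \<le> (1 - (norm (m j p))^2) + 2 * of_nat (card (Basis :: (real^2^2) set)) * \<eta>"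
          using close[of j] by linarith
      qed
      also have "\<dots> = (\<Sum>j\<in>J. 1 - (norm (m j p))^2) + of_nat (card J) * (2 * of_nat (card (Basis :: (real^2^2) set)) * \<eta>)"
        unfolding sum.distrib by simp
      also have "\<dots> \<le> 72 * C + e"
      proof (rule add_mono[OF mp])
        define c where "c = real (card (Basis :: (real^2^2) set))"
        have "0 < c" by (simp add: c_def)
        have "2 * c * \<eta> = e / (of_nat (card J) + 1)"
          using \<open>0 < c\<close> unfolding \<eta>_def c_def[symmetric] by simp
        then have "of_nat (card J) * (2 * c * \<eta>) = e * (of_nat (card J) / (of_nat (card J) + 1))" by simp
        also have "\<dots> \<le> e * 1" using e by (intro mult_left_mono) auto
        finally show "of_nat (card J) * (2 * of_nat (card (Basis :: (real^2^2) set)) * \<eta>) \<le> e" by (simp add: c_def)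
      qed
      finally show "(\<Sum>j\<in>J. 1 - (norm (m j q))^2) \<le> 72 * C + e" .
    qed
    define s where "s y = 1 - (norm (q y))^2" for y
    have s01: "0 \<le> s y" "norm (s y) \<le> 1" for y using power_le_one[OF norm_ge_zero q1, of y 2] by (auto simp: s_def)
    have sm[measurable]: "s \<in> borel_measurable borel" unfolding s_def by measurable
    have ksi: "integrable lborel (\<lambda>y. k j y * s y)" if "j \<in> J" for j
      using kfi[OF that sm s01(2)] by simp
    have jensen: "(LINT y|lborel. k j y * s y) \<le> 1 - (norm (m j q))^2" if j: "j \<in> J" for j
    proof -
      have i1: "integrable lborel (\<lambda>y. k j y *\<^sub>R q y)" by (rule kfi[OF j q(1) q1])
      have i2: "integrable lborel (\<lambda>y. k j y * (norm (q y))^2)"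
        using kfi[OF j, of "\<lambda>y. (norm (q y))^2"] power_le_one[OF norm_ge_zero q1, of _ 2] by simp
      have "0 \<le> (LINT y|lborel. k j y * (norm (q y - m j q))^2)" using k0 by simp
      also have "\<dots> = (LINT y|lborel. k j y * (norm (q y))^2 - 2 * ((k j y *\<^sub>R q y) \<bullet> m j q) + k j y * (norm (m j q))^2)"
        by (intro Bochner_Integration.integral_cong)
           (simp_all add: power2_norm_eq_inner inner_diff_left inner_diff_right inner_commute algebra_simps)
      also have "\<dots> = (LINT y|lborel. k j y * (norm (q y))^2) - 2 * ((LINT y|lborel. k j y *\<^sub>R q y) \<bullet> m j q) + (norm (m j q))^2"
        using i1 i2 ki[OF j] by (simp del: inner_scaleR_left)
      also have "\<dots> = (LINT y|lborel. k j y * (norm (q y))^2) - (norm (m j q))^2"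
        by (simp add: m_def[symmetric] power2_norm_eq_inner)
      finally have "(norm (m j q))^2 \<le> (LINT y|lborel. k j y * (norm (q y))^2)" by simp
      moreover have "(LINT y|lborel. k j y * s y) = 1 - (LINT y|lborel. k j y * (norm (q y))^2)"
        using i2 ki[OF j] by (simp add: s_def right_diff_distrib)
      ultimately show ?thesis by simp
    qed
    have "(LINT x|lborel. indicator T x * s x) \<le> (LINT x|lborel. \<delta>^2 * (\<Sum>j\<in>J. k j x * s x))"
    proof (rule integral_mono)
      have "integrable lborel (indicat_real T)"
        using emeasure_compact_finite[OF T(1)] by (simp add: integrable_indicator_iff)
      then show "integrable lborel (\<lambda>x. indicat_real T x * s x)"
        by (rule Bochner_Integration.integrable_bound) (use s01 in \<open>auto simp: indicator_def\<close>)
      show "integrable lborel (\<lambda>x. \<delta>^2 * (\<Sum>j\<in>J. k j x * s x))" using ksi by simp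
      fix x
      show "indicator T x * s x \<le> \<delta>^2 * (\<Sum>j\<in>J. k j x * s x)"
      proof (cases "x \<in> T")
        case True
        then have "cell_index \<delta> x \<in> J" by (auto simp: J_def)
        then have "k (cell_index \<delta> x) x * s x \<le> (\<Sum>j\<in>J. k j x * s x)"
          using J k0 s01 by (intro member_le_sum) auto
        then have "\<delta>^2 * (k (cell_index \<delta> x) x * s x) \<le> \<delta>^2 * (\<Sum>j\<in>J. k j x * s x)" by (rule mult_left_mono) simp
        then show ?thesis using True \<delta> by (simp add: k_def B_def)
      qed (use k0 s01 in \<open>auto intro!: mult_nonneg_nonneg sum_nonneg\<close>)
    qed
    also have "\<dots> = \<delta>^2 * (\<Sum>j\<in>J. LINT x|lborel. k j x * s x)" using ksi by simp
    also have "\<dots> \<le> \<delta>^2 * (\<Sum>j\<in>J. 1 - (norm (m j q))^2)" by (intro mult_left_mono sum_mono jensen) auto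
    also have "\<dots> \<le> \<delta>^2 * (72 * C)" by (intro mult_left_mono sum_le) simp
    finally show ?thesis by (simp add: s_def mult_ac)
  qed
  show ?thesis
  proof (rule tendsto_lowerbound)
    show "((\<lambda>\<delta>. 72 * C * \<delta>^2) \<longlongrightarrow> 0) (at_right 0)"
      by (rule tendsto_eq_rhs, (rule tendsto_intros)+) simp
    show "eventually (\<lambda>\<delta>. (LINT x|lborel. indicator T x * (1 - (norm (q x))^2)) \<le> 72 * C * \<delta>^2) (at_right 0)"
      unfolding eventually_at_right_field using est d(1) by (intro exI[of _ "d / 9"]) auto
  qed simp
qed

text \<open>The compact estimate is applied to closed balls in \<open>S\<close>, and countably many
  of the open balls cover \<open>S\<close>; with symmetry and trace this gives all the equations
  that describe \<open>bd_K\<close>.\<close>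

lemma energy_limit_bd_K:
  assumes S: "open S" "bounded S" and lim: "energy_limit S C Q"
  shows "AE x in lebesgue_on S. Q x \<in> bd_K"
proof -
  have Q: "Q \<in> Linf_sym S" using lim by (simp add: energy_limit_def)
  then have Qm: "Q \<in> borel_measurable (lebesgue_on S)" by (simp add: Linf_sym_def)
  obtain q0 where q0: "q0 \<in> borel_measurable borel" "\<And>x. x \<notin> S \<Longrightarrow> q0 x = 0" "AE x in lebesgue_on S. Q x = q0 x"
    using lebesgue_on_borel_rep[OF S(1) Qm] by blast
  note [measurable] = q0(1)
  \<comment> \<open>Truncated so that the norm bound holds everywhere and not just almost
    everywhere.\<close>
  define q where "q x = (if norm (q0 x) \<le> 1 then 1 else 0 :: real) *\<^sub>R q0 x" for x
  have qm[measurable]: "q \<in> borel_measurable borel" unfolding q_def by measurable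
  have q1: "norm (q x) \<le> 1" for x by (simp add: q_def)
  have Qq: "AE x in lebesgue_on S. Q x = q x"
    using q0(3) energy_limit_norm_le[OF S lim] by eventually_elim (simp add: q_def)
  define F where "F = {ball x r | x r. 0 < r \<and> cball x r \<subseteq> S}"
  have b: "AE x in lborel. x \<in> B \<longrightarrow> norm (q x) = 1" if BF: "B \<in> F" for B
  proof -
    obtain x r where B: "B = ball x r" "cball x r \<subseteq> S" using BF by (auto simp: F_def)
    define f where "f y = indicator (cball x r) y * (1 - (norm (q y))^2)" for y
    have f0: "0 \<le> f y" for y using power_le_one[OF norm_ge_zero q1, of y 2] by (simp add: f_def)
    have [measurable]: "cball x r \<in> sets borel" by simp
    have fm: "f \<in> borel_measurable borel" unfolding f_def by measurable
    have "integrable lborel (indicat_real (cball x r))"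
      using emeasure_compact_finite[OF compact_cball, of x r] by (simp add: integrable_indicator_iff)
    then have fi: "integrable lborel f"
      by (rule Bochner_Integration.integrable_bound)
         (use power_le_one[OF norm_ge_zero q1, of _ 2] fm in \<open>auto simp: f_def indicator_def\<close>)
    have "(LINT y|lborel. f y) \<le> 0"
      unfolding f_def by (rule energy_limit_norm_eq_on_compact[OF S lim compact_cball B(2) qm Qq q1])
    moreover have "0 \<le> (LINT y|lborel. f y)" using f0 by simp
    ultimately have "(LINT y|lborel. f y) = 0" by simp
    then have "AE y in lborel. f y = 0" using fi f0 by (subst (asm) integral_nonneg_eq_0_iff_AE) auto
    then show ?thesis
    proof eventually_elim
      case (elim y)
      show ?case
      proof
        assume "y \<in> B"
        then have "(norm (q y))^2 = 1" using elim B by (simp add: f_def less_imp_le)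
        then show "norm (q y) = 1" by (simp add: power2_eq_1_iff) (metis norm_ge_zero neg_0_le_iff_le not_one_le_zero)
      qed
    qed
  qed
  have "S \<subseteq> \<Union>F"
  proof
    fix x assume "x \<in> S"
    then obtain r where "r > 0" "cball x r \<subseteq> S" using S(1) open_contains_cball by blast
    then show "x \<in> \<Union>F" by (auto simp: F_def intro!: exI[of _ "ball x r"])
  qed
  obtain G where G: "G \<subseteq> F" "countable G" "\<Union>G = \<Union>F"
    by (rule Lindelof[of F]) (auto simp: F_def)
  have "AE x in lborel. \<forall>B\<in>G. x \<in> B \<longrightarrow> norm (q x) = 1"
    using G(1) b by (subst AE_ball_countable[OF G(2)]) auto
  then have "AE x in lborel. x \<in> S \<longrightarrow> norm (q x) = 1"
    by eventually_elim (use \<open>S \<subseteq> \<Union>F\<close> G(3) in blast)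
  then have "AE x in lebesgue. x \<in> S \<longrightarrow> norm (q x) = 1" by (rule AE_completion)
  then have "AE x in lebesgue_on S. norm (q x) = 1" using S by (subst AE_restrict_space_iff) auto
  moreover have "AE x in lebesgue_on S. Q x \<in> sym_mat" using Q by (simp add: Linf_sym_def)
  ultimately show ?thesis using Qq energy_limit_trace[OF S lim]
    by eventually_elim (simp add: bd_K_iff)
qed

section \<open>The liminf inequality\<close>

text \<open>If the \<Gamma>-liminf is at most \<open>c\<close>, then for every c' > c the limit has
  a weak gradient with squared norm at most 2 c'/\<gamma>, and \<gamma>/2 times this is c'. The
  slack is there because the energy bound is extracted from a strict inequality.\<close>

lemma Gamma_liminf_ge:
  assumes S: "open S" "bounded S" and "0 < \<gamma>"
    and h: "\<And>x. x \<in> {0..1} \<Longrightarrow> h x - h 1 \<ge> \<gamma> / 2 * (1 - x^2)"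
    and inf: "(INF x\<in>{0..1}. h x) = h 1" and Q: "Q \<in> Linf_sym S"
  shows "F1_gamma \<gamma> S Q \<le> Gamma_liminf (weak_star S) (at_right 0) (F1_eps h S) Q"
proof (rule ereal_le_real)
  fix c assume "Gamma_liminf (weak_star S) (at_right 0) (F1_eps h S) Q \<le> ereal c"
  have "F1_gamma \<gamma> S Q \<le> ereal c'" if "c < c'" for c'
  proof -
    have "Gamma_liminf (weak_star S) (at_right 0) (F1_eps h S) Q < ereal c'"
      using \<open>Gamma_liminf (weak_star S) (at_right 0) (F1_eps h S) Q \<le> ereal c\<close> that
      by (metis less_ereal.simps(1) order_le_less_trans)
    note lim = energy_limitI[OF S \<open>0 < \<gamma>\<close> h inf Q this]
    obtain D where D: "L2_weak_gradient S Q D" "(LINT x|lebesgue_on S. (norm (D x))^2) \<le> 2 * c' / \<gamma>"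
      using energy_limit_weak_gradient[OF S lim] by blast
    have "Q \<in> L2 S" using Linf_sym_integrable(2)[OF S Q] Q by (simp add: L2_def Linf_sym_def)
    then have "Q \<in> W12_bd_K S"
      using D Q energy_limit_bd_K[OF S lim] by (auto simp: W12_bd_K_def W12_sym_def Linf_sym_def)
    moreover have "L2_weak_gradient S Q (weak_grad S Q)"
      unfolding weak_grad_def by (rule someI[of "L2_weak_gradient S Q", OF D(1)])
    then have "AE x in lebesgue_on S. weak_grad S Q x = D x"
      using D(1) L2_weak_gradient_unique[OF S] by blast
    then have "(LINT x|lebesgue_on S. (norm (weak_grad S Q x))^2) = (LINT x|lebesgue_on S. (norm (D x))^2)"
      using \<open>L2_weak_gradient S Q (weak_grad S Q)\<close> D(1)
      by (intro integral_cong_AE) (auto simp: L2_weak_gradient_def L2_def elim!: eventually_mono)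
    ultimately show ?thesis using D(2) \<open>0 < \<gamma>\<close> by (simp add: F1_gamma_def field_simps)
  qed
  then have "F1_gamma \<gamma> S Q \<le> ereal c + ereal e" if "0 < e" for e :: real using that by simp
  then show "F1_gamma \<gamma> S Q \<le> ereal c" by (rule ereal_le_epsilon2)
qed

section \<open>Lipschitz boundaries\<close>

lemma lipschitz_boundary_chart:
  assumes "lipschitz_boundary S" "p \<in> frontier S"
  obtains r e1 e2 g L where "0 < r" "norm e1 = 1" "norm e2 = 1" "e1 \<bullet> e2 = 0" "L-lipschitz_on UNIV (g :: real \<Rightarrow> real)"
    "\<And>x. x \<in> ball p r \<Longrightarrow> x \<in> S \<longleftrightarrow> g (x \<bullet> e1) < x \<bullet> e2"
proof -
  obtain r e1 e2 g L where *: "0 < r" "norm e1 = 1" "norm e2 = 1" "e1 \<bullet> e2 = 0" "L-lipschitz_on UNIV (g :: real \<Rightarrow> real)"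
    "S \<inter> ball p r = {x \<in> ball p r. g (x \<bullet> e1) < x \<bullet> e2}"
    using assms unfolding lipschitz_boundary_def by blast
  show ?thesis by (rule that[OF *(1-5)]) (use *(6) in blast)
qed

text \<open>Inside the ball, the set strictly below the graph is open and misses \<open>S\<close>,
  hence also the closure of \<open>S\<close>.\<close>

lemma closure_above_graph:
  fixes g :: "real \<Rightarrow> real"
  assumes "continuous_on UNIV g" "\<And>x. x \<in> ball p r \<Longrightarrow> x \<in> S \<longleftrightarrow> g (x \<bullet> e1) < x \<bullet> e2"
    "x \<in> closure S" "x \<in> ball p r"
  shows "g (x \<bullet> e1) \<le> x \<bullet> e2"
proof (rule ccontr)
  assume "\<not> ?thesis"
  then have "x \<in> {y. y \<bullet> e2 < g (y \<bullet> e1)} \<inter> ball p r" using assms(4) by simp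
  moreover have "open ({y. y \<bullet> e2 < g (y \<bullet> e1)} \<inter> ball p r)"
    by (intro open_Int open_Collect_less continuous_on_compose2[OF assms(1)] continuous_intros) auto
  ultimately have "({y. y \<bullet> e2 < g (y \<bullet> e1)} \<inter> ball p r) \<inter> S \<noteq> {}"
    using assms(3) open_Int_closure_eq_empty[of "{y. y \<bullet> e2 < g (y \<bullet> e1)} \<inter> ball p r" S] by blast
  then show False using assms(2) by force
qed

text \<open>The graph is contained in the image of the null hyperplane orthogonal to e2 under the
  Lipschitz map that adds g(x.e1) e2 to x.\<close>

lemma negligible_Lipschitz_graph:
  fixes e1 e2 :: "real^2" and g :: "real \<Rightarrow> real"
  assumes "norm e2 = 1" "e1 \<bullet> e2 = 0" "L-lipschitz_on UNIV g"
  shows "negligible {x. x \<bullet> e2 = g (x \<bullet> e1)}"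
proof -
  define F where "F x = x + g (x \<bullet> e1) *\<^sub>R e2" for x
  have "negligible {x. e2 \<bullet> x = 0}" using assms(1) by (intro negligible_hyperplane) auto
  then have "negligible (F ` {x. e2 \<bullet> x = 0})"
  proof (rule negligible_locally_Lipschitz_image[rotated])
    fix x assume "x \<in> {x. e2 \<bullet> x = 0}"
    show "\<exists>T B. open T \<and> x \<in> T \<and> (\<forall>y\<in>{x. e2 \<bullet> x = 0} \<inter> T. norm (F y - F x) \<le> B * norm (y - x))"
    proof (intro exI conjI ballI)
      fix y assume "y \<in> {x. e2 \<bullet> x = 0} \<inter> UNIV"
      have "norm (F y - F x) \<le> norm (y - x) + \<bar>g (y \<bullet> e1) - g (x \<bullet> e1)\<bar>"
      proof -
        have "F y - F x = (y - x) + (g (y \<bullet> e1) - g (x \<bullet> e1)) *\<^sub>R e2" by (simp add: F_def algebra_simps)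
        then show ?thesis
          using norm_triangle_ineq[of "y - x" "(g (y \<bullet> e1) - g (x \<bullet> e1)) *\<^sub>R e2"] assms(1) by simp
      qed
      also have "\<bar>g (y \<bullet> e1) - g (x \<bullet> e1)\<bar> \<le> L * \<bar>y \<bullet> e1 - x \<bullet> e1\<bar>"
        using lipschitz_onD[OF assms(3), of "y \<bullet> e1" "x \<bullet> e1"] by (simp add: dist_real_def)
      also have "\<dots> \<le> L * (norm (y - x) * norm e1)"
        using Cauchy_Schwarz_ineq2[of "y - x" e1] lipschitz_on_nonneg[OF assms(3)]
        by (intro mult_left_mono) (auto simp: inner_diff_left)
      finally show "norm (F y - F x) \<le> (1 + L * norm e1) * norm (y - x)" by (simp add: algebra_simps)
    qed auto
  qed auto
  moreover have "{x. x \<bullet> e2 = g (x \<bullet> e1)} \<subseteq> F ` {x. e2 \<bullet> x = 0}"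
  proof
    fix x assume "x \<in> {x. x \<bullet> e2 = g (x \<bullet> e1)}"
    then have x: "x \<bullet> e2 = g (x \<bullet> e1)" by simp
    have e22: "e2 \<bullet> e2 = 1" using assms(1) by (simp add: norm_eq_1)
    define y where "y = x - (x \<bullet> e2) *\<^sub>R e2"
    have "e2 \<bullet> e1 = 0" using assms(2) by (simp add: inner_commute)
    then have "y \<bullet> e1 = x \<bullet> e1" by (simp add: y_def inner_diff_left)
    then have "x = F y" using x by (simp add: F_def y_def)
    moreover have "e2 \<bullet> y = 0" using e22 by (simp add: y_def inner_diff_right inner_commute)
    ultimately show "x \<in> F ` {x. e2 \<bullet> x = 0}" by blast
  qed
  ultimately show ?thesis by (rule negligible_subset)
qed

text \<open>In a chart a frontier point lies on the graph, since it is in the closure but not in the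
  open set \<open>S\<close>; compactness reduces to finitely many charts.\<close>

lemma negligible_frontier_lipschitz:
  assumes "open S" "bounded S" "lipschitz_boundary S"
  shows "negligible (frontier S)"
proof -
  have loc: "\<exists>r>0. negligible (frontier S \<inter> ball p r)" if p: "p \<in> frontier S" for p
  proof (rule lipschitz_boundary_chart[OF assms(3) p])
    fix r e1 e2 L and g :: "real \<Rightarrow> real"
    assume c: "0 < r" "norm e1 = 1" "norm e2 = 1" "e1 \<bullet> e2 = 0" "L-lipschitz_on UNIV g"
      "\<And>x. x \<in> ball p r \<Longrightarrow> x \<in> S \<longleftrightarrow> g (x \<bullet> e1) < x \<bullet> e2"
    have cont: "continuous_on UNIV g" by (rule lipschitz_on_continuous_on[OF c(5)])
    have "frontier S \<inter> ball p r \<subseteq> {x. x \<bullet> e2 = g (x \<bullet> e1)}"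
    proof
      fix x assume x: "x \<in> frontier S \<inter> ball p r"
      then have "x \<notin> S" "x \<in> closure S" using assms(1) by (auto simp: frontier_def interior_open)
      then show "x \<in> {x. x \<bullet> e2 = g (x \<bullet> e1)}"
        using closure_above_graph[OF cont c(6), of p r x] c(6)[of x] x by force
    qed
    then show ?thesis using negligible_Lipschitz_graph[OF c(3,4,5)] c(1) negligible_subset by blast
  qed
  then obtain r where r: "\<And>p. p \<in> frontier S \<Longrightarrow> r p > 0 \<and> negligible (frontier S \<inter> ball p (r p))" by metis
  have "compact (frontier S)" using assms(2) by (rule compact_frontier_bounded)
  then obtain M where M: "M \<subseteq> frontier S" "finite M" "frontier S \<subseteq> (\<Union>p\<in>M. ball p (r p))"
    by (rule compactE_image[where f = "\<lambda>p. ball p (r p)" and C = "frontier S"]) (use r in auto)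
  have "negligible (\<Union>p\<in>M. frontier S \<inter> ball p (r p))"
    by (rule negligible_Union) (use M r in auto)
  then show ?thesis by (rule negligible_subset) (use M in auto)
qed

lemma AE_not_frontier:
  assumes "open S" "bounded S" "lipschitz_boundary S"
  shows "AE x in lborel. x \<notin> frontier S"
proof -
  have "frontier S \<in> null_sets lebesgue" 
    using negligible_frontier_lipschitz[OF assms] by (simp add: negligible_iff_null_sets)
  moreover have "frontier S \<in> sets lborel" by (simp add: borel_closed)
  ultimately have "frontier S \<in> null_sets lborel"
    by (simp add: null_sets_completion_iff)
  then show ?thesis by (rule AE_not_in)
qed

text \<open>Moving a point of the closure in the local vertical directions, one chart after the other,
  brings it into the open set.\<close>

lemma inward_field:
  assumes S: "open S" "bounded S" "lipschitz_boundary S" and s: "0 < s"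
  obtains V t0 where "\<And>j. test_function UNIV (\<lambda>x. V x $ j)" "0 < t0"
    "\<And>x. V x \<noteq> 0 \<Longrightarrow> \<exists>p\<in>frontier S. dist x p < s"
    "\<And>t x. 0 < t \<Longrightarrow> t \<le> t0 \<Longrightarrow> x \<in> closure S \<Longrightarrow> x + t *\<^sub>R V x \<in> S"
proof -
  \<comment> \<open>In a chart the direction e2 raises the height x.e2 but keeps x.e1, so a positive
    multiple carries a point on or above the graph strictly above it.\<close>
  have "\<exists>r d. 0 < r \<and> norm d = 1 \<and> (\<forall>x \<tau>. x \<in> closure S \<and> x \<in> ball p r \<and> 0 < \<tau> \<and> x + \<tau> *\<^sub>R d \<in> ball p r \<longrightarrow> x + \<tau> *\<^sub>R d \<in> S)"
    if p: "p \<in> frontier S" for p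
  proof (rule lipschitz_boundary_chart[OF S(3) p])
    fix r e1 e2 L and g :: "real \<Rightarrow> real"
    assume c: "0 < r" "norm e1 = 1" "norm e2 = 1" "e1 \<bullet> e2 = 0" "L-lipschitz_on UNIV g"
      "\<And>x. x \<in> ball p r \<Longrightarrow> x \<in> S \<longleftrightarrow> g (x \<bullet> e1) < x \<bullet> e2"
    have cont: "continuous_on UNIV g" by (rule lipschitz_on_continuous_on[OF c(5)])
    show ?thesis
    proof (intro exI conjI allI impI)
      fix x \<tau> assume x: "x \<in> closure S \<and> x \<in> ball p r \<and> 0 < \<tau> \<and> x + \<tau> *\<^sub>R e2 \<in> ball p r"
      have "g (x \<bullet> e1) \<le> x \<bullet> e2" using closure_above_graph[OF cont c(6), of p r x] x by blast
      moreover have "(x + \<tau> *\<^sub>R e2) \<bullet> e2 = x \<bullet> e2 + \<tau>" "(x + \<tau> *\<^sub>R e2) \<bullet> e1 = x \<bullet> e1"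
      proof -
        have "e2 \<bullet> e1 = 0" "e2 \<bullet> e2 = 1" using c(3,4) by (simp_all add: inner_commute norm_eq_1)
        then show "(x + \<tau> *\<^sub>R e2) \<bullet> e2 = x \<bullet> e2 + \<tau>" "(x + \<tau> *\<^sub>R e2) \<bullet> e1 = x \<bullet> e1"
          by (simp_all add: inner_add_left)
      qed
      ultimately show "x + \<tau> *\<^sub>R e2 \<in> S" using c(6)[of "x + \<tau> *\<^sub>R e2"] x by simp
    qed (use c in auto)
  qed
  then obtain r d where r: "\<And>p. p \<in> frontier S \<Longrightarrow> 0 < r p" and d: "\<And>p. p \<in> frontier S \<Longrightarrow> norm (d p :: real^2) = 1"
    and push: "\<And>p x \<tau>. p \<in> frontier S \<Longrightarrow> x \<in> closure S \<Longrightarrow> x \<in> ball p (r p) \<Longrightarrow> 0 < \<tau> \<Longrightarrow>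
      x + \<tau> *\<^sub>R d p \<in> ball p (r p) \<Longrightarrow> x + \<tau> *\<^sub>R d p \<in> S"
    by metis
  \<comment> \<open>The box of half-side \<open>c p\<close> lies within distance 2 c p of p, half of
    the smaller of \<open>r p\<close> and \<open>s\<close>; the other half of the chart radius is
    room for the displacement.\<close>
  define c where "c p = min (r p) s / 4" for p
  have c0: "0 < c p" if "p \<in> frontier S" for p using r[OF that] s by (simp add: c_def)
  define B where "B p = box (p - (\<chi> k. c p)) (p + (\<chi> k. c p))" for p
  have Bd: "dist x p \<le> min (r p) s / 2" if "x \<in> B p" for x p
  proof -
    have "\<bar>(x - p) $ k\<bar> \<le> c p" for k
    proof -
      have "(p - (\<chi> k. c p)) $ k < x $ k \<and> x $ k < (p + (\<chi> k. c p)) $ k" using that unfolding B_def mem_box_cart by blast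
      then show ?thesis by (auto simp: abs_le_iff)
    qed
    then show ?thesis using norm_le_of_components(1)[of "x - p" "c p"] by (simp add: dist_norm c_def)
  qed
  have "compact (frontier S)" using S(2) by (rule compact_frontier_bounded)
  then obtain M where M: "M \<subseteq> frontier S" "finite M" "frontier S \<subseteq> (\<Union>p\<in>M. B p)"
  proof (rule compactE_image[where f = B and C = "frontier S"])
    show "frontier S \<subseteq> (\<Union>p\<in>frontier S. B p)" using c0 by (auto simp: B_def mem_box_cart)
  qed (auto simp: B_def)
  define X where "X p = box_bump 1 (p - (\<chi> k. c p)) (p + (\<chi> k. c p))" for p
  have X01: "0 \<le> X p x" "X p x \<le> 1" for p x by (auto simp: X_def box_bump_nonneg box_bump_le_1)
  have Xpos: "X p x > 0 \<longleftrightarrow> x \<in> B p" for p x by (simp add: X_def B_def box_bump_pos_iff)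
  define V where "V x = (\<Sum>p\<in>M. X p x *\<^sub>R d p)" for x
  define R where "R = Min (insert 1 (r ` M))"
  have R: "0 < R" "\<And>p. p \<in> M \<Longrightarrow> R \<le> r p" unfolding R_def using M r by auto
  \<comment> \<open>Every partial displacement is then at most R/4, since at most card M unit
    vectors with weights in [0, 1] are added.\<close>
  define t0 where "t0 = R / (4 * (of_nat (card M) + 1))"
  have cM: "0 < of_nat (card M) + (1::real)" by (simp add: add_nonneg_pos)
  show ?thesis
  proof (rule that[of V t0])
    show "test_function UNIV (\<lambda>x. V x $ j)" for j
    proof -
      have "test_function UNIV (\<lambda>x. (\<Sum>p\<in>N. d p $ j * X p x))" if "finite N" for N
        using that
      proof (induction N)
        case empty
        then show ?case by (simp add: test_function_zero)
      next
        case (insert p N)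
        have "test_function UNIV (X p)" unfolding X_def by (rule test_function_box_bump) auto
        then show ?case using insert by (simp add: test_function_add test_function_cmult)
      qed
      from this[OF M(2)] show ?thesis by (simp add: V_def mult.commute)
    qed
    show "0 < t0" using R(1) cM by (simp add: t0_def)
    show "\<exists>p\<in>frontier S. dist x p < s" if nz: "V x \<noteq> 0" for x
    proof -
      obtain p where p: "p \<in> M" "X p x *\<^sub>R d p \<noteq> 0" using nz unfolding V_def by (meson sum.not_neutral_contains_not_neutral)
      then have "x \<in> B p" using X01(1)[of p x] Xpos[of p x] by (auto simp: less_le)
      then have "dist x p \<le> s / 2" using Bd[of x p] by linarith
      then show ?thesis using p M s by force
    qed
    fix t x assume t: "0 < t" "t \<le> t0" and x: "x \<in> closure S"
    have tR: "t * of_nat (card M) \<le> R / 4"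
    proof -
      have "t * of_nat (card M) \<le> t0 * (of_nat (card M) + 1)" using t by (intro mult_mono) auto
      also have "\<dots> = R / 4" using cM by (simp add: t0_def field_simps)
      finally show ?thesis .
    qed
    define Y where "Y N = x + t *\<^sub>R (\<Sum>p\<in>N. X p x *\<^sub>R d p)" for N
    have Yx: "norm (Y N - x) \<le> R / 4" if "N \<subseteq> M" for N
    proof -
      have "norm (\<Sum>p\<in>N. X p x *\<^sub>R d p) \<le> (\<Sum>p\<in>N. 1)"
        using X01 d M that by (intro sum_norm_le) auto
      also have "\<dots> \<le> of_nat (card M)" using card_mono[OF M(2) that] by simp
      finally have "t * norm (\<Sum>p\<in>N. X p x *\<^sub>R d p) \<le> t * of_nat (card M)" using t by (intro mult_left_mono) auto
      moreover have "norm (Y N - x) = t * norm (\<Sum>p\<in>N. X p x *\<^sub>R d p)" using t by (simp add: Y_def)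
      ultimately show ?thesis using tR by linarith
    qed
    \<comment> \<open>The pushes are added one at a time. The point never leaves the closure and
      lies in \<open>S\<close> as soon as one push with positive weight has acted. The induction can
      go on because the push property starts from any point of the closure.\<close>
    have "Y N \<in> closure S \<and> ((x \<in> S \<or> (\<exists>p\<in>N. X p x \<noteq> 0)) \<longrightarrow> Y N \<in> S)" if "N \<subseteq> M" for N
      using finite_subset[OF that M(2)] that
    proof (induction N)
      case empty
      then show ?case using x by (simp add: Y_def)
    next
      case (insert p N)
      have Yi: "Y (insert p N) = Y N + (t * X p x) *\<^sub>R d p"
        using insert by (simp add: Y_def algebra_simps)
      show ?case
      proof (cases "X p x = 0")
        case True
        then show ?thesis using insert Yi by auto
      next
        case False
        then have pos: "0 < X p x" using X01(1)[of p x] by simp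
        then have dx: "dist x p \<le> r p / 2" using Bd[of x p] Xpos[of p x] by linarith
        have pf: "p \<in> frontier S" and rp: "R \<le> r p" using insert M R by auto
        have ball: "Y N' \<in> ball p (r p)" if "N' \<subseteq> M" for N'
        proof -
          have "dist (Y N') p \<le> dist (Y N') x + dist x p" by (rule dist_triangle)
          then have "dist (Y N') p < r p" using Yx[OF that] dx rp r[OF pf] by (simp add: dist_norm)
          then show ?thesis by (simp add: dist_commute)
        qed
        have "Y (insert p N) \<in> S"
          unfolding Yi
        proof (rule push[OF pf])
          show "Y N \<in> closure S" using insert by auto
          show "Y N \<in> ball p (r p)" using insert by (intro ball) auto
          show "0 < t * X p x" using pos t by simp
          show "Y N + (t * X p x) *\<^sub>R d p \<in> ball p (r p)" using ball[of "insert p N"] insert Yi by auto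
        qed
        then show ?thesis using closure_subset by auto
      qed
    qed
    from this[of M] have YM: "(x \<in> S \<or> (\<exists>p\<in>M. X p x \<noteq> 0)) \<Longrightarrow> Y M \<in> S" by blast
    have "x \<in> S \<or> (\<exists>p\<in>M. X p x \<noteq> 0)"
    proof (cases "x \<in> S")
      case False
      then have "x \<in> frontier S" using x S(1) by (simp add: frontier_def interior_open)
      then obtain p where "p \<in> M" "x \<in> B p" using M(3) by blast
      then show ?thesis using Xpos[of p x] by force
    qed simp
    then show "x + t *\<^sub>R V x \<in> S" using YM by (simp add: Y_def V_def)
  qed
qed

section \<open>Mollifiers\<close>

lemma lborel_integral_affine:
  fixes f :: "'a::euclidean_space \<Rightarrow> real"
  assumes [measurable]: "f \<in> borel_measurable borel" and "c \<noteq> 0"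
  shows "(LINT x|lborel. f (v + c *\<^sub>R x)) = (LINT x|lborel. f x) / \<bar>c\<bar> ^ DIM('a)"
proof -
  have "(LINT x|lborel. f x) = (LINT x|density (distr lborel borel (\<lambda>x. v + c *\<^sub>R x)) (\<lambda>_. \<bar>c\<bar> ^ DIM('a)). f x)"
    using lborel_affine[of c v] assms(2) by simp
  also have "\<dots> = (LINT x|distr lborel borel (\<lambda>x. v + c *\<^sub>R x). \<bar>c\<bar> ^ DIM('a) * f x)"
    by (subst integral_density) auto
  also have "\<dots> = (LINT x|lborel. \<bar>c\<bar> ^ DIM('a) * f (v + c *\<^sub>R x))"
    by (subst integral_distr) auto
  finally show ?thesis using assms(2) by simp
qed

text \<open>One bump on the square of half-side 1, divided by its mass m and rescaled; as the bump
  is at most 1, the constant \<kappa> = 1/m does not depend on r.\<close>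

lemma mollifiers:
  obtains \<kappa> :: real and \<eta> :: "real \<Rightarrow> real^2 \<Rightarrow> real" where "0 < \<kappa>"
    "\<And>r. 0 < r \<Longrightarrow> test_function UNIV (\<eta> r)" "\<And>r x. 0 < r \<Longrightarrow> 0 \<le> \<eta> r x"
    "\<And>r x. 0 < r \<Longrightarrow> \<eta> r x \<le> \<kappa> / r^2" "\<And>r x k. 0 < r \<Longrightarrow> \<eta> r x \<noteq> 0 \<Longrightarrow> \<bar>x $ k\<bar> < r"
    "\<And>r. 0 < r \<Longrightarrow> (LINT x|lborel. \<eta> r x) = 1"
proof -
  define b :: "real^2 \<Rightarrow> real" where "b = box_bump 1 (- (\<chi> k. 1)) (\<chi> k. 1)"
  have bt: "test_function UNIV b" unfolding b_def by (rule test_function_box_bump) auto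
  have bi: "integrable lborel b" by (rule test_function_integrable[OF bt])
  note [measurable] = test_function_borel[OF bt]
  define m where "m = (LINT x|lborel. b x)"
  have "m \<noteq> 0"
  proof
    assume "m = 0"
    then have "AE x in lborel. b x = 0"
      unfolding m_def using bi by (subst (asm) integral_nonneg_eq_0_iff_AE) (auto simp: b_def box_bump_nonneg)
    then have "AE x in lborel. x \<notin> box (- (\<chi> k. 1)) (\<chi> k. 1 :: real^2)"
      by eventually_elim (metis b_def box_bump_pos_iff less_irrefl)
    then have "box (- (\<chi> k. 1)) (\<chi> k. 1) \<in> null_sets (lborel :: (real^2) measure)"
      by (subst AE_iff_null_sets) auto
    then have "box (- (\<chi> k. 1)) (\<chi> k. 1) \<in> null_sets (lebesgue :: (real^2) measure)"
      by (rule null_sets_completionI)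
    then have "negligible (box (- (\<chi> k. 1)) (\<chi> k. 1) :: (real^2) set)" by (simp add: negligible_iff_null_sets)
    moreover have "0 \<in> box (- (\<chi> k. 1)) (\<chi> k. 1 :: real^2)" by (simp add: mem_box_cart)
    ultimately show False using open_not_negligible[of "box (- (\<chi> k. 1)) (\<chi> k. 1) :: (real^2) set"] by auto
  qed
  moreover have "0 \<le> m" unfolding m_def by (simp add: b_def box_bump_nonneg)
  ultimately have m: "0 < m" by simp
  define \<eta> where "\<eta> r x = 1 / (m * r^2) * b ((1 / r) *\<^sub>R x)" for r x
  show ?thesis
  proof (rule that[of "1 / m" \<eta>])
    show "0 < 1 / m" using m by simp
    fix r :: real assume r: "0 < r"
    have supp: "b x \<noteq> 0 \<Longrightarrow> x \<in> cbox (- (\<chi> k. 1)) (\<chi> k. 1)" for x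
      unfolding b_def using box_bump_outside box_subset_cbox by blast
    have "test_function UNIV (\<lambda>x. b ((1 / r) *\<^sub>R x + 0))"
      by (rule test_function_affine[OF bt, of _ _ "cbox (- (\<chi> k. 1)) (\<chi> k. 1)"]) (use r supp in auto)
    then show "test_function UNIV (\<eta> r)" unfolding \<eta>_def by (intro test_function_cmult) simp
    show "0 \<le> \<eta> r x" for x unfolding \<eta>_def using m r by (simp add: b_def box_bump_nonneg)
    show "\<eta> r x \<le> 1 / m / r^2" for x
      unfolding \<eta>_def using m r box_bump_le_1[of 1 "- (\<chi> k. 1)" "\<chi> k. 1" "(1 / r) *\<^sub>R x"]
      by (simp add: b_def divide_simps)
    show "\<bar>x $ k\<bar> < r" if "\<eta> r x \<noteq> 0" for x k
    proof -
      have "b ((1 / r) *\<^sub>R x) \<noteq> 0" using that by (auto simp: \<eta>_def)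
      then have "(1 / r) *\<^sub>R x \<in> box (- (\<chi> k. 1)) (\<chi> k. 1)" unfolding b_def using box_bump_outside by blast
      then have "- 1 < x $ k / r \<and> x $ k / r < 1" by (auto simp: mem_box_cart)
      then show ?thesis using r by (auto simp: field_simps abs_less_iff)
    qed
    show "(LINT x|lborel. \<eta> r x) = 1"
      unfolding \<eta>_def using lborel_integral_affine[of b "1 / r" 0] r m
      by (simp add: m_def[symmetric] power2_eq_square field_simps)
  qed
qed

section \<open>Mollification\<close>

text \<open>Nonnegativity of the weighted variance.\<close>

lemma weighted_Jensen:
  fixes g :: "'a \<Rightarrow> 'b::euclidean_space"
  assumes k: "integrable M k" "(LINT y|M. k y) = 1" "\<And>y. 0 \<le> k y"
    and i1: "integrable M (\<lambda>y. k y *\<^sub>R g y)" and i2: "integrable M (\<lambda>y. k y * (norm (g y))^2)"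
  shows "(norm (LINT y|M. k y *\<^sub>R g y))^2 \<le> (LINT y|M. k y * (norm (g y))^2)"
proof -
  define m where "m = (LINT y|M. k y *\<^sub>R g y)"
  have "0 \<le> (LINT y|M. k y * (norm (g y - m))^2)" using k(3) by simp
  also have "\<dots> = (LINT y|M. k y * (norm (g y))^2 - 2 * ((k y *\<^sub>R g y) \<bullet> m) + k y * (norm m)^2)"
    by (intro Bochner_Integration.integral_cong)
       (simp_all add: power2_norm_eq_inner inner_diff_left inner_diff_right inner_commute algebra_simps)
  also have "\<dots> = (LINT y|M. k y * (norm (g y))^2) - 2 * ((LINT y|M. k y *\<^sub>R g y) \<bullet> m) + (norm m)^2"
    using i1 i2 k by (simp del: inner_scaleR_left)
  also have "\<dots> = (LINT y|M. k y * (norm (g y))^2) - (norm m)^2"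
    by (simp add: m_def[symmetric] power2_norm_eq_inner)
  finally show ?thesis by (simp add: m_def)
qed

lemma integral_truncation:
  fixes f :: "'a \<Rightarrow> real"
  assumes f: "integrable M f" "\<And>x. 0 \<le> f x" and e: "0 < e"
  obtains n :: nat where "(LINT x|M. f x - min (f x) (real n)) < e"
proof -
  note [measurable] = borel_measurable_integrable[OF f(1)]
  have "(\<lambda>n. LINT x|M. f x - min (f x) (real n)) \<longlonglongrightarrow> (LINT x|M. 0)"
  proof (rule integral_dominated_convergence[where w = f])
    show "AE x in M. (\<lambda>n. f x - min (f x) (real n)) \<longlonglongrightarrow> 0"
    proof (intro AE_I2 tendsto_eventually)
      fix x
      obtain N :: nat where "f x \<le> real N" using real_arch_simple by blast
      then show "eventually (\<lambda>n. f x - min (f x) (real n) = 0) sequentially"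
        unfolding eventually_sequentially by (intro exI[of _ N]) auto
    qed
  qed (use f in \<open>auto simp: min_def\<close>)
  then have "eventually (\<lambda>n. (LINT x|M. f x - min (f x) (real n)) < e) sequentially"
    using e by (intro order_tendstoD(2)[where y = "(LINT x|M. 0)"]) auto
  then show ?thesis using that by (auto simp: eventually_sequentially)
qed

text \<open>Absolute continuity of the integral: truncate \<open>f\<close> at a height n above which
  the excess has integral below e/2, and control the bounded part by n times the measure.\<close>

lemma integral_small_on_small_sets:
  fixes f :: "'a \<Rightarrow> real"
  assumes f: "integrable M f" "\<And>x. 0 \<le> f x" and e: "0 < e"
  obtains \<rho> where "0 < \<rho>" "\<And>A. A \<in> sets M \<Longrightarrow> emeasure M A \<le> ennreal \<rho> \<Longrightarrow> (LINT x|M. indicator A x * f x) \<le> e"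
proof -
  note [measurable] = borel_measurable_integrable[OF f(1)]
  obtain n :: nat where n: "(LINT x|M. f x - min (f x) (real n)) < e / 2"
    using integral_truncation[OF f, of "e / 2"] e by auto
  have mi: "integrable M (\<lambda>x. min (f x) (real n))"
    by (rule Bochner_Integration.integrable_bound[OF f(1)]) (use f in \<open>auto simp: min_def\<close>)
  show ?thesis
  proof (rule that[of "e / (2 * (real n + 1))"])
    show "0 < e / (2 * (real n + 1))" using e by simp
    fix A assume A: "A \<in> sets M" "emeasure M A \<le> ennreal (e / (2 * (real n + 1)))"
    have Af: "emeasure M A < \<infinity>" using A(2) by (rule le_less_trans) simp
    have mA: "measure M A \<le> e / (2 * (real n + 1))"
      using A(2) e Af by (simp add: emeasure_eq_ennreal_measure less_top[symmetric] ennreal_le_iff)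
    have iA: "integrable M (indicat_real A)" using A Af by (simp add: integrable_indicator_iff)
    have "(LINT x|M. indicator A x * f x) \<le> (LINT x|M. (f x - min (f x) (real n)) + real n * indicat_real A x)"
    proof (rule integral_mono)
      show "integrable M (\<lambda>x. indicator A x * f x)" using integrable_mult_indicator[OF A(1) f(1)] by simp
      show "integrable M (\<lambda>x. (f x - min (f x) (real n)) + real n * indicat_real A x)" using f(1) mi iA by simp
    qed (auto simp: indicator_def min_def)
    also have "\<dots> = (LINT x|M. f x - min (f x) (real n)) + real n * measure M A"
      using f(1) mi iA A(1) by simp
    also have "real n * measure M A \<le> e / 2"
    proof -
      have "real n * measure M A \<le> (real n + 1) * (e / (2 * (real n + 1)))" using mA by (intro mult_mono) auto
      also have "\<dots> = e / 2"
      proof -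
        have "real n + 1 \<noteq> 0" by linarith
        then show ?thesis by (simp add: divide_simps)
      qed
      finally show ?thesis .
    qed
    finally show "(LINT x|M. indicator A x * f x) \<le> e" using n by linarith
  qed
qed

definition moll :: "(real^2 \<Rightarrow> real) \<Rightarrow> (real^2 \<Rightarrow> 'b::euclidean_space) \<Rightarrow> real^2 \<Rightarrow> 'b" where
  "moll \<phi> q z = (LINT y|lborel. \<phi> (z - y) *\<^sub>R q y)"

lemma moll_has_derivative:
  "test_function S \<phi> \<Longrightarrow> integrable lborel q \<Longrightarrow>
    (moll \<phi> q has_derivative (\<lambda>v. \<Sum>k\<in>UNIV. v $ k *\<^sub>R moll (partial_deriv k \<phi>) q z)) (at z)"
  unfolding moll_def[abs_def] by (rule convolution_has_derivative)

lemma moll_continuous: "test_function S \<phi> \<Longrightarrow> integrable lborel q \<Longrightarrow> continuous_on UNIV (moll \<phi> q)"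
  by (intro continuous_at_imp_continuous_on ballI has_derivative_continuous[OF moll_has_derivative])

locale mollifier =
  fixes \<phi> :: "real^2 \<Rightarrow> real" and \<kappa> r :: real
  assumes r: "0 < r" and \<kappa>: "0 < \<kappa>" and \<phi>: "test_function UNIV \<phi>" and nonneg: "0 \<le> \<phi> x"
    and le: "\<phi> x \<le> \<kappa> / r^2" and supp: "\<phi> x \<noteq> 0 \<Longrightarrow> \<bar>x $ k\<bar> < r" and mass: "(LINT x|lborel. \<phi> x) = 1"
begin

lemma borel[measurable]: "\<phi> \<in> borel_measurable borel" by (rule test_function_borel[OF \<phi>])

lemma kernel:
  shows "integrable lborel (\<lambda>y. \<phi> (z - y))" "(LINT y|lborel. \<phi> (z - y)) = 1"
    and "integrable lborel (\<lambda>x. \<phi> (x - y))" "(LINT x|lborel. \<phi> (x - y)) = 1"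
proof -
  show "integrable lborel (\<lambda>y. \<phi> (z - y))" by (rule test_function_integrable[OF test_function_reflect[OF \<phi>]])
  show "(LINT y|lborel. \<phi> (z - y)) = 1" using lborel_integral_affine[OF borel, of "-1" z] mass by simp
  show "integrable lborel (\<lambda>x. \<phi> (x - y))" by (rule test_function_integrable[OF test_function_translate[OF \<phi>, where T = UNIV]]) simp
  show "(LINT x|lborel. \<phi> (x - y)) = 1" using lborel_integral_affine[OF borel, of 1 "-y"] mass by simp
qed

lemma test_reflect:
  assumes "\<And>y. (\<And>k. \<bar>(z - y) $ k\<bar> \<le> r) \<Longrightarrow> y \<in> S"
  shows "test_function S (\<lambda>y. \<phi> (z - y))"
proof (rule test_functionI[of _ "cbox (z - (\<chi> k. r)) (z + (\<chi> k. r))"])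
  show "Cn_plane n (\<lambda>y. \<phi> (z - y))" for n by (rule test_function_Cn[OF test_function_reflect[OF \<phi>]])
  have iff: "y \<in> cbox (z - (\<chi> k. r)) (z + (\<chi> k. r)) \<longleftrightarrow> (\<forall>k. \<bar>(z - y) $ k\<bar> \<le> r)" for y
  proof -
    have "z $ k - r \<le> y $ k \<and> y $ k \<le> z $ k + r \<longleftrightarrow> \<bar>z $ k - y $ k\<bar> \<le> r" for k by linarith
    then show ?thesis by (simp add: mem_box_cart)
  qed
  show "cbox (z - (\<chi> k. r)) (z + (\<chi> k. r)) \<subseteq> S" using assms by (auto simp: iff)
  show "y \<in> cbox (z - (\<chi> k. r)) (z + (\<chi> k. r))" if "\<phi> (z - y) \<noteq> 0" for y
    unfolding iff using supp[OF that] by (auto intro: less_imp_le)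
qed auto

text \<open>When the box of half-side r about z lies in \<open>S\<close>, the function of y given by
  \<phi>(z - y) is itself a test function in \<open>S\<close>; the sign from the reflection cancels
  the sign in the definition of the weak derivative.\<close>

lemma moll_partial:
  assumes wp: "weak_pair S q d" and box: "\<And>y. (\<And>k. \<bar>(z - y) $ k\<bar> \<le> r) \<Longrightarrow> y \<in> S"
  shows "moll (partial_deriv k \<phi>) q z = moll \<phi> (\<lambda>y. d y $ k) z"
proof -
  have t: "test_function S (\<lambda>y. \<phi> (z - y))" by (rule test_reflect[OF box])
  have "partial_deriv k (\<lambda>x. \<phi> ((-1) *\<^sub>R x + z)) y = (-1) * partial_deriv k \<phi> ((-1) *\<^sub>R y + z)" for y
    by (rule partial_deriv_affine(2)) (rule test_function_differentiable[OF \<phi>])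
  then have pd: "partial_deriv k (\<lambda>y. \<phi> (z - y)) y = - partial_deriv k \<phi> (z - y)" for y by simp
  have "(LINT x|lborel. partial_deriv k (\<lambda>y. \<phi> (z - y)) x *\<^sub>R q x) = - (LINT x|lborel. \<phi> (z - x) *\<^sub>R d x $ k)"
    using wp t unfolding weak_pair_def by blast
  then show ?thesis by (simp add: pd moll_def)
qed

lemma moll_integrable_bounded:
  fixes g :: "real^2 \<Rightarrow> 'b::euclidean_space"
  assumes [measurable]: "g \<in> borel_measurable borel" and "\<And>y. norm (g y) \<le> B"
  shows "integrable lborel (\<lambda>y. \<phi> (z - y) *\<^sub>R g y)"
proof (rule Bochner_Integration.integrable_bound)
  show "integrable lborel (\<lambda>y. B * \<phi> (z - y))" using kernel(1) by simp
  show "AE y in lborel. norm (\<phi> (z - y) *\<^sub>R g y) \<le> norm (B * \<phi> (z - y))"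
  proof (intro AE_I2)
    fix y
    have "\<phi> (z - y) * norm (g y) \<le> \<phi> (z - y) * B" using nonneg assms(2) by (intro mult_left_mono)
    then show "norm (\<phi> (z - y) *\<^sub>R g y) \<le> norm (B * \<phi> (z - y))"
      using nonneg[of "z - y"] by (simp add: abs_of_nonneg mult.commute abs_mult) (smt (verit) mult_right_mono norm_ge_zero assms(2)[of y])
  qed
qed measurable

lemma moll_norm_le:
  fixes g :: "real^2 \<Rightarrow> 'b::euclidean_space"
  assumes "g \<in> borel_measurable borel" "\<And>y. norm (g y) \<le> B"
  shows "norm (moll \<phi> g z) \<le> B"
proof -
  have "norm (moll \<phi> g z) \<le> (LINT y|lborel. B * \<phi> (z - y))"
    unfolding moll_def
  proof (rule Bochner_Integration.integral_norm_bound_integral)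
    show "integrable lborel (\<lambda>y. \<phi> (z - y) *\<^sub>R g y)" by (rule moll_integrable_bounded[OF assms])
    show "integrable lborel (\<lambda>y. B * \<phi> (z - y))" using kernel(1) by simp
    show "norm (\<phi> (z - y) *\<^sub>R g y) \<le> B * \<phi> (z - y)" for y
      using nonneg[of "z - y"] assms(2)[of y] by (simp add: mult.commute mult_right_mono)
  qed
  then show ?thesis using kernel(2) by simp
qed

lemma moll_Jensen:
  fixes g :: "real^2 \<Rightarrow> 'b::euclidean_space"
  assumes [measurable]: "g \<in> borel_measurable borel" and g2: "integrable lborel (\<lambda>y. (norm (g y))^2)"
  shows "ennreal ((norm (moll \<phi> g z))^2) \<le> (\<integral>\<^sup>+y. ennreal (\<phi> (z - y)) * ennreal ((norm (g y))^2) \<partial>lborel)"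
proof -
  have t: "test_function UNIV (\<lambda>y. \<phi> (z - y))" by (rule test_function_reflect[OF \<phi>])
  have i2: "integrable lborel (\<lambda>y. \<phi> (z - y) * (norm (g y))^2)"
    using test_function_times_integrable[OF t g2] by simp
  have "integrable lborel (\<lambda>y. \<phi> (z - y) *\<^sub>R g y)"
    by (rule L2_scaleR_integrable[OF _ _ _ g2])
       (use test_function_times_integrable[OF t test_function_integrable[OF t]] in \<open>auto simp: power2_eq_square\<close>)
  from weighted_Jensen[OF kernel(1,2) nonneg this i2]
  have "ennreal ((norm (moll \<phi> g z))^2) \<le> ennreal (LINT y|lborel. \<phi> (z - y) * (norm (g y))^2)"
    unfolding moll_def by (rule ennreal_leI)
  also have "\<dots> = (\<integral>\<^sup>+y. ennreal (\<phi> (z - y) * (norm (g y))^2) \<partial>lborel)"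
    using i2 nonneg by (intro nn_integral_eq_integral[symmetric]) auto
  finally show ?thesis using nonneg by (simp add: ennreal_mult)
qed

text \<open>The mean defect on a box of half-side r. Shifts between its points lie in a square of
  area 16 r^2 and satisfy |w|^2 \<le> 8 r^2; with the density bound \<kappa>/r^2 the constant is
  half of (\<kappa>/r^2)^2 times 16 r^2 times 8 r^2, which is 64 \<kappa>^2. That r cancels is
  special to the plane: little energy on the box suffices for a norm close to 1.\<close>

lemma mean_norm_ge:
  fixes q :: "real^2 \<Rightarrow> 'b::euclidean_space"
  assumes wp: "weak_pair S q d" and q1: "\<And>x. norm (q x) \<le> 1" "\<And>x. x \<in> S \<Longrightarrow> norm (q x) = 1"
    and box: "\<And>y. (\<And>k. \<bar>(z - y) $ k\<bar> \<le> r) \<Longrightarrow> y \<in> S"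
  shows "1 - (norm (moll \<phi> q z))^2 \<le> 64 * \<kappa>^2 * (LINT y|lborel. indicator {y. \<forall>k. \<bar>(z - y) $ k\<bar> < r} y * (norm (d y))^2)"
proof -
  define B where "B = {y. \<forall>k. \<bar>(z - y) $ k\<bar> < r}"
  define D where "D = (LINT y|lborel. indicator B y * (norm (d y))^2)"
  have Bbox: "B = Topology_Euclidean_Space.box (z - (\<chi> k. r)) (z + (\<chi> k. r))"
  proof -
    have "\<bar>z $ k - y $ k\<bar> < r \<longleftrightarrow> z $ k - r < y $ k \<and> y $ k < z $ k + r" for k y by linarith
    then show ?thesis by (auto simp: B_def mem_box_cart)
  qed
  have oB: "open B" and bB: "bounded B" and cB: "convex B"
    unfolding Bbox by (rule open_box bounded_box convex_box)+
  have [measurable]: "B \<in> sets borel" using oB by simp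
  have BS: "B \<subseteq> S" using box by (auto simp: B_def intro: less_imp_le)
  have qm[measurable]: "q \<in> borel_measurable borel" using wp by (simp add: weak_pair_def)
  have D0: "0 \<le> D" by (simp add: D_def)
  define W where "W = {w :: real^2. \<forall>k. \<bar>w $ k\<bar> \<le> 2 * r}"
  have [measurable]: "W \<in> sets borel" unfolding W_def by (rule square_borel)
  have mW: "emeasure lborel W = ennreal (16 * r^2)"
    unfolding W_def using emeasure_square[of "2 * r"] r by (simp add: power_mult_distrib)
  have "1 - (norm (LINT y|lborel. \<phi> (z - y) *\<^sub>R q y))^2 \<le> (\<kappa> / r^2)^2 * (measure lborel W * (8 * r^2 * D)) / 2"
  proof (rule weighted_mean_norm_ge[where B = B])
    show "z' - y \<in> W" if "y \<in> B" "z' \<in> B" for y z'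
    proof -
      have "\<bar>(z' - y) $ k\<bar> \<le> 2 * r" for k
      proof -
        have "\<bar>(z - y) $ k\<bar> < r" "\<bar>(z - z') $ k\<bar> < r" using that by (auto simp: B_def)
        then show ?thesis by simp
      qed
      then show ?thesis by (simp add: W_def)
    qed
    fix w assume w: "w \<in> W"
    \<comment> \<open>Convexity of \<open>B\<close> keeps the segments from y to y + w inside, so
      only the gradient on \<open>B\<close> enters.\<close>
    define T where "T = B \<inter> {y. y + w \<in> B}"
    have "open {y. y + w \<in> B}"
      using open_translation[OF oB, of "- w"] by (rule back_subst) (auto simp: image_iff algebra_simps intro!: bexI[of _ "_ + w"])
    then have T: "open T" "bounded T" unfolding T_def using oB bB by (auto intro: bounded_subset)
    have "(norm w)^2 \<le> 8 * r^2"
    proof -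
      have "(norm w)^2 \<le> 2 * (2 * r)^2" using w by (intro norm_le_of_components(2)) (simp add: W_def)
      then show ?thesis by (simp add: power_mult_distrib)
    qed
    have tr: "(LINT y|lborel. indicator T y * (norm (q (y + w) - q y))^2) \<le> (norm w)^2 * D"
      unfolding D_def
    proof (rule weak_pair_translation[OF wp q1(1) T])
      fix s y assume s: "0 \<le> s" "s \<le> (1::real)" and y: "y \<in> T"
      have "(1 - s) *\<^sub>R y + s *\<^sub>R (y + w) \<in> B"
        using cB y s unfolding T_def convex_alt by blast
      then show "y + s *\<^sub>R w \<in> S \<inter> B" using BS by (auto simp: algebra_simps)
    qed simp
    have "(\<integral>\<^sup>+y. indicator B y * indicator B (y + w) * ennreal ((norm (q (y + w) - q y))^2) \<partial>lborel)
        = (\<integral>\<^sup>+y. ennreal (indicator T y * (norm (q (y + w) - q y))^2) \<partial>lborel)"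
      by (intro nn_integral_cong) (auto simp: T_def indicator_def)
    also have "\<dots> = ennreal (LINT y|lborel. indicator T y * (norm (q (y + w) - q y))^2)"
    proof (rule nn_integral_eq_integral)
      have [measurable]: "T \<in> sets borel" using T by simp
      have "integrable lborel (indicat_real T)" using emeasure_bounded_finite[OF T(2)] by (simp add: integrable_indicator_iff)
      then have "integrable lborel (\<lambda>y. 4 * indicat_real T y)" by simp
      then show "integrable lborel (\<lambda>y. indicator T y * (norm (q (y + w) - q y))^2)"
      proof (rule Bochner_Integration.integrable_bound)
        have "norm (q (y + w) - q y) \<le> 2" for y
          using norm_triangle_ineq4[of "q (y + w)" "q y"] q1(1)[of y] q1(1)[of "y + w"] by linarith
        then have "(norm (q (y + w) - q y))^2 \<le> 2^2" for y by (intro power_mono) auto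
        then show "AE y in lborel. norm (indicator T y * (norm (q (y + w) - q y))^2) \<le> norm (4 * indicat_real T y)"
          by (intro AE_I2) (auto simp: indicator_def)
      qed measurable
    qed auto
    also have "\<dots> \<le> ennreal (8 * r^2 * D)"
      using tr \<open>(norm w)^2 \<le> 8 * r^2\<close> D0 by (intro ennreal_leI) (meson mult_right_mono order_trans)
    finally show "(\<integral>\<^sup>+y. indicator B y * indicator B (y + w) * ennreal ((norm (q (y + w) - q y))^2) \<partial>lborel) \<le> ennreal (8 * r^2 * D)" .
  next
    show "\<phi> (z - y) = 0" if "y \<notin> B" for y using that supp[of "z - y"] by (auto simp: B_def)
    show "norm (q y) = 1" if "y \<in> B" for y using that BS q1(2) by auto
    show "emeasure lborel W < \<infinity>" using mW by simp
  qed (use D0 kernel nonneg le in auto)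
  also have "\<dots> = 64 * \<kappa>^2 * D"
    using r mW by (simp add: measure_def power2_eq_square field_simps)
  finally show ?thesis by (simp add: moll_def D_def B_def)
qed

text \<open>By Jensen the squared error is at most a kernel average of |q y - q x|^2, which the
  translation estimate controls: the shifts fill an area 4 r^2, the kernel is at most \<kappa>/r^2
  and |w|^2 \<le> 2 r^2, in total 8 \<kappa> r^2.\<close>

lemma moll_L2_close:
  fixes q :: "real^2 \<Rightarrow> 'b::euclidean_space"
  assumes wp: "weak_pair S q d" and q1: "\<And>x. norm (q x) \<le> 1"
    and I: "open I" "bounded I" "\<And>x y. x \<in> I \<Longrightarrow> (\<And>k. \<bar>(x - y) $ k\<bar> \<le> r) \<Longrightarrow> y \<in> S"
  shows "(\<integral>\<^sup>+x. indicator I x * ennreal ((norm (moll \<phi> q x - q x))^2) \<partial>lborel) \<le> ennreal (8 * \<kappa> * r^2 * (LINT y|lborel. (norm (d y))^2))"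
proof -
  define D where "D = (LINT y|lborel. (norm (d y))^2)"
  have D0: "0 \<le> D" by (simp add: D_def)
  have qm[measurable]: "q \<in> borel_measurable borel" using wp by (simp add: weak_pair_def)
  have [measurable]: "I \<in> sets borel" using I by simp
  define W where "W = {w :: real^2. \<forall>k. \<bar>w $ k\<bar> \<le> r}"
  have [measurable]: "W \<in> sets borel" unfolding W_def by (rule square_borel)
  have mW: "emeasure lborel W = ennreal (4 * r^2)" unfolding W_def using emeasure_square[of r] r by simp
  define \<rho> where "\<rho> x y = indicator I x * ennreal (\<phi> (x - y))" for x y
  have "(\<integral>\<^sup>+x. indicator I x * ennreal ((norm (moll \<phi> q x - q x))^2) \<partial>lborel) \<le>
      (\<integral>\<^sup>+x. \<integral>\<^sup>+y. \<rho> x y * ennreal ((norm (q y - q x))^2) \<partial>lborel \<partial>lborel)"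
  proof (rule nn_integral_mono)
    fix x
    have g2: "norm (q y - q x) \<le> 2" for y
      using norm_triangle_ineq4[of "q y" "q x"] q1(1)[of y] q1(1)[of x] by linarith
    have i1: "integrable lborel (\<lambda>y. \<phi> (x - y) *\<^sub>R (q y - q x))"
      by (rule moll_integrable_bounded[OF _ g2]) measurable
    have i2: "integrable lborel (\<lambda>y. \<phi> (x - y) * (norm (q y - q x))^2)"
      using moll_integrable_bounded[of "\<lambda>y. (norm (q y - q x))^2" 4 x] power_mono[OF g2, of _ 2] by simp
    have "moll \<phi> q x - q x = (LINT y|lborel. \<phi> (x - y) *\<^sub>R q y) - (LINT y|lborel. \<phi> (x - y) *\<^sub>R q x)"
    proof -
      have "(LINT y|lborel. \<phi> (x - y) *\<^sub>R q x) = (LINT y|lborel. \<phi> (x - y)) *\<^sub>R q x"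
        by (rule integral_scaleR_left) (rule kernel(1))
      then show ?thesis by (simp add: moll_def kernel(2))
    qed
    also have "\<dots> = (LINT y|lborel. \<phi> (x - y) *\<^sub>R (q y - q x))"
      unfolding scaleR_diff_right
      by (intro Bochner_Integration.integral_diff[symmetric] moll_integrable_bounded[OF qm q1] integrable_scaleR_left kernel)
    finally have "(norm (moll \<phi> q x - q x))^2 \<le> (LINT y|lborel. \<phi> (x - y) * (norm (q y - q x))^2)"
      using weighted_Jensen[OF kernel(1,2) nonneg i1 i2] by simp
    then have "ennreal ((norm (moll \<phi> q x - q x))^2) \<le> (\<integral>\<^sup>+y. ennreal (\<phi> (x - y) * (norm (q y - q x))^2) \<partial>lborel)"
      using i2 nonneg by (subst nn_integral_eq_integral) (auto intro: ennreal_leI)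
    then show "indicator I x * ennreal ((norm (moll \<phi> q x - q x))^2) \<le> (\<integral>\<^sup>+y. \<rho> x y * ennreal ((norm (q y - q x))^2) \<partial>lborel)"
      using nonneg by (cases "x \<in> I") (auto simp: \<rho>_def ennreal_mult)
  qed
  also have "\<dots> \<le> emeasure lborel W * ennreal (\<kappa> / r^2 * (2 * r^2 * D))"
  proof (rule nn_integral_oscillation_le)
    show "(\<lambda>(y, z). \<rho> y z) \<in> borel_measurable (borel \<Otimes>\<^sub>M borel)" unfolding \<rho>_def by measurable
    show "\<rho> y z = 0" if "z - y \<notin> W" for y z
    proof -
      have "\<phi> (y - z) = 0"
      proof (rule ccontr)
        assume "\<phi> (y - z) \<noteq> 0"
        then have "\<bar>(z - y) $ k\<bar> \<le> r" for k using supp[of "y - z" k] by (simp add: abs_minus_commute)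
        then show False using that by (simp add: W_def)
      qed
      then show ?thesis by (simp add: \<rho>_def)
    qed
    fix w assume w: "w \<in> W"
    have nw: "(norm w)^2 \<le> 2 * r^2" using w by (intro norm_le_of_components(2)) (simp add: W_def)
    have tr: "(LINT y|lborel. indicator I y * (norm (q (y + w) - q y))^2) \<le> (norm w)^2 * (LINT y|lborel. indicator UNIV y * (norm (d y))^2)"
    proof (rule weak_pair_translation[OF wp q1(1) I(1,2)])
      fix s y assume s: "0 \<le> s" "s \<le> (1::real)" and y: "y \<in> I"
      have "y + s *\<^sub>R w \<in> S"
      proof (rule I(3)[OF y])
        fix k
        have "\<bar>(y - (y + s *\<^sub>R w)) $ k\<bar> = s * \<bar>w $ k\<bar>" using s by (simp add: abs_mult)
        also have "\<dots> \<le> 1 * r" using s w by (intro mult_mono) (auto simp: W_def)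
        finally show "\<bar>(y - (y + s *\<^sub>R w)) $ k\<bar> \<le> r" by simp
      qed
      then show "y + s *\<^sub>R w \<in> S \<inter> UNIV" by simp
    qed simp
    have "(\<integral>\<^sup>+y. \<rho> y (y + w) * ennreal ((norm (q (y + w) - q y))^2) \<partial>lborel)
        = ennreal (\<phi> (- w)) * (\<integral>\<^sup>+y. ennreal (indicator I y * (norm (q (y + w) - q y))^2) \<partial>lborel)"
      by (subst nn_integral_cmult[symmetric]) (auto intro!: nn_integral_cong simp: \<rho>_def indicator_def)
    also have "(\<integral>\<^sup>+y. ennreal (indicator I y * (norm (q (y + w) - q y))^2) \<partial>lborel) = ennreal (LINT y|lborel. indicator I y * (norm (q (y + w) - q y))^2)"
    proof (rule nn_integral_eq_integral)
      have "integrable lborel (indicat_real I)" using emeasure_bounded_finite[OF I(2)] by (simp add: integrable_indicator_iff)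
      then have "integrable lborel (\<lambda>y. 4 * indicat_real I y)" by simp
      then show "integrable lborel (\<lambda>y. indicator I y * (norm (q (y + w) - q y))^2)"
      proof (rule Bochner_Integration.integrable_bound)
        have "norm (q (y + w) - q y) \<le> 2" for y
          using norm_triangle_ineq4[of "q (y + w)" "q y"] q1(1)[of y] q1(1)[of "y + w"] by linarith
        then have "(norm (q (y + w) - q y))^2 \<le> 2^2" for y by (intro power_mono) auto
        then show "AE y in lborel. norm (indicator I y * (norm (q (y + w) - q y))^2) \<le> norm (4 * indicat_real I y)"
          by (intro AE_I2) (auto simp: indicator_def)
      qed measurable
    qed auto
    also have "ennreal (\<phi> (- w)) * \<dots> \<le> ennreal (\<kappa> / r^2) * ennreal (2 * r^2 * D)"
    proof (intro mult_mono ennreal_leI le)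
      have "(norm w)^2 * D \<le> 2 * r^2 * D" using nw D0 by (rule mult_right_mono)
      then show "(LINT y|lborel. indicator I y * (norm (q (y + w) - q y))^2) \<le> 2 * r^2 * D"
        using tr by (simp add: D_def)
    qed auto
    also have "\<dots> = ennreal (\<kappa> / r^2 * (2 * r^2 * D))" using \<kappa> D0 by (intro ennreal_mult[symmetric]) auto
    finally show "(\<integral>\<^sup>+y. \<rho> y (y + w) * ennreal ((norm (q (y + w) - q y))^2) \<partial>lborel) \<le> ennreal (\<kappa> / r^2 * (2 * r^2 * D))" .
  qed measurable
  also have "\<dots> = ennreal (4 * r^2 * (\<kappa> / r^2 * (2 * r^2 * D)))"
    unfolding mW using \<kappa> D0 by (intro ennreal_mult[symmetric]) auto
  also have "4 * r^2 * (\<kappa> / r^2 * (2 * r^2 * D)) = 8 * \<kappa> * r^2 * D" using r by simp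
  finally show ?thesis by (simp add: D_def)
qed

text \<open>Jensen for the mollified gradient and then Tonelli: the integral of \<phi>(\<Phi> x - y)
  over x is the multiplicity with which y is seen, and the bound \<open>c\<close> on it takes the
  place of a change of variables. \<open>N\<close> contains the points that are seen from
  \<open>A\<close>.\<close>

lemma push_integral_le:
  fixes \<Phi> :: "real^2 \<Rightarrow> real^2" and d :: "real^2 \<Rightarrow> 'b::euclidean_space^2"
  assumes [measurable]: "\<Phi> \<in> borel_measurable borel" "A \<in> sets borel" "N \<in> sets borel" "d \<in> borel_measurable borel"
    and d2: "integrable lborel (\<lambda>y. (norm (d y))^2)"
    and AN: "\<And>x y. x \<in> A \<Longrightarrow> (\<And>k. \<bar>(\<Phi> x - y) $ k\<bar> < r) \<Longrightarrow> y \<in> N"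
    and mult: "\<And>y. (\<integral>\<^sup>+x. indicator A x * ennreal (\<phi> (\<Phi> x - y)) \<partial>lborel) \<le> ennreal c" and "0 \<le> c"
  shows "(\<integral>\<^sup>+x. indicator A x * ennreal (\<Sum>k\<in>UNIV. (norm (moll \<phi> (\<lambda>y. d y $ k) (\<Phi> x)))^2) \<partial>lborel)
    \<le> ennreal (c * (LINT y|lborel. indicator N y * (norm (d y))^2))"
proof -
  note [measurable] = borel_measurable_vec_nth'[OF assms(4)]
  have dk2: "integrable lborel (\<lambda>y. (norm (d y $ k))^2)" for k
    by (rule Bochner_Integration.integrable_bound[OF d2])
       (auto intro!: AE_I2 power_mono simp: Finite_Cartesian_Product.norm_nth_le)
  have "(\<integral>\<^sup>+x. indicator A x * ennreal (\<Sum>k\<in>UNIV. (norm (moll \<phi> (\<lambda>y. d y $ k) (\<Phi> x)))^2) \<partial>lborel) \<le>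
    (\<integral>\<^sup>+x. \<integral>\<^sup>+y. indicator A x * (ennreal (\<phi> (\<Phi> x - y)) * (indicator N y * ennreal ((norm (d y))^2))) \<partial>lborel \<partial>lborel)"
  proof (rule nn_integral_mono)
    fix x
    show "indicator A x * ennreal (\<Sum>k\<in>UNIV. (norm (moll \<phi> (\<lambda>y. d y $ k) (\<Phi> x)))^2) \<le>
      (\<integral>\<^sup>+y. indicator A x * (ennreal (\<phi> (\<Phi> x - y)) * (indicator N y * ennreal ((norm (d y))^2))) \<partial>lborel)"
    proof (cases "x \<in> A")
      case True
      have "ennreal (\<Sum>k\<in>UNIV. (norm (moll \<phi> (\<lambda>y. d y $ k) (\<Phi> x)))^2) = (\<Sum>k\<in>UNIV. ennreal ((norm (moll \<phi> (\<lambda>y. d y $ k) (\<Phi> x)))^2))"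
        by (rule sum_ennreal[symmetric]) simp
      also have "\<dots> \<le> (\<Sum>k\<in>UNIV. \<integral>\<^sup>+y. ennreal (\<phi> (\<Phi> x - y)) * ennreal ((norm (d y $ k))^2) \<partial>lborel)"
        by (intro sum_mono moll_Jensen dk2) measurable
      also have "\<dots> = (\<integral>\<^sup>+y. (\<Sum>k\<in>UNIV. ennreal (\<phi> (\<Phi> x - y)) * ennreal ((norm (d y $ k))^2)) \<partial>lborel)"
        by (rule nn_integral_sum[symmetric]) measurable
      also have "\<dots> = (\<integral>\<^sup>+y. ennreal (\<phi> (\<Phi> x - y)) * (indicator N y * ennreal ((norm (d y))^2)) \<partial>lborel)"
      proof (rule nn_integral_cong)
        fix y
        have "(\<Sum>k\<in>UNIV. ennreal (\<phi> (\<Phi> x - y)) * ennreal ((norm (d y $ k))^2)) = ennreal (\<phi> (\<Phi> x - y)) * ennreal ((norm (d y))^2)"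
          by (simp add: sum_distrib_left[symmetric] norm_sq_vec[of "d y"] sum_ennreal)
        moreover have "\<phi> (\<Phi> x - y) = 0" if "y \<notin> N"
          using AN[OF True, of y] that supp[of "\<Phi> x - y"] by blast
        ultimately show "(\<Sum>k\<in>UNIV. ennreal (\<phi> (\<Phi> x - y)) * ennreal ((norm (d y $ k))^2)) =
            ennreal (\<phi> (\<Phi> x - y)) * (indicator N y * ennreal ((norm (d y))^2))"
          by (cases "y \<in> N") auto
      qed
      finally show ?thesis using True by simp
    qed simp
  qed
  also have "\<dots> = (\<integral>\<^sup>+y. \<integral>\<^sup>+x. indicator A x * (ennreal (\<phi> (\<Phi> x - y)) * (indicator N y * ennreal ((norm (d y))^2))) \<partial>lborel \<partial>lborel)"
    by (rule lborel_pair.Fubini') measurable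
  also have "\<dots> = (\<integral>\<^sup>+y. (indicator N y * ennreal ((norm (d y))^2)) * (\<integral>\<^sup>+x. indicator A x * ennreal (\<phi> (\<Phi> x - y)) \<partial>lborel) \<partial>lborel)"
    by (intro nn_integral_cong, subst nn_integral_cmult[symmetric]) (auto simp: mult_ac)
  also have "\<dots> \<le> (\<integral>\<^sup>+y. (indicator N y * ennreal ((norm (d y))^2)) * ennreal c \<partial>lborel)"
    by (intro nn_integral_mono mult_left_mono mult) simp
  also have "\<dots> = (\<integral>\<^sup>+y. ennreal (c * (indicator N y * (norm (d y))^2)) \<partial>lborel)"
    using \<open>0 \<le> c\<close> by (intro nn_integral_cong) (auto simp: indicator_def ennreal_mult mult.commute)
  also have "\<dots> = ennreal (LINT y|lborel. c * (indicator N y * (norm (d y))^2))"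
    using integrable_mult_indicator[OF _ d2, of N] \<open>0 \<le> c\<close>
    by (intro nn_integral_eq_integral) auto
  finally show ?thesis by simp
qed

text \<open>Two points whose images see y have images within 4 r of each other, so they are
  themselves within 8 r. All such points fit into a square of area 256 r^2, on which the kernel is
  at most \<kappa>/r^2.\<close>

lemma push_multiplicity:
  fixes \<Phi> :: "real^2 \<Rightarrow> real^2"
  assumes [measurable]: "\<Phi> \<in> borel_measurable borel" "A \<in> sets borel"
    and exp: "\<And>x x'. norm (x - x') \<le> 2 * norm (\<Phi> x - \<Phi> x')"
  shows "(\<integral>\<^sup>+x. indicator A x * ennreal (\<phi> (\<Phi> x - y)) \<partial>lborel) \<le> ennreal (256 * \<kappa>)"
proof (cases "\<exists>x0. \<phi> (\<Phi> x0 - y) \<noteq> 0")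
  case False
  then show ?thesis by simp
next
  case True
  then obtain x0 where x0: "\<phi> (\<Phi> x0 - y) \<noteq> 0" by blast
  define E where "E = {w :: real^2. \<forall>k. \<bar>w $ k\<bar> \<le> 8 * r}"
  have [measurable]: "E \<in> sets borel" unfolding E_def by (rule square_borel)
  have "x - x0 \<in> E" if "\<phi> (\<Phi> x - y) \<noteq> 0" for x
  proof -
    have c: "\<bar>(\<Phi> x - \<Phi> x0) $ k\<bar> \<le> 2 * r" for k
      using supp[OF that, of k] supp[OF x0, of k] by simp
    then have "norm (x - x0) \<le> 8 * r" using exp[of x x0] norm_le_of_components(1)[OF c] by simp
    then show ?thesis unfolding E_def using component_le_norm_cart[of "x - x0"] order_trans by blast
  qed
  then have "\<phi> (\<Phi> x - y) = 0" if "x - x0 \<notin> E" for x using that by blast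
  then have "(\<integral>\<^sup>+x. indicator A x * ennreal (\<phi> (\<Phi> x - y)) \<partial>lborel) \<le> (\<integral>\<^sup>+x. ennreal (\<kappa> / r^2) * indicator E (- x0 + x) \<partial>lborel)"
    using le by (intro nn_integral_mono) (auto simp: indicator_def intro!: ennreal_leI)
  also have "\<dots> = ennreal (\<kappa> / r^2) * (\<integral>\<^sup>+x. indicator E (- x0 + x) \<partial>lborel)"
    by (rule nn_integral_cmult) measurable
  also have "(\<integral>\<^sup>+x. indicator E (- x0 + x) \<partial>lborel) = emeasure lborel E"
    by (subst nn_integral_lborel_translate) auto
  also have "emeasure lborel E = ennreal (4 * (8 * r)^2)"
    unfolding E_def using r by (intro emeasure_square) simp
  also have "ennreal (\<kappa> / r^2) * \<dots> = ennreal (\<kappa> / r^2 * (4 * (8 * r)^2))" using \<kappa> by (intro ennreal_mult[symmetric]) auto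
  also have "\<kappa> / r^2 * (4 * (8 * r)^2) = 256 * \<kappa>" using r by (simp add: power_mult_distrib)
  finally show ?thesis .
qed

end

section \<open>Smooth approximation up to the boundary\<close>

text \<open>The layers shrink to the empty set because \<open>S\<close> is open and misses its
  frontier; dominated convergence does the rest.\<close>

lemma boundary_layer_small:
  fixes S :: "(real^2) set" and f :: "real^2 \<Rightarrow> real"
  assumes S: "open S" "bounded S" "S \<noteq> {}" and f: "integrable lborel f" "\<And>x. 0 \<le> f x" and e: "0 < e"
  obtains s where "0 < s" "(LINT x|lborel. indicator {x \<in> S. infdist x (frontier S) \<le> s} x * f x) \<le> e"
proof -
  note [measurable] = borel_measurable_integrable[OF f(1)]
  have [measurable]: "S \<in> sets borel" using S by simp
  have ne: "frontier S \<noteq> {}" using S not_bounded_UNIV by (auto simp: frontier_eq_empty)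
  define L where "L n = {x \<in> S. infdist x (frontier S) \<le> 1 / real (Suc n)}" for n
  have cl: "closed {x. infdist x (frontier S) \<le> c}" for c by (intro closed_Collect_le continuous_intros)
  have [measurable]: "L n \<in> sets borel" for n
    using cl[of "1 / real (Suc n)"] unfolding L_def by (auto simp: Collect_conj_eq)
  have "(\<lambda>n. LINT x|lborel. indicator (L n) x * f x) \<longlonglongrightarrow> (LINT x|(lborel :: (real^2) measure). 0)"
  proof (rule integral_dominated_convergence[where w = f])
    show "AE x in lborel. (\<lambda>n. indicator (L n) x * f x) \<longlonglongrightarrow> 0"
    proof (intro AE_I2 tendsto_eventually)
      fix x
      show "eventually (\<lambda>n. indicator (L n) x * f x = 0) sequentially"
      proof (cases "x \<in> S")
        case True
        then have "x \<notin> frontier S" using S by (simp add: frontier_def interior_open)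
        then have "0 < infdist x (frontier S)"
          using in_closed_iff_infdist_zero[OF frontier_closed ne] infdist_nonneg[of x "frontier S"] by (metis less_eq_real_def)
        then have "eventually (\<lambda>n. 1 / real (Suc n) < infdist x (frontier S)) sequentially"
          using LIMSEQ_Suc[OF lim_1_over_n] by (rule order_tendstoD(2)[rotated])
        then show ?thesis by eventually_elim (simp add: L_def)
      qed (simp add: L_def)
    qed
  qed (use f in \<open>auto simp: indicator_def\<close>)
  then have "eventually (\<lambda>n. (LINT x|lborel. indicator (L n) x * f x) < e) sequentially"
    using e by (intro order_tendstoD(2)[where y = "(LINT x|(lborel :: (real^2) measure). 0)"]) auto
  then obtain n where "(LINT x|lborel. indicator (L n) x * f x) < e" by (auto simp: eventually_sequentially)
  then show ?thesis by (intro that[of "1 / real (Suc n)"]) (auto simp: L_def)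
qed

text \<open>\<Phi> is the identity plus t V with the inward field \<open>V\<close>. For small t the
  partial derivatives of t V are at most 1/8, so t V is 1/2-Lipschitz and \<Phi> shrinks distances
  at most by half. The closure of \<open>S\<close> is mapped into the open set \<open>S\<close>,
  which leaves room for mollifying, and \<Phi> is the identity away from the frontier because
  \<open>V\<close> vanishes there.\<close>

lemma boundary_deformation:
  assumes S: "open S" "bounded S" "lipschitz_boundary S" and s: "0 < s"
  obtains \<Phi> :: "real^2 \<Rightarrow> real^2" and J :: "2 \<Rightarrow> 2 \<Rightarrow> real^2 \<Rightarrow> real" where
    "\<And>x. (\<Phi> has_derivative (\<lambda>v. v + (\<chi> k. \<Sum>j\<in>UNIV. v $ j * J j k x))) (at x)"
    "\<And>j k. continuous_on UNIV (J j k)" "\<And>j k x. \<bar>J j k x\<bar> \<le> 1 / 8"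
    "\<And>x. norm (\<Phi> x - x) \<le> s" "\<And>x x'. norm (x - x') \<le> 2 * norm (\<Phi> x - \<Phi> x')"
    "\<And>x. x \<in> closure S \<Longrightarrow> \<Phi> x \<in> S" "\<And>x. s < infdist x (frontier S) \<Longrightarrow> \<Phi> x = x"
    "\<And>x j k. s < infdist x (frontier S) \<Longrightarrow> J j k x = 0"
proof -
  obtain V t0 where V: "\<And>j. test_function UNIV (\<lambda>x. V x $ j)" and t0: "0 < t0"
    and near: "\<And>x. V x \<noteq> 0 \<Longrightarrow> \<exists>p\<in>frontier S. dist x p < s"
    and inw: "\<And>t x. 0 < t \<Longrightarrow> t \<le> t0 \<Longrightarrow> x \<in> closure S \<Longrightarrow> x + t *\<^sub>R V x \<in> S"
    using inward_field[OF S s] by blast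
  have "\<forall>k. \<exists>B>0. \<forall>x. \<bar>V x $ k\<bar> \<le> B" using test_function_bounded[OF V] by metis
  then obtain B where B: "\<And>k. 0 < B k" "\<And>k x. \<bar>V x $ k\<bar> \<le> B k" by metis
  have "\<forall>j k. \<exists>C>0. \<forall>x. \<bar>partial_deriv j (\<lambda>x. V x $ k) x\<bar> \<le> C"
    using test_function_bounded[OF test_function_partial_deriv[OF V]] by metis
  then obtain C where C: "\<And>j k. 0 < C j k" "\<And>j k x. \<bar>partial_deriv j (\<lambda>x. V x $ k) x\<bar> \<le> C j k" by metis
  define B0 where "B0 = (\<Sum>k\<in>UNIV. B k)"
  define C0 where "C0 = (\<Sum>j\<in>UNIV. \<Sum>k\<in>UNIV. C j k)"
  have B0: "0 < B0" unfolding B0_def using B(1) by (intro sum_pos) auto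
  have C0: "0 < C0" unfolding C0_def using C(1) by (intro sum_pos) auto
  have CC0: "C j k \<le> C0" for j k
  proof -
    have "C j k \<le> (\<Sum>k\<in>UNIV. C j k)" using C(1) by (intro member_le_sum) (auto intro: less_imp_le)
    also have "\<dots> \<le> C0" unfolding C0_def
      by (rule member_le_sum[of j UNIV "\<lambda>j. \<Sum>k\<in>UNIV. C j k"]) (use C(1) in \<open>auto intro!: sum_nonneg intro: less_imp_le\<close>)
    finally show ?thesis .
  qed
  have nV: "norm (V x) \<le> B0" for x
    using norm_le_l1_cart[of "V x"] sum_mono[of UNIV "\<lambda>k. \<bar>V x $ k\<bar>" B] B(2) unfolding B0_def by fastforce
  \<comment> \<open>The three entries ensure in turn that \<Phi> maps into \<open>S\<close>, that
    points move by at most s, and that the derivative is small.\<close>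
  define t where "t = min t0 (min (s / B0) (1 / (8 * C0)))"
  have t: "0 < t" "t \<le> t0" "t * B0 \<le> s" "t * C0 \<le> 1 / 8"
  proof -
    show "0 < t" "t \<le> t0" using t0 s B0 C0 by (simp_all add: t_def)
    have "t \<le> s / B0" "t \<le> 1 / (8 * C0)" by (simp_all add: t_def)
    then show "t * B0 \<le> s" "t * C0 \<le> 1 / 8" using B0 C0 by (simp_all add: field_simps)
  qed
  define J where "J j k x = t * partial_deriv j (\<lambda>x. V x $ k) x" for j k x
  define \<Phi> where "\<Phi> x = x + t *\<^sub>R V x" for x
  have J8: "\<bar>J j k x\<bar> \<le> 1 / 8" for j k x
  proof -
    have "\<bar>J j k x\<bar> = t * \<bar>partial_deriv j (\<lambda>x. V x $ k) x\<bar>" using t by (simp add: J_def abs_mult)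
    also have "\<dots> \<le> t * C0" using C(2)[of j k x] CC0[of j k] t by (intro mult_left_mono) auto
    finally show ?thesis using t(4) by linarith
  qed
  have dV: "((\<lambda>x. t *\<^sub>R V x) has_derivative (\<lambda>v. \<chi> k. \<Sum>j\<in>UNIV. v $ j * J j k x)) (at x)" for x
  proof (subst has_derivative_componentwise_within, intro ballI)
    fix b :: "real^2" assume "b \<in> Basis"
    then obtain k where b: "b = axis k 1" using Basis_axis by blast
    have "((\<lambda>x. t * V x $ k) has_derivative (\<lambda>v. t * (\<Sum>j\<in>UNIV. v $ j * partial_deriv j (\<lambda>x. V x $ k) x))) (at x)"
      by (intro has_derivative_mult_right test_function_has_derivative[OF V])
    then show "((\<lambda>x. (t *\<^sub>R V x) \<bullet> b) has_derivative (\<lambda>v. (\<chi> k. \<Sum>j\<in>UNIV. v $ j * J j k x) \<bullet> b)) (at x)"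
      by (simp add: b inner_axis J_def sum_distrib_left mult_ac)
  qed
  have small: "norm ((\<chi> k. \<Sum>j\<in>UNIV. v $ j * J j k x) :: real^2) \<le> 1 / 2 * norm v" for v x
  proof -
    have "norm ((\<chi> k. \<Sum>j\<in>UNIV. v $ j * J j k x) :: real^2) \<le> (\<Sum>k\<in>UNIV. \<bar>\<Sum>j\<in>UNIV. v $ j * J j k x\<bar>)"
      using norm_le_l1_cart[of "(\<chi> k. \<Sum>j\<in>UNIV. v $ j * J j k x) :: real^2"] by simp
    also have "\<dots> \<le> (\<Sum>k\<in>(UNIV::2 set). \<Sum>j\<in>(UNIV::2 set). norm v * (1 / 8))"
    proof (intro sum_mono order_trans[OF sum_abs])
      fix j k
      show "\<bar>v $ j * J j k x\<bar> \<le> norm v * (1 / 8)"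
        unfolding abs_mult by (intro mult_mono component_le_norm_cart J8) auto
    qed
    finally show ?thesis by simp
  qed
  have contr: "norm (t *\<^sub>R V x - t *\<^sub>R V x') \<le> 1 / 2 * norm (x - x')" for x x'
  proof (rule differentiable_bound[OF convex_UNIV _ _ UNIV_I UNIV_I])
    show "((\<lambda>x. t *\<^sub>R V x) has_derivative (\<lambda>v. \<chi> k. \<Sum>j\<in>UNIV. v $ j * J j k x)) (at x within UNIV)" for x
      using dV by simp
    show "onorm (\<lambda>v. (\<chi> k. \<Sum>j\<in>UNIV. v $ j * J j k x) :: real^2) \<le> 1 / 2" for x
      by (rule onorm_bound) (use small in auto)
  qed
  have far: "V x = 0" if "s < infdist x (frontier S)" for x
    using near[of x] infdist_le[of _ "frontier S" x] that by fastforce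
  show ?thesis
  proof (rule that[of \<Phi> J])
    show "(\<Phi> has_derivative (\<lambda>v. v + (\<chi> k. \<Sum>j\<in>UNIV. v $ j * J j k x))) (at x)" for x
      unfolding \<Phi>_def[abs_def] by (intro has_derivative_add has_derivative_ident dV)
    show "continuous_on UNIV (J j k)" for j k
      unfolding J_def by (intro continuous_intros test_function_continuous[OF test_function_partial_deriv[OF V]])
    show "\<bar>J j k x\<bar> \<le> 1 / 8" for j k x by (rule J8)
    show "norm (\<Phi> x - x) \<le> s" for x
    proof -
      have "t * norm (V x) \<le> t * B0" using nV t by (intro mult_left_mono) auto
      then have "t * norm (V x) \<le> s" using t(3) by linarith
      then show ?thesis using t by (simp add: \<Phi>_def)
    qed
    show "norm (x - x') \<le> 2 * norm (\<Phi> x - \<Phi> x')" for x x'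
    proof -
      have "x - x' = (\<Phi> x - \<Phi> x') - (t *\<^sub>R V x - t *\<^sub>R V x')" by (simp add: \<Phi>_def)
      then have "norm (x - x') \<le> norm (\<Phi> x - \<Phi> x') + norm (t *\<^sub>R V x - t *\<^sub>R V x')" by (metis norm_triangle_ineq4)
      then show ?thesis using contr[of x x'] by linarith
    qed
    show "\<Phi> x \<in> S" if "x \<in> closure S" for x unfolding \<Phi>_def by (rule inw[OF t(1,2) that])
    show "\<Phi> x = x" if "s < infdist x (frontier S)" for x using far[OF that] by (simp add: \<Phi>_def)
    show "J j k x = 0" if x: "s < infdist x (frontier S)" for x j k
    proof -
      have op: "open {x. s < infdist x (frontier S)}" by (intro open_Collect_less continuous_intros)
      have "((\<lambda>x. V x $ k) has_derivative (\<lambda>_. 0)) (at x)"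
        by (rule has_derivative_transform_within_open[OF has_derivative_const[of 0] op]) (use x far in auto)
      from partial_deriv_eqI[OF this, of j] show ?thesis by (simp add: J_def)
    qed
  qed
qed

text \<open>Averaging preserves linear constraints; this is applied to the difference of the
  off-diagonal entries and to the trace.\<close>

lemma (in mollifier) moll_functional:
  fixes q :: "real^2 \<Rightarrow> 'b::euclidean_space" and f :: "'b \<Rightarrow> real"
  assumes f: "bounded_linear f" and q: "q \<in> borel_measurable borel" "\<And>y. norm (q y) \<le> B"
    and fc: "\<And>y. y \<in> S \<Longrightarrow> f (q y) = c" and box: "\<And>y. (\<And>k. \<bar>(z - y) $ k\<bar> \<le> r) \<Longrightarrow> y \<in> S"
  shows "f (moll \<phi> q z) = c"
proof -
  interpret f: bounded_linear f by fact
  have "f (moll \<phi> q z) = (LINT y|lborel. f (\<phi> (z - y) *\<^sub>R q y))"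
    unfolding moll_def by (rule integral_bounded_linear[OF f moll_integrable_bounded[OF q], symmetric])
  also have "\<dots> = (LINT y|lborel. \<phi> (z - y) * c)"
  proof (rule Bochner_Integration.integral_cong[OF refl])
    fix y
    show "f (\<phi> (z - y) *\<^sub>R q y) = \<phi> (z - y) * c"
    proof (cases "\<phi> (z - y) = 0")
      case False
      then have "y \<in> S" using supp by (intro box less_imp_le)
      then show ?thesis by (simp add: f.scaleR fc)
    qed (simp add: f.zero)
  qed
  finally show ?thesis by (simp add: kernel)
qed

text \<open>A crude chain-rule bound for composition with \<Phi>; the constant 4 is affordable
  because it is used only in the boundary layer.\<close>

lemma perturbed_pair_norm_le:
  fixes N :: "2 \<Rightarrow> 'b::real_normed_vector" and J :: "2 \<Rightarrow> 2 \<Rightarrow> real"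
  assumes J: "\<And>j k. \<bar>J j k\<bar> \<le> 1 / 8"
  shows "(\<Sum>j\<in>UNIV. (norm (N j + (\<Sum>k\<in>UNIV. J j k *\<^sub>R N k)))^2) \<le> 4 * (\<Sum>k\<in>UNIV. (norm (N k))^2)"
proof -
  define b where "b = (norm (N 1) + norm (N 2)) / 8"
  have *: "(norm (N j + (\<Sum>k\<in>UNIV. J j k *\<^sub>R N k)))^2 \<le> 2 * (norm (N j))^2 + 2 * b^2" for j
  proof -
    have "norm (\<Sum>k\<in>UNIV. J j k *\<^sub>R N k) \<le> (\<Sum>k\<in>UNIV. 1 / 8 * norm (N k))"
    proof (intro sum_norm_le)
      fix k
      show "norm (J j k *\<^sub>R N k) \<le> 1 / 8 * norm (N k)"
        unfolding norm_scaleR by (rule mult_right_mono[OF J norm_ge_zero])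
    qed
    then have "norm (N j + (\<Sum>k\<in>UNIV. J j k *\<^sub>R N k)) \<le> norm (N j) + b"
      using norm_triangle_ineq[of "N j" "\<Sum>k\<in>UNIV. J j k *\<^sub>R N k"] unfolding b_def sum_2 by argo
    then have "(norm (N j + (\<Sum>k\<in>UNIV. J j k *\<^sub>R N k)))^2 \<le> (norm (N j) + b)^2" by (intro power_mono) auto
    also have "\<dots> \<le> 2 * (norm (N j))^2 + 2 * b^2"
      using zero_le_power2[of "norm (N j) - b"] by (simp add: power2_eq_square algebra_simps)
    finally show ?thesis .
  qed
  have "32 * b^2 \<le> (norm (N 1))^2 + (norm (N 2))^2"
    using zero_le_power2[of "norm (N 1) - norm (N 2)"] by (simp add: b_def power2_eq_square field_simps)
  then show ?thesis using *[of 1] *[of 2] zero_le_power2[of b] unfolding sum_2 by argo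
qed

text \<open>The approximation evaluates the mollified \<open>q\<close> at \<Phi> x. The parameters
  depend on each other in the order c, s, \<delta>, r: the width of a layer carrying little energy
  and area, the displacement, the distance of the deformed closure from the complement of
  \<open>S\<close>, the mollification radius. In the interior, where \<Phi> is the identity, Jensen
  gives no loss of energy.\<close>

lemma smooth_approximation:
  fixes S :: "(real^2) set" and q :: "real^2 \<Rightarrow> real^2^2"
  assumes S: "open S" "bounded S" "lipschitz_boundary S" "S \<noteq> {}"
    and wp: "weak_pair S q d" and qK: "\<And>x. x \<in> S \<Longrightarrow> q x \<in> bd_K" and \<nu>: "0 < \<nu>"
  obtains A and G :: "2 \<Rightarrow> real^2 \<Rightarrow> real^2^2" where
    "\<And>x. (A has_derivative (\<lambda>v. \<Sum>j\<in>UNIV. v $ j *\<^sub>R G j x)) (at x)" "\<And>j. continuous_on UNIV (G j)"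
    "\<And>x. x \<in> S \<Longrightarrow> A x \<in> sym_mat \<and> trace (A x) = 1 \<and> 1 - (norm (A x))^2 \<le> \<nu>"
    "(\<integral>\<^sup>+x. indicator S x * ennreal (\<Sum>j\<in>UNIV. (norm (G j x))^2) \<partial>lborel) \<le> ennreal ((LINT x|lborel. (norm (d x))^2) + \<nu>)"
    "(\<integral>\<^sup>+x. indicator S x * ennreal (norm (A x - q x)) \<partial>lborel) \<le> ennreal \<nu>"
proof -
  define F where "F = frontier S"
  define D where "D = (LINT x|lborel. (norm (d x))^2)"
  have D0: "0 \<le> D" by (simp add: D_def)
  have qm[measurable]: "q \<in> borel_measurable borel" and dm[measurable]: "d \<in> borel_measurable borel"
    and qi: "integrable lborel q" and d2: "integrable lborel (\<lambda>x. (norm (d x))^2)"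
    and out: "\<And>x. x \<notin> S \<Longrightarrow> q x = 0" "\<And>x. x \<notin> S \<Longrightarrow> d x = 0"
    using wp by (auto simp: weak_pair_def)
  note [measurable] = borel_measurable_vec_nth'[OF dm]
  have [measurable]: "S \<in> sets borel" using S by simp
  have iS: "integrable lborel (indicat_real S)" using emeasure_bounded_finite[OF S(2)] by (simp add: integrable_indicator_iff)
  define m where "m = measure lborel S"
  have m0: "0 \<le> m" by (simp add: m_def)
  have em: "emeasure lborel S = ennreal m"
    unfolding m_def using emeasure_bounded_finite[OF S(2)] by (intro emeasure_eq_ennreal_measure) auto
  have q1: "norm (q x) \<le> 1" "x \<in> S \<Longrightarrow> norm (q x) = 1" for x
    using qK[of x] out(1)[of x] by (cases "x \<in> S"; simp add: bd_K_iff)+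
  have dki: "integrable lborel (\<lambda>y. d y $ k)" for k
  proof (rule Bochner_Integration.integrable_bound)
    show "integrable lborel d"
    proof -
      have "(\<lambda>x. indicator S x *\<^sub>R d x) = d" "(\<lambda>x. indicator S x * (norm (d x))^2) = (\<lambda>x. (norm (d x))^2)"
        using out(2) by (auto simp: fun_eq_iff indicator_def)
      then show ?thesis using L2_on_finite_integrable[of d S] S d2 by simp
    qed
  qed (auto intro!: AE_I2 simp: Finite_Cartesian_Product.norm_nth_le)
  obtain \<kappa> :: real and \<eta> where \<kappa>: "0 < \<kappa>" and \<eta>:
    "\<And>r. 0 < r \<Longrightarrow> test_function UNIV (\<eta> r)" "\<And>r x. 0 < r \<Longrightarrow> 0 \<le> \<eta> r x"
    "\<And>r x. 0 < r \<Longrightarrow> \<eta> r x \<le> \<kappa> / r^2" "\<And>r x k. 0 < r \<Longrightarrow> \<eta> r x \<noteq> 0 \<Longrightarrow> \<bar>x $ k\<bar> < r"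
    "\<And>r. 0 < r \<Longrightarrow> (LINT x|lborel. \<eta> r x) = 1"
    using mollifiers by blast

  \<comment> \<open>1024 \<kappa> is the chain-rule factor 4 times the multiplicity 256 \<kappa>;
    the second term is there because |A - q| \<le> 2 in the layer.\<close>
  define f where "f x = 1024 * \<kappa> * (norm (d x))^2 + 2 * indicat_real S x" for x
  have fi: "integrable lborel f" and f0: "\<And>x. 0 \<le> f x" unfolding f_def using d2 iS \<kappa> by auto
  obtain c where c: "0 < c" "(LINT x|lborel. indicator {x \<in> S. infdist x F \<le> c} x * f x) \<le> \<nu> / 2"
    unfolding F_def using boundary_layer_small[OF S(1,2,4) fi f0, of "\<nu> / 2"] \<nu> by auto
  \<comment> \<open>Points seen from the layer of width s lie within s + s + 2 r \<le> 3 s of the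
    frontier, hence in the layer of width c.\<close>
  define s where "s = c / 4"
  have s: "0 < s" using c by (simp add: s_def)
  obtain \<Phi> J where \<Phi>:
    "\<And>x. (\<Phi> has_derivative (\<lambda>v. v + (\<chi> k. \<Sum>j\<in>UNIV. v $ j * J j k x))) (at x)"
    and J: "\<And>j k. continuous_on UNIV (J j k)" "\<And>j k x. \<bar>J j k x\<bar> \<le> 1 / 8"
    and \<Phi>s: "\<And>x. norm (\<Phi> x - x) \<le> s" "\<And>x x'. norm (x - x') \<le> 2 * norm (\<Phi> x - \<Phi> x')"
    and \<Phi>S: "\<And>x. x \<in> closure S \<Longrightarrow> \<Phi> x \<in> S" and far: "\<And>x. s < infdist x F \<Longrightarrow> \<Phi> x = x"
    "\<And>x j k. s < infdist x F \<Longrightarrow> J j k x = 0"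
    unfolding F_def using boundary_deformation[OF S(1-3) s] by blast
  have \<Phi>c: "continuous_on T \<Phi>" for T by (intro continuous_at_imp_continuous_on ballI has_derivative_continuous[OF \<Phi>])
  have [measurable]: "\<Phi> \<in> borel_measurable borel" by (rule borel_measurable_continuous_onI[OF \<Phi>c])
  have "compact (\<Phi> ` closure S)" using S(2) \<Phi>c by (intro compact_continuous_image) (auto simp: compact_closure)
  then obtain \<delta> where \<delta>: "0 < \<delta>" "\<And>x z. x \<in> \<Phi> ` closure S \<Longrightarrow> norm (z - x) < \<delta> \<Longrightarrow> z \<in> S"
    using compact_subset_open_margin[of "\<Phi> ` closure S" S] \<Phi>S S(1) by blast
  obtain \<rho> where \<rho>: "0 < \<rho>"
    "\<And>B. B \<in> sets lborel \<Longrightarrow> emeasure lborel B \<le> ennreal \<rho> \<Longrightarrow> (LINT x|lborel. indicator B x * (norm (d x))^2) \<le> \<nu> / (64 * \<kappa>^2)"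
    using integral_small_on_small_sets[OF d2, of "\<nu> / (64 * \<kappa>^2)"] \<nu> \<kappa> by auto
  \<comment> \<open>\<beta> is the weight in a \<le> \<beta> + a^2/\<beta>, which trades the L^1
    distance for the available L^2 bound.\<close>
  define \<beta> where "\<beta> = \<nu> / (4 * (m + 1))"
  have \<beta>: "0 < \<beta>" "\<beta> * m \<le> \<nu> / 4" using m0 \<nu> by (auto simp: \<beta>_def field_simps)
  \<comment> \<open>The first entry brings the area 4 r^2 of the mollification box below \<rho>; the
    second makes the L^2 error divided by \<beta> at most \<nu>/4.\<close>
  define \<omega> where "\<omega> = min (\<rho> / 4) (\<nu> * \<beta> / (32 * \<kappa> * (D + 1)))"
  have \<omega>: "0 < \<omega>" using \<rho> \<nu> \<beta> \<kappa> D0 by (simp add: \<omega>_def)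
  define r where "r = min (min (\<delta> / 4) (s / 2)) (sqrt \<omega>)"
  have rr: "0 < r" "r \<le> \<delta> / 4" "r \<le> s / 2" using \<delta> s \<omega> by (auto simp: r_def)
  have "r \<le> sqrt \<omega>" by (simp add: r_def)
  then have "r^2 \<le> (sqrt \<omega>)^2" using rr by (intro power_mono) auto
  then have r2: "r^2 \<le> \<rho> / 4" "r^2 \<le> \<nu> * \<beta> / (32 * \<kappa> * (D + 1))" using \<omega> by (auto simp: \<omega>_def)
  interpret mollifier "\<eta> r" \<kappa> r by unfold_locales (use rr \<kappa> \<eta> in auto)
  have box: "y \<in> S" if "x \<in> S" "\<And>k. \<bar>(\<Phi> x - y) $ k\<bar> \<le> r" for x y
  proof (rule \<delta>(2))
    show "\<Phi> x \<in> \<Phi> ` closure S" using that(1) closure_subset by blast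
    show "norm (y - \<Phi> x) < \<delta>"
      using norm_le_of_components(1)[OF that(2)] rr(2) \<delta>(1) by (simp only: norm_minus_commute[of y])
  qed

  define N where "N k z = moll (partial_deriv k (\<eta> r)) q z" for k z
  define A where "A x = moll (\<eta> r) q (\<Phi> x)" for x
  define G where "G j x = N j (\<Phi> x) + (\<Sum>k\<in>UNIV. J j k x *\<^sub>R N k (\<Phi> x))" for j x
  have Nc: "continuous_on UNIV (N k)" for k
    unfolding N_def by (rule moll_continuous[OF test_function_partial_deriv[OF \<phi>] qi])
  have Gc: "continuous_on UNIV (G j)" for j
    unfolding G_def by (intro continuous_intros J continuous_on_compose2[OF Nc \<Phi>c]) auto
  have Ader: "(A has_derivative (\<lambda>v. \<Sum>j\<in>UNIV. v $ j *\<^sub>R G j x)) (at x)" for x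
  proof -
    have "(A has_derivative (\<lambda>v. \<Sum>k\<in>UNIV. (v + (\<chi> k. \<Sum>j\<in>UNIV. v $ j * J j k x)) $ k *\<^sub>R N k (\<Phi> x))) (at x)"
      unfolding A_def[abs_def] N_def by (rule has_derivative_compose[OF \<Phi> moll_has_derivative[OF \<phi> qi]])
    then show ?thesis by (rule has_derivative_eq_rhs) (simp add: fun_eq_iff G_def sum_2 algebra_simps)
  qed
  have Ac: "continuous_on UNIV A" by (intro continuous_at_imp_continuous_on ballI has_derivative_continuous[OF Ader])
  note [measurable] = borel_measurable_continuous_onI[OF Nc] borel_measurable_continuous_onI[OF Gc] borel_measurable_continuous_onI[OF Ac]
    borel_measurable_continuous_onI[OF moll_continuous[OF \<phi> dki]] borel_measurable_continuous_onI[OF moll_continuous[OF \<phi> qi]]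
  have Nd: "N k (\<Phi> x) = moll (\<eta> r) (\<lambda>y. d y $ k) (\<Phi> x)" if "x \<in> S" for x k
    unfolding N_def by (rule moll_partial[OF wp box[OF that]])

  \<comment> \<open>On \<open>I\<close> the map \<Phi> is the identity, \<open>O'\<close> is the
    layer that may be deformed, and \<open>L\<close> is a wider layer containing all points averaged
    by the values on \<open>O'\<close>.\<close>
  define I where "I = {x \<in> S. s < infdist x F}"
  define O' where "O' = {x \<in> S. infdist x F \<le> s}"
  define L where "L = {x \<in> S. infdist x F \<le> c}"
  have oI: "open I"
  proof -
    have "open {x. s < infdist x F}" by (intro open_Collect_less continuous_intros)
    then show ?thesis unfolding I_def using S(1) by (simp add: Collect_conj_eq open_Int)
  qed
  have [measurable]: "I \<in> sets borel" using oI by simp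
  have cl: "closed {x. infdist x F \<le> c}" for c by (intro closed_Collect_le continuous_intros)
  have [measurable]: "O' \<in> sets borel" "L \<in> sets borel" using cl unfolding O'_def L_def by (auto simp: Collect_conj_eq)
  have "bounded L" by (rule bounded_subset[OF S(2)]) (auto simp: L_def)
  then have Lf: "emeasure lborel L < \<infinity>" using emeasure_bounded_finite by simp
  then have iL: "integrable lborel (indicat_real L)" by (simp add: integrable_indicator_iff)
  have idL: "integrable lborel (\<lambda>x. indicator L x * (norm (d x))^2)" using integrable_mult_indicator[OF _ d2, of L] by simp
  define X where "X = (LINT x|lborel. indicator L x * (norm (d x))^2)"
  have X0: "0 \<le> X" by (simp add: X_def)
  have XL: "1024 * \<kappa> * X + 2 * measure lborel L \<le> \<nu> / 2"
  proof -
    have "(LINT x|lborel. indicator L x * f x) = (LINT x|lborel. 1024 * \<kappa> * (indicator L x * (norm (d x))^2) + 2 * indicat_real L x)"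
      by (intro Bochner_Integration.integral_cong) (auto simp: f_def L_def indicator_def)
    also have "\<dots> = 1024 * \<kappa> * X + 2 * measure lborel L" using iL idL by (simp add: X_def)
    finally show ?thesis using c(2) by (simp add: L_def)
  qed
  have eL: "emeasure lborel L = ennreal (measure lborel L)"
    using Lf by (intro emeasure_eq_ennreal_measure) auto
  have XL1: "1024 * \<kappa> * X \<le> \<nu> / 2" "2 * measure lborel L \<le> \<nu> / 2"
    using XL X0 \<kappa> measure_nonneg[of lborel L] mult_nonneg_nonneg[of \<kappa> X] by linarith+

  show ?thesis
  proof (rule that[OF Ader Gc])
    fix x assume x: "x \<in> S"
    have "bounded_linear (\<lambda>Q :: real^2^2. Q $ 1 $ 2 - Q $ 2 $ 1)" "bounded_linear (\<lambda>Q :: real^2^2. Q $ 1 $ 1 + Q $ 2 $ 2)"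
      by (intro bounded_linear_sub bounded_linear_add bounded_linear_compose[OF bounded_linear_vec_nth] bounded_linear_vec_nth)+
    from moll_functional[OF this(1) qm q1(1) _ box[OF x], of 0] moll_functional[OF this(2) qm q1(1) _ box[OF x], of 1]
    have "A x \<in> sym_mat" "trace (A x) = 1"
      using qK by (simp_all add: A_def sym_mat_iff trace_mat2 bd_K_iff)
    moreover have "1 - (norm (A x))^2 \<le> \<nu>"
    proof -
      define B where "B = {y. \<forall>k. \<bar>(\<Phi> x - y) $ k\<bar> < r}"
      have "B = (\<Inter>k. {y. \<bar>(\<Phi> x - y) $ k\<bar> < r})" by (auto simp: B_def)
      then have oB: "open B" by (simp only:) (intro open_INT ballI open_Collect_less continuous_intros finite)
      define W where "W = {w :: real^2. \<forall>k. \<bar>w $ k\<bar> \<le> r}"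
      have [measurable]: "W \<in> sets borel" unfolding W_def by (rule square_borel)
      have "emeasure lborel B = (\<integral>\<^sup>+y. indicator B y \<partial>lborel)" using oB by simp
      also have "\<dots> \<le> (\<integral>\<^sup>+y. indicator W (- \<Phi> x + y) \<partial>lborel)"
        by (intro nn_integral_mono) (auto simp: indicator_def B_def W_def abs_minus_commute intro: less_imp_le)
      also have "\<dots> = emeasure lborel W" by (subst nn_integral_lborel_translate) auto
      also have "\<dots> = ennreal (4 * r^2)" unfolding W_def using rr(1) by (intro emeasure_square) simp
      also have "\<dots> \<le> ennreal \<rho>" using r2(1) by (intro ennreal_leI) linarith
      finally have "(LINT y|lborel. indicator B y * (norm (d y))^2) \<le> \<nu> / (64 * \<kappa>^2)" using oB by (intro \<rho>(2)) auto
      then have "64 * \<kappa>^2 * (LINT y|lborel. indicator B y * (norm (d y))^2) \<le> \<nu>" using \<kappa> by (simp add: field_simps)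
      moreover have "1 - (norm (A x))^2 \<le> 64 * \<kappa>^2 * (LINT y|lborel. indicator B y * (norm (d y))^2)"
        unfolding A_def B_def by (rule mean_norm_ge[OF wp q1 box[OF x]])
      ultimately show ?thesis by linarith
    qed
    ultimately show "A x \<in> sym_mat \<and> trace (A x) = 1 \<and> 1 - (norm (A x))^2 \<le> \<nu>" by blast
  next
    define M where "M z = (\<Sum>k\<in>UNIV. (norm (moll (\<eta> r) (\<lambda>y. d y $ k) z))^2)" for z
    have [measurable]: "M \<in> borel_measurable borel" unfolding M_def by measurable
    have "(\<integral>\<^sup>+x. indicator S x * ennreal (\<Sum>j\<in>UNIV. (norm (G j x))^2) \<partial>lborel) \<le>
      (\<integral>\<^sup>+x. indicator I x * ennreal (M x) + 4 * (indicator O' x * ennreal (M (\<Phi> x))) \<partial>lborel)"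
    proof (rule nn_integral_mono)
      fix x
      consider "x \<notin> S" | "x \<in> S" "s < infdist x F" | "x \<in> S" "infdist x F \<le> s" by linarith
      then show "indicator S x * ennreal (\<Sum>j\<in>UNIV. (norm (G j x))^2) \<le> indicator I x * ennreal (M x) + 4 * (indicator O' x * ennreal (M (\<Phi> x)))"
      proof cases
        case 2
        have "G j x = moll (\<eta> r) (\<lambda>y. d y $ j) x" for j
          using Nd[OF 2(1), of j] far[OF 2(2)] by (simp add: G_def)
        then show ?thesis using 2 by (simp add: I_def M_def)
      next
        case 3
        have "(\<Sum>j\<in>UNIV. (norm (G j x))^2) \<le> 4 * M (\<Phi> x)"
          unfolding G_def M_def using perturbed_pair_norm_le[of "\<lambda>j k. J j k x" "\<lambda>k. N k (\<Phi> x)"] J(2) Nd[OF 3(1)] by simp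
        then have "ennreal (\<Sum>j\<in>UNIV. (norm (G j x))^2) \<le> 4 * ennreal (M (\<Phi> x))"
          by (subst ennreal_numeral[symmetric], subst ennreal_mult[symmetric]) (auto simp: M_def intro!: ennreal_leI sum_nonneg)
        then show ?thesis using 3 by (simp add: I_def O'_def)
      qed simp
    qed
    also have "\<dots> = (\<integral>\<^sup>+x. indicator I x * ennreal (M x) \<partial>lborel) + 4 * (\<integral>\<^sup>+x. indicator O' x * ennreal (M (\<Phi> x)) \<partial>lborel)"
      by (simp add: nn_integral_add nn_integral_cmult)
    also have "\<dots> \<le> ennreal D + 4 * ennreal (256 * \<kappa> * X)"
    proof (intro add_mono mult_left_mono)
      have "(\<integral>\<^sup>+x. indicator I x * ennreal (M x) \<partial>lborel) \<le> ennreal (1 * (LINT y|lborel. indicator S y * (norm (d y))^2))"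
        unfolding M_def
      proof (rule push_integral_le[OF _ _ _ dm d2, where \<Phi> = "\<lambda>x. x" and A = I and N = S])
        show "y \<in> S" if "x \<in> I" "\<And>k. \<bar>(x - y) $ k\<bar> < r" for x y
          using box[of x y] that far(1)[of x] by (auto simp: I_def intro: less_imp_le)
        fix y
        have "(\<integral>\<^sup>+x. indicator I x * ennreal (\<eta> r (x - y)) \<partial>lborel) \<le> (\<integral>\<^sup>+x. ennreal (\<eta> r (x - y)) \<partial>lborel)"
          by (intro nn_integral_mono) (auto simp: indicator_def)
        also have "\<dots> = 1" using kernel(3,4) nonneg by (subst nn_integral_eq_integral) auto
        finally show "(\<integral>\<^sup>+x. indicator I x * ennreal (\<eta> r (x - y)) \<partial>lborel) \<le> ennreal 1" by simp
      qed auto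
      also have "(LINT y|lborel. indicator S y * (norm (d y))^2) = D"
        unfolding D_def using out(2) by (intro Bochner_Integration.integral_cong) (auto simp: indicator_def)
      finally show "(\<integral>\<^sup>+x. indicator I x * ennreal (M x) \<partial>lborel) \<le> ennreal D" by simp
      show "(\<integral>\<^sup>+x. indicator O' x * ennreal (M (\<Phi> x)) \<partial>lborel) \<le> ennreal (256 * \<kappa> * X)"
        unfolding M_def X_def
      proof (rule push_integral_le[OF _ _ _ dm d2])
        show "(\<integral>\<^sup>+x. indicator O' x * ennreal (\<eta> r (\<Phi> x - y)) \<partial>lborel) \<le> ennreal (256 * \<kappa>)" for y
          by (rule push_multiplicity) (auto intro: \<Phi>s)
        show "y \<in> L" if "x \<in> O'" and xy: "\<And>k. \<bar>(\<Phi> x - y) $ k\<bar> < r" for x y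
        proof -
          have x: "x \<in> S" "infdist x F \<le> s" using that(1) by (auto simp: O'_def)
          have "norm (\<Phi> x - y) \<le> 2 * r" by (rule norm_le_of_components(1)) (use xy in \<open>auto intro: less_imp_le\<close>)
          moreover have "infdist y F \<le> infdist x F + dist y x" by (rule infdist_triangle)
          moreover have "dist y x \<le> norm (\<Phi> x - y) + norm (\<Phi> x - x)"
            using norm_triangle_ineq4[of "\<Phi> x - x" "\<Phi> x - y"] by (simp add: dist_norm)
          ultimately have "infdist y F \<le> c" using x(2) \<Phi>s(1)[of x] rr(3) s unfolding s_def by linarith
          then show ?thesis using box[OF x(1)] xy by (auto simp: L_def intro: less_imp_le)
        qed
      qed (use \<kappa> in auto)
    qed simp
    also have "\<dots> = ennreal (D + 1024 * \<kappa> * X)"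
      using D0 \<kappa> X0 by (subst ennreal_numeral[symmetric], subst ennreal_mult[symmetric]) (auto simp: ennreal_plus[symmetric] mult.assoc simp del: ennreal_plus)
    also have "\<dots> \<le> ennreal (D + \<nu>)" using XL1(1) \<nu> by (intro ennreal_leI) linarith
    finally show "(\<integral>\<^sup>+x. indicator S x * ennreal (\<Sum>j\<in>UNIV. (norm (G j x))^2) \<partial>lborel) \<le> ennreal ((LINT x|lborel. (norm (d x))^2) + \<nu>)"
      by (simp add: D_def)
  next
    define E where "E x = (norm (moll (\<eta> r) q x - q x))^2" for x
    have [measurable]: "E \<in> borel_measurable borel" unfolding E_def by measurable
    have "(\<integral>\<^sup>+x. indicator S x * ennreal (norm (A x - q x)) \<partial>lborel) \<le>
      (\<integral>\<^sup>+x. ennreal \<beta> * indicator S x + (ennreal (1 / \<beta>) * (indicator I x * ennreal (E x)) + ennreal 2 * indicator L x) \<partial>lborel)"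
    proof (rule nn_integral_mono)
      fix x
      consider "x \<notin> S" | "x \<in> S" "s < infdist x F" | "x \<in> S" "infdist x F \<le> s" by linarith
      then show "indicator S x * ennreal (norm (A x - q x)) \<le> ennreal \<beta> * indicator S x + (ennreal (1 / \<beta>) * (indicator I x * ennreal (E x)) + ennreal 2 * indicator L x)"
      proof cases
        case 2
        define a where "a = norm (A x - q x)"
        have "E x = a^2" using far(1)[OF 2(2)] by (simp add: a_def E_def A_def)
        moreover have "a \<le> \<beta> + 1 / \<beta> * a^2"
        proof -
          have "0 \<le> a * \<beta>" using \<beta>(1) by (simp add: a_def)
          then have "a * \<beta> \<le> \<beta>^2 + a^2" using sum_squares_bound[of a \<beta>] by linarith
          then show ?thesis using \<beta>(1) by (simp add: field_simps power2_eq_square)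
        qed
        ultimately have "ennreal a \<le> ennreal (\<beta> + 1 / \<beta> * E x)" by (intro ennreal_leI) simp
        also have "\<dots> = ennreal \<beta> + ennreal (1 / \<beta>) * ennreal (E x)"
          using \<beta>(1) by (subst ennreal_mult[symmetric]) (auto simp: E_def)
        also have "\<dots> \<le> ennreal \<beta> + (ennreal (1 / \<beta>) * ennreal (E x) + ennreal 2 * indicator L x)"
          by (intro add_left_mono) simp
        finally show ?thesis using 2 by (simp add: I_def a_def)
      next
        case 3
        have "norm (A x - q x) \<le> 2"
          using norm_triangle_ineq4[of "A x" "q x"] q1(1)[of x] moll_norm_le[OF qm q1(1), of "\<Phi> x"] unfolding A_def by linarith
        then have "ennreal (norm (A x - q x)) \<le> ennreal 2" by (rule ennreal_leI)
        moreover have "x \<in> L" using 3 s by (simp add: L_def s_def)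
        ultimately show ?thesis using 3 by (simp add: I_def add_increasing)
      qed simp
    qed
    also have "\<dots> = ennreal \<beta> * emeasure lborel S + (ennreal (1 / \<beta>) * (\<integral>\<^sup>+x. indicator I x * ennreal (E x) \<partial>lborel) + ennreal 2 * emeasure lborel L)"
      by (simp add: nn_integral_add nn_integral_cmult)
    also have "\<dots> \<le> ennreal \<beta> * ennreal m + (ennreal (1 / \<beta>) * ennreal (8 * \<kappa> * r^2 * D) + ennreal 2 * ennreal (measure lborel L))"
      unfolding em eL
    proof (intro add_mono mult_left_mono order_refl)
      show "(\<integral>\<^sup>+x. indicator I x * ennreal (E x) \<partial>lborel) \<le> ennreal (8 * \<kappa> * r^2 * D)"
        unfolding E_def D_def
      proof (rule moll_L2_close[OF wp q1(1) oI])
        show "bounded I" using S(2) by (auto simp: I_def intro: bounded_subset)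
        show "y \<in> S" if "x \<in> I" "\<And>k. \<bar>(x - y) $ k\<bar> \<le> r" for x y
          using box[of x y] that far(1)[of x] by (auto simp: I_def)
      qed
    qed simp_all
    also have "\<dots> = ennreal (\<beta> * m + (1 / \<beta> * (8 * \<kappa> * r^2 * D) + 2 * measure lborel L))"
    proof -
      have "0 \<le> 8 * \<kappa> * r^2 * D" using \<kappa> D0 by simp
      then show ?thesis using \<beta>(1) m0
        by (simp only: ennreal_mult[symmetric] ennreal_plus[symmetric] mult_nonneg_nonneg measure_nonneg less_imp_le
            zero_le_divide_1_iff add_nonneg_nonneg zero_le_numeral)
    qed
    also have "\<dots> \<le> ennreal \<nu>"
    proof (rule ennreal_leI)
      have "8 * \<kappa> * r^2 * D \<le> 8 * \<kappa> * (\<nu> * \<beta> / (32 * \<kappa> * (D + 1))) * D"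
        using r2(2) \<kappa> D0 by (intro mult_right_mono mult_left_mono) auto
      also have "\<dots> = \<nu> * \<beta> / 4 * (D / (D + 1))" using \<kappa> D0 by (simp add: divide_simps)
      also have "\<dots> \<le> \<nu> * \<beta> / 4 * 1" using \<nu> \<beta> D0 by (intro mult_left_mono) auto
      finally have "1 / \<beta> * (8 * \<kappa> * r^2 * D) \<le> 1 / \<beta> * (\<nu> * \<beta> / 4 * 1)" using \<beta>(1) by (intro mult_left_mono) auto
      also have "\<dots> = \<nu> / 4" using \<beta>(1) by simp
      finally show "\<beta> * m + (1 / \<beta> * (8 * \<kappa> * r^2 * D) + 2 * measure lborel L) \<le> \<nu>"
        using \<beta>(2) XL1(2) by linarith
    qed
    finally show "(\<integral>\<^sup>+x. indicator S x * ennreal (norm (A x - q x)) \<partial>lborel) \<le> ennreal \<nu>" .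
  qed
qed

section \<open>First-order behaviour of h at 1\<close>

text \<open>Near 1 the increment of \<open>h\<close> is at most (|h'(1)| + \<eta>) (1 - x), and 2 (1
  - x) = (1 - x^2) + (1 - x)^2, where the last term is of higher order. This is why 1 - x^2 appears
  with half the slope.\<close>

lemma slope_bound:
  assumes "Cn_on 1 {0..1} h" and \<eta>: "0 < \<eta>"
  obtains \<tau> where "0 < \<tau>"
    "\<And>x. 0 \<le> x \<Longrightarrow> x \<le> 1 \<Longrightarrow> 1 - x^2 \<le> \<tau> \<Longrightarrow> h x - h 1 \<le> (\<bar>slope_at_1 h\<bar> / 2 + \<eta>) * (1 - x^2)"
proof -
  define a where "a = slope_at_1 h"
  obtain h' where "\<forall>x\<in>{0..1}. (h has_real_derivative h' x) (at x within {0..1})" using assms(1) by auto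
  then have h1: "(h has_real_derivative h' 1) (at 1 within {0..1})" by simp
  then have "vector_derivative h (at 1 within {0..1}) = h' 1"
    by (intro vector_derivative_within_cbox[of 0 1, unfolded box_real]) (auto simp: has_real_derivative_iff_has_vector_derivative)
  then have "((\<lambda>y. (h y - h 1) / (y - 1)) \<longlongrightarrow> a) (at 1 within {0..1})"
    using h1 by (simp add: has_field_derivative_iff a_def slope_at_1_def)
  then have "eventually (\<lambda>y. dist ((h y - h 1) / (y - 1)) a < \<eta>) (at 1 within {0..1})"
    using \<eta> by (rule tendstoD)
  then obtain \<delta> where \<delta>: "0 < \<delta>" "\<And>y. y \<in> {0..1} \<Longrightarrow> y \<noteq> 1 \<Longrightarrow> dist y 1 < \<delta> \<Longrightarrow> \<bar>(h y - h 1) / (y - 1) - a\<bar> < \<eta>"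
    unfolding eventually_at dist_real_def by blast
  \<comment> \<open>Since 1 - x \<le> 1 - x^2 \<le> \<tau>, the first entry keeps x in the range of
    the difference quotient estimate; the second lets (|a| + \<eta>) (1 - x)^2 be absorbed into
    \<eta> (1 - x^2).\<close>
  define \<tau> where "\<tau> = min (\<delta> / 2) (\<eta> / (\<bar>a\<bar> + \<eta>))"
  show ?thesis
  proof (rule that)
    show "0 < \<tau>" using \<delta> \<eta> by (simp add: \<tau>_def add_nonneg_pos)
    fix x :: real assume x: "0 \<le> x" "x \<le> 1" "1 - x^2 \<le> \<tau>"
    show "h x - h 1 \<le> (\<bar>slope_at_1 h\<bar> / 2 + \<eta>) * (1 - x^2)"
    proof (cases "x = 1")
      case False
      have x2: "x^2 \<le> x" using x by (simp add: power2_eq_square mult_left_le)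
      then have x\<tau>: "1 - x \<le> \<tau>" using x by linarith
      define g where "g = (h x - h 1) / (x - 1)"
      have "\<bar>g - a\<bar> < \<eta>" unfolding g_def using x False x\<tau> \<delta>(1) by (intro \<delta>(2)) (auto simp: dist_real_def \<tau>_def)
      then have "- g \<le> \<bar>a\<bar> + \<eta>" by linarith
      then have "- g * (1 - x) \<le> (\<bar>a\<bar> + \<eta>) * (1 - x)" using x by (intro mult_right_mono) auto
      moreover have "h x - h 1 = - g * (1 - x)" using False by (simp add: g_def field_simps)
      moreover have "(\<bar>a\<bar> + \<eta>) * (1 - x) \<le> (\<bar>a\<bar> / 2 + \<eta>) * (1 - x^2)"
      proof -
        have "(1 - x)^2 \<le> \<tau> * (1 - x^2)"
          unfolding power2_eq_square[of "1 - x"] using x x2 x\<tau> by (intro mult_mono) auto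
        then have "(\<bar>a\<bar> + \<eta>) * (1 - x)^2 \<le> (\<bar>a\<bar> + \<eta>) * (\<tau> * (1 - x^2))"
          using \<eta> by (intro mult_left_mono) auto
        also have "\<dots> = ((\<bar>a\<bar> + \<eta>) * \<tau>) * (1 - x^2)" by simp
        also have "\<dots> \<le> \<eta> * (1 - x^2)"
        proof (intro mult_right_mono)
          have "\<tau> \<le> \<eta> / (\<bar>a\<bar> + \<eta>)" "0 < \<bar>a\<bar> + \<eta>" using \<eta> by (auto simp: \<tau>_def)
          then show "(\<bar>a\<bar> + \<eta>) * \<tau> \<le> \<eta>" by (simp add: field_simps)
        qed (use x x2 in linarith)
        finally have "(\<bar>a\<bar> + \<eta>) * (1 - x)^2 \<le> \<eta> * (1 - x^2)" .
        moreover have "2 * ((\<bar>a\<bar> + \<eta>) * (1 - x)) = (\<bar>a\<bar> + \<eta>) * (1 - x^2) + (\<bar>a\<bar> + \<eta>) * (1 - x)^2"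
          by (simp add: power2_eq_square algebra_simps)
        moreover have "2 * ((\<bar>a\<bar> / 2 + \<eta>) * (1 - x^2)) = (\<bar>a\<bar> + \<eta>) * (1 - x^2) + \<eta> * (1 - x^2)"
          by (simp add: algebra_simps)
        ultimately show ?thesis by linarith
      qed
      ultimately show ?thesis unfolding a_def by linarith
    qed simp
  qed
qed

section \<open>Projection onto the circle of rank-one projections\<close>

text \<open>Within the symmetric matrices of trace one, \<open>bd_K\<close> is the circle of radius
  1/sqrt 2 about half the identity; this is the radial projection onto that circle.\<close>

definition bd_K_proj :: "real^2^2 \<Rightarrow> real^2^2" where
  "bd_K_proj M = mat (1/2) + (1 / (sqrt 2 * norm (M - mat (1/2)))) *\<^sub>R (M - mat (1/2))"

lemma deviator_norm:
  fixes M :: "real^2^2"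
  assumes "trace M = 1"
  shows "(norm (M - mat (1/2)))^2 = (norm M)^2 - 1/2" "(M - mat (1/2)) \<bullet> mat (1/2) = 0"
proof -
  have "M$1$1 + M$2$2 = 1" using assms by (simp add: trace_mat2)
  then have "M$2$2 = 1 - M$1$1" by linarith
  then show "(norm (M - mat (1/2)))^2 = (norm M)^2 - 1/2" "(M - mat (1/2)) \<bullet> mat (1/2) = 0"
    unfolding norm_mat2_sq inner_mat2 by (simp_all add: mat_def power2_eq_square algebra_simps)
qed

text \<open>The norm condition says that the trace-free part is nonzero. Being orthogonal to half
  the identity, the normalised trace-free part contributes 1/2 to the squared norm, and half the
  identity the other 1/2.\<close>

lemma bd_K_proj_in:
  assumes "M \<in> sym_mat" "trace M = 1" "1/2 < (norm M)^2"
  shows "bd_K_proj M \<in> bd_K"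
proof -
  define B where "B = M - mat (1/2)"
  have B: "0 < (norm B)^2" "B \<bullet> mat (1/2) = 0" using deviator_norm[OF assms(2)] assms(3) by (simp_all add: B_def)
  have n: "norm B \<noteq> 0" using B by auto
  define c where "c = 1 / (sqrt 2 * norm B)"
  have c: "c^2 * (norm B)^2 = 1/2" using n by (simp add: c_def power_mult_distrib power_divide)
  have tB: "B$1$1 + B$2$2 = 0" using assms(2) by (simp add: B_def trace_mat2 mat_def)
  have sB: "B$1$2 = B$2$1" using assms(1) by (simp add: B_def sym_mat_iff mat_def)
  have P: "bd_K_proj M = mat (1/2) + c *\<^sub>R B" by (simp add: bd_K_proj_def B_def c_def)
  have half: "(norm (mat (1/2) :: real^2^2))^2 = 1/2" unfolding norm_mat2_sq by (simp add: mat_def power2_eq_square)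
  have "(norm (bd_K_proj M))^2 = (norm (mat (1/2) :: real^2^2))^2 + 2 * c * (B \<bullet> mat (1/2)) + c^2 * (norm B)^2"
    unfolding P power2_norm_eq_inner by (simp add: inner_add_left inner_add_right inner_commute power2_eq_square algebra_simps)
  also have "\<dots> = 1" using B(2) c half by simp
  finally have "norm (bd_K_proj M) = 1" by (simp add: power2_eq_1_iff) (smt (verit) norm_ge_zero)
  moreover have "trace (bd_K_proj M) = 1 + c * (B$1$1 + B$2$2)"
    by (simp add: P trace_mat2 mat_def algebra_simps)
  moreover have "bd_K_proj M \<in> sym_mat" using sB by (simp add: P sym_mat_iff mat_def)
  ultimately show ?thesis using tB by (simp add: bd_K_iff)
qed

lemma bd_K_proj_fixes: "M \<in> bd_K \<Longrightarrow> bd_K_proj M = M"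
proof -
  assume M: "M \<in> bd_K"
  then have "(norm (M - mat (1/2)))^2 = 1/2" using deviator_norm(1)[of M] by (simp add: bd_K_iff)
  then have "norm (M - mat (1/2)) = 1 / sqrt 2"
    by (metis norm_ge_zero real_sqrt_divide real_sqrt_one real_sqrt_unique)
  then show ?thesis by (simp add: bd_K_proj_def)
qed

text \<open>Expanding gives (2 |B| |B'| - 2 B.B') / (|B| |B'|), and the numerator is at most |B -
  B'|^2. Equality holds for |B|^2 = |B'|^2 = c, so the constant is sharp.\<close>

lemma norm_normalized_diff_le:
  fixes B B' :: "'a::real_inner"
  assumes c: "0 < c" "c \<le> (norm B)^2" "c \<le> (norm B')^2"
  shows "(norm ((1 / norm B) *\<^sub>R B - (1 / norm B') *\<^sub>R B'))^2 \<le> (norm (B - B'))^2 / c"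
proof -
  have n: "0 < norm B" "0 < norm B'" using c by auto
  have cc: "c \<le> norm B * norm B'"
  proof (rule power2_le_imp_le)
    have "c * c \<le> (norm B)^2 * (norm B')^2" using c by (intro mult_mono) auto
    then show "c^2 \<le> (norm B * norm B')^2" by (simp add: power2_eq_square mult_ac)
  qed simp
  have u: "norm ((1 / norm B) *\<^sub>R B) = 1" "norm ((1 / norm B') *\<^sub>R B') = 1" using n by auto
  have "(norm ((1 / norm B) *\<^sub>R B - (1 / norm B') *\<^sub>R B'))^2
      = (norm ((1 / norm B) *\<^sub>R B))^2 + (norm ((1 / norm B') *\<^sub>R B'))^2 - 2 * (((1 / norm B) *\<^sub>R B) \<bullet> ((1 / norm B') *\<^sub>R B'))"
    unfolding power2_norm_eq_inner by (simp only: inner_diff_left inner_diff_right inner_commute)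
  also have "\<dots> = (2 * norm B * norm B' - 2 * (B \<bullet> B')) / (norm B * norm B')"
    unfolding u using n by (simp add: field_simps)
  also have "\<dots> \<le> (norm (B - B'))^2 / (norm B * norm B')"
  proof (rule divide_right_mono)
    have "(norm (B - B'))^2 = (norm B)^2 + (norm B')^2 - 2 * (B \<bullet> B')"
      unfolding power2_norm_eq_inner by (simp add: inner_diff_left inner_diff_right inner_commute)
    then show "2 * norm B * norm B' - 2 * (B \<bullet> B') \<le> (norm (B - B'))^2"
      using sum_squares_bound[of "norm B" "norm B'"] by linarith
  qed simp
  also have "\<dots> \<le> (norm (B - B'))^2 / c" using c cc n by (intro divide_left_mono) auto
  finally show ?thesis .
qed

text \<open>The circle has squared radius 1/2 and the trace-free parts have squared norm at least
  1/2 - \<nu>; the quotient 1/(1 - 2 \<nu>) tends to 1 with \<nu>, so the projection costs nothing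
  in the limit.\<close>

lemma bd_K_proj_dist:
  assumes "trace M = 1" "trace M' = 1" "1 - (norm M)^2 \<le> \<nu>" "1 - (norm M')^2 \<le> \<nu>" "\<nu> < 1/2"
  shows "(norm (bd_K_proj M - bd_K_proj M'))^2 \<le> (norm (M - M'))^2 / (1 - 2 * \<nu>)"
proof -
  define B B' where "B = M - mat (1/2)" and "B' = M' - mat (1/2)"
  have "0 < 1/2 - \<nu>" "1/2 - \<nu> \<le> (norm B)^2" "1/2 - \<nu> \<le> (norm B')^2"
    using assms deviator_norm(1)[OF assms(1)] deviator_norm(1)[OF assms(2)] by (simp_all add: B_def B'_def)
  note * = norm_normalized_diff_le[OF this]
  have "bd_K_proj M - bd_K_proj M' = (1 / sqrt 2) *\<^sub>R ((1 / norm B) *\<^sub>R B - (1 / norm B') *\<^sub>R B')"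
    by (simp add: bd_K_proj_def B_def B'_def scaleR_diff_right)
  then have "(norm (bd_K_proj M - bd_K_proj M'))^2 = (norm ((1 / norm B) *\<^sub>R B - (1 / norm B') *\<^sub>R B'))^2 / 2"
    by (simp add: power_divide)
  also have "\<dots> \<le> (norm (B - B'))^2 / (1/2 - \<nu>) / 2" using * by (intro divide_right_mono) auto
  also have "\<dots> = (norm (M - M'))^2 / (1 - 2 * \<nu>)" using assms(5) by (simp add: B_def B'_def field_simps)
  finally show ?thesis .
qed

section \<open>Difference quotients\<close>

text \<open>The mean value inequality along an edge for \<open>A\<close> minus a linear term. With c
  the derivative at a nearby point it gives convergence of difference quotients, with c = 0 it
  bounds them.\<close>

lemma increment_bound:
  fixes A :: "real^2 \<Rightarrow> 'b::real_normed_vector"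
  assumes A: "\<And>x. (A has_derivative (\<lambda>v. \<Sum>j\<in>UNIV. v $ j *\<^sub>R G j x)) (at x)" and "0 \<le> \<epsilon>"
    and le: "\<And>s. 0 \<le> s \<Longrightarrow> s \<le> \<epsilon> \<Longrightarrow> norm (G k (x + s *\<^sub>R axis k 1) - c) \<le> e"
  shows "norm (A (x + \<epsilon> *\<^sub>R axis k 1) - A x - \<epsilon> *\<^sub>R c) \<le> e * \<epsilon>"
proof -
  define f where "f s = A (x + s *\<^sub>R axis k 1) - s *\<^sub>R c" for s
  have ax: "(\<Sum>j\<in>UNIV. (t *\<^sub>R axis k 1 :: real^2) $ j *\<^sub>R G j z) = t *\<^sub>R G k z" for t z
  proof -
    have "(\<Sum>j\<in>UNIV. (t *\<^sub>R axis k 1 :: real^2) $ j *\<^sub>R G j z) = (\<Sum>j\<in>UNIV. if j = k then t *\<^sub>R G j z else 0)"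
      by (intro sum.cong) (auto simp: axis_def)
    then show ?thesis by simp
  qed
  have f': "(f has_derivative (\<lambda>t. t *\<^sub>R (G k (x + s *\<^sub>R axis k 1) - c))) (at s within T)" for s T
  proof -
    have "((\<lambda>s. A (x + s *\<^sub>R axis k 1)) has_derivative (\<lambda>t. \<Sum>j\<in>UNIV. (t *\<^sub>R axis k 1) $ j *\<^sub>R G j (x + s *\<^sub>R axis k 1))) (at s within T)"
      by (rule has_derivative_compose[OF _ A]) (auto intro!: derivative_eq_intros)
    then show ?thesis
      unfolding f_def[abs_def] ax by (auto intro!: derivative_eq_intros simp: scaleR_diff_right)
  qed
  have "norm (f \<epsilon> - f 0) \<le> e * norm (\<epsilon> - 0)"
  proof (rule differentiable_bound[where S = "{0..\<epsilon>}"])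
    show "(f has_derivative (\<lambda>t. t *\<^sub>R (G k (x + s *\<^sub>R axis k 1) - c))) (at s within {0..\<epsilon>})" for s by (rule f')
    fix s assume "s \<in> {0..\<epsilon>}"
    then have "norm (G k (x + s *\<^sub>R axis k 1) - c) \<le> e" by (intro le) auto
    then show "onorm (\<lambda>t. t *\<^sub>R (G k (x + s *\<^sub>R axis k 1) - c)) \<le> e"
      by (intro onorm_le) (simp add: mult.commute[of e] mult_left_mono)
  qed (use \<open>0 \<le> \<epsilon>\<close> in auto)
  then show ?thesis using \<open>0 \<le> \<epsilon>\<close> by (simp add: f_def algebra_simps)
qed

lemma bounded_near_bounded:
  fixes G :: "real^2 \<Rightarrow> 'b::real_normed_vector"
  assumes "continuous_on UNIV G" "bounded S"
  obtains C where "0 < C" "\<And>x y. x \<in> S \<Longrightarrow> norm (y - x) \<le> 1 \<Longrightarrow> norm (G y) \<le> C"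
proof -
  obtain B where B: "\<And>x. x \<in> S \<Longrightarrow> norm x \<le> B" using assms(2) by (auto simp: bounded_iff)
  have "compact (G ` cball 0 (B + 1))" by (intro compact_continuous_image continuous_on_subset[OF assms(1)]) auto
  then obtain C where C: "0 < C" "\<And>z. z \<in> G ` cball 0 (B + 1) \<Longrightarrow> norm z \<le> C"
    using compact_imp_bounded bounded_pos by metis
  show ?thesis
  proof (rule that[OF C(1)])
    fix x y assume xy: "x \<in> S" "norm (y - x) \<le> 1"
    have "norm y \<le> B + 1" using norm_triangle_ineq[of "y - x" x] xy(2) B[OF xy(1)] by simp
    then show "norm (G y) \<le> C" by (intro C(2)) auto
  qed
qed

lemma norm_divideR_le:
  fixes v :: "'b::real_normed_vector"
  shows "0 < \<epsilon> \<Longrightarrow> norm v \<le> c * \<epsilon> \<Longrightarrow> norm (v /\<^sub>R \<epsilon>) \<le> c"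
  by (simp add: divide_simps mult.commute)

lemma cell_centre_tendsto:
  assumes "\<And>n. 0 < \<epsilon> n" "\<epsilon> \<longlonglongrightarrow> 0"
  shows "(\<lambda>n. \<epsilon> n *\<^sub>R cell_index (\<epsilon> n) x) \<longlonglongrightarrow> x"
proof (rule LIM_zero_cancel, rule tendsto_norm_zero_cancel, rule tendsto_sandwich[OF _ _ tendsto_const assms(2)])
  show "eventually (\<lambda>n. norm (\<epsilon> n *\<^sub>R cell_index (\<epsilon> n) x - x) \<le> \<epsilon> n) sequentially"
    using cell_index_close(2)[OF assms(1)] by simp
qed simp

text \<open>The lattice sum is the integral of the step function of squared difference quotients,
  the cell area cancelling \<epsilon>^2. Off the frontier, a null set, the quotients converge inside
  \<open>S\<close> and eventually drop out outside; dominated convergence concludes.\<close>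

lemma discrete_energy_tendsto:
  fixes A :: "real^2 \<Rightarrow> 'b::euclidean_space"
  assumes S: "open S" "bounded S" "lipschitz_boundary S"
    and A: "\<And>x. (A has_derivative (\<lambda>v. \<Sum>j\<in>UNIV. v $ j *\<^sub>R G j x)) (at x)" and G: "\<And>j. continuous_on UNIV (G j)"
    and \<epsilon>: "\<And>n. 0 < \<epsilon> n" "\<epsilon> \<longlonglongrightarrow> 0"
  shows "(\<lambda>n. \<Sum>i\<in>{i \<in> Z_eps (\<epsilon> n) S. i + axis k 1 \<in> Z_eps (\<epsilon> n) S}. (norm (A (\<epsilon> n *\<^sub>R (i + axis k 1)) - A (\<epsilon> n *\<^sub>R i)))^2)
    \<longlonglongrightarrow> (LINT x|lborel. indicator S x * (norm (G k x))^2)"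
proof -
  define I where "I n = {i \<in> Z_eps (\<epsilon> n) S. i + axis k 1 \<in> Z_eps (\<epsilon> n) S}" for n
  define g where "g n i = (norm ((A (\<epsilon> n *\<^sub>R (i + axis k 1)) - A (\<epsilon> n *\<^sub>R i)) /\<^sub>R \<epsilon> n))^2" for n i
  define F where "F n x = indicator (I n) (cell_index (\<epsilon> n) x) * g n (cell_index (\<epsilon> n) x)" for n x
  have I: "finite (I n)" "I n \<subseteq> lattice" for n
    using finite_Z_eps[OF \<epsilon>(1) S(2)] Z_eps_lattice by (auto simp: I_def)
  have Fi: "integrable lborel (F n)" and Fs: "(LINT x|lborel. F n x) = (\<Sum>i\<in>I n. (norm (A (\<epsilon> n *\<^sub>R (i + axis k 1)) - A (\<epsilon> n *\<^sub>R i)))^2)" for n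
  proof -
    show "integrable lborel (F n)" unfolding F_def by (rule cell_step_integral(1)[OF \<epsilon>(1) I])
    have "(LINT x|lborel. F n x) = (\<epsilon> n)^2 * (\<Sum>i\<in>I n. g n i)" unfolding F_def by (rule cell_step_integral(2)[OF \<epsilon>(1) I])
    also have "\<dots> = (\<Sum>i\<in>I n. (norm (A (\<epsilon> n *\<^sub>R (i + axis k 1)) - A (\<epsilon> n *\<^sub>R i)))^2)"
      using \<epsilon>(1)[of n] unfolding sum_distrib_left
      by (intro sum.cong refl) (simp add: g_def power_mult_distrib power_inverse)
    finally show "(LINT x|lborel. F n x) = (\<Sum>i\<in>I n. (norm (A (\<epsilon> n *\<^sub>R (i + axis k 1)) - A (\<epsilon> n *\<^sub>R i)))^2)" .
  qed
  obtain C where C: "0 < C" "\<And>x y. x \<in> S \<Longrightarrow> norm (y - x) \<le> 1 \<Longrightarrow> norm (G k y) \<le> C"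
    using bounded_near_bounded[OF G S(2)] by blast
  obtain R where R: "0 < R" "\<And>x. x \<in> S \<Longrightarrow> norm x \<le> R" using S(2) by (auto simp: bounded_pos)
  note centre = cell_centre_tendsto[OF \<epsilon>]
  have small: "eventually (\<lambda>n. \<epsilon> n \<le> 1) sequentially"
    using order_tendstoD(2)[OF \<epsilon>(2), of 1] by (auto elim: eventually_mono)
  then obtain n0 where n0: "\<And>n. n0 \<le> n \<Longrightarrow> \<epsilon> n \<le> 1" by (auto simp: eventually_sequentially)
  \<comment> \<open>The sequence is shifted past the indices with \<epsilon> > 1, since domination
    by one constant on the ball of radius R + 1 uses \<epsilon> \<le> 1.\<close>
  have "(\<lambda>n. LINT x|lborel. F (n + n0) x) \<longlonglongrightarrow> (LINT x|lborel. indicator S x * (norm (G k x))^2)"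
  proof (rule integral_dominated_convergence[where w = "\<lambda>x. C^2 * indicator (cball 0 (R + 1)) x"])
    have [measurable]: "S \<in> sets borel" "G k \<in> borel_measurable borel" using S(1) G by (auto intro: borel_measurable_continuous_onI)
    show "(\<lambda>x. indicator S x * (norm (G k x))^2) \<in> borel_measurable lborel" by measurable
    show "F (n + n0) \<in> borel_measurable lborel" for n using Fi by (rule borel_measurable_integrable)
    show "integrable lborel (\<lambda>x. C^2 * indicat_real (cball (0 :: real^2) (R + 1)) x)"
      using emeasure_bounded_finite[OF bounded_cball[of "0 :: real^2"]] by (simp add: integrable_indicator_iff)
    show "AE x in lborel. (\<lambda>n. F (n + n0) x) \<longlonglongrightarrow> indicator S x * (norm (G k x))^2"
      using AE_not_frontier[OF S]
    proof eventually_elim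
      fix x assume nf: "x \<notin> frontier S"
      have "(\<lambda>n. F n x) \<longlonglongrightarrow> indicator S x * (norm (G k x))^2"
      proof (cases "x \<in> S")
        case True
        have e1: "eventually (\<lambda>n. \<epsilon> n *\<^sub>R cell_index (\<epsilon> n) x \<in> S) sequentially"
          by (rule topological_tendstoD[OF centre S(1) True])
        have "(\<lambda>n. \<epsilon> n *\<^sub>R cell_index (\<epsilon> n) x + \<epsilon> n *\<^sub>R axis k 1) \<longlonglongrightarrow> x + 0 *\<^sub>R axis k 1"
          by (intro tendsto_intros centre \<epsilon>(2))
        then have e2: "eventually (\<lambda>n. \<epsilon> n *\<^sub>R (cell_index (\<epsilon> n) x + axis k 1) \<in> S) sequentially"
          using topological_tendstoD[of _ x sequentially S] S(1) True by (simp add: scaleR_add_right)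
        have lim: "(\<lambda>n. (A (\<epsilon> n *\<^sub>R (cell_index (\<epsilon> n) x + axis k 1)) - A (\<epsilon> n *\<^sub>R cell_index (\<epsilon> n) x)) /\<^sub>R \<epsilon> n) \<longlonglongrightarrow> G k x"
        proof (rule tendstoI)
          fix e :: real assume e: "0 < e"
          have "continuous (at x) (G k)" using G by (simp add: continuous_on_eq_continuous_at)
          then obtain \<delta> where \<delta>: "0 < \<delta>" "\<And>y. dist y x < \<delta> \<Longrightarrow> dist (G k y) (G k x) < e / 2"
            unfolding continuous_at_eps_delta using e by (metis half_gt_zero)
          have "eventually (\<lambda>n. \<epsilon> n < \<delta> / 2) sequentially" using \<delta> by (intro order_tendstoD(2)[OF \<epsilon>(2)]) auto
          then show "eventually (\<lambda>n. dist ((A (\<epsilon> n *\<^sub>R (cell_index (\<epsilon> n) x + axis k 1)) - A (\<epsilon> n *\<^sub>R cell_index (\<epsilon> n) x)) /\<^sub>R \<epsilon> n) (G k x) < e) sequentially"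
          proof eventually_elim
            fix n assume n: "\<epsilon> n < \<delta> / 2"
            define y where "y = \<epsilon> n *\<^sub>R cell_index (\<epsilon> n) x"
            have "norm (A (y + \<epsilon> n *\<^sub>R axis k 1) - A y - \<epsilon> n *\<^sub>R G k x) \<le> e / 2 * \<epsilon> n"
            proof (rule increment_bound[OF A less_imp_le[OF \<epsilon>(1)]])
              fix s assume s: "0 \<le> s" "s \<le> \<epsilon> n"
              have "norm (y + s *\<^sub>R axis k 1 - x) \<le> norm (y - x) + norm (s *\<^sub>R (axis k 1 :: real^2))"
                using norm_triangle_ineq[of "y - x" "s *\<^sub>R axis k 1"] by (simp add: algebra_simps)
              also have "\<dots> \<le> \<epsilon> n + \<epsilon> n" using cell_index_close(2)[OF \<epsilon>(1), of n x] s by (simp add: y_def norm_axis_1)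
              finally have "dist (y + s *\<^sub>R axis k 1) x < \<delta>" using n by (simp add: dist_norm)
              from \<delta>(2)[OF this] show "norm (G k (y + s *\<^sub>R axis k 1) - G k x) \<le> e / 2" by (simp add: dist_norm)
            qed
            then have "norm ((A (y + \<epsilon> n *\<^sub>R axis k 1) - A y - \<epsilon> n *\<^sub>R G k x) /\<^sub>R \<epsilon> n) \<le> e / 2"
              by (rule norm_divideR_le[OF \<epsilon>(1)])
            also have "e / 2 < e" using e by simp
            finally show "dist ((A (\<epsilon> n *\<^sub>R (cell_index (\<epsilon> n) x + axis k 1)) - A (\<epsilon> n *\<^sub>R cell_index (\<epsilon> n) x)) /\<^sub>R \<epsilon> n) (G k x) < e"
              using \<epsilon>(1)[of n] by (simp add: dist_norm y_def scaleR_add_right scaleR_diff_right)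
          qed
        qed
        have "(\<lambda>n. g n (cell_index (\<epsilon> n) x)) \<longlonglongrightarrow> (norm (G k x))^2"
          unfolding g_def by (intro tendsto_intros lim)
        moreover have "eventually (\<lambda>n. g n (cell_index (\<epsilon> n) x) = F n x) sequentially"
          using e1 e2 by eventually_elim
             (simp add: F_def I_def mem_Z_eps cell_index_in_lattice lattice_add axis_in_lattice)
        ultimately show ?thesis using True by (simp add: filterlim_cong[OF refl refl, THEN iffD1])
      next
        case False
        then have "x \<in> - closure S" using nf S(1) by (simp add: frontier_def interior_open)
        then have "eventually (\<lambda>n. \<epsilon> n *\<^sub>R cell_index (\<epsilon> n) x \<in> - closure S) sequentially"
          by (intro topological_tendstoD[OF centre]) auto
        then have "eventually (\<lambda>n. F n x = 0) sequentially"
          by eventually_elim (use closure_subset[of S] in \<open>auto simp: F_def I_def mem_Z_eps indicator_def\<close>)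
        then show ?thesis using False by (simp add: tendsto_eventually)
      qed
      then show "(\<lambda>n. F (n + n0) x) \<longlonglongrightarrow> indicator S x * (norm (G k x))^2" by (rule LIMSEQ_ignore_initial_segment)
    qed
    fix n
    show "AE x in lborel. norm (F (n + n0) x) \<le> C^2 * indicator (cball 0 (R + 1)) x"
    proof (intro AE_I2)
      fix x
      define m where "m = n + n0"
      have m1: "\<epsilon> m \<le> 1" by (rule n0) (simp add: m_def)
      show "norm (F (n + n0) x) \<le> C^2 * indicator (cball 0 (R + 1)) x"
      proof (cases "cell_index (\<epsilon> m) x \<in> I m")
        case True
        define y where "y = \<epsilon> m *\<^sub>R cell_index (\<epsilon> m) x"
        have y: "y \<in> S" using True by (simp add: I_def mem_Z_eps y_def)
        have "norm x \<le> norm y + norm (y - x)" using norm_triangle_ineq4[of y "y - x"] by simp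
        then have "norm x \<le> R + 1" using R(2)[OF y] cell_index_close(2)[OF \<epsilon>(1), of m x] m1 by (simp add: y_def)
        moreover have "norm (A (y + \<epsilon> m *\<^sub>R axis k 1) - A y - \<epsilon> m *\<^sub>R 0) \<le> C * \<epsilon> m"
        proof (rule increment_bound[OF A less_imp_le[OF \<epsilon>(1)]])
          fix s assume "0 \<le> s" "s \<le> \<epsilon> m"
          then show "norm (G k (y + s *\<^sub>R axis k 1) - 0) \<le> C" using C(2)[OF y] m1 by (simp add: norm_axis_1)
        qed
        then have "norm ((A (y + \<epsilon> m *\<^sub>R axis k 1) - A y) /\<^sub>R \<epsilon> m) \<le> C" by (intro norm_divideR_le[OF \<epsilon>(1)]) simp
        then have "g m (cell_index (\<epsilon> m) x) \<le> C^2"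
          unfolding g_def by (intro power_mono) (simp_all add: y_def scaleR_add_right)
        ultimately show ?thesis using True by (simp add: F_def m_def[symmetric]) (simp add: g_def)
      next
        case False
        then show ?thesis by (simp add: F_def m_def)
      qed
    qed
  qed
  then have "(\<lambda>n. LINT x|lborel. F n x) \<longlonglongrightarrow> (LINT x|lborel. indicator S x * (norm (G k x))^2)"
    by (rule LIMSEQ_offset)
  then show ?thesis by (simp only: Fs I_def)
qed

section \<open>The recovery sequence\<close>

text \<open>Cells whose centre lies outside \<open>S\<close> keep the original values: there
  \<open>C_eps\<close> asks only for membership in the circle, which \<open>P\<close> already
  has.\<close>

definition sampled :: "(real^2) set \<Rightarrow> (real^2 \<Rightarrow> real^2^2) \<Rightarrow> real \<Rightarrow> real^2 \<Rightarrow> real^2^2" where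
  "sampled S P \<epsilon> x = (if \<epsilon> *\<^sub>R cell_index \<epsilon> x \<in> S then P (\<epsilon> *\<^sub>R cell_index \<epsilon> x) else P x)"

lemma sampled_lattice: "0 < \<epsilon> \<Longrightarrow> i \<in> lattice \<Longrightarrow> sampled S P \<epsilon> (\<epsilon> *\<^sub>R i) = P (\<epsilon> *\<^sub>R i)"
  by (simp add: sampled_def cell_index_lattice_point)

lemma sampled_C_eps:
  assumes "0 < \<epsilon>" "\<And>x. x \<in> S \<Longrightarrow> P x \<in> bd_K"
  shows "sampled S P \<epsilon> \<in> C_eps \<epsilon> S"
  unfolding C_eps_def
proof (intro CollectI conjI ballI impI)
  show "sampled S P \<epsilon> x \<in> S1_tensor" if "x \<in> S" for x
    using assms that by (simp add: sampled_def S1_tensor_eq_bd_K)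
  fix i x assume i: "i \<in> Z_eps \<epsilon> S" and "x \<in> S" "x \<in> (\<lambda>w. \<epsilon> *\<^sub>R (i + w)) ` W_cell"
  then have "cell_index \<epsilon> x = i" using cell_index_iff_cell[OF assms(1)] by (simp add: mem_Z_eps)
  then show "sampled S P \<epsilon> x = sampled S P \<epsilon> (\<epsilon> *\<^sub>R i)"
    using i assms(1) by (simp add: sampled_lattice mem_Z_eps) (simp add: sampled_def)
qed

lemma bd_K_valued_Linf_sym:
  assumes "open S" "R \<in> borel_measurable borel" "\<And>x. x \<in> S \<Longrightarrow> R x \<in> bd_K"
  shows "R \<in> Linf_sym S"
  unfolding Linf_sym_def
proof (intro CollectI conjI exI)
  show "R \<in> borel_measurable (lebesgue_on S)" using assms(1,2) by (rule borel_measurable_lebesgue_on)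
  show "AE x in lebesgue_on S. R x \<in> sym_mat" "AE x in lebesgue_on S. norm (R x) \<le> 1"
    using assms(3) by (auto intro!: AE_I2 simp: bd_K_iff space_restrict_space)
qed

lemma sampled_Linf_sym:
  assumes S: "open S" and [measurable]: "P \<in> borel_measurable borel" and P: "\<And>x. x \<in> S \<Longrightarrow> P x \<in> bd_K"
  shows "sampled S P \<epsilon> \<in> Linf_sym S"
proof (rule bd_K_valued_Linf_sym[OF S])
  have [measurable]: "S \<in> sets borel" using S by simp
  show "sampled S P \<epsilon> \<in> borel_measurable borel" unfolding sampled_def[abs_def] by measurable
  show "sampled S P \<epsilon> x \<in> bd_K" if "x \<in> S" for x using P that by (simp add: sampled_def)
qed

text \<open>Cell centres converge to the point and \<open>P\<close> is continuous and of norm one,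
  so |\<Phi>| dominates.\<close>

lemma sampled_pairing_tendsto:
  assumes S: "open S" and P: "P \<in> borel_measurable borel" "\<And>x. x \<in> S \<Longrightarrow> P x \<in> bd_K" "continuous_on S P"
    and \<epsilon>: "\<And>n. 0 < \<epsilon> n" "\<epsilon> \<longlonglongrightarrow> 0" and \<Phi>: "integrable (lebesgue_on S) \<Phi>"
  shows "(\<lambda>n. pairing S (sampled S P (\<epsilon> n)) \<Phi>) \<longlonglongrightarrow> pairing S P \<Phi>"
  unfolding pairing_def
proof (rule integral_dominated_convergence[where w = "\<lambda>x. norm (\<Phi> x)"])
  note [measurable] = borel_measurable_integrable[OF \<Phi>] borel_measurable_lebesgue_on[OF S P(1)]
  have [measurable]: "sampled S P e \<in> borel_measurable (lebesgue_on S)" for e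
    using sampled_Linf_sym[OF S P(1,2)] by (simp add: Linf_sym_def)
  show "(\<lambda>x. P x \<bullet> \<Phi> x) \<in> borel_measurable (lebesgue_on S)" by measurable
  show "(\<lambda>x. sampled S P (\<epsilon> n) x \<bullet> \<Phi> x) \<in> borel_measurable (lebesgue_on S)" for n by measurable
  show "integrable (lebesgue_on S) (\<lambda>x. norm (\<Phi> x))" using \<Phi> by simp
  show "AE x in lebesgue_on S. norm (sampled S P (\<epsilon> n) x \<bullet> \<Phi> x) \<le> norm (\<Phi> x)" for n
  proof (rule AE_I2)
    fix x assume "x \<in> space (lebesgue_on S)"
    then have "norm (sampled S P (\<epsilon> n) x) = 1"
      using P(2) by (auto simp: sampled_def bd_K_iff space_restrict_space)
    then show "norm (sampled S P (\<epsilon> n) x \<bullet> \<Phi> x) \<le> norm (\<Phi> x)"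
      using Cauchy_Schwarz_ineq2[of "sampled S P (\<epsilon> n) x" "\<Phi> x"] by simp
  qed
  show "AE x in lebesgue_on S. (\<lambda>n. sampled S P (\<epsilon> n) x \<bullet> \<Phi> x) \<longlonglongrightarrow> P x \<bullet> \<Phi> x"
  proof (rule AE_I2)
    fix x assume "x \<in> space (lebesgue_on S)"
    then have x: "x \<in> S" by (simp add: space_restrict_space)
    have ev: "eventually (\<lambda>n. \<epsilon> n *\<^sub>R cell_index (\<epsilon> n) x \<in> S) sequentially"
      by (rule topological_tendstoD[OF cell_centre_tendsto[OF \<epsilon>] S x])
    have "isCont P x" using P(3) S x by (simp add: continuous_on_eq_continuous_at)
    then have "(\<lambda>n. P (\<epsilon> n *\<^sub>R cell_index (\<epsilon> n) x)) \<longlonglongrightarrow> P x"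
      by (rule isCont_tendsto_compose[OF _ cell_centre_tendsto[OF \<epsilon>]])
    moreover have "eventually (\<lambda>n. P (\<epsilon> n *\<^sub>R cell_index (\<epsilon> n) x) = sampled S P (\<epsilon> n) x) sequentially"
      using ev by eventually_elim (simp add: sampled_def)
    ultimately have "(\<lambda>n. sampled S P (\<epsilon> n) x) \<longlonglongrightarrow> P x" by (rule Lim_transform_eventually)
    then show "(\<lambda>n. sampled S P (\<epsilon> n) x \<bullet> \<Phi> x) \<longlonglongrightarrow> P x \<bullet> \<Phi> x" by (intro tendsto_intros)
  qed
qed

text \<open>For neighbouring spins with x = |u.v| the squared difference of the values is 2 (1 -
  x^2); the factor 2 from counting bonds twice therefore turns a (1 - x^2) into a times that square.
  The smallness hypothesis places x where the bound on \<open>h\<close> is valid.\<close>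

lemma F1_eps_le:
  assumes S: "open S" "bounded S" and e: "0 < \<epsilon>" and R: "R \<in> C_eps \<epsilon> S"
    and inf: "(INF x\<in>{0..1}. h x) = h 1"
    and h: "\<And>x. 0 \<le> x \<Longrightarrow> x \<le> 1 \<Longrightarrow> 1 - x^2 \<le> \<tau> \<Longrightarrow> h x - h 1 \<le> a * (1 - x^2)"
    and small: "\<And>k i. i \<in> Z_eps \<epsilon> S \<Longrightarrow> i + axis k 1 \<in> Z_eps \<epsilon> S \<Longrightarrow> (norm (R (\<epsilon> *\<^sub>R (i + axis k 1)) - R (\<epsilon> *\<^sub>R i)))^2 \<le> 2 * \<tau>"
  shows "F1_eps h S \<epsilon> R \<le> ereal (a * (\<Sum>k\<in>UNIV. \<Sum>i\<in>{i \<in> Z_eps \<epsilon> S. i + axis k 1 \<in> Z_eps \<epsilon> S}.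
    (norm (R (\<epsilon> *\<^sub>R (i + axis k 1)) - R (\<epsilon> *\<^sub>R i)))^2))"
proof -
  have "\<forall>i\<in>Z_eps \<epsilon> S. \<exists>v. norm v = 1 \<and> R (\<epsilon> *\<^sub>R i) = tensor_square v"
    using R by (auto simp: C_eps_def S1_tensor_def mem_Z_eps)
  then obtain u where u: "\<And>i. i \<in> Z_eps \<epsilon> S \<Longrightarrow> norm (u i) = 1 \<and> R (\<epsilon> *\<^sub>R i) = tensor_square (u i)" by metis
  then have "spins_of \<epsilon> S R u" unfolding spins_of_def using R by (intro bexI[of _ R]) auto
  then have "F1_eps h S \<epsilon> R = ereal (spin_energy h S \<epsilon> u)" by (rule F1_eps_eq[OF S(1) e])
  also have "spin_energy h S \<epsilon> u = 2 * (\<Sum>k\<in>UNIV. \<Sum>i\<in>{i \<in> Z_eps \<epsilon> S. i + axis k 1 \<in> Z_eps \<epsilon> S}. h \<bar>u i \<bullet> u (i + axis k 1)\<bar> - h 1)"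
    unfolding spin_energy_def inf by (rule bond_sum[OF finite_Z_eps[OF e S(2)] Z_eps_lattice]) (simp add: inner_commute)
  also have "\<dots> \<le> a * (\<Sum>k\<in>UNIV. \<Sum>i\<in>{i \<in> Z_eps \<epsilon> S. i + axis k 1 \<in> Z_eps \<epsilon> S}. (norm (R (\<epsilon> *\<^sub>R (i + axis k 1)) - R (\<epsilon> *\<^sub>R i)))^2)"
    unfolding sum_distrib_left
  proof (intro sum_mono)
    fix k i assume "i \<in> {i \<in> Z_eps \<epsilon> S. i + axis k 1 \<in> Z_eps \<epsilon> S}"
    then have i: "i \<in> Z_eps \<epsilon> S" "i + axis k 1 \<in> Z_eps \<epsilon> S" by auto
    define x where "x = \<bar>u i \<bullet> u (i + axis k 1)\<bar>"
    have "x \<le> 1" using Cauchy_Schwarz_ineq2[of "u i" "u (i + axis k 1)"] u[OF i(1)] u[OF i(2)] by (simp add: x_def)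
    moreover have n: "(norm (R (\<epsilon> *\<^sub>R (i + axis k 1)) - R (\<epsilon> *\<^sub>R i)))^2 = 2 * (1 - x^2)"
      using tensor_square_dist[of "u (i + axis k 1)" "u i"] u[OF i(1)] u[OF i(2)] by (simp add: x_def inner_commute)
    moreover have "0 \<le> x" by (simp add: x_def)
    ultimately have "h x - h 1 \<le> a * (1 - x^2)" using small[OF i] by (intro h) auto
    then show "2 * (h \<bar>u i \<bullet> u (i + axis k 1)\<bar> - h 1) \<le> a * (norm (R (\<epsilon> *\<^sub>R (i + axis k 1)) - R (\<epsilon> *\<^sub>R i)))^2"
      unfolding n x_def[symmetric] by (simp add: algebra_simps)
  qed
  finally show ?thesis by simp
qed

text \<open>An L^1 bound alone does not control pairings with L^1 fields; with the additional bound
  2 on |P - Q| the fields can be truncated at a height n. The threshold depends only on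
  \<open>F\<close> and \<open>e\<close>, so it is available before \<open>P\<close> is
  constructed.\<close>

lemma pairing_close:
  assumes "finite F" "F \<subseteq> L1_sym S" and e: "0 < e"
  obtains \<nu> where "0 < \<nu>"
    "\<And>P Q \<Phi>. P \<in> Linf_sym S \<Longrightarrow> Q \<in> Linf_sym S \<Longrightarrow> AE x in lebesgue_on S. norm (P x - Q x) \<le> 2 \<Longrightarrow>
      integrable (lebesgue_on S) (\<lambda>x. norm (P x - Q x)) \<Longrightarrow> (LINT x|lebesgue_on S. norm (P x - Q x)) \<le> \<nu> \<Longrightarrow> \<Phi> \<in> F \<Longrightarrow>
      \<bar>pairing S P \<Phi> - pairing S Q \<Phi>\<bar> < e"
proof -
  define w where "w x = (\<Sum>\<Phi>\<in>F. norm (\<Phi> x))" for x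
  have F: "\<Phi> \<in> F \<Longrightarrow> integrable (lebesgue_on S) \<Phi>" for \<Phi> using assms(2) by (auto simp: L1_sym_def)
  have w: "integrable (lebesgue_on S) w" "\<And>x. 0 \<le> w x" unfolding w_def by (auto intro!: sum_nonneg F)
  obtain n :: nat where n: "(LINT x|lebesgue_on S. w x - min (w x) (real n)) < e / 4"
    using integral_truncation[OF w, of "e / 4"] e by auto
  note [measurable] = borel_measurable_integrable[OF w(1)]
  have mi: "integrable (lebesgue_on S) (\<lambda>x. min (w x) (real n))"
    by (rule Bochner_Integration.integrable_bound[OF w(1)]) (use w(2) in \<open>auto simp: min_def\<close>)
  show ?thesis
  proof (rule that[of "e / (4 * (real n + 1))"])
    show "0 < e / (4 * (real n + 1))" using e by simp
    fix P Q \<Phi>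
    assume PQ: "P \<in> Linf_sym S" "Q \<in> Linf_sym S" and le2: "AE x in lebesgue_on S. norm (P x - Q x) \<le> 2"
      and i: "integrable (lebesgue_on S) (\<lambda>x. norm (P x - Q x))" and small: "(LINT x|lebesgue_on S. norm (P x - Q x)) \<le> e / (4 * (real n + 1))"
      and \<Phi>: "\<Phi> \<in> F"
    note [measurable] = borel_measurable_integrable[OF F[OF \<Phi>]]
    have [measurable]: "P \<in> borel_measurable (lebesgue_on S)" "Q \<in> borel_measurable (lebesgue_on S)" using PQ by (auto simp: Linf_sym_def)
    have ii: "integrable (lebesgue_on S) (\<lambda>x. P x \<bullet> \<Phi> x)" "integrable (lebesgue_on S) (\<lambda>x. Q x \<bullet> \<Phi> x)"
      using Linf_sym_inner_integrable[OF PQ(1) F[OF \<Phi>]] Linf_sym_inner_integrable[OF PQ(2) F[OF \<Phi>]] .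
    have "pairing S P \<Phi> - pairing S Q \<Phi> = (LINT x|lebesgue_on S. (P x - Q x) \<bullet> \<Phi> x)"
      unfolding pairing_def inner_diff_left using ii by simp
    also have "\<bar>\<dots>\<bar> \<le> (LINT x|lebesgue_on S. \<bar>(P x - Q x) \<bullet> \<Phi> x\<bar>)" by (rule integral_abs_bound)
    also have "\<dots> \<le> (LINT x|lebesgue_on S. 2 * (w x - min (w x) (real n)) + real n * norm (P x - Q x))"
    proof (rule integral_mono_AE)
      show "integrable (lebesgue_on S) (\<lambda>x. \<bar>(P x - Q x) \<bullet> \<Phi> x\<bar>)"
        using Bochner_Integration.integrable_diff[OF ii] by (simp add: inner_diff_left)
      show "integrable (lebesgue_on S) (\<lambda>x. 2 * (w x - min (w x) (real n)) + real n * norm (P x - Q x))" using w(1) mi i by simp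
      show "AE x in lebesgue_on S. \<bar>(P x - Q x) \<bullet> \<Phi> x\<bar> \<le> 2 * (w x - min (w x) (real n)) + real n * norm (P x - Q x)"
        using le2
      proof eventually_elim
        fix x assume 2: "norm (P x - Q x) \<le> 2"
        have "norm (\<Phi> x) \<le> w x" unfolding w_def using \<Phi> assms(1) by (intro member_le_sum) auto
        then have "\<bar>(P x - Q x) \<bullet> \<Phi> x\<bar> \<le> norm (P x - Q x) * w x"
          using Cauchy_Schwarz_ineq2[of "P x - Q x" "\<Phi> x"] mult_left_mono[of "norm (\<Phi> x)" "w x" "norm (P x - Q x)"] by simp
        also have "\<dots> = norm (P x - Q x) * (w x - min (w x) (real n)) + norm (P x - Q x) * min (w x) (real n)"
          by (simp add: algebra_simps)
        also have "\<dots> \<le> 2 * (w x - min (w x) (real n)) + norm (P x - Q x) * real n"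
          using 2 by (intro add_mono mult_right_mono mult_left_mono) auto
        finally show "\<bar>(P x - Q x) \<bullet> \<Phi> x\<bar> \<le> 2 * (w x - min (w x) (real n)) + real n * norm (P x - Q x)" by (simp add: mult.commute)
      qed
    qed
    also have "\<dots> = 2 * (LINT x|lebesgue_on S. w x - min (w x) (real n)) + real n * (LINT x|lebesgue_on S. norm (P x - Q x))"
      using w(1) mi i by simp
    also have "\<dots> < 2 * (e / 4) + e / 4"
    proof (rule add_less_le_mono)
      have "real n * (LINT x|lebesgue_on S. norm (P x - Q x)) \<le> (real n + 1) * (e / (4 * (real n + 1)))"
        using small by (intro mult_mono) auto
      also have "\<dots> = e / 4"
      proof -
        have "real n + 1 \<noteq> 0" by linarith
        then show ?thesis by (simp add: divide_simps)
      qed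
      finally show "real n * (LINT x|lebesgue_on S. norm (P x - Q x)) \<le> e / 4" .
    qed (use n in simp)
    finally show "\<bar>pairing S P \<Phi> - pairing S Q \<Phi>\<bar> < e" using e by linarith
  qed
qed

lemma W12_bd_K_representative:
  assumes S: "open S" "bounded S" and Q: "Q \<in> W12_bd_K S"
  obtains q d where "weak_pair S q d" "\<And>x. x \<in> S \<Longrightarrow> q x \<in> bd_K" "AE x in lebesgue_on S. Q x = q x"
    "(LINT x|lborel. (norm (d x))^2) = (LINT x|lebesgue_on S. (norm (weak_grad S Q x))^2)"
proof -
  have [measurable]: "S \<in> sets borel" using S by simp
  define D where "D = weak_grad S Q"
  have QL: "Q \<in> borel_measurable (lebesgue_on S)" and QK: "AE x in lebesgue_on S. Q x \<in> bd_K"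
    using Q by (auto simp: W12_bd_K_def W12_sym_def L2_def)
  have gr: "L2_weak_gradient S Q D"
    unfolding D_def weak_grad_def using Q by (auto simp: W12_bd_K_def W12_sym_def intro: someI[of "L2_weak_gradient S Q"])
  have DL: "D \<in> borel_measurable (lebesgue_on S)" and D2: "integrable (lebesgue_on S) (\<lambda>x. (norm (D x))^2)"
    using gr by (auto simp: L2_weak_gradient_def L2_def)
  obtain q0 where q0: "q0 \<in> borel_measurable borel" "\<And>x. x \<notin> S \<Longrightarrow> q0 x = 0" "AE x in lebesgue_on S. Q x = q0 x"
    using lebesgue_on_borel_rep[OF S(1) QL] by blast
  obtain d where d: "d \<in> borel_measurable borel" "\<And>x. x \<notin> S \<Longrightarrow> d x = 0" "AE x in lebesgue_on S. D x = d x"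
    using lebesgue_on_borel_rep[OF S(1) DL] by blast
  note [measurable] = q0(1) d(1)
  define K0 :: "real^2^2" where "K0 = tensor_square (axis 1 1)"
  have K0: "K0 \<in> bd_K" unfolding K0_def S1_tensor_eq_bd_K[symmetric] S1_tensor_def by (auto intro!: exI[of _ "axis 1 1"])
  \<comment> \<open>Redefined on a null set, with an arbitrary member \<open>K0\<close> of the
    circle, so that the constraint holds at every point of \<open>S\<close>.\<close>
  define q where "q x = (if x \<in> S then if q0 x \<in> bd_K then q0 x else K0 else 0)" for x
  have cK: "closed bd_K"
  proof -
    have eq: "bd_K = {A :: real^2^2. A$1$2 = A$2$1} \<inter> {A. A$1$1 + A$2$2 = 1} \<inter> {A. norm A = 1}"
      by (auto simp: bd_K_iff sym_mat_iff trace_mat2)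
    show ?thesis unfolding eq by (intro closed_Int closed_Collect_eq continuous_intros)
  qed
  then have [measurable]: "bd_K \<in> sets borel" by (rule borel_closed)
  have qm: "q \<in> borel_measurable borel" unfolding q_def[abs_def] by measurable
  have qK: "q x \<in> bd_K" if "x \<in> S" for x using that K0 by (simp add: q_def)
  have q_out: "q x = 0" if "x \<notin> S" for x using that by (simp add: q_def)
  have Qq: "AE x in lebesgue_on S. Q x = q x"
    using q0(3) QK AE_space by eventually_elim (auto simp: q_def space_restrict_space)
  have nd: "AE x in lebesgue_on S. (norm (D x))^2 = (norm (d x))^2" using d(3) by eventually_elim simp
  have nDm: "(\<lambda>x. (norm (D x))^2) \<in> borel_measurable (lebesgue_on S)" using D2 by (rule borel_measurable_integrable)
  have "weak_pair S q d"
    unfolding weak_pair_def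
  proof (intro conjI allI impI qm d(1))
    have "integrable lborel (indicat_real S)" using emeasure_bounded_finite[OF S(2)] by (simp add: integrable_indicator_iff)
    then show "integrable lborel q"
    proof (rule Bochner_Integration.integrable_bound)
      show "AE x in lborel. norm (q x) \<le> norm (indicat_real S x)"
        using qK q_out by (intro AE_I2) (auto simp: indicator_def bd_K_iff)
    qed (use qm in simp)
    show "integrable lborel (\<lambda>x. (norm (d x))^2)"
      using lebesgue_on_borel_integral(2)[OF S(1) nDm _ _ nd] D2 d(2) by simp
    show "q x = 0" "d x = 0" if "x \<notin> S" for x using that q_out d(2) by auto
    fix \<phi> k assume \<phi>: "test_function S \<phi>"
    note \<psi> = test_function_partial_deriv[OF \<phi>, of k]
    note [measurable] = borel_measurable_lebesgue_on[OF S(1) test_function_borel[OF \<phi>]] test_function_borel[OF \<phi>]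
       borel_measurable_lebesgue_on[OF S(1) test_function_borel[OF \<psi>]] test_function_borel[OF \<psi>]
       QL qm borel_measurable_vec_nth'[OF DL, of k] borel_measurable_vec_nth'[OF d(1), of k]
    have "(LINT x|lebesgue_on S. partial_deriv k \<phi> x *\<^sub>R Q x) = (LINT x|lborel. partial_deriv k \<phi> x *\<^sub>R q x)"
    proof (rule lebesgue_on_borel_integral(1)[OF S(1)])
      show "AE x in lebesgue_on S. partial_deriv k \<phi> x *\<^sub>R Q x = partial_deriv k \<phi> x *\<^sub>R q x"
        using Qq by eventually_elim simp
    qed (measurable, simp add: q_out)
    moreover have "(LINT x|lebesgue_on S. \<phi> x *\<^sub>R D x $ k) = (LINT x|lborel. \<phi> x *\<^sub>R d x $ k)"
    proof (rule lebesgue_on_borel_integral(1)[OF S(1)])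
      show "AE x in lebesgue_on S. \<phi> x *\<^sub>R D x $ k = \<phi> x *\<^sub>R d x $ k"
        using d(3) by eventually_elim simp
    qed (measurable, simp add: d(2))
    moreover have "(LINT x|lebesgue_on S. partial_deriv k \<phi> x *\<^sub>R Q x) = - (LINT x|lebesgue_on S. \<phi> x *\<^sub>R D x $ k)"
      using gr \<phi> unfolding L2_weak_gradient_def by blast
    ultimately show "(LINT x|lborel. partial_deriv k \<phi> x *\<^sub>R q x) = - (LINT x|lborel. \<phi> x *\<^sub>R d x $ k)"
      by simp
  qed
  moreover have "(LINT x|lborel. (norm (d x))^2) = (LINT x|lebesgue_on S. (norm (D x))^2)"
    using lebesgue_on_borel_integral(1)[OF S(1) nDm _ _ nd] d(2) by simp
  ultimately show ?thesis using that qK Qq unfolding D_def by blast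
qed

section \<open>The limsup inequality\<close>

text \<open>Projection multiplies squared differences by at most 1/(1 - 2 \<nu>), and the lattice
  energy of the unprojected \<open>A\<close> converges to a limit at most E, hence is eventually
  below E + \<nu>. The bound on \<open>h\<close> applies because neighbouring values differ by
  O(\<epsilon>).\<close>

lemma smooth_recovery_energy:
  fixes A :: "real^2 \<Rightarrow> real^2^2"
  assumes S: "open S" "bounded S" "lipschitz_boundary S"
    and A: "\<And>x. (A has_derivative (\<lambda>v. \<Sum>j\<in>UNIV. v $ j *\<^sub>R G j x)) (at x)" and G: "\<And>j. continuous_on UNIV (G j)"
    and AS: "\<And>x. x \<in> S \<Longrightarrow> trace (A x) = 1 \<and> 1 - (norm (A x))^2 \<le> \<nu>"
    and AK: "\<And>x. x \<in> S \<Longrightarrow> bd_K_proj (A x) \<in> bd_K"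
    and gr: "(\<integral>\<^sup>+x. indicator S x * ennreal (\<Sum>j\<in>UNIV. (norm (G j x))^2) \<partial>lborel) \<le> ennreal E" "0 \<le> E"
    and \<nu>: "0 < \<nu>" "\<nu> < 1/2" and \<tau>: "0 < \<tau>" and c: "0 \<le> c"
    and inf: "(INF x\<in>{0..1}. h x) = h 1"
    and h: "\<And>x. 0 \<le> x \<Longrightarrow> x \<le> 1 \<Longrightarrow> 1 - x^2 \<le> \<tau> \<Longrightarrow> h x - h 1 \<le> c * (1 - x^2)"
    and \<epsilon>: "\<And>n. 0 < \<epsilon> n" "\<epsilon> \<longlonglongrightarrow> 0"
  shows "eventually (\<lambda>n. F1_eps h S (\<epsilon> n) (sampled S (\<lambda>x. bd_K_proj (A x)) (\<epsilon> n)) \<le> ereal (c * ((E + \<nu>) / (1 - 2 * \<nu>)))) sequentially"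
proof -
  define P where "P x = bd_K_proj (A x)" for x
  define Z where "Z n k = {i \<in> Z_eps (\<epsilon> n) S. i + axis k 1 \<in> Z_eps (\<epsilon> n) S}" for n and k :: 2
  define dA where "dA n k i = (norm (A (\<epsilon> n *\<^sub>R (i + axis k 1)) - A (\<epsilon> n *\<^sub>R i)))^2" for n k i
  have Pdist: "(norm (P x - P y))^2 \<le> (norm (A x - A y))^2 / (1 - 2 * \<nu>)" if "x \<in> S" "y \<in> S" for x y
    unfolding P_def using AS that \<nu> by (intro bd_K_proj_dist) auto
  have [measurable]: "S \<in> sets borel" "\<And>j. G j \<in> borel_measurable borel"
    using S(1) G by (auto intro: borel_measurable_continuous_onI)
  define g where "g x = (\<Sum>j\<in>UNIV. indicator S x * (norm (G j x))^2)" for x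
  have [measurable]: "g \<in> borel_measurable borel" unfolding g_def[abs_def] by measurable
  have "(\<integral>\<^sup>+x. ennreal (g x) \<partial>lborel) \<le> ennreal E"
  proof -
    have "(\<integral>\<^sup>+x. ennreal (g x) \<partial>lborel) = (\<integral>\<^sup>+x. indicator S x * ennreal (\<Sum>j\<in>UNIV. (norm (G j x))^2) \<partial>lborel)"
      by (intro nn_integral_cong) (auto simp: g_def indicator_def)
    then show ?thesis using gr(1) by simp
  qed
  then have gi: "integrable lborel g" "(LINT x|lborel. g x) \<le> E"
    by (intro integrable_of_nn_bound[of g lborel E]; use gr(2) in \<open>auto simp: g_def intro!: sum_nonneg\<close>)+
  have Gi: "integrable lborel (\<lambda>x. indicator S x * (norm (G k x))^2)" for k
  proof (rule Bochner_Integration.integrable_bound[OF gi(1)])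
    have "indicator S x * (norm (G k x))^2 \<le> g x" for x
      unfolding g_def by (rule member_le_sum[of k UNIV "\<lambda>k. indicator S x * (norm (G k x))^2"]) auto
    then show "AE x in lborel. norm (indicator S x * (norm (G k x))^2) \<le> norm (g x)"
      by (intro AE_I2) (auto intro: order_trans[OF _ abs_ge_self])
  qed measurable
  have "(\<lambda>n. \<Sum>k\<in>UNIV. \<Sum>i\<in>Z n k. dA n k i) \<longlonglongrightarrow> (\<Sum>k\<in>UNIV. LINT x|lborel. indicator S x * (norm (G k x))^2)"
    unfolding Z_def dA_def by (intro tendsto_sum discrete_energy_tendsto[OF S A G \<epsilon>])
  moreover have "(\<Sum>k\<in>UNIV. LINT x|lborel. indicator S x * (norm (G k x))^2) < E + \<nu>"
  proof -
    have "(LINT x|lborel. g x) = (\<Sum>k\<in>UNIV. LINT x|lborel. indicator S x * (norm (G k x))^2)"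
      unfolding g_def by (rule Bochner_Integration.integral_sum) (rule Gi)
    then show ?thesis using gi(2) \<nu>(1) by linarith
  qed
  ultimately have ev1: "eventually (\<lambda>n. (\<Sum>k\<in>UNIV. \<Sum>i\<in>Z n k. dA n k i) < E + \<nu>) sequentially"
    by (rule order_tendstoD(2))
  have "\<forall>k. \<exists>C>0. \<forall>x y. x \<in> S \<longrightarrow> norm (y - x) \<le> 1 \<longrightarrow> norm (G k y) \<le> C"
    using bounded_near_bounded[OF G S(2)] by metis
  then obtain C where C: "\<And>k. 0 < C k" "\<And>k x y. x \<in> S \<Longrightarrow> norm (y - x) \<le> 1 \<Longrightarrow> norm (G k y) \<le> C k" by metis
  have ev2: "eventually (\<lambda>n. \<forall>k. (C k * \<epsilon> n)^2 / (1 - 2 * \<nu>) < 2 * \<tau>) sequentially"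
  proof (rule eventually_all_finite)
    fix k
    have "(\<lambda>n. (C k * \<epsilon> n)^2 / (1 - 2 * \<nu>)) \<longlonglongrightarrow> (C k * 0)^2 / (1 - 2 * \<nu>)"
      using \<nu> by (intro tendsto_intros \<epsilon>(2)) auto
    then show "eventually (\<lambda>n. (C k * \<epsilon> n)^2 / (1 - 2 * \<nu>) < 2 * \<tau>) sequentially"
      by (rule order_tendstoD(2)) (use \<tau> in simp)
  qed
  have ev3: "eventually (\<lambda>n. \<epsilon> n < 1) sequentially" by (rule order_tendstoD(2)[OF \<epsilon>(2)]) simp
  show ?thesis
    using ev1 ev2 ev3
  proof eventually_elim
    fix n assume n: "(\<Sum>k\<in>UNIV. \<Sum>i\<in>Z n k. dA n k i) < E + \<nu>" "\<forall>k. (C k * \<epsilon> n)^2 / (1 - 2 * \<nu>) < 2 * \<tau>" "\<epsilon> n < 1"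
    define R where "R = sampled S P (\<epsilon> n)"
    have Reps: "R (\<epsilon> n *\<^sub>R i) = P (\<epsilon> n *\<^sub>R i)" if "i \<in> Z_eps (\<epsilon> n) S" for i
      unfolding R_def using that by (intro sampled_lattice \<epsilon>) (simp add: mem_Z_eps)
    have dR: "(norm (R (\<epsilon> n *\<^sub>R (i + axis k 1)) - R (\<epsilon> n *\<^sub>R i)))^2 \<le> dA n k i / (1 - 2 * \<nu>)"
      if i: "i \<in> Z_eps (\<epsilon> n) S" "i + axis k 1 \<in> Z_eps (\<epsilon> n) S" for i k
      unfolding Reps[OF i(1)] Reps[OF i(2)] dA_def by (rule Pdist) (use i in \<open>auto simp: mem_Z_eps\<close>)
    have dA: "dA n k i \<le> (C k * \<epsilon> n)^2" if i: "i \<in> Z_eps (\<epsilon> n) S" for i k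
    proof -
      have "norm (A (\<epsilon> n *\<^sub>R i + \<epsilon> n *\<^sub>R axis k 1) - A (\<epsilon> n *\<^sub>R i) - \<epsilon> n *\<^sub>R 0) \<le> C k * \<epsilon> n"
      proof (rule increment_bound[OF A less_imp_le[OF \<epsilon>(1)]])
        fix s assume "0 \<le> s" "s \<le> \<epsilon> n"
        then show "norm (G k (\<epsilon> n *\<^sub>R i + s *\<^sub>R axis k 1) - 0) \<le> C k"
          using i n(3) C(2)[of "\<epsilon> n *\<^sub>R i"] by (simp add: mem_Z_eps norm_axis_1)
      qed
      then show ?thesis unfolding dA_def by (intro power_mono) (simp_all add: scaleR_add_right)
    qed
    have "F1_eps h S (\<epsilon> n) R \<le> ereal (c * (\<Sum>k\<in>UNIV. \<Sum>i\<in>Z n k. (norm (R (\<epsilon> n *\<^sub>R (i + axis k 1)) - R (\<epsilon> n *\<^sub>R i)))^2))"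
      unfolding Z_def
    proof (rule F1_eps_le[OF S(1,2) \<epsilon>(1) _ inf h])
      show "R \<in> C_eps (\<epsilon> n) S" unfolding R_def by (rule sampled_C_eps[OF \<epsilon>(1)]) (simp add: P_def AK)
      fix k i assume i: "i \<in> Z_eps (\<epsilon> n) S" "i + axis k 1 \<in> Z_eps (\<epsilon> n) S"
      have "dA n k i / (1 - 2 * \<nu>) \<le> (C k * \<epsilon> n)^2 / (1 - 2 * \<nu>)" using dA[OF i(1)] \<nu> by (intro divide_right_mono) auto
      then show "(norm (R (\<epsilon> n *\<^sub>R (i + axis k 1)) - R (\<epsilon> n *\<^sub>R i)))^2 \<le> 2 * \<tau>"
        using dR[OF i] n(2) by (meson less_imp_le order_trans)
    qed
    also have "\<dots> \<le> ereal (c * ((E + \<nu>) / (1 - 2 * \<nu>)))"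
    proof -
      have "(\<Sum>k\<in>UNIV. \<Sum>i\<in>Z n k. (norm (R (\<epsilon> n *\<^sub>R (i + axis k 1)) - R (\<epsilon> n *\<^sub>R i)))^2) \<le> (\<Sum>k\<in>UNIV. \<Sum>i\<in>Z n k. dA n k i / (1 - 2 * \<nu>))"
        by (intro sum_mono dR) (auto simp: Z_def)
      also have "\<dots> = (\<Sum>k\<in>UNIV. \<Sum>i\<in>Z n k. dA n k i) / (1 - 2 * \<nu>)" by (simp add: sum_divide_distrib)
      also have "\<dots> \<le> (E + \<nu>) / (1 - 2 * \<nu>)" using n(1) \<nu> by (intro divide_right_mono) auto
      finally show ?thesis unfolding ereal_less_eq by (rule mult_left_mono[OF _ c])
    qed
    finally show "F1_eps h S (\<epsilon> n) (sampled S (\<lambda>x. bd_K_proj (A x)) (\<epsilon> n)) \<le> ereal (c * ((E + \<nu>) / (1 - 2 * \<nu>)))"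
      by (simp add: R_def P_def[abs_def])
  qed
qed

text \<open>For each neighbourhood, smoothing and projecting use half of the tolerance and sampling
  the other half; the threshold for L^1 closeness is fixed by the neighbourhood before \<nu> is
  chosen.\<close>

lemma Gamma_limsup_le:
  assumes S: "open S" "bounded S" "lipschitz_boundary S" and h: "Cn_on 1 {0..1} h"
    and inf: "(INF x\<in>{0..1}. h x) = h 1" and Q: "Q \<in> Linf_sym S"
  shows "Gamma_limsup (weak_star S) (at_right 0) (F1_eps h S) Q \<le> F1 h S Q"
proof (cases "Q \<in> W12_bd_K S")
  case False
  then show ?thesis by (simp add: F1_def)
next
  case True
  obtain q d where wp: "weak_pair S q d" and qK: "\<And>x. x \<in> S \<Longrightarrow> q x \<in> bd_K" and Qq: "AE x in lebesgue_on S. Q x = q x"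
    and E: "(LINT x|lborel. (norm (d x))^2) = (LINT x|lebesgue_on S. (norm (weak_grad S Q x))^2)"
    using W12_bd_K_representative[OF S(1,2) True] by blast
  define E where "E = (LINT x|lborel. (norm (d x))^2)"
  have E0: "0 \<le> E" by (simp add: E_def)
  define a where "a = \<bar>slope_at_1 h\<bar> / 2"
  have a0: "0 \<le> a" by (simp add: a_def)
  have F1: "F1 h S Q = ereal (a * E)" using True E by (simp add: F1_def a_def E_def)
  have [measurable]: "S \<in> sets borel" using S by simp
  have qm[measurable]: "q \<in> borel_measurable borel" using wp by (simp add: weak_pair_def)
  show ?thesis
    unfolding Gamma_limsup_def
  proof (rule SUP_least)
    fix U assume "U \<in> {U. openin (weak_star S) U \<and> Q \<in> U}"
    then have oU: "openin (weak_star S) U" and QU: "Q \<in> U" by auto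
    obtain F e where F: "finite F" "F \<subseteq> L1_sym S" and e: "0 < e"
      and U: "\<And>P. P \<in> Linf_sym S \<Longrightarrow> (\<And>\<Phi>. \<Phi> \<in> F \<Longrightarrow> \<bar>pairing S P \<Phi> - pairing S Q \<Phi>\<bar> < e) \<Longrightarrow> P \<in> U"
      by (rule weak_star_nbhd[OF oU QU]) (rule that; blast)
    obtain \<nu>0 where \<nu>0: "0 < \<nu>0"
      "\<And>P Q \<Phi>. P \<in> Linf_sym S \<Longrightarrow> Q \<in> Linf_sym S \<Longrightarrow> AE x in lebesgue_on S. norm (P x - Q x) \<le> 2 \<Longrightarrow>
        integrable (lebesgue_on S) (\<lambda>x. norm (P x - Q x)) \<Longrightarrow> (LINT x|lebesgue_on S. norm (P x - Q x)) \<le> \<nu>0 \<Longrightarrow> \<Phi> \<in> F \<Longrightarrow>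
        \<bar>pairing S P \<Phi> - pairing S Q \<Phi>\<bar> < e / 2"
      using pairing_close[OF F, of "e / 2"] e by auto
    have "Limsup (at_right 0) (\<lambda>\<epsilon>. INF P\<in>U. F1_eps h S \<epsilon> P) \<le> ereal (a * E) + ereal \<theta>" if \<theta>: "0 < \<theta>" for \<theta> :: real
    proof -
      \<comment> \<open>The errors from slope, smoothing and projection share one parameter \<nu>;
        the resulting bound tends to a E.\<close>
      have "((\<lambda>\<nu>. (a + \<nu>) * ((E + \<nu> + \<nu>) / (1 - 2 * \<nu>))) \<longlongrightarrow> (a + 0) * ((E + 0 + 0) / (1 - 2 * 0))) (at_right 0)"
        by (intro tendsto_intros) auto
      then have "eventually (\<lambda>\<nu>. (a + \<nu>) * ((E + \<nu> + \<nu>) / (1 - 2 * \<nu>)) < a * E + \<theta>) (at_right 0)"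
        by (rule order_tendstoD(2)) (use \<theta> in simp)
      moreover have "eventually (\<lambda>\<nu>::real. \<nu> \<in> {0<..<min (1/4) (\<nu>0 / 2)}) (at_right 0)"
        by (rule eventually_at_right_real) (use \<nu>0 in simp)
      ultimately have "eventually (\<lambda>\<nu>. (a + \<nu>) * ((E + \<nu> + \<nu>) / (1 - 2 * \<nu>)) < a * E + \<theta> \<and> 0 < \<nu> \<and> \<nu> < 1/4 \<and> 2 * \<nu> < \<nu>0) (at_right 0)"
        by eventually_elim auto
      then obtain \<nu> where \<nu>: "(a + \<nu>) * ((E + \<nu> + \<nu>) / (1 - 2 * \<nu>)) < a * E + \<theta>" "0 < \<nu>" "\<nu> < 1/4" "2 * \<nu> < \<nu>0"
        using eventually_happens'[OF trivial_limit_at_right_real] by blast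
      obtain A and G :: "2 \<Rightarrow> real^2 \<Rightarrow> real^2^2" where
        A: "\<And>x. (A has_derivative (\<lambda>v. \<Sum>j\<in>UNIV. v $ j *\<^sub>R G j x)) (at x)" and G: "\<And>j. continuous_on UNIV (G j)"
        and AS: "\<And>x. x \<in> S \<Longrightarrow> A x \<in> sym_mat \<and> trace (A x) = 1 \<and> 1 - (norm (A x))^2 \<le> \<nu>"
        and gr: "(\<integral>\<^sup>+x. indicator S x * ennreal (\<Sum>j\<in>UNIV. (norm (G j x))^2) \<partial>lborel) \<le> ennreal (E + \<nu>)"
        and L1: "(\<integral>\<^sup>+x. indicator S x * ennreal (norm (A x - q x)) \<partial>lborel) \<le> ennreal \<nu>"
      \<comment> \<open>The layer construction measures distances to a nonempty frontier, so the
        empty set is treated apart.\<close>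
      proof (cases "S = {}")
        case True
        show thesis by (rule that[of "\<lambda>_. 0" "\<lambda>_ _. 0"]) (use True in auto)
      next
        case False
        show thesis
          by (rule smooth_approximation[OF S False wp qK \<nu>(2), folded E_def]) (assumption, rule that)
      qed
      obtain \<tau> where \<tau>: "0 < \<tau>" "\<And>x. 0 \<le> x \<Longrightarrow> x \<le> 1 \<Longrightarrow> 1 - x^2 \<le> \<tau> \<Longrightarrow> h x - h 1 \<le> (a + \<nu>) * (1 - x^2)"
        unfolding a_def using slope_bound[OF h \<nu>(2)] by blast
      define P where "P x = bd_K_proj (A x)" for x
      have PK: "P x \<in> bd_K" if "x \<in> S" for x
        unfolding P_def using AS[OF that] \<nu> by (intro bd_K_proj_in) auto
      have Ac: "continuous_on T A" for T by (intro continuous_at_imp_continuous_on ballI has_derivative_continuous[OF A])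
      note [measurable] = borel_measurable_continuous_onI[OF Ac]
      have Pm[measurable]: "P \<in> borel_measurable borel" unfolding P_def[abs_def] bd_K_proj_def by measurable
      \<comment> \<open>The squared Lipschitz constant 1/(1 - 2 \<nu>) is below 4, as \<nu> < 1/4.
        With \<open>M\<close> a value of \<open>A\<close> this gives continuity of \<open>P\<close>;
        with \<open>M\<close> a value of \<open>q\<close>, which the projection fixes, it compares
        \<open>P\<close> with \<open>q\<close>.\<close>
      have close: "norm (P x - bd_K_proj M) \<le> 2 * norm (A x - M)"
        if "x \<in> S" "trace M = 1" "1 - (norm M)^2 \<le> \<nu>" for x M
      proof (rule power2_le_imp_le)
        have "(norm (P x - bd_K_proj M))^2 \<le> (norm (A x - M))^2 / (1 - 2 * \<nu>)"
          unfolding P_def using AS that \<nu> by (intro bd_K_proj_dist) auto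
        also have "\<dots> \<le> (norm (A x - M))^2 / (1 / 4)" using \<nu> by (intro divide_left_mono) auto
        finally show "(norm (P x - bd_K_proj M))^2 \<le> (2 * norm (A x - M))^2" by (simp add: power_mult_distrib)
      qed simp
      have Pc: "continuous_on S P"
        unfolding continuous_on_iff
      proof (intro ballI allI impI)
        fix x and r :: real assume x: "x \<in> S" and r: "0 < r"
        obtain \<delta> where \<delta>: "0 < \<delta>" "\<And>y. y \<in> S \<Longrightarrow> dist y x < \<delta> \<Longrightarrow> dist (A y) (A x) < r / 2"
          using Ac[of S] x r unfolding continuous_on_iff by (metis half_gt_zero)
        show "\<exists>\<delta>>0. \<forall>y\<in>S. dist y x < \<delta> \<longrightarrow> dist (P y) (P x) < r"
        proof (intro exI[of _ \<delta>] conjI ballI impI \<delta>(1))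
          fix y assume y: "y \<in> S" "dist y x < \<delta>"
          show "dist (P y) (P x) < r"
            using close[OF y(1), of "A x"] AS[OF x] \<delta>(2)[OF y] by (simp add: dist_norm P_def)
        qed
      qed
      have PL: "P \<in> Linf_sym S" by (rule bd_K_valued_Linf_sym[OF S(1) Pm PK])
      have near: "\<bar>pairing S P \<Phi> - pairing S Q \<Phi>\<bar> < e / 2" if "\<Phi> \<in> F" for \<Phi>
      proof (rule \<nu>0(2)[OF PL Q _ _ _ that])
        define f where "f x = indicator S x * norm (A x - q x)" for x
        have [measurable]: "f \<in> borel_measurable borel" unfolding f_def[abs_def] by measurable
        have "(\<integral>\<^sup>+x. ennreal (f x) \<partial>lborel) = (\<integral>\<^sup>+x. indicator S x * ennreal (norm (A x - q x)) \<partial>lborel)"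
          by (intro nn_integral_cong) (auto simp: f_def indicator_def)
        then have fi: "integrable lborel f" "(LINT x|lborel. f x) \<le> \<nu>"
          by (intro integrable_of_nn_bound[of f lborel \<nu>]; use L1 \<nu> in \<open>auto simp: f_def\<close>)+
        have Pq: "norm (P x - q x) \<le> 2 * norm (A x - q x)" if "x \<in> S" for x
          using close[OF that, of "q x"] qK[OF that] bd_K_proj_fixes[OF qK[OF that]] \<nu>(2) by (simp add: bd_K_iff)
        have QL: "Q \<in> borel_measurable (lebesgue_on S)" using Q by (simp add: Linf_sym_def)
        note [measurable] = QL borel_measurable_lebesgue_on[OF S(1) Pm]
        show "AE x in lebesgue_on S. norm (P x - Q x) \<le> 2"
          using Qq AE_space
        proof eventually_elim
          fix x assume x: "Q x = q x" "x \<in> space (lebesgue_on S)"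
          then have "x \<in> S" by (simp add: space_restrict_space)
          then show "norm (P x - Q x) \<le> 2"
            using norm_triangle_ineq4[of "P x" "q x"] PK[of x] qK[of x] x(1) by (simp add: bd_K_iff)
        qed
        have eq: "AE x in lebesgue_on S. norm (P x - Q x) = indicator S x * norm (P x - q x)"
          using Qq AE_space by eventually_elim (simp add: space_restrict_space)
        have gi: "integrable lborel (\<lambda>x. indicator S x * norm (P x - q x))"
        proof (rule Bochner_Integration.integrable_bound)
          show "integrable lborel (\<lambda>x. 2 * f x)" using fi by simp
          show "AE x in lborel. norm (indicator S x * norm (P x - q x)) \<le> norm (2 * f x)"
            using Pq by (intro AE_I2) (auto simp: f_def indicator_def)
        qed measurable
        note conv = lebesgue_on_borel_integral[OF S(1) _ _ _ eq]
        show "integrable (lebesgue_on S) (\<lambda>x. norm (P x - Q x))" using conv(2) gi by simp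
        have "(LINT x|lebesgue_on S. norm (P x - Q x)) = (LINT x|lborel. indicator S x * norm (P x - q x))"
          by (rule conv(1)) auto
        also have "\<dots> \<le> (LINT x|lborel. 2 * f x)"
        proof (rule integral_mono[OF gi])
          show "integrable lborel (\<lambda>x. 2 * f x)" using fi(1) by simp
          show "indicator S x * norm (P x - q x) \<le> 2 * f x" for x
            using Pq by (cases "x \<in> S") (auto simp: f_def)
        qed
        also have "\<dots> \<le> \<nu>0" using fi(2) \<nu>(4) by simp
        finally show "(LINT x|lebesgue_on S. norm (P x - Q x)) \<le> \<nu>0" .
      qed
      have "eventually (\<lambda>\<epsilon>. (INF R\<in>U. F1_eps h S \<epsilon> R) \<le> ereal (a * E) + ereal \<theta>) (at_right 0)"
      \<comment> \<open>The sampling estimates rest on dominated convergence along sequences; a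
        property that holds eventually along the null sequences of positive scales holds eventually
        at 0 from the right.\<close>
      proof (rule sequentially_imp_eventually_at_right[of 0 "1::real"])
        fix \<epsilon> :: "nat \<Rightarrow> real" assume \<epsilon>: "\<And>n. 0 < \<epsilon> n" "\<epsilon> \<longlonglongrightarrow> 0"
        have "eventually (\<lambda>n. F1_eps h S (\<epsilon> n) (sampled S P (\<epsilon> n)) \<le> ereal ((a + \<nu>) * ((E + \<nu> + \<nu>) / (1 - 2 * \<nu>)))) sequentially"
          unfolding P_def[abs_def]
          by (rule smooth_recovery_energy[OF S A G _ _ gr _ \<nu>(2) _ \<tau>(1) _ inf \<tau>(2) \<epsilon>])
             (use AS PK E0 \<nu> a0 in \<open>auto simp: P_def\<close>)
        moreover have "eventually (\<lambda>n. \<forall>\<Phi>\<in>F. \<bar>pairing S (sampled S P (\<epsilon> n)) \<Phi> - pairing S P \<Phi>\<bar> < e / 2) sequentially"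
        proof (rule eventually_ball_finite[OF F(1)], rule ballI)
          fix \<Phi> assume "\<Phi> \<in> F"
          then have "integrable (lebesgue_on S) \<Phi>" using F by (auto simp: L1_sym_def)
          from tendstoD[OF sampled_pairing_tendsto[OF S(1) Pm PK Pc \<epsilon> this], of "e / 2"] e
          show "eventually (\<lambda>n. \<bar>pairing S (sampled S P (\<epsilon> n)) \<Phi> - pairing S P \<Phi>\<bar> < e / 2) sequentially"
            by (simp add: dist_real_def)
        qed
        ultimately show "eventually (\<lambda>n. (INF R\<in>U. F1_eps h S (\<epsilon> n) R) \<le> ereal (a * E) + ereal \<theta>) sequentially"
        proof eventually_elim
          fix n assume n: "F1_eps h S (\<epsilon> n) (sampled S P (\<epsilon> n)) \<le> ereal ((a + \<nu>) * ((E + \<nu> + \<nu>) / (1 - 2 * \<nu>)))"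
            "\<forall>\<Phi>\<in>F. \<bar>pairing S (sampled S P (\<epsilon> n)) \<Phi> - pairing S P \<Phi>\<bar> < e / 2"
          have "sampled S P (\<epsilon> n) \<in> U"
          proof (rule U[OF sampled_Linf_sym[OF S(1) Pm PK]])
            fix \<Phi> assume "\<Phi> \<in> F"
            from near[OF this] bspec[OF n(2) this]
            show "\<bar>pairing S (sampled S P (\<epsilon> n)) \<Phi> - pairing S Q \<Phi>\<bar> < e" by linarith
          qed
          then have "(INF R\<in>U. F1_eps h S (\<epsilon> n) R) \<le> F1_eps h S (\<epsilon> n) (sampled S P (\<epsilon> n))" by (rule INF_lower)
          also note n(1)
          also have "ereal ((a + \<nu>) * ((E + \<nu> + \<nu>) / (1 - 2 * \<nu>))) \<le> ereal (a * E) + ereal \<theta>" using \<nu>(1) by simp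
          finally show "(INF R\<in>U. F1_eps h S (\<epsilon> n) R) \<le> ereal (a * E) + ereal \<theta>" .
        qed
      qed simp
      then show ?thesis by (rule Limsup_bounded)
    qed
    then show "Limsup (at_right 0) (\<lambda>\<epsilon>. INF P\<in>U. F1_eps h S \<epsilon> P) \<le> F1 h S Q"
      unfolding F1 by (rule ereal_le_epsilon2)
  qed
qed

theorem theorem4p3:
  fixes \<Omega> :: "(real^2) set" and h :: "real \<Rightarrow> real"
  assumes "open \<Omega>" and "bounded \<Omega>" and "simply_connected \<Omega>" and "lipschitz_boundary \<Omega>"
    and "Cn_on 1 {0..1} h"
    and "(INF x\<in>{0..1}. h x) = h 1"
    and "\<exists>\<delta>. 0 < \<delta> \<and> \<delta> \<le> 1 \<and> Cn_on 2 {1 - \<delta>..1} h"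
  shows
    "(\<forall>Q\<in>Linf_sym \<Omega>. Gamma_limsup (weak_star \<Omega>) (at_right 0) (F1_eps h \<Omega>) Q \<le> F1 h \<Omega> Q) \<and>
     (\<forall>\<gamma>>0. (\<forall>x\<in>{0..1}. h x - h 1 \<ge> \<gamma> / 2 * (1 - x\<^sup>2)) \<longrightarrow>
        (\<forall>Q\<in>Linf_sym \<Omega>.
           Gamma_liminf (weak_star \<Omega>) (at_right 0) (F1_eps h \<Omega>) Q \<ge> F1_gamma \<gamma> \<Omega> Q)) \<and>
     (\<bar>slope_at_1 h\<bar> > 0 \<and> (\<forall>x\<in>{0..1}. h x - h 1 \<ge> \<bar>slope_at_1 h\<bar> / 2 * (1 - x\<^sup>2)) \<longrightarrow>
        Gamma_converges (weak_star \<Omega>) (at_right 0) (F1_eps h \<Omega>) (F1 h \<Omega>))"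
proof -
  have a: "Gamma_limsup (weak_star \<Omega>) (at_right 0) (F1_eps h \<Omega>) Q \<le> F1 h \<Omega> Q" if "Q \<in> Linf_sym \<Omega>" for Q
    by (rule Gamma_limsup_le[OF assms(1,2,4,5,6) that])
  have b: "F1_gamma \<gamma> \<Omega> Q \<le> Gamma_liminf (weak_star \<Omega>) (at_right 0) (F1_eps h \<Omega>) Q"
    if "0 < \<gamma>" "\<forall>x\<in>{0..1}. h x - h 1 \<ge> \<gamma> / 2 * (1 - x^2)" "Q \<in> Linf_sym \<Omega>" for \<gamma> Q
    by (rule Gamma_liminf_ge[OF assms(1,2) that(1) _ assms(6) that(3)]) (use that(2) in blast)
  have le: "Gamma_liminf (weak_star \<Omega>) (at_right 0) (F1_eps h \<Omega>) Q \<le> Gamma_limsup (weak_star \<Omega>) (at_right 0) (F1_eps h \<Omega>) Q" for Q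
    unfolding Gamma_liminf_def Gamma_limsup_def by (intro SUP_mono' Liminf_le_Limsup) simp
  \<comment> \<open>With \<gamma> = |h'(1)| the lower and the upper candidate coincide, so both
    \<Gamma>-limits are squeezed to the same value.\<close>
  have eq: "F1_gamma \<bar>slope_at_1 h\<bar> \<Omega> Q = F1 h \<Omega> Q" for Q by (simp add: F1_gamma_def F1_def)
  have "Gamma_converges (weak_star \<Omega>) (at_right 0) (F1_eps h \<Omega>) (F1 h \<Omega>)"
    if s: "\<bar>slope_at_1 h\<bar> > 0" "\<forall>x\<in>{0..1}. h x - h 1 \<ge> \<bar>slope_at_1 h\<bar> / 2 * (1 - x^2)"
    unfolding Gamma_converges_def topspace_weak_star
  proof (intro ballI conjI antisym)
    fix Q assume Q: "Q \<in> Linf_sym \<Omega>"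
    note b' = b[OF s Q, unfolded eq]
    show "F1 h \<Omega> Q \<le> Gamma_liminf (weak_star \<Omega>) (at_right 0) (F1_eps h \<Omega>) Q" by (rule b')
    show "Gamma_liminf (weak_star \<Omega>) (at_right 0) (F1_eps h \<Omega>) Q \<le> F1 h \<Omega> Q" using le a[OF Q] by (rule order_trans)
    show "Gamma_limsup (weak_star \<Omega>) (at_right 0) (F1_eps h \<Omega>) Q \<le> F1 h \<Omega> Q" by (rule a[OF Q])
    show "F1 h \<Omega> Q \<le> Gamma_limsup (weak_star \<Omega>) (at_right 0) (F1_eps h \<Omega>) Q" using b' le by (rule order_trans)
  qed
  then show ?thesis using a b by blast
qed

end
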